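(* Let $(M,\xi,f)$ be a sub-Finsler manifold and $U\subset M$ a closed equidimensional submanifold with smooth boundary $\partial U$ (the billiard table). Then every $C^1$-gliding trajectory $\gamma:I\to\partial U$ is a (possibly singular) reparametrisation of a boundary geodesic.
   Context: A sub-Finsler manifold $(M,\xi,f)$ is a smooth manifold $M$ with a bracket-generating distribution $\xi\subset TM$ and a fibrewise (possibly asymmetric) Finsler norm $f:\xi\to\mathbb R$. $H_f:T^*M\to\mathbb R$, $H_f(\lambda)=\max\{\lambda(v):v\in\xi,\ f(v)\le1\}$, is the maximised Hamiltonian; it is smooth away from the annihilator $\mathrm{Ann}(\xi)$. Put $S_f=H_f^{-1}(1)$, $D_f=H_f^{-1}((-\infty,1])$, let $X_f$ be the Hamiltonian vector field of $H_f$ and $\pi:T^*M\to M$ the projection. Boundary geodesics: the boundary distribution is $\xi_\partial=\xi\cap T\partial U$; it may have singular points, namely the $q\in\partial U$ with $\xi_q\subset T_q\partial U$, and $\partial U^\circ$ denotes the complement of these in $\partial U$. Boundary geodesics are the geodesics of the structure $(\partial U,\xi_\partial,f|_{\xi_\partial})$. Their flow is defined over $\partial U^\circ$ (even though $\xi_\partial$ need not be bracket-generating) as the Hamiltonian flow, on the unit level set, of $H_\partial(\mu)=\max\{\mu(v):v\in\xi_\partial,\ f(v)\le1\}$ on $T^*\partial U^\circ$; boundary geodesics are the projections of its orbits. "Possibly singular" means that the speed of the reparametrisation is allowed to vanish. Billiards: the microlocal realisation of the table is $B_f=S_f|_U\cup D_f|_{\partial U}\subset T^*M$. Let $G$ be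 a smooth function on $M$ (lifted to $T^*M$) having $\partial U$ as a regular level set, with sign chosen so that the flow of its Hamiltonian vector field $X_G$ (fibrewise translation along $dG$) goes, within $D_f|_{\partial U}$, from strictly outward pointing to strictly inward pointing covectors of $S_f|_{\partial U}$ (a covector $p$ is strictly outward/inward pointing if the unique $v\in\xi$ with $f(v)\le1$ maximising $p(v)$ points strictly out of/into $U$). A billiard characteristic is a Lipschitz characteristic curve $\lambda:I\to B_f$ with $\dot\lambda$ equal to $X_f$ (in $S_f|_U$) or $X_G$ (in $D_f|_{\partial U}$) almost everywhere. Its projection $\pi\circ\lambda$ is an unreduced billiard trajectory; the reparametrisation of the latter by arclength is a (reduced) billiard trajectory. A curve $\gamma:I\to U$ is a limit trajectory if it is a $C^0_{loc}$-limit of (reduced) billiard trajectories. It is a $C^1$-limit trajectory if, for some approximating sequence $\gamma_i$ of billiard trajectories, the corresponding billiard characteristics $\lambda_i$ converge in $C^0_{loc}$ to a cotangent lift $\lambda$ of $\gamma$, i.e. to a curve $\lambda$ in $T^*M$ projecting to $\gamma$ (here $\lambda_i$ and $\lambda$ carry the parametrisation of billiard characteristics, so their projections are the unreduced versions of $\gamma_i$ and $\gamma$). A $C^1$-limit trajectory with $\gamma(I)\subseteq\partial U$ is called a $C^1$-gliding trajectory.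
   Formalization: The boundary flow exists only over ∂U°, but gliding trajectories can cross singular points; there a boundary geodesic is only required to be a unit-speed horizontal curve of ∂U a.e., while each piece in ∂U° is the projection of an orbit of the boundary Hamiltonian flow. *)

theory Defs
  imports "HOL-Analysis.Analysis"
begin

section \<open>Smooth maps and smooth manifolds\<close>

text \<open>Smoothness on a set \<open>S\<close> that is relatively open in a linear subspace \<open>V\<close>. On \<open>V\<close> the
  derivative \<open>D x\<close> is determined by \<open>f\<close>; only its values there are used.\<close>

primrec Ck_on :: "'b::euclidean_space set \<Rightarrow> 'b set \<Rightarrow> nat \<Rightarrow> ('b \<Rightarrow> 'c::real_normed_vector) \<Rightarrow> bool" where
  "Ck_on V S 0 f \<longleftrightarrow> continuous_on S f"
| "Ck_on V S (Suc n) f \<longleftrightarrow>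
     (\<exists>D. (\<forall>x\<in>S. (f has_derivative D x) (at x within S)) \<and> (\<forall>v\<in>V. Ck_on V S n (\<lambda>x. D x v)))"

definition smooth_on :: "'b::euclidean_space set \<Rightarrow> 'b set \<Rightarrow> ('b \<Rightarrow> 'c::real_normed_vector) \<Rightarrow> bool" where
  "smooth_on V S f \<longleftrightarrow> (\<forall>n. Ck_on V S n f)"

text \<open>A chart is a domain together with a coordinate map; the values of the map outside the domain
  are irrelevant.\<close>

type_synonym ('a, 'e) chart = "'a set \<times> ('a \<Rightarrow> 'e)"

definition chart_inv :: "('a, 'e) chart \<Rightarrow> 'e \<Rightarrow> 'a" where
  "chart_inv c = inv_into (fst c) (snd c)"

definition transition :: "('a, 'e) chart \<Rightarrow> ('a, 'e) chart \<Rightarrow> 'e \<Rightarrow> 'e" where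
  "transition c d = snd d \<circ> chart_inv c"

definition is_chart :: "('a::topological_space, 'e::euclidean_space) chart \<Rightarrow> bool" where
  "is_chart c \<longleftrightarrow> open (fst c) \<and> open (snd c ` fst c) \<and> inj_on (snd c) (fst c) \<and>
     continuous_on (fst c) (snd c) \<and> continuous_on (snd c ` fst c) (chart_inv c)"

definition compatible :: "('a, 'e::euclidean_space) chart \<Rightarrow> ('a, 'e) chart \<Rightarrow> bool" where
  "compatible c d \<longleftrightarrow>
     smooth_on UNIV (snd c ` (fst c \<inter> fst d)) (transition c d) \<and>
     smooth_on UNIV (snd d ` (fst c \<inter> fst d)) (transition d c)"

text \<open>The manifold is the whole type \<open>'a\<close> (taken Hausdorff and second countable in the main theorem),
  its smooth structure is a maximal atlas.\<close>

definition smooth_structure :: "('a::topological_space, 'e::euclidean_space) chart set \<Rightarrow> bool" where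
  "smooth_structure A \<longleftrightarrow>
     \<Union> (fst ` A) = UNIV \<and> (\<forall>c\<in>A. is_chart c) \<and> (\<forall>c\<in>A. \<forall>d\<in>A. compatible c d) \<and>
     (\<forall>c. is_chart c \<and> (\<forall>d\<in>A. compatible c d) \<longrightarrow> c \<in> A)"

section \<open>Tangent and cotangent bundle\<close>

text \<open>The definitions of this section are used for \<open>M\<close> (charts with values in \<open>V = UNIV\<close>) and for
  the boundary of the table (charts with values in a hyperplane \<open>V\<close>).

  A tangent vector at \<open>q\<close> is the family of its components in all charts around \<open>q\<close>, transforming by
  the derivatives of the coordinate changes. A covector is the family of its components, i.e. of the
  vectors representing it through the inner product, such that the pairing with tangent vectors does
  not depend on the chart. Components in other charts are set to \<open>0\<close>, so that equality of tangent
  vectors or covectors is equality of functions.\<close>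

definition transforms :: "('a, 'e::euclidean_space) chart \<Rightarrow> ('a, 'e) chart \<Rightarrow> 'a \<Rightarrow> 'e \<Rightarrow> 'e \<Rightarrow> bool" where
  "transforms c d q h k \<longleftrightarrow>
     (\<exists>L. (transition c d has_derivative L) (at (snd c q) within snd c ` (fst c \<inter> fst d)) \<and> k = L h)"

definition components :: "'e set \<Rightarrow> ('a, 'e::euclidean_space) chart set \<Rightarrow> 'a \<Rightarrow> (('a, 'e) chart \<Rightarrow> 'e) set" where
  "components V A q = {v. \<forall>c. if c \<in> A \<and> q \<in> fst c then v c \<in> V else v c = 0}"

definition tangent_space :: "'e set \<Rightarrow> ('a, 'e::euclidean_space) chart set \<Rightarrow> 'a \<Rightarrow> (('a, 'e) chart \<Rightarrow> 'e) set" where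
  "tangent_space V A q = {v \<in> components V A q.
     \<forall>c\<in>A. \<forall>d\<in>A. q \<in> fst c \<inter> fst d \<longrightarrow> transforms c d q (v c) (v d)}"

definition cotangent_space :: "'e set \<Rightarrow> ('a, 'e::euclidean_space) chart set \<Rightarrow> 'a \<Rightarrow> (('a, 'e) chart \<Rightarrow> 'e) set" where
  "cotangent_space V A q = {p \<in> components V A q.
     \<forall>c\<in>A. \<forall>d\<in>A. q \<in> fst c \<inter> fst d \<longrightarrow>
       (\<forall>h\<in>V. \<forall>k. transforms c d q h k \<longrightarrow> p c \<bullet> h = p d \<bullet> k)}"

definition pairing :: "('a, 'e::euclidean_space) chart set \<Rightarrow> 'a \<Rightarrow> (('a, 'e) chart \<Rightarrow> 'e) \<Rightarrow> (('a, 'e) chart \<Rightarrow> 'e) \<Rightarrow> real" where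
  "pairing A q p v = (let c = SOME c. c \<in> A \<and> q \<in> fst c in p c \<bullet> v c)"

type_synonym ('a, 'e) cotangent = "'a \<times> (('a, 'e) chart \<Rightarrow> 'e)"

definition cotangent_bundle :: "'e set \<Rightarrow> ('a, 'e::euclidean_space) chart set \<Rightarrow> ('a, 'e) cotangent set" where
  "cotangent_bundle V A = Sigma (\<Union> (fst ` A)) (cotangent_space V A)"

definition coords :: "('a, 'e) chart \<Rightarrow> ('a, 'e) cotangent \<Rightarrow> 'e \<times> 'e" where
  "coords c z = (snd c (fst z), snd z c)"

definition cotangent_topology :: "'e set \<Rightarrow> ('a, 'e::euclidean_space) chart set \<Rightarrow> ('a, 'e) cotangent topology" where
  "cotangent_topology V A = topology_generated_by
     {{z \<in> cotangent_bundle V A. fst z \<in> fst c \<and> coords c z \<in> W} | c W. c \<in> A \<and> open W}"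

text \<open>Hamiltonian vector field in canonical coordinates, with the convention
  \<open>q' = \<partial>H/\<partial>p\<close>, \<open>p' = - \<partial>H/\<partial>q\<close>: \<open>w = (q', p')\<close> is its value at \<open>z\<close> in the chart \<open>c\<close>.\<close>

definition hamiltonian_vector ::
  "'e set \<Rightarrow> ('a, 'e::euclidean_space) chart set \<Rightarrow> (('a, 'e) cotangent \<Rightarrow> real) \<Rightarrow>
   ('a, 'e) chart \<Rightarrow> ('a, 'e) cotangent \<Rightarrow> 'e \<times> 'e \<Rightarrow> bool" where
  "hamiltonian_vector V A H c z w \<longleftrightarrow> w \<in> V \<times> V \<and>
     ((\<lambda>y. H (inv_into {z \<in> cotangent_bundle V A. fst z \<in> fst c} (coords c) y)) has_derivative
        (\<lambda>(h, k). fst w \<bullet> k - snd w \<bullet> h)) (at (coords c z) within V \<times> V)"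

text \<open>The curve \<open>lam\<close> on \<open>J\<close> is differentiable at \<open>t\<close> with velocity the Hamiltonian vector field of \<open>H\<close>.\<close>

definition flows_along ::
  "'e set \<Rightarrow> ('a, 'e::euclidean_space) chart set \<Rightarrow> (('a, 'e) cotangent \<Rightarrow> real) \<Rightarrow>
   (real \<Rightarrow> ('a, 'e) cotangent) \<Rightarrow> real set \<Rightarrow> real \<Rightarrow> bool" where
  "flows_along V A H lam J t \<longleftrightarrow> lam t \<in> cotangent_bundle V A \<and>
     (\<forall>c\<in>A. fst (lam t) \<in> fst c \<longrightarrow>
        (\<exists>w. hamiltonian_vector V A H c (lam t) w \<and>
             ((\<lambda>s. coords c (lam s)) has_vector_derivative w) (at t within J)))"

definition velocity ::
  "'e set \<Rightarrow> ('a, 'e::euclidean_space) chart set \<Rightarrow> (real \<Rightarrow> 'a) \<Rightarrow> real set \<Rightarrow> real \<Rightarrow>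
   (('a, 'e) chart \<Rightarrow> 'e) \<Rightarrow> bool" where
  "velocity V A \<alpha> J t v \<longleftrightarrow> v \<in> tangent_space V A (\<alpha> t) \<and>
     (\<forall>c\<in>A. \<alpha> t \<in> fst c \<longrightarrow> ((\<lambda>s. snd c (\<alpha> s)) has_vector_derivative v c) (at t within J))"

definition locally_lipschitz :: "real set \<Rightarrow> (real \<Rightarrow> 'b::metric_space) \<Rightarrow> bool" where
  "locally_lipschitz J g \<longleftrightarrow> (\<forall>t\<in>J. \<exists>\<epsilon>>0. \<exists>C. lipschitz_on C (J \<inter> ball t \<epsilon>) g)"

text \<open>A Lipschitz curve in a manifold is one that is locally Lipschitz in charts. Here \<open>g c\<close> are the
  coordinates of the curve in the chart \<open>c\<close>, and \<open>\<alpha>\<close> is its base curve (so that the same definition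
  covers curves in the manifold and in its cotangent bundle).\<close>

definition lipschitz_in_charts ::
  "('a, 'e) chart set \<Rightarrow> (real \<Rightarrow> 'a) \<Rightarrow> (('a, 'e) chart \<Rightarrow> real \<Rightarrow> 'b::metric_space) \<Rightarrow> real set \<Rightarrow> bool" where
  "lipschitz_in_charts A \<alpha> g J \<longleftrightarrow>
     (\<forall>t\<in>J. \<forall>c\<in>A. \<alpha> t \<in> fst c \<longrightarrow>
        (\<exists>\<epsilon>>0. \<exists>C. (\<forall>s\<in>J \<inter> ball t \<epsilon>. \<alpha> s \<in> fst c) \<and> lipschitz_on C (J \<inter> ball t \<epsilon>) (g c)))"

text \<open>\<open>C\<^sup>0\<^sub>l\<^sub>o\<^sub>c\<close>-convergence is convergence in the compact-open topology, i.e. locally uniform convergence.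
  The approximating curves need only be defined, from some index on, on each given compact part of
  the limit interval.\<close>

definition C0_loc_limit ::
  "'x topology \<Rightarrow> (nat \<Rightarrow> real set) \<Rightarrow> (nat \<Rightarrow> real \<Rightarrow> 'x) \<Rightarrow> real set \<Rightarrow> (real \<Rightarrow> 'x) \<Rightarrow> bool" where
  "C0_loc_limit T Is gs I g \<longleftrightarrow> continuous_map (top_of_set I) T g \<and>
     (\<forall>K N. compact K \<and> K \<subseteq> I \<and> openin T N \<and> g ` K \<subseteq> N \<longrightarrow>
        (\<forall>\<^sub>F i in sequentially. K \<subseteq> Is i \<and> gs i ` K \<subseteq> N))"

section \<open>Sub-Finsler manifolds\<close>

text \<open>\<open>F x\<close> maps the fixed vector space \<open>W\<close> isomorphically onto the fibre of \<open>\<xi>\<close>, in the chart \<open>c\<close>, over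
  the point with coordinates \<open>x \<in> \<Omega>\<close>.\<close>

definition trivialises ::
  "('a \<Rightarrow> (('a, 'e::euclidean_space) chart \<Rightarrow> 'e) set) \<Rightarrow> ('a, 'e) chart \<Rightarrow>
   'e set \<Rightarrow> 'e set \<Rightarrow> ('e \<Rightarrow> 'e \<Rightarrow> 'e) \<Rightarrow> bool" where
  "trivialises \<xi> c \<Omega> W F \<longleftrightarrow> open \<Omega> \<and> \<Omega> \<subseteq> snd c ` fst c \<and> subspace W \<and>
     (\<forall>x\<in>\<Omega>. linear (F x) \<and> inj_on (F x) W \<and> F x ` W = (\<lambda>v. v c) ` \<xi> (chart_inv c x)) \<and>
     (\<forall>w\<in>W. smooth_on UNIV \<Omega> (\<lambda>x. F x w))"

definition smooth_distribution ::
  "('a, 'e::euclidean_space) chart set \<Rightarrow> ('a \<Rightarrow> (('a, 'e) chart \<Rightarrow> 'e) set) \<Rightarrow> bool" where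
  "smooth_distribution A \<xi> \<longleftrightarrow>
     (\<forall>q. \<xi> q \<subseteq> tangent_space UNIV A q) \<and>
     (\<forall>c\<in>A. \<forall>q\<in>fst c. \<exists>\<Omega> W F. snd c q \<in> \<Omega> \<and> trivialises \<xi> c \<Omega> W F)"

definition lie_bracket :: "('e::euclidean_space \<Rightarrow> 'e) \<Rightarrow> ('e \<Rightarrow> 'e) \<Rightarrow> 'e \<Rightarrow> 'e" where
  "lie_bracket X Y x = frechet_derivative Y (at x) (X x) - frechet_derivative X (at x) (Y x)"

definition local_sections ::
  "('a \<Rightarrow> (('a, 'e::euclidean_space) chart \<Rightarrow> 'e) set) \<Rightarrow> ('a, 'e) chart \<Rightarrow> ('e \<Rightarrow> 'e) set" where
  "local_sections \<xi> c = {X. smooth_on UNIV (snd c ` fst c) X \<and>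
     (\<forall>q\<in>fst c. X (snd c q) \<in> (\<lambda>v. v c) ` \<xi> q)}"

inductive_set iterated_brackets :: "('e::euclidean_space \<Rightarrow> 'e) set \<Rightarrow> ('e \<Rightarrow> 'e) set"
  for S :: "('e \<Rightarrow> 'e) set" where
  "X \<in> S \<Longrightarrow> X \<in> iterated_brackets S"
| "X \<in> iterated_brackets S \<Longrightarrow> Y \<in> iterated_brackets S \<Longrightarrow> lie_bracket X Y \<in> iterated_brackets S"

definition bracket_generating ::
  "('a, 'e::euclidean_space) chart set \<Rightarrow> ('a \<Rightarrow> (('a, 'e) chart \<Rightarrow> 'e) set) \<Rightarrow> bool" where
  "bracket_generating A \<xi> \<longleftrightarrow>
     (\<forall>c\<in>A. \<forall>q\<in>fst c. span ((\<lambda>X. X (snd c q)) ` iterated_brackets (local_sections \<xi> c)) = UNIV)"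

text \<open>Fibrewise Finsler norm: positively homogeneous, positive definite, smooth off the zero section
  and strongly convex, i.e. the Hessian of \<open>f\<^sup>2\<close> along the fibres is positive definite off the zero
  section. No symmetry \<open>f (-v) = f v\<close> is required.\<close>

definition finsler_norm ::
  "('a, 'e::euclidean_space) chart set \<Rightarrow> ('a \<Rightarrow> (('a, 'e) chart \<Rightarrow> 'e) set) \<Rightarrow>
   ('a \<Rightarrow> (('a, 'e) chart \<Rightarrow> 'e) \<Rightarrow> real) \<Rightarrow> bool" where
  "finsler_norm A \<xi> f \<longleftrightarrow>
     (\<forall>q. \<forall>v\<in>\<xi> q. 0 \<le> f q v \<and> (f q v = 0 \<longleftrightarrow> v = (\<lambda>c. 0)) \<and>
        (\<forall>r>0. f q (\<lambda>c. r *\<^sub>R v c) = r * f q v)) \<and>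
     (\<forall>c\<in>A. \<forall>\<Omega> W F. trivialises \<xi> c \<Omega> W F \<longrightarrow>
        smooth_on (UNIV \<times> W) (\<Omega> \<times> (W - {0}))
          (\<lambda>(x, w). f (chart_inv c x)
             (THE v. v \<in> tangent_space UNIV A (chart_inv c x) \<and> v c = F x w))) \<and>
     (\<forall>q. \<forall>v\<in>\<xi> q - {\<lambda>c. 0}. \<forall>h\<in>\<xi> q - {\<lambda>c. 0}.
        deriv (deriv (\<lambda>t. (f q (\<lambda>c. v c + t *\<^sub>R h c))\<^sup>2)) 0 > 0)"

definition sub_finsler_manifold ::
  "('a::topological_space, 'e::euclidean_space) chart set \<Rightarrow> ('a \<Rightarrow> (('a, 'e) chart \<Rightarrow> 'e) set) \<Rightarrow>
   ('a \<Rightarrow> (('a, 'e) chart \<Rightarrow> 'e) \<Rightarrow> real) \<Rightarrow> bool" where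
  "sub_finsler_manifold A \<xi> f \<longleftrightarrow>
     smooth_structure A \<and> smooth_distribution A \<xi> \<and> bracket_generating A \<xi> \<and> finsler_norm A \<xi> f"

text \<open>The maximised Hamiltonian. For a Finsler norm the supremum is attained.\<close>

definition maximised_hamiltonian ::
  "('a, 'e::euclidean_space) chart set \<Rightarrow> ('a \<Rightarrow> (('a, 'e) chart \<Rightarrow> 'e) set) \<Rightarrow>
   ('a \<Rightarrow> (('a, 'e) chart \<Rightarrow> 'e) \<Rightarrow> real) \<Rightarrow> ('a, 'e) cotangent \<Rightarrow> real" where
  "maximised_hamiltonian A \<xi> f z =
     Sup {pairing A (fst z) (snd z) v | v. v \<in> \<xi> (fst z) \<and> f (fst z) v \<le> 1}"

definition unit_level ::
  "('a, 'e::euclidean_space) chart set \<Rightarrow> ('a \<Rightarrow> (('a, 'e) chart \<Rightarrow> 'e) set) \<Rightarrow>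
   ('a \<Rightarrow> (('a, 'e) chart \<Rightarrow> 'e) \<Rightarrow> real) \<Rightarrow> ('a, 'e) cotangent set" where
  "unit_level A \<xi> f = {z \<in> cotangent_bundle UNIV A. maximised_hamiltonian A \<xi> f z = 1}"

definition unit_disc ::
  "('a, 'e::euclidean_space) chart set \<Rightarrow> ('a \<Rightarrow> (('a, 'e) chart \<Rightarrow> 'e) set) \<Rightarrow>
   ('a \<Rightarrow> (('a, 'e) chart \<Rightarrow> 'e) \<Rightarrow> real) \<Rightarrow> ('a, 'e) cotangent set" where
  "unit_disc A \<xi> f = {z \<in> cotangent_bundle UNIV A. maximised_hamiltonian A \<xi> f z \<le> 1}"

section \<open>The table and its boundary\<close>

text \<open>Boundary charts are the charts of \<open>M\<close> taking \<open>U\<close> to the half space \<open>x \<bullet> conormal \<ge> 0\<close>. They give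
  charts of \<open>\<partial>U\<close> with values in the hyperplane orthogonal to \<open>conormal\<close>.\<close>

definition conormal :: "'e::euclidean_space" where
  "conormal = (SOME b. b \<in> Basis)"

definition boundary_charts :: "('a, 'e::euclidean_space) chart set \<Rightarrow> 'a set \<Rightarrow> ('a, 'e) chart set" where
  "boundary_charts A U = {c \<in> A. snd c ` (fst c \<inter> U) = snd c ` fst c \<inter> {x. 0 \<le> x \<bullet> conormal}}"

definition billiard_table :: "('a::topological_space, 'e::euclidean_space) chart set \<Rightarrow> 'a set \<Rightarrow> bool" where
  "billiard_table A U \<longleftrightarrow> closed U \<and> (\<forall>q\<in>frontier U. \<exists>c\<in>boundary_charts A U. q \<in> fst c)"

definition boundary_model :: "'e::euclidean_space set" where
  "boundary_model = {x. x \<bullet> conormal = 0}"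

definition boundary_atlas ::
  "('a::topological_space, 'e::euclidean_space) chart set \<Rightarrow> 'a set \<Rightarrow> ('a, 'e) chart set" where
  "boundary_atlas A U = (\<lambda>c. (fst c \<inter> frontier U, snd c)) ` boundary_charts A U"

text \<open>\<open>v\<close> is the image of the vector \<open>u\<close> tangent to \<open>\<partial>U\<close> under the differential of the inclusion into \<open>M\<close>.\<close>

definition pushes_forward ::
  "('a::topological_space, 'e::euclidean_space) chart set \<Rightarrow> 'a set \<Rightarrow> 'a \<Rightarrow>
   (('a, 'e) chart \<Rightarrow> 'e) \<Rightarrow> (('a, 'e) chart \<Rightarrow> 'e) \<Rightarrow> bool" where
  "pushes_forward A U q u v \<longleftrightarrow>
     u \<in> tangent_space boundary_model (boundary_atlas A U) q \<and> v \<in> tangent_space UNIV A q \<and>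
     (\<forall>c\<in>boundary_atlas A U. \<forall>d\<in>A. q \<in> fst c \<inter> fst d \<longrightarrow> transforms c d q (u c) (v d))"

definition boundary_distribution ::
  "('a::topological_space, 'e::euclidean_space) chart set \<Rightarrow> ('a \<Rightarrow> (('a, 'e) chart \<Rightarrow> 'e) set) \<Rightarrow>
   'a set \<Rightarrow> 'a \<Rightarrow> (('a, 'e) chart \<Rightarrow> 'e) set" where
  "boundary_distribution A \<xi> U q = {u. \<exists>v\<in>\<xi> q. pushes_forward A U q u v}"

definition boundary_norm ::
  "('a::topological_space, 'e::euclidean_space) chart set \<Rightarrow> ('a \<Rightarrow> (('a, 'e) chart \<Rightarrow> 'e) \<Rightarrow> real) \<Rightarrow>
   'a set \<Rightarrow> 'a \<Rightarrow> (('a, 'e) chart \<Rightarrow> 'e) \<Rightarrow> real" where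
  "boundary_norm A f U q u = f q (THE v. pushes_forward A U q u v)"

definition regular_boundary ::
  "('a::topological_space, 'e::euclidean_space) chart set \<Rightarrow> ('a \<Rightarrow> (('a, 'e) chart \<Rightarrow> 'e) set) \<Rightarrow>
   'a set \<Rightarrow> 'a set" where
  "regular_boundary A \<xi> U = {q \<in> frontier U. \<not> (\<forall>v\<in>\<xi> q. \<exists>u. pushes_forward A U q u v)}"

definition boundary_hamiltonian ::
  "('a::topological_space, 'e::euclidean_space) chart set \<Rightarrow> ('a \<Rightarrow> (('a, 'e) chart \<Rightarrow> 'e) set) \<Rightarrow>
   ('a \<Rightarrow> (('a, 'e) chart \<Rightarrow> 'e) \<Rightarrow> real) \<Rightarrow> 'a set \<Rightarrow> ('a, 'e) cotangent \<Rightarrow> real" where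
  "boundary_hamiltonian A \<xi> f U =
     maximised_hamiltonian (boundary_atlas A U) (boundary_distribution A \<xi> U) (boundary_norm A f U)"

definition unit_boundary_orbit ::
  "('a::topological_space, 'e::euclidean_space) chart set \<Rightarrow> ('a \<Rightarrow> (('a, 'e) chart \<Rightarrow> 'e) set) \<Rightarrow>
   ('a \<Rightarrow> (('a, 'e) chart \<Rightarrow> 'e) \<Rightarrow> real) \<Rightarrow> 'a set \<Rightarrow> (real \<Rightarrow> ('a, 'e) cotangent) \<Rightarrow> real set \<Rightarrow> bool" where
  "unit_boundary_orbit A \<xi> f U \<mu> C \<longleftrightarrow>
     (\<forall>t\<in>C. \<mu> t \<in> cotangent_bundle boundary_model (boundary_atlas A U) \<and>
        fst (\<mu> t) \<in> regular_boundary A \<xi> U \<and> boundary_hamiltonian A \<xi> f U (\<mu> t) = 1 \<and>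
        flows_along boundary_model (boundary_atlas A U) (boundary_hamiltonian A \<xi> f U) \<mu> C t)"

text \<open>Over the complement of the singular points a boundary geodesic is the projection of an orbit of
  the Hamiltonian flow on the unit level. At singular points that flow is not defined; a boundary
  geodesic may meet them, and is required there to be a unit speed horizontal curve of
  \<open>(\<partial>U, \<xi>\<^sub>\<partial>, f)\<close>. For a curve avoiding the singular points the last clause, with \<open>C = K\<close>, says that
  the whole curve is the projection of an orbit.\<close>

definition boundary_geodesic ::
  "('a::topological_space, 'e::euclidean_space) chart set \<Rightarrow> ('a \<Rightarrow> (('a, 'e) chart \<Rightarrow> 'e) set) \<Rightarrow>
   ('a \<Rightarrow> (('a, 'e) chart \<Rightarrow> 'e) \<Rightarrow> real) \<Rightarrow> 'a set \<Rightarrow> (real \<Rightarrow> 'a) \<Rightarrow> real set \<Rightarrow> bool" where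
  "boundary_geodesic A \<xi> f U \<delta> K \<longleftrightarrow>
     is_interval K \<and> \<delta> ` K \<subseteq> frontier U \<and>
     lipschitz_in_charts (boundary_atlas A U) \<delta> (\<lambda>c s. snd c (\<delta> s)) K \<and>
     (AE t in lebesgue. t \<in> K \<longrightarrow>
        (\<exists>u\<in>boundary_distribution A \<xi> U (\<delta> t).
           velocity boundary_model (boundary_atlas A U) \<delta> K t u \<and> boundary_norm A f U (\<delta> t) u = 1)) \<and>
     (\<forall>C. is_interval C \<and> C \<subseteq> K \<and> \<delta> ` C \<subseteq> regular_boundary A \<xi> U \<longrightarrow>
        (\<exists>\<mu>. unit_boundary_orbit A \<xi> f U \<mu> C \<and> (\<forall>t\<in>C. fst (\<mu> t) = \<delta> t)))"

text \<open>Reparametrisation by a nondecreasing locally Lipschitz \<open>\<tau>\<close>, whose speed may vanish.\<close>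

definition singular_reparametrisation ::
  "(real \<Rightarrow> 'a) \<Rightarrow> real set \<Rightarrow> (real \<Rightarrow> 'a) \<Rightarrow> real set \<Rightarrow> bool" where
  "singular_reparametrisation \<gamma> I \<delta> K \<longleftrightarrow>
     (\<exists>\<tau>. mono_on I \<tau> \<and> locally_lipschitz I \<tau> \<and> \<tau> ` I = K \<and> (\<forall>x\<in>I. \<gamma> x = \<delta> (\<tau> x)))"

section \<open>Billiards\<close>

definition points_into :: "('a, 'e::euclidean_space) chart set \<Rightarrow> 'a set \<Rightarrow> 'a \<Rightarrow> (('a, 'e) chart \<Rightarrow> 'e) \<Rightarrow> bool" where
  "points_into A U q v \<longleftrightarrow> (\<exists>c\<in>boundary_charts A U. q \<in> fst c \<and> v c \<bullet> conormal > 0)"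

definition points_out_of :: "('a, 'e::euclidean_space) chart set \<Rightarrow> 'a set \<Rightarrow> 'a \<Rightarrow> (('a, 'e) chart \<Rightarrow> 'e) \<Rightarrow> bool" where
  "points_out_of A U q v \<longleftrightarrow> (\<exists>c\<in>boundary_charts A U. q \<in> fst c \<and> v c \<bullet> conormal < 0)"

definition maximising_vector ::
  "('a, 'e::euclidean_space) chart set \<Rightarrow> ('a \<Rightarrow> (('a, 'e) chart \<Rightarrow> 'e) set) \<Rightarrow>
   ('a \<Rightarrow> (('a, 'e) chart \<Rightarrow> 'e) \<Rightarrow> real) \<Rightarrow> ('a, 'e) cotangent \<Rightarrow> (('a, 'e) chart \<Rightarrow> 'e) \<Rightarrow> bool" where
  "maximising_vector A \<xi> f z v \<longleftrightarrow> v \<in> \<xi> (fst z) \<and> f (fst z) v \<le> 1 \<and>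
     pairing A (fst z) (snd z) v = maximised_hamiltonian A \<xi> f z"

text \<open>With the sign convention of \<^const>\<open>hamiltonian_vector\<close>, the flow of \<open>G\<close> (lifted to the cotangent
  bundle) is translation by \<open>- t dG\<close>.\<close>

definition lifted :: "('a \<Rightarrow> real) \<Rightarrow> ('a, 'e) cotangent \<Rightarrow> real" where
  "lifted G z = G (fst z)"

definition table_function ::
  "('a::topological_space, 'e::euclidean_space) chart set \<Rightarrow> ('a \<Rightarrow> (('a, 'e) chart \<Rightarrow> 'e) set) \<Rightarrow>
   ('a \<Rightarrow> (('a, 'e) chart \<Rightarrow> 'e) \<Rightarrow> real) \<Rightarrow> 'a set \<Rightarrow> ('a \<Rightarrow> real) \<Rightarrow> bool" where
  "table_function A \<xi> f U G \<longleftrightarrow>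
     (\<forall>c\<in>A. smooth_on UNIV (snd c ` fst c) (G \<circ> chart_inv c)) \<and>
     (\<exists>r. frontier U = G -` {r}) \<and>
     (\<forall>c\<in>A. \<forall>q\<in>fst c \<inter> frontier U. frechet_derivative (G \<circ> chart_inv c) (at (snd c q)) \<noteq> (\<lambda>h. 0)) \<and>
     (\<forall>z\<in>unit_level A \<xi> f. fst z \<in> frontier U \<and>
        (\<exists>v. maximising_vector A \<xi> f z v \<and> points_out_of A U (fst z) v) \<longrightarrow>
        (\<exists>T>0. \<exists>lam. lam 0 = z \<and>
           (\<forall>t\<in>{0..T}. lam t \<in> unit_disc A \<xi> f \<and> fst (lam t) \<in> frontier U \<and>
              flows_along UNIV A (lifted G) lam {0..T} t) \<and>
           lam T \<in> unit_level A \<xi> f \<and>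
           (\<exists>v. maximising_vector A \<xi> f (lam T) v \<and> points_into A U (fst (lam T)) v)))"

definition billiard_characteristic ::
  "('a::topological_space, 'e::euclidean_space) chart set \<Rightarrow> ('a \<Rightarrow> (('a, 'e) chart \<Rightarrow> 'e) set) \<Rightarrow>
   ('a \<Rightarrow> (('a, 'e) chart \<Rightarrow> 'e) \<Rightarrow> real) \<Rightarrow> 'a set \<Rightarrow> ('a \<Rightarrow> real) \<Rightarrow>
   (real \<Rightarrow> ('a, 'e) cotangent) \<Rightarrow> real set \<Rightarrow> bool" where
  "billiard_characteristic A \<xi> f U G lam J \<longleftrightarrow>
     is_interval J \<and>
     (\<forall>t\<in>J. lam t \<in> unit_level A \<xi> f \<and> fst (lam t) \<in> U \<or>
            lam t \<in> unit_disc A \<xi> f \<and> fst (lam t) \<in> frontier U) \<and>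
     lipschitz_in_charts A (\<lambda>t. fst (lam t)) (\<lambda>c t. coords c (lam t)) J \<and>
     (AE t in lebesgue. t \<in> J \<longrightarrow>
        lam t \<in> unit_level A \<xi> f \<and> fst (lam t) \<in> U \<and>
          flows_along UNIV A (maximised_hamiltonian A \<xi> f) lam J t \<or>
        lam t \<in> unit_disc A \<xi> f \<and> fst (lam t) \<in> frontier U \<and>
          flows_along UNIV A (lifted G) lam J t)"

definition speed ::
  "('a, 'e::euclidean_space) chart set \<Rightarrow> ('a \<Rightarrow> (('a, 'e) chart \<Rightarrow> 'e) \<Rightarrow> real) \<Rightarrow>
   (real \<Rightarrow> 'a) \<Rightarrow> real set \<Rightarrow> real \<Rightarrow> real" where
  "speed A f \<alpha> J t = f (\<alpha> t) (THE v. velocity UNIV A \<alpha> J t v)"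

text \<open>\<open>s\<close> is an arclength function of \<open>\<alpha>\<close>, and \<open>\<gamma>\<close> is \<open>\<alpha>\<close> parametrised by it.\<close>

definition arclength_reparametrisation ::
  "('a, 'e::euclidean_space) chart set \<Rightarrow> ('a \<Rightarrow> (('a, 'e) chart \<Rightarrow> 'e) \<Rightarrow> real) \<Rightarrow>
   (real \<Rightarrow> 'a) \<Rightarrow> real set \<Rightarrow> (real \<Rightarrow> real) \<Rightarrow> (real \<Rightarrow> 'a) \<Rightarrow> real set \<Rightarrow> bool" where
  "arclength_reparametrisation A f \<alpha> J s \<gamma> I \<longleftrightarrow>
     (\<forall>a\<in>J. \<forall>b\<in>J. a \<le> b \<longrightarrow> (speed A f \<alpha> J has_integral (s b - s a)) {a..b}) \<and>
     s ` J = I \<and> (\<forall>t\<in>J. \<gamma> (s t) = \<alpha> t)"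

text \<open>\<open>\<gamma>s i\<close> are the approximating billiard trajectories and \<open>lams i\<close> the corresponding billiard
  characteristics. The limit \<open>lam\<close> projects to an unreduced version \<open>\<gamma> \<circ> s\<close> of \<open>\<gamma>\<close>, i.e. to \<open>\<gamma>\<close> traversed
  with a nondecreasing, possibly locally constant, parametrisation.\<close>

definition C1_limit_trajectory ::
  "('a::topological_space, 'e::euclidean_space) chart set \<Rightarrow> ('a \<Rightarrow> (('a, 'e) chart \<Rightarrow> 'e) set) \<Rightarrow>
   ('a \<Rightarrow> (('a, 'e) chart \<Rightarrow> 'e) \<Rightarrow> real) \<Rightarrow> 'a set \<Rightarrow> ('a \<Rightarrow> real) \<Rightarrow> (real \<Rightarrow> 'a) \<Rightarrow> real set \<Rightarrow> bool" where
  "C1_limit_trajectory A \<xi> f U G \<gamma> I \<longleftrightarrow>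
     is_interval I \<and> interior I \<noteq> {} \<and> \<gamma> ` I \<subseteq> U \<and>
     (\<exists>\<gamma>s Is lams Js ss lam J s.
        (\<forall>i. billiard_characteristic A \<xi> f U G (lams i) (Js i) \<and>
             arclength_reparametrisation A f (\<lambda>t. fst (lams i t)) (Js i) (ss i) (\<gamma>s i) (Is i)) \<and>
        C0_loc_limit euclidean Is \<gamma>s I \<gamma> \<and>
        is_interval J \<and> C0_loc_limit (cotangent_topology UNIV A) Js lams J lam \<and>
        mono_on J s \<and> continuous_on J s \<and> s ` J = I \<and> (\<forall>t\<in>J. fst (lam t) = \<gamma> (s t)))"

definition C1_gliding_trajectory ::
  "('a::topological_space, 'e::euclidean_space) chart set \<Rightarrow> ('a \<Rightarrow> (('a, 'e) chart \<Rightarrow> 'e) set) \<Rightarrow>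
   ('a \<Rightarrow> (('a, 'e) chart \<Rightarrow> 'e) \<Rightarrow> real) \<Rightarrow> 'a set \<Rightarrow> ('a \<Rightarrow> real) \<Rightarrow> (real \<Rightarrow> 'a) \<Rightarrow> real set \<Rightarrow> bool" where
  "C1_gliding_trajectory A \<xi> f U G \<gamma> I \<longleftrightarrow>
     C1_limit_trajectory A \<xi> f U G \<gamma> I \<and> \<gamma> ` I \<subseteq> frontier U"

end

theory Submission
  imports Defs "HOL-Complex_Analysis.Great_Picard"
begin

text \<open>
  Let \<open>\<sigma>\<close> be the limit, along a subsequence, of the arclength functions of the approximating characteristics.
  As \<open>X_G\<close> only changes the normal component of a covector, the restriction of the limit characteristic \<open>\<lambda>\<close> to
  \<open>T\<partial>U\<close> moves at the rate \<open>d\<sigma>\<close>, and its velocity with respect to \<open>\<sigma>\<close> is the tangential part of \<open>X_f\<close>.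
  It rests while \<open>H \<lambda> < 1\<close>, so \<open>H \<lambda> = 1\<close> wherever \<open>\<sigma>\<close> moves; there the base point stays in \<open>\<partial>U\<close>, so the
  maximising vector is tangent to \<open>\<partial>U\<close>. For a covector of this kind the boundary Hamiltonian of the restriction is \<open>1\<close>
  and its Hamiltonian vector is the tangential part of \<open>X_f\<close>. Hence the restriction, as a function of \<open>\<sigma>\<close>, is a unit
  orbit of the boundary flow, and \<open>\<gamma>\<close> is a reparametrisation of its projection.

  If \<open>\<sigma>\<close> is constant, so is \<open>\<gamma>\<close>, and a constant curve at \<open>q\<close> reparametrises the one-point geodesic at \<open>q\<close> as soon as
  a unit covector there has a tangent maximiser. At a regular \<open>q\<close> such a covector is found by minimising \<open>H\<close> along the
  conormal direction unless \<open>\<xi>\<close> has rank one and is transverse to \<open>\<partial>U\<close>; but then billiard trajectories have short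
  length near \<open>q\<close> and cannot converge to a constant curve on a nondegenerate interval.
\<close>

section \<open>Calculus\<close>

text \<open>The characteristics converge only in \<open>C^0\<close>, so their velocities need not
  converge and the limit cannot be differentiated termwise. What survives the limit are integrated
  inequalities: over a short time the increment of the tangential coordinates differs from a fixed
  vector times the increment of arclength by at most \<epsilon> times that increment. Derivatives
  are therefore two-point ("strong") derivatives, which also descend along a monotone
  parametrisation with plateaus.

  The normal component of \<lambda> acts as a multiplier and can change while \<sigma> rests, so
  \<lambda> itself is no function of \<sigma>. Only its restriction to the boundary is, and strict
  convexity of the norm makes a tangent maximiser depend on the restriction alone.

  No hypothesis links the parametrisation \<open>s\<close> of a limit trajectory to the arclengths
  \<open>ss i\<close>. They are compared through the base curve: a limit of curves parametrised by
  arclength is locally Lipschitz, and the geodesic has nonzero velocity.\<close>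

lemma difference_quotient_sequence:
  fixes F :: "real \<Rightarrow> 'b::real_normed_vector"
  assumes F: "(F has_vector_derivative v) (at t within S)"
    and e: "\<And>k. t + e k \<in> S" "\<And>k. e k > 0" "e \<longlonglongrightarrow> 0"
  shows "(\<lambda>k::nat. (F (t + e k) - F t) /\<^sub>R e k) \<longlonglongrightarrow> v"
proof -
  have *: "((\<lambda>y. (1 / norm (y - t)) *\<^sub>R (F y - (F t + (y - t) *\<^sub>R v))) \<longlongrightarrow> 0) (at t within S)"
    using F by (auto simp: has_vector_derivative_def has_derivative_within)
  have "(\<lambda>k. t + e k) \<longlonglongrightarrow> t"
    using tendsto_add[OF tendsto_const[of t] e(3)] by simp
  then have "filterlim (\<lambda>k. t + e k) (at t within S) sequentially"
    using e(1,2) by (auto simp: filterlim_at intro!: always_eventually) (metis less_numeral_extra(3))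
  from filterlim_compose[OF * this]
  have "(\<lambda>k. (1 / norm (e k)) *\<^sub>R (F (t + e k) - (F t + e k *\<^sub>R v))) \<longlonglongrightarrow> 0"
    by simp
  moreover have "(1 / norm (e k)) *\<^sub>R (F (t + e k) - (F t + e k *\<^sub>R v)) = (F (t + e k) - F t) /\<^sub>R e k - v" for k
    using e(2)[of k] by (simp add: algebra_simps divide_inverse)
  ultimately have "(\<lambda>k. (F (t + e k) - F t) /\<^sub>R e k - v) \<longlonglongrightarrow> 0"
    by simp
  then show ?thesis by (simp add: LIM_zero_iff)
qed

text \<open>The difference quotients of \<open>g\<close> are bounded, so dominated convergence applies to them.\<close>

lemma lipschitz_fundamental_theorem_of_calculus:
  fixes g :: "real \<Rightarrow> 'b::euclidean_space"
  assumes ab: "a \<le> b" and lip: "C-lipschitz_on {a..b} g" and N: "negligible N"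
    and d: "\<And>t. t \<in> {a..b} - N \<Longrightarrow> (g has_vector_derivative g' t) (at t within {a..b})"
  shows "(g' has_integral (g b - g a)) {a..b}"
proof -
  \<comment> \<open>Constant continuation beyond \<open>b\<close>, so that forward difference
    quotients with step at most 1 make sense on all of \<open>{a..b}\<close>.\<close>
  define h where "h t = g (min t b)" for t
  define e where "e k = 1 / (real k + 1)" for k
  have e0: "e k > 0" "e k \<le> 1" for k by (auto simp: e_def)
  have elim: "e \<longlonglongrightarrow> 0"
    using LIMSEQ_inverse_real_of_nat by (simp add: e_def[abs_def] inverse_eq_divide add.commute)
  have C: "C \<ge> 0" using lip by (rule lipschitz_on_nonneg)
  have hlip: "C-lipschitz_on {a..b+1} h"
  proof (rule lipschitz_onI[OF _ C])
    fix x y assume xy: "x \<in> {a..b+1}" "y \<in> {a..b+1}"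
    have "dist (g (min x b)) (g (min y b)) \<le> C * dist (min x b) (min y b)"
      using lipschitz_onD[OF lip, of "min x b" "min y b"] xy ab by auto
    also have "\<dots> \<le> C * dist x y"
      using C by (intro mult_left_mono) (auto simp: dist_real_def)
    finally show "dist (h x) (h y) \<le> C * dist x y" by (simp add: h_def)
  qed
  have hcont: "continuous_on {a..b+1} h" using hlip by (rule lipschitz_on_continuous_on)
  \<comment> \<open>A difference quotient of \<open>h\<close> is the derivative of the same
    difference quotient of its antiderivative \<open>F\<close>. The classical fundamental theorem
    thus integrates \<open>f k\<close> exactly, and the boundary terms \<open>G k\<close> tend to
    \<open>g\<close>.\<close>
  define F where "F t = integral {a..t} h" for t
  have Fd: "(F has_vector_derivative h t) (at t within {a..b+1})" if "t \<in> {a..b+1}" for t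
    unfolding F_def using integral_has_vector_derivative[OF hcont that] .
  define f where "f k t = (h (t + e k) - h t) /\<^sub>R e k" for k t
  define G where "G k t = (F (t + e k) - F t) /\<^sub>R e k" for k t
  have fint: "(f k has_integral (G k b - G k a)) {a..b}" for k
  proof (rule fundamental_theorem_of_calculus[OF ab])
    fix t assume t: "t \<in> {a..b}"
    have 1: "(F has_vector_derivative h t) (at t within {a..b})"
      by (rule has_vector_derivative_within_subset[OF Fd]) (use t in auto)
    have "((\<lambda>t. t + e k) has_vector_derivative 1) (at t within {a..b})"
      by (auto intro!: derivative_eq_intros)
    moreover have "(F has_vector_derivative h (t + e k)) (at (t + e k) within (\<lambda>t. t + e k) ` {a..b})"
      by (rule has_vector_derivative_within_subset[OF Fd]) (use t e0[of k] in auto)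
    ultimately have "((F \<circ> (\<lambda>t. t + e k)) has_vector_derivative 1 *\<^sub>R h (t + e k)) (at t within {a..b})"
      by (rule vector_diff_chain_within)
    then have 2: "((\<lambda>t. F (t + e k)) has_vector_derivative h (t + e k)) (at t within {a..b})"
      by (simp add: o_def)
    have 3: "((\<lambda>t. F (t + e k) - F t) has_vector_derivative h (t + e k) - h t) (at t within {a..b})"
      by (intro has_vector_derivative_diff 2 1)
    have "((\<lambda>t. inverse (e k) *\<^sub>R (F (t + e k) - F t)) has_vector_derivative inverse (e k) *\<^sub>R (h (t + e k) - h t)) (at t within {a..b})"
      using bounded_linear.has_vector_derivative[OF bounded_linear_scaleR_right 3] .
    then show "(G k has_vector_derivative f k t) (at t within {a..b})"
      unfolding G_def f_def .
  qed
  have Glim: "(\<lambda>k. G k t) \<longlonglongrightarrow> g t" if t: "t \<in> {a..b}" for t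
  proof -
    have tk: "t + e k \<in> {a..b+1}" for k using t e0[of k] by auto
    have "(\<lambda>k. (F (t + e k) - F t) /\<^sub>R e k) \<longlonglongrightarrow> h t"
      by (rule difference_quotient_sequence[OF Fd]) (use t tk e0 elim in auto)
    then show ?thesis using t by (simp add: G_def h_def min_def)
  qed
  \<comment> \<open>At \<open>b\<close> the forward quotients see only the constant continuation and
    need not tend to \<open>g' b\<close>.\<close>
  define N' where "N' = insert b N"
  have N': "negligible N'" using N by (simp add: N'_def)
  define f' where "f' k t = (if t \<in> N' then 0 else f k t)" for k t
  define g'' where "g'' t = (if t \<in> N' then 0 else g' t)" for t
  have "(g'' has_integral (g b - g a)) {a..b}"
  proof (rule has_integral_dominated_convergence[where f = f' and h = "\<lambda>_. C"])
    show "(f' k has_integral (G k b - G k a)) {a..b}" for k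
      by (rule has_integral_spike[OF N' _ fint[of k]]) (auto simp: f'_def)
    show "(\<lambda>_. C) integrable_on {a..b}" by (rule integrable_const_ivl)
    show "\<forall>t\<in>{a..b}. norm (f' k t) \<le> C" for k
    proof
      fix t assume t: "t \<in> {a..b}"
      have "norm (h (t + e k) - h t) \<le> C * e k"
        using lipschitz_onD[OF hlip, of "t + e k" t] t e0[of k] by (auto simp: dist_norm)
      moreover have "norm (f k t) = norm (h (t + e k) - h t) / e k"
        unfolding f_def norm_scaleR using e0[of k] by (simp add: divide_inverse mult.commute)
      ultimately show "norm (f' k t) \<le> C"
        using e0[of k] C by (simp add: f'_def pos_divide_le_eq)
    qed
    show "\<forall>t\<in>{a..b}. (\<lambda>k. f' k t) \<longlonglongrightarrow> g'' t"
    proof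
      fix t assume t: "t \<in> {a..b}"
      show "(\<lambda>k. f' k t) \<longlonglongrightarrow> g'' t"
      proof (cases "t \<in> N'")
        case False
        then have t': "t < b" "t \<notin> N" using t by (auto simp: N'_def)
        have hd: "(h has_vector_derivative g' t) (at t within {a..b+1})"
        proof -
          have "(g has_vector_derivative g' t) (at t within {a..<b})"
            by (rule has_vector_derivative_within_subset[OF d]) (use t t' in auto)
          then have "(h has_vector_derivative g' t) (at t within {a..<b})"
            by (rule has_vector_derivative_transform_within[where d = 1]) (use t t' in \<open>auto simp: h_def min_def\<close>)
          moreover have "at t within {a..<b} = at t within {a..b+1}"
            by (rule at_within_nhd[of _ "{..<b}"]) (use t t' in auto)
          ultimately show ?thesis by simp
        qed
        have tk: "t + e k \<in> {a..b+1}" for k using t e0[of k] by auto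
        have "(\<lambda>k. (h (t + e k) - h t) /\<^sub>R e k) \<longlonglongrightarrow> g' t"
          by (rule difference_quotient_sequence[OF hd]) (use tk e0 elim in auto)
        then show ?thesis using False by (simp add: f'_def f_def g''_def)
      qed (simp add: f'_def g''_def)
    qed
    show "(\<lambda>k. G k b - G k a) \<longlonglongrightarrow> g b - g a"
      using ab by (intro tendsto_diff Glim) auto
  qed
  then show ?thesis
    by (rule has_integral_spike[OF N', rotated]) (auto simp: g''_def)
qed

text \<open>Within a set that is only relatively open in \<open>V\<close>, a derivative is
  determined only along \<open>V\<close>. Restriction to lines with direction in \<open>V\<close>
  reduces uniqueness to functions of one real variable.\<close>

lemma has_derivative_path:
  fixes f :: "'v::real_normed_vector \<Rightarrow> 'w::real_normed_vector"
  assumes f: "(f has_derivative L) (at x within S)" and "subspace V" "open Q" "x \<in> Q" "Q \<inter> V \<subseteq> S" "x \<in> V" "h \<in> V"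
  shows "((\<lambda>t. f (x + t *\<^sub>R h)) has_vector_derivative L h) (at 0)"
proof -
  define T where "T = (\<lambda>t. x + t *\<^sub>R h) -` Q"
  have T: "open T" unfolding T_def by (intro open_vimage assms continuous_intros)
  have "0 \<in> T" by (simp add: T_def assms)
  have sub: "(\<lambda>t. x + t *\<^sub>R h) ` T \<subseteq> S"
  proof clarify
    fix t assume "t \<in> T"
    have "t *\<^sub>R h \<in> V" using assms by (simp add: subspace_mul)
    then have "x + t *\<^sub>R h \<in> V" using assms by (simp add: subspace_add)
    then show "x + t *\<^sub>R h \<in> S" using \<open>t \<in> T\<close> assms by (auto simp: T_def)
  qed
  have 1: "((\<lambda>t. x + t *\<^sub>R h) has_derivative (\<lambda>t. t *\<^sub>R h)) (at 0 within T)"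
    by (auto intro!: derivative_eq_intros)
  have 2: "(f has_derivative L) (at (x + 0 *\<^sub>R h) within (\<lambda>t. x + t *\<^sub>R h) ` T)"
    using has_derivative_subset[OF f sub] by simp
  have "((\<lambda>t. f (x + t *\<^sub>R h)) has_derivative (\<lambda>t. L (t *\<^sub>R h))) (at 0 within T)"
    using has_derivative_in_compose[OF 1 2] .
  then have "((\<lambda>t. f (x + t *\<^sub>R h)) has_derivative (\<lambda>t. t *\<^sub>R L h)) (at 0 within T)"
    using has_derivative_linear[OF f] by (simp add: linear_scale)
  then show ?thesis
    using at_within_open[OF \<open>0 \<in> T\<close> T] by (simp add: has_vector_derivative_def)
qed

lemma has_derivative_unique_on_subspace:
  fixes f :: "'v::real_normed_vector \<Rightarrow> 'w::real_normed_vector"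
  assumes "(f has_derivative L) (at x within S)" "(f has_derivative L') (at x within S)"
    and "subspace V" "open Q" "x \<in> Q" "Q \<inter> V \<subseteq> S" "x \<in> V" "h \<in> V"
  shows "L h = L' h"
  using has_derivative_path[OF assms(1,3-)] has_derivative_path[OF assms(2-)] vector_derivative_unique_at by blast

text \<open>The difference of \<open>f\<close> and the line has a local minimum at 0. In this way
  the derivative of a maximum is read off from a single competitor.\<close>

lemma derivative_touching:
  fixes f :: "real \<Rightarrow> real"
  assumes f: "(f has_real_derivative D) (at 0)" and "f 0 = c" "d > 0"
    and ge: "\<And>t. \<bar>t\<bar> < d \<Longrightarrow> c + t * b \<le> f t"
  shows "D = b"
proof -
  have "((\<lambda>t. f t - (c + t * b)) has_real_derivative D - b) (at 0)"
    by (auto intro!: derivative_eq_intros f)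
  then have "D - b = 0"
    by (rule DERIV_local_min[OF _ \<open>d > 0\<close>]) (use assms in auto)
  then show ?thesis by simp
qed

text \<open>Along each line in \<open>S\<close> the difference \<open>u - l\<close> has a minimum at
  \<open>z\<close>, so the two derivatives agree on \<open>S\<close>, and the remainder quotient of
  \<open>m\<close> lies between those of \<open>l\<close> and \<open>u\<close>. It serves to
  differentiate the boundary Hamiltonian, which is controlled through bounds from both
  sides.\<close>

lemma has_derivative_squeeze:
  fixes m l u :: "'v::real_normed_vector \<Rightarrow> real"
  assumes l: "(l has_derivative L') (at z within S)" and u: "(u has_derivative U') (at z within S)"
    and S: "subspace S" "z \<in> S"
    and ev: "d > 0" "\<And>y. y \<in> S \<Longrightarrow> dist y z < d \<Longrightarrow> l y \<le> m y" "\<And>y. y \<in> S \<Longrightarrow> dist y z < d \<Longrightarrow> m y \<le> u y"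
    and eq: "l z = m z" "u z = m z"
  shows "(m has_derivative U') (at z within S)"
proof -
  have LU: "L' h = U' h" if h: "h \<in> S" for h
  proof -
    have 1: "((\<lambda>t. l (z + t *\<^sub>R h)) has_vector_derivative L' h) (at 0)"
      by (rule has_derivative_path[OF l S(1) open_UNIV]) (use S h in auto)
    have 2: "((\<lambda>t. u (z + t *\<^sub>R h)) has_vector_derivative U' h) (at 0)"
      by (rule has_derivative_path[OF u S(1) open_UNIV]) (use S h in auto)
    have der: "((\<lambda>t. u (z + t *\<^sub>R h) - l (z + t *\<^sub>R h)) has_real_derivative U' h - L' h) (at 0)"
      using has_vector_derivative_diff[OF 2 1] by (simp add: has_real_derivative_iff_has_vector_derivative)
    define r where "r = d / (norm h + 1)"
    have "r > 0" using ev(1) by (simp add: r_def add_nonneg_pos)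
    have ge: "0 + t * 0 \<le> u (z + t *\<^sub>R h) - l (z + t *\<^sub>R h)" if t: "\<bar>t\<bar> < r" for t
    proof -
      have "z + t *\<^sub>R h \<in> S" using S h by (simp add: subspace_add subspace_mul)
      moreover have "\<bar>t\<bar> * norm h < d"
      proof -
        have "\<bar>t\<bar> * norm h \<le> \<bar>t\<bar> * (norm h + 1)" by (simp add: algebra_simps)
        also have "\<dots> < d" using t by (simp add: r_def pos_less_divide_eq add_nonneg_pos)
        finally show ?thesis .
      qed
      ultimately show ?thesis using ev(2)[of "z + t *\<^sub>R h"] ev(3)[of "z + t *\<^sub>R h"] by (simp add: dist_norm)
    qed
    have "U' h - L' h = 0"
      by (rule derivative_touching[OF der _ \<open>r > 0\<close> ge]) (simp_all add: eq)
    then show ?thesis by simp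
  qed
  have *: "((\<lambda>y. (1 / norm (y - z)) *\<^sub>R (l y - (l z + L' (y - z)))) \<longlongrightarrow> 0) (at z within S)"
    "((\<lambda>y. (1 / norm (y - z)) *\<^sub>R (u y - (u z + U' (y - z)))) \<longlongrightarrow> 0) (at z within S)"
    using l u by (auto simp: has_derivative_within)
  have "((\<lambda>y. (1 / norm (y - z)) *\<^sub>R (m y - (m z + U' (y - z)))) \<longlongrightarrow> 0) (at z within S)"
  proof (rule tendsto_sandwich[OF _ _ *])
    have near: "\<forall>\<^sub>F y in at z within S. y \<in> S \<and> dist y z < d"
      using ev(1) by (auto simp: eventually_at)
    show "\<forall>\<^sub>F y in at z within S. (1 / norm (y - z)) *\<^sub>R (l y - (l z + L' (y - z))) \<le> (1 / norm (y - z)) *\<^sub>R (m y - (m z + U' (y - z)))"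
      using near
    proof eventually_elim
      case (elim y)
      then have "L' (y - z) = U' (y - z)" using S by (intro LU) (simp add: subspace_diff)
      then show ?case using ev(2)[of y] elim eq by (auto intro!: divide_right_mono)
    qed
    show "\<forall>\<^sub>F y in at z within S. (1 / norm (y - z)) *\<^sub>R (m y - (m z + U' (y - z))) \<le> (1 / norm (y - z)) *\<^sub>R (u y - (u z + U' (y - z)))"
      using near
    proof eventually_elim
      case (elim y)
      then show ?case using ev(3)[of y] elim eq by (auto intro!: divide_right_mono)
    qed
  qed
  then show ?thesis
    using has_derivative_bounded_linear[OF u] by (simp add: has_derivative_within)
qed

section \<open>Maxima of families of functions\<close>

text \<open>Each maximum is tested with the maximiser of the other parameter; compactness of
  \<open>S\<close> makes the change of \<Phi> uniform in \<open>w\<close>.\<close>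

lemma maximum_continuous:
  fixes \<Phi> :: "'z::metric_space \<Rightarrow> 'w::metric_space \<Rightarrow> real"
  assumes cont: "continuous_on (Q \<times> S) (\<lambda>(z, w). \<Phi> z w)" and S: "compact S" "S \<noteq> {}" and z0: "z0 \<in> Q" and "e > 0"
  shows "\<exists>d>0. \<forall>z\<in>Q. dist z z0 < d \<longrightarrow> \<bar>(SUP w\<in>S. \<Phi> z w) - (SUP w\<in>S. \<Phi> z0 w)\<bar> < e"
proof -
  have e2: "e / 2 > 0" using \<open>e > 0\<close> by simp
  obtain X0 where "z0 \<in> X0" "open X0" and X0': "\<forall>z\<in>X0 \<inter> Q. \<forall>w\<in>S. dist ((\<lambda>(z, w). \<Phi> z w) (z, w)) ((\<lambda>(z, w). \<Phi> z w) (z0, w)) \<le> e/2"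
    by (rule continuous_on_prod_compactE[OF cont S(1) z0 e2])
  then have X0: "open X0" "z0 \<in> X0" "\<And>z w. z \<in> X0 \<inter> Q \<Longrightarrow> w \<in> S \<Longrightarrow> \<bar>\<Phi> z w - \<Phi> z0 w\<bar> \<le> e/2"
    by (simp_all add: dist_real_def)
  obtain d where d: "d > 0" "ball z0 d \<subseteq> X0" using X0 openE by blast
  have "\<bar>(SUP w\<in>S. \<Phi> z w) - (SUP w\<in>S. \<Phi> z0 w)\<bar> < e" if z: "z \<in> Q" "dist z z0 < d" for z
  proof -
    have ac: "\<exists>w\<in>S. \<Phi> y w = (SUP w\<in>S. \<Phi> y w) \<and> (\<forall>w'\<in>S. \<Phi> y w' \<le> (SUP w\<in>S. \<Phi> y w))" if "y \<in> Q" for y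
    proof -
      have "continuous_on S ((\<lambda>(z, w). \<Phi> z w) \<circ> (\<lambda>w. (y, w)))"
        by (intro continuous_on_compose continuous_intros continuous_on_subset[OF cont]) (use that in auto)
      then have "continuous_on S (\<Phi> y)" by (simp add: o_def)
      then obtain w where w: "w \<in> S" "\<And>w'. w' \<in> S \<Longrightarrow> \<Phi> y w' \<le> \<Phi> y w"
        using continuous_attains_sup[OF S] by blast
      then have "(SUP w\<in>S. \<Phi> y w) = \<Phi> y w" by (intro cSup_eq_maximum) auto
      then show ?thesis using w by auto
    qed
    have zX: "z \<in> X0" using z d by (auto simp: dist_commute)
    obtain w w' where "w \<in> S" "\<Phi> z w = (SUP w\<in>S. \<Phi> z w)" "w' \<in> S" "\<Phi> z0 w' = (SUP w\<in>S. \<Phi> z0 w)"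
      "\<Phi> z0 w \<le> (SUP w\<in>S. \<Phi> z0 w)" "\<Phi> z w' \<le> (SUP w\<in>S. \<Phi> z w)"
      using ac[OF z(1)] ac[OF z0] by metis
    then show ?thesis using X0(3)[of z w] X0(3)[of z w'] zX z(1) \<open>e > 0\<close>
      unfolding Int_iff abs_le_iff abs_less_iff by linarith
  qed
  then show ?thesis using d(1) by blast
qed

text \<open>Otherwise maximisers for parameters tending to \<open>z0\<close> would accumulate, by
  compactness of \<open>S\<close>, at a maximiser for \<open>z0\<close> other than
  \<open>w0\<close>. The bound holds for every maximiser at \<open>z\<close>, unique or not.\<close>

lemma maximiser_continuous:
  fixes \<Phi> :: "'z::metric_space \<Rightarrow> 'w::metric_space \<Rightarrow> real"
  assumes cont: "continuous_on (Q \<times> S) (\<lambda>(z, w). \<Phi> z w)" and S: "compact S" "w0 \<in> S" and z0: "z0 \<in> Q"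
    and uniq: "\<And>w. w \<in> S \<Longrightarrow> w \<noteq> w0 \<Longrightarrow> \<Phi> z0 w < \<Phi> z0 w0" and "e > 0"
  shows "\<exists>d>0. \<forall>z\<in>Q. dist z z0 < d \<longrightarrow> (\<forall>w\<in>S. (\<forall>w'\<in>S. \<Phi> z w' \<le> \<Phi> z w) \<longrightarrow> dist w w0 < e)"
proof (rule ccontr)
  assume "\<not> ?thesis"
  then have "\<forall>k::nat. \<exists>z w. z \<in> Q \<and> dist z z0 < 1 / (real k + 1) \<and> w \<in> S \<and> (\<forall>w'\<in>S. \<Phi> z w' \<le> \<Phi> z w) \<and> \<not> dist w w0 < e"
    by (metis add_nonneg_pos of_nat_0_le_iff zero_less_divide_1_iff zero_less_one)
  then obtain z w where zw: "\<And>k::nat. z k \<in> Q" "\<And>k. dist (z k) z0 < 1 / (real k + 1)" "\<And>k. w k \<in> S"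
    "\<And>k w'. w' \<in> S \<Longrightarrow> \<Phi> (z k) w' \<le> \<Phi> (z k) (w k)" "\<And>k. \<not> dist (w k) w0 < e" by metis
  have "z \<longlonglongrightarrow> z0"
  proof (rule tendstoI)
    fix r :: real assume "r > 0"
    have "(\<lambda>k. 1 / (real k + 1)) \<longlonglongrightarrow> 0"
      using LIMSEQ_inverse_real_of_nat by (simp add: inverse_eq_divide add.commute)
    then have "\<forall>\<^sub>F k in sequentially. 1 / (real k + 1) < r" using \<open>r > 0\<close> by (rule order_tendstoD)
    then show "\<forall>\<^sub>F k in sequentially. dist (z k) z0 < r"
      by eventually_elim (use zw(2) in \<open>force intro: less_trans\<close>)
  qed
  obtain w1 r where w1: "w1 \<in> S" "strict_mono r" "(w \<circ> r) \<longlonglongrightarrow> w1"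
    using S(1) zw(3) unfolding compact_def by metis
  have zr: "(z \<circ> r) \<longlonglongrightarrow> z0" using LIMSEQ_subseq_LIMSEQ[OF \<open>z \<longlonglongrightarrow> z0\<close> w1(2)] .
  have lim: "(\<lambda>k. \<Phi> (z (r k)) (u k)) \<longlonglongrightarrow> \<Phi> z0 u0" if "u \<longlonglongrightarrow> u0" "u0 \<in> S" "\<And>k. u k \<in> S" for u u0
  proof -
    have "(\<lambda>k. (z (r k), u k)) \<longlonglongrightarrow> (z0, u0)" using zr that by (auto intro: tendsto_Pair simp: o_def)
    moreover have "(z0, u0) \<in> Q \<times> S" using that z0 by simp
    ultimately have "(\<lambda>k. (\<lambda>(z, w). \<Phi> z w) (z (r k), u k)) \<longlonglongrightarrow> (\<lambda>(z, w). \<Phi> z w) (z0, u0)"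
      by (intro continuous_on_tendsto_compose[OF cont]) (use that zw in auto)
    then show ?thesis by simp
  qed
  have "\<Phi> z0 w0 \<le> \<Phi> z0 w1"
  proof (rule LIMSEQ_le[OF lim lim])
    show "(\<lambda>k. w0) \<longlonglongrightarrow> w0" by simp
    show "(\<lambda>k. w (r k)) \<longlonglongrightarrow> w1" using w1(3) by (simp add: o_def)
  qed (use S w1 zw in auto)
  then have "w1 = w0" using uniq[OF w1(1)] by force
  then have "\<forall>\<^sub>F k in sequentially. dist ((w \<circ> r) k) w0 < e" using tendstoD[OF w1(3) \<open>e > 0\<close>] by simp
  then show False using zw(5) by (auto simp: eventually_sequentially)
qed

text \<open>Danskin's theorem at a point with a unique maximiser. The competitor \<open>w0\<close>
  bounds the increment of the maximum from below and the maximiser at the new point bounds it from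
  above; the latter is close to \<open>w0\<close>, so both have nearly the same linear part.\<close>

lemma has_derivative_maximum:
  fixes \<Phi> :: "'z::euclidean_space \<Rightarrow> 'w::metric_space \<Rightarrow> real" and D :: "'z \<Rightarrow> 'w \<Rightarrow> 'z"
  assumes Q: "open Q" and S: "compact S" "w0 \<in> S" and z0: "z0 \<in> Q"
    and cont: "continuous_on (Q \<times> S) (\<lambda>(z, w). \<Phi> z w)"
    and contD: "continuous_on (Q \<times> S) (\<lambda>(z, w). D z w)"
    and der: "\<And>z w. z \<in> Q \<Longrightarrow> w \<in> S \<Longrightarrow> ((\<lambda>z. \<Phi> z w) has_derivative (\<lambda>h. D z w \<bullet> h)) (at z)"
    and uniq: "\<And>w. w \<in> S \<Longrightarrow> w \<noteq> w0 \<Longrightarrow> \<Phi> z0 w < \<Phi> z0 w0"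
  shows "((\<lambda>z. SUP w\<in>S. \<Phi> z w) has_derivative (\<lambda>h. D z0 w0 \<bullet> h)) (at z0)"
  unfolding has_derivative_within_alt
proof (intro conjI allI impI)
  show "bounded_linear (\<lambda>h. D z0 w0 \<bullet> h)" by (rule bounded_linear_inner_right)
  fix e :: real assume e: "e > 0"
  have att: "\<exists>w\<in>S. \<Phi> y w = (SUP w\<in>S. \<Phi> y w) \<and> (\<forall>w'\<in>S. \<Phi> y w' \<le> \<Phi> y w)" if "y \<in> Q" for y
  proof -
    have "continuous_on S ((\<lambda>(z, w). \<Phi> z w) \<circ> (\<lambda>w. (y, w)))"
      by (intro continuous_on_compose continuous_intros continuous_on_subset[OF cont]) (use that in auto)
    then have "continuous_on S (\<Phi> y)" by (simp add: o_def)
    then obtain w where w: "w \<in> S" "\<And>w'. w' \<in> S \<Longrightarrow> \<Phi> y w' \<le> \<Phi> y w"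
      using continuous_attains_sup[OF S(1)] S(2) by blast
    then have "(SUP w\<in>S. \<Phi> y w) = \<Phi> y w" by (intro cSup_eq_maximum) auto
    then show ?thesis using w by auto
  qed
  have m0: "(SUP w\<in>S. \<Phi> z0 w) = \<Phi> z0 w0"
    by (rule cSup_eq_maximum) (use S uniq in \<open>auto simp: order_le_less\<close>)
  obtain d1 where d1: "d1 > 0" "\<And>z w. z \<in> Q \<Longrightarrow> w \<in> S \<Longrightarrow> dist (z, w) (z0, w0) < d1 \<Longrightarrow> norm (D z w - D z0 w0) < e"
  proof -
    have "(z0, w0) \<in> Q \<times> S" using z0 S by simp
    then obtain d where "d > 0" "\<forall>x\<in>Q \<times> S. dist x (z0, w0) < d \<longrightarrow> dist ((\<lambda>(z, w). D z w) x) ((\<lambda>(z, w). D z w) (z0, w0)) < e"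
      using contD e unfolding continuous_on_iff by meson
    then show ?thesis using that[of d] by (auto simp: dist_norm[of "D _ _"])
  qed
  have d12: "d1/2 > 0" using d1 by simp
  obtain d2 where d2: "d2 > 0" "\<And>z w. z \<in> Q \<Longrightarrow> dist z z0 < d2 \<Longrightarrow> w \<in> S \<Longrightarrow> (\<And>w'. w' \<in> S \<Longrightarrow> \<Phi> z w' \<le> \<Phi> z w) \<Longrightarrow> dist w w0 < d1/2"
    using maximiser_continuous[OF cont S z0 uniq d12] by metis
  obtain d3 where d3: "d3 > 0" "ball z0 d3 \<subseteq> Q" using Q z0 openE by blast
  define d where "d = min d3 (min d2 (d1/2))"
  have d: "d > 0" using d1 d2 d3 by (simp add: d_def)
  \<comment> \<open>Mean value estimate, uniform in all \<open>w\<close> close to \<open>w0\<close>: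
    it applies to \<open>w0\<close> itself and to the maximiser at \<open>y\<close>.\<close>
  have near: "\<bar>\<Phi> z w - \<Phi> z0 w - D z0 w0 \<bullet> (z - z0)\<bar> \<le> e * norm (z - z0)"
    if w: "w \<in> S" "dist w w0 < d1/2" and z: "dist z z0 < d" for z w
  proof -
    have "norm ((\<Phi> z w - D z0 w0 \<bullet> z) - (\<Phi> z0 w - D z0 w0 \<bullet> z0)) \<le> e * norm (z - z0)"
    proof (rule differentiable_bound[OF convex_ball[of z0 d]])
      fix y assume y: "y \<in> ball z0 d"
      then have yQ: "y \<in> Q" using d3 by (auto simp: d_def)
      have "((\<lambda>z. \<Phi> z w - D z0 w0 \<bullet> z) has_derivative (\<lambda>h. D y w \<bullet> h - D z0 w0 \<bullet> h)) (at y)"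
        by (rule has_derivative_diff[OF der[OF yQ w(1)] has_derivative_inner_right[OF has_derivative_ident]])
      then show "((\<lambda>z. \<Phi> z w - D z0 w0 \<bullet> z) has_derivative (\<lambda>h. (D y w - D z0 w0) \<bullet> h)) (at y within ball z0 d)"
        unfolding inner_diff_left by (rule has_derivative_at_withinI)
      have "dist (y, w) (z0, w0) \<le> dist y z0 + dist w w0"
        unfolding dist_Pair_Pair by (rule sqrt_sum_squares_le_sum) auto
      also have "\<dots> < d1" using y w by (auto simp: d_def dist_commute)
      finally have *: "norm (D y w - D z0 w0) < e" using d1 yQ w by blast
      show "onorm (\<lambda>h. (D y w - D z0 w0) \<bullet> h) \<le> e"
      proof (rule onorm_le)
        fix h
        have "norm ((D y w - D z0 w0) \<bullet> h) \<le> norm (D y w - D z0 w0) * norm h"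
          unfolding real_norm_def by (rule Cauchy_Schwarz_ineq2)
        also have "\<dots> \<le> e * norm h" using * by (intro mult_right_mono) auto
        finally show "norm ((D y w - D z0 w0) \<bullet> h) \<le> e * norm h" .
      qed
    qed (use z d in \<open>auto simp: dist_commute\<close>)
    moreover have "(\<Phi> z w - D z0 w0 \<bullet> z) - (\<Phi> z0 w - D z0 w0 \<bullet> z0) = \<Phi> z w - \<Phi> z0 w - D z0 w0 \<bullet> (z - z0)"
      unfolding inner_diff_right by linarith
    ultimately show ?thesis by (simp only: real_norm_def)
  qed
  show "\<exists>d>0. \<forall>y\<in>UNIV. norm (y - z0) < d \<longrightarrow> norm ((SUP w\<in>S. \<Phi> y w) - (SUP w\<in>S. \<Phi> z0 w) - D z0 w0 \<bullet> (y - z0)) \<le> e * norm (y - z0)"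
  proof (intro exI[of _ d] conjI ballI impI d)
    fix y assume y: "norm (y - z0) < d"
    then have yd: "dist y z0 < d" by (simp add: dist_norm)
    then have yQ: "y \<in> Q" using d3 by (auto simp: d_def dist_commute)
    obtain w where w: "w \<in> S" "\<Phi> y w = (SUP w\<in>S. \<Phi> y w)" "\<And>w'. w' \<in> S \<Longrightarrow> \<Phi> y w' \<le> \<Phi> y w"
      using att[OF yQ] by blast
    have "dist w w0 < d1/2" by (rule d2(2)[OF yQ _ w(1)]) (use yd w in \<open>auto simp: d_def\<close>)
    note b1 = near[OF w(1) this yd]
    have b2: "\<bar>\<Phi> y w0 - \<Phi> z0 w0 - D z0 w0 \<bullet> (y - z0)\<bar> \<le> e * norm (y - z0)"
      by (rule near[OF S(2) _ yd]) (use d1 in auto)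
    have "\<Phi> z0 w \<le> \<Phi> z0 w0" using uniq[OF w(1)] by (cases "w = w0") auto
    moreover have "\<Phi> y w0 \<le> \<Phi> y w" using w S by blast
    ultimately have "\<bar>\<Phi> y w - \<Phi> z0 w0 - D z0 w0 \<bullet> (y - z0)\<bar> \<le> e * norm (y - z0)"
      using b1 b2 by (simp only: abs_le_iff) linarith
    then show "norm ((SUP w\<in>S. \<Phi> y w) - (SUP w\<in>S. \<Phi> z0 w) - D z0 w0 \<bullet> (y - z0)) \<le> e * norm (y - z0)"
      unfolding m0 w(2) real_norm_def .
  qed
qed

section \<open>Monotone reparametrisation\<close>

text \<open>The negation of local constancy: on a plateau of a monotone \<sigma> only the end points
  can be moving. These are the times at which a rate of change with respect to \<sigma> is
  determined.\<close>

definition moving :: "real set \<Rightarrow> (real \<Rightarrow> real) \<Rightarrow> real \<Rightarrow> bool" where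
  "moving J \<sigma> t \<longleftrightarrow> (\<forall>d>0. \<exists>b\<in>J. \<bar>b - t\<bar> < d \<and> \<sigma> b \<noteq> \<sigma> t)"

lemma interval_Icc_subset: "is_interval (J::real set) \<Longrightarrow> a \<in> J \<Longrightarrow> b \<in> J \<Longrightarrow> {a..b} \<subseteq> J"
  unfolding is_interval_1 by (meson atLeastAtMost_iff subsetI)

text \<open>Locally uniform convergence speaks only of compact subsets of an interval, so a compact
  neighbourhood relative to \<open>J\<close> is needed, also at an end point of
  \<open>J\<close>.\<close>

lemma interval_neighbourhood:
  fixes J :: "real set"
  assumes J: "is_interval J" "t \<in> J" and d: "d > 0"
  obtains a b e where "e > 0" "a \<le> t" "t \<le> b" "a \<in> J" "b \<in> J" "{a..b} \<subseteq> J \<inter> ball t d" "J \<inter> ball t e \<subseteq> {a..b}"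
proof -
  have right: "\<exists>b e. e > 0 \<and> t \<le> b \<and> b \<in> J \<and> b < t + d \<and> (\<forall>s\<in>J. s < t + e \<longrightarrow> s \<le> b)"
  proof (cases "\<exists>y\<in>J. y > t")
    case True
    then obtain y where y: "y \<in> J" "y > t" by blast
    define b where "b = min y (t + d / 2)"
    have "b \<in> J" using interval_Icc_subset[OF J(1) J(2) y(1)] y d by (auto simp: b_def min_def subset_iff)
    then show ?thesis using y d
      by (intro exI[of _ b] exI[of _ "b - t"]) (auto simp: b_def min_def)
  next
    case False
    then show ?thesis using J d by (intro exI[of _ t] exI[of _ 1]) force
  qed
  have left: "\<exists>a e. e > 0 \<and> a \<le> t \<and> a \<in> J \<and> t - d < a \<and> (\<forall>s\<in>J. t - e < s \<longrightarrow> a \<le> s)"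
  proof (cases "\<exists>y\<in>J. y < t")
    case True
    then obtain y where y: "y \<in> J" "y < t" by blast
    define a where "a = max y (t - d / 2)"
    have "a \<in> J" using interval_Icc_subset[OF J(1) y(1) J(2)] y d by (auto simp: a_def max_def subset_iff)
    then show ?thesis using y d
      by (intro exI[of _ a] exI[of _ "t - a"]) (auto simp: a_def max_def)
  next
    case False
    then show ?thesis using J d by (intro exI[of _ t] exI[of _ 1]) force
  qed
  obtain b e1 where b: "e1 > 0" "t \<le> b" "b \<in> J" "b < t + d" "\<And>s. s \<in> J \<Longrightarrow> s < t + e1 \<Longrightarrow> s \<le> b" using right by blast
  obtain a e2 where a: "e2 > 0" "a \<le> t" "a \<in> J" "t - d < a" "\<And>s. s \<in> J \<Longrightarrow> t - e2 < s \<Longrightarrow> a \<le> s" using left by blast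
  show ?thesis
  proof (rule that[of "min e1 e2" a b])
    show "{a..b} \<subseteq> J \<inter> ball t d"
    proof
      fix s assume s: "s \<in> {a..b}"
      then have "t - s < d" "s - t < d" using a(4) b(4) by auto
      then show "s \<in> J \<inter> ball t d"
        using interval_Icc_subset[OF J(1) a(3) b(3)] s by (auto simp: dist_real_def abs_less_iff)
    qed
    show "J \<inter> ball t (min e1 e2) \<subseteq> {a..b}"
    proof
      fix s assume s: "s \<in> J \<inter> ball t (min e1 e2)"
      then have "s < t + e1" "t - e2 < s" by (auto simp: dist_real_def)
      then show "s \<in> {a..b}" using a(5) b(5) s by auto
    qed
    show "0 < min e1 e2" using a(1) b(1) by simp
  qed (rule a(2) b(2) a(3) b(3))+
qed

text \<open>The right half of the next lemma. At the last time \<open>a2\<close> with \<open>\<sigma> a2 = \<sigma> t0\<close> the parametrisation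
  starts to move, and nearby parameter values to the right come from times to the right of \<open>a2\<close>.\<close>

lemma strong_right_derivative_reparametrisation:
  fixes g :: "real \<Rightarrow> 'b::real_normed_vector"
  assumes J: "is_interval J" and \<sigma>: "mono_on J \<sigma>" "continuous_on J \<sigma>"
    and G: "\<And>t. t \<in> J \<Longrightarrow> G (\<sigma> t) = g t"
    and star: "\<And>t e. t \<in> J \<Longrightarrow> \<sigma> t = \<sigma> t0 \<Longrightarrow> e > 0 \<Longrightarrow>
      \<exists>d>0. \<forall>a\<in>J \<inter> ball t d. \<forall>b\<in>J \<inter> ball t d. a \<le> b \<longrightarrow> norm (g b - g a - (\<sigma> b - \<sigma> a) *\<^sub>R y t) \<le> e * (\<sigma> b - \<sigma> a)"
    and t0: "t0 \<in> J" and y: "\<And>t. t \<in> J \<Longrightarrow> \<sigma> t = \<sigma> t0 \<Longrightarrow> moving J \<sigma> t \<Longrightarrow> y t = v"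
    and e: "e > 0"
  shows "\<exists>d>0. \<forall>p\<in>\<sigma> ` J. \<forall>r\<in>\<sigma> ` J. \<sigma> t0 \<le> p \<longrightarrow> p \<le> r \<longrightarrow> r < \<sigma> t0 + d \<longrightarrow> norm (G r - G p - (r - p) *\<^sub>R v) \<le> e * (r - p)"
proof (cases "\<exists>t1\<in>J. \<sigma> t0 < \<sigma> t1")
  case False
  have "norm (G r - G p - (r - p) *\<^sub>R v) \<le> e * (r - p)"
    if "p \<in> \<sigma> ` J" "r \<in> \<sigma> ` J" "\<sigma> t0 \<le> p" "p \<le> r" for p r
  proof -
    have "p = \<sigma> t0" "r = \<sigma> t0" using that False by force+
    then show ?thesis by simp
  qed
  then show ?thesis by (intro exI[of _ 1]) auto
next
  case True
  then obtain t1 where t1: "t1 \<in> J" "\<sigma> t0 < \<sigma> t1" by blast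
  have t01: "t0 < t1"
  proof (rule ccontr)
    assume "\<not> t0 < t1"
    then have "\<sigma> t1 \<le> \<sigma> t0" using mono_onD[OF \<sigma>(1) t1(1) t0] by simp
    then show False using t1 by simp
  qed
  have sub: "{t0..t1} \<subseteq> J" by (rule interval_Icc_subset[OF J t0 t1(1)])
  \<comment> \<open>Cutting the plateau off at \<open>t1\<close> makes it compact, so that it has a
    last point.\<close>
  define S where "S = {t \<in> {t0..t1}. \<sigma> t = \<sigma> t0}"
  have "continuous_on {t0..t1} \<sigma>" by (rule continuous_on_subset[OF \<sigma>(2) sub])
  then have "closed S" unfolding S_def by (intro continuous_closed_preimage_constant) auto
  moreover have "bounded S" by (rule bounded_subset[of "{t0..t1}"]) (auto simp: S_def)
  ultimately have "compact S" by (simp add: compact_eq_bounded_closed)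
  moreover have "t0 \<in> S" using t01 by (simp add: S_def)
  ultimately obtain a2 where a2: "a2 \<in> S" "\<And>t. t \<in> S \<Longrightarrow> t \<le> a2" using compact_attains_sup[of S] by blast
  have a2J: "a2 \<in> J" "\<sigma> a2 = \<sigma> t0" "t0 \<le> a2" using a2(1) sub by (auto simp: S_def)
  have a2t1: "a2 < t1" using a2(1) t1(2) by (auto simp: S_def order_le_less)
  have gt: "\<sigma> t0 < \<sigma> t" if "t \<in> J" "a2 < t" for t
  proof (cases "t \<le> t1")
    case True
    have "\<sigma> t \<noteq> \<sigma> t0" using a2(2)[of t] that True a2J by (auto simp: S_def)
    moreover have "\<sigma> a2 \<le> \<sigma> t" using mono_onD[OF \<sigma>(1) a2J(1) that(1)] that by simp
    ultimately show ?thesis using a2J by simp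
  next
    case False
    then have "\<sigma> t1 \<le> \<sigma> t" using mono_onD[OF \<sigma>(1) t1(1) that(1)] by simp
    then show ?thesis using t1 by simp
  qed
  have step: "\<exists>b\<in>J. a2 < b \<and> b < a2 + d" if "d > 0" for d
  proof -
    have "min t1 (a2 + d/2) \<in> {t0..t1}" using a2t1 a2J that by auto
    then show ?thesis using sub a2t1 that by (intro bexI[of _ "min t1 (a2 + d/2)"]) auto
  qed
  have "moving J \<sigma> a2" unfolding moving_def
  proof (intro allI impI)
    fix d :: real assume "d > 0"
    then obtain b where b: "b \<in> J" "a2 < b" "b < a2 + d" using step by blast
    then show "\<exists>b\<in>J. \<bar>b - a2\<bar> < d \<and> \<sigma> b \<noteq> \<sigma> a2"
      using gt[OF b(1,2)] a2J by (intro bexI[of _ b]) auto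
  qed
  then have ya2: "y a2 = v" using y a2J by blast
  obtain d where d: "d > 0" "\<And>a b. a \<in> J \<inter> ball a2 d \<Longrightarrow> b \<in> J \<inter> ball a2 d \<Longrightarrow> a \<le> b \<Longrightarrow> norm (g b - g a - (\<sigma> b - \<sigma> a) *\<^sub>R v) \<le> e * (\<sigma> b - \<sigma> a)"
    using star[OF a2J(1,2) e] unfolding ya2 by blast
  obtain t2 where t2: "t2 \<in> J" "a2 < t2" "t2 < a2 + d" using step[OF d(1)] by blast
  have pre: "\<exists>t\<in>J. a2 \<le> t \<and> t < t2 \<and> \<sigma> t = p" if p: "p \<in> \<sigma> ` J" "\<sigma> t0 \<le> p" "p < \<sigma> t2" for p
  proof (cases "p = \<sigma> t0")
    case True
    then show ?thesis using a2J t2 by (intro bexI[of _ a2]) auto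
  next
    case False
    obtain t where t: "t \<in> J" "p = \<sigma> t" using p by blast
    have "a2 \<le> t"
    proof (rule ccontr)
      assume "\<not> a2 \<le> t"
      then have "\<sigma> t \<le> \<sigma> a2" using mono_onD[OF \<sigma>(1) t(1) a2J(1)] by simp
      then show False using False p t a2J by simp
    qed
    moreover have "t < t2"
    proof (rule ccontr)
      assume "\<not> t < t2"
      then have "\<sigma> t2 \<le> \<sigma> t" using mono_onD[OF \<sigma>(1) t2(1) t(1)] by simp
      then show False using p t by simp
    qed
    ultimately show ?thesis using t by auto
  qed
  show ?thesis
  proof (intro exI[of _ "\<sigma> t2 - \<sigma> t0"] conjI ballI impI)
    show "0 < \<sigma> t2 - \<sigma> t0" using gt[OF t2(1,2)] by simp
    fix p r assume pr: "p \<in> \<sigma> ` J" "r \<in> \<sigma> ` J" "\<sigma> t0 \<le> p" "p \<le> r" "r < \<sigma> t0 + (\<sigma> t2 - \<sigma> t0)"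
    obtain tp where tp: "tp \<in> J" "a2 \<le> tp" "tp < t2" "\<sigma> tp = p" using pre[of p] pr by auto
    obtain tr where tr: "tr \<in> J" "a2 \<le> tr" "tr < t2" "\<sigma> tr = r" using pre[of r] pr by auto
    show "norm (G r - G p - (r - p) *\<^sub>R v) \<le> e * (r - p)"
    proof (cases "p = r")
      case False
      have "tp \<le> tr"
      proof (rule ccontr)
        assume "\<not> tp \<le> tr"
        then have "r \<le> p" using mono_onD[OF \<sigma>(1) tr(1) tp(1)] tp tr by simp
        then show False using pr False by simp
      qed
      moreover have "tp \<in> J \<inter> ball a2 d" "tr \<in> J \<inter> ball a2 d"
        using tp tr t2 by (auto simp: dist_real_def)
      ultimately have "norm (g tr - g tp - (\<sigma> tr - \<sigma> tp) *\<^sub>R v) \<le> e * (\<sigma> tr - \<sigma> tp)" using d(2) by blast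
      then show ?thesis using G tp tr by auto
    qed simp
  qed
qed

lemma moving_reflect: "moving (uminus ` J) (\<lambda>t. - \<sigma> (- t)) t \<longleftrightarrow> moving J \<sigma> (- t)"
proof -
  have "\<bar>- b - t\<bar> = \<bar>b + t\<bar>" for b by arith
  then show ?thesis unfolding moving_def by simp
qed

lemma strong_derivative_reparametrisation:
  fixes g :: "real \<Rightarrow> 'b::real_normed_vector"
  assumes J: "is_interval J" and \<sigma>: "mono_on J \<sigma>" "continuous_on J \<sigma>"
    and G: "\<And>t. t \<in> J \<Longrightarrow> G (\<sigma> t) = g t"
    and star: "\<And>t e. t \<in> J \<Longrightarrow> \<sigma> t = \<sigma> t0 \<Longrightarrow> e > 0 \<Longrightarrow>
      \<exists>d>0. \<forall>a\<in>J \<inter> ball t d. \<forall>b\<in>J \<inter> ball t d. a \<le> b \<longrightarrow> norm (g b - g a - (\<sigma> b - \<sigma> a) *\<^sub>R y t) \<le> e * (\<sigma> b - \<sigma> a)"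
    and t0: "t0 \<in> J" and y: "\<And>t. t \<in> J \<Longrightarrow> \<sigma> t = \<sigma> t0 \<Longrightarrow> moving J \<sigma> t \<Longrightarrow> y t = v"
    and e: "e > 0"
  shows "\<exists>d>0. \<forall>p\<in>\<sigma> ` J \<inter> ball (\<sigma> t0) d. \<forall>r\<in>\<sigma> ` J \<inter> ball (\<sigma> t0) d. p \<le> r \<longrightarrow> norm (G r - G p - (r - p) *\<^sub>R v) \<le> e * (r - p)"
proof -
  obtain d1 where d1: "d1 > 0" "\<And>p r. p \<in> \<sigma> ` J \<Longrightarrow> r \<in> \<sigma> ` J \<Longrightarrow> \<sigma> t0 \<le> p \<Longrightarrow> p \<le> r \<Longrightarrow> r < \<sigma> t0 + d1 \<Longrightarrow> norm (G r - G p - (r - p) *\<^sub>R v) \<le> e * (r - p)"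
    using strong_right_derivative_reparametrisation[OF J \<sigma> G star t0 y e] by blast
  \<comment> \<open>Reversing time, parameter and value together turns left neighbourhoods into
    right ones and keeps \<sigma> increasing and the form of the estimate.\<close>
  define J' where "J' = uminus ` J"
  define \<sigma>' where "\<sigma>' t = - \<sigma> (- t)" for t
  have J'i: "- t \<in> J' \<longleftrightarrow> t \<in> J" "s \<in> J' \<longleftrightarrow> - s \<in> J" for t s by (force simp: J'_def)+
  have "\<exists>d>0. \<forall>p\<in>\<sigma>' ` J'. \<forall>r\<in>\<sigma>' ` J'. \<sigma>' (- t0) \<le> p \<longrightarrow> p \<le> r \<longrightarrow> r < \<sigma>' (- t0) + d \<longrightarrow> norm (- G (- r) - - G (- p) - (r - p) *\<^sub>R v) \<le> e * (r - p)"
  proof (rule strong_right_derivative_reparametrisation[where G = "\<lambda>p. - G (- p)" and g = "\<lambda>t. - g (- t)" and y = "\<lambda>t. y (- t)"])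
    show "is_interval J'" using J unfolding J'_def by simp
    show "mono_on J' \<sigma>'" using \<sigma>(1) by (auto simp: mono_on_def J'i \<sigma>'_def)
    show "continuous_on J' \<sigma>'" unfolding \<sigma>'_def
      by (intro continuous_intros continuous_on_compose2[OF \<sigma>(2)]) (auto simp: J'i)
    show "- G (- \<sigma>' t) = - g (- t)" if "t \<in> J'" for t using that G by (simp add: J'i \<sigma>'_def)
    show "- t0 \<in> J'" using t0 by (simp add: J'i)
    show "y (- t) = v" if "t \<in> J'" "\<sigma>' t = \<sigma>' (- t0)" "moving J' \<sigma>' t" for t
    proof (rule y)
      show "- t \<in> J" using that by (simp add: J'i)
      show "\<sigma> (- t) = \<sigma> t0" using that by (simp add: \<sigma>'_def)
      show "moving J \<sigma> (- t)" using that(3) moving_reflect[of J \<sigma> t] by (simp only: J'_def \<sigma>'_def[abs_def])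
    qed
    fix t r :: real assume t: "t \<in> J'" and "\<sigma>' t = \<sigma>' (- t0)" "r > 0"
    then obtain d where d: "d > 0" "\<And>a b. a \<in> J \<inter> ball (- t) d \<Longrightarrow> b \<in> J \<inter> ball (- t) d \<Longrightarrow> a \<le> b \<Longrightarrow> norm (g b - g a - (\<sigma> b - \<sigma> a) *\<^sub>R y (- t)) \<le> r * (\<sigma> b - \<sigma> a)"
      using star[of "- t" r] by (auto simp: J'i \<sigma>'_def)
    show "\<exists>d>0. \<forall>a\<in>J' \<inter> ball t d. \<forall>b\<in>J' \<inter> ball t d. a \<le> b \<longrightarrow> norm (- g (- b) - - g (- a) - (\<sigma>' b - \<sigma>' a) *\<^sub>R y (- t)) \<le> r * (\<sigma>' b - \<sigma>' a)"
    proof (intro exI[of _ d] conjI ballI impI d(1))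
      fix a b assume ab: "a \<in> J' \<inter> ball t d" "b \<in> J' \<inter> ball t d" "a \<le> b"
      have "norm (g (- a) - g (- b) - (\<sigma> (- a) - \<sigma> (- b)) *\<^sub>R y (- t)) \<le> r * (\<sigma> (- a) - \<sigma> (- b))"
        by (rule d(2)) (use ab in \<open>auto simp: J'i dist_real_def\<close>)
      then show "norm (- g (- b) - - g (- a) - (\<sigma>' b - \<sigma>' a) *\<^sub>R y (- t)) \<le> r * (\<sigma>' b - \<sigma>' a)"
        by (simp add: \<sigma>'_def algebra_simps)
    qed
  qed (rule e)
  then obtain d2 where d2: "d2 > 0" "\<And>p r. p \<in> \<sigma>' ` J' \<Longrightarrow> r \<in> \<sigma>' ` J' \<Longrightarrow> \<sigma>' (- t0) \<le> p \<Longrightarrow> p \<le> r \<Longrightarrow> r < \<sigma>' (- t0) + d2 \<Longrightarrow> norm (- G (- r) - - G (- p) - (r - p) *\<^sub>R v) \<le> e * (r - p)"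
    by blast
  have im: "- p \<in> \<sigma>' ` J'" if "p \<in> \<sigma> ` J" for p
    using that by (force simp: \<sigma>'_def J'_def image_iff)
  have left: "norm (G r - G p - (r - p) *\<^sub>R v) \<le> e * (r - p)"
    if "p \<in> \<sigma> ` J" "r \<in> \<sigma> ` J" "p \<le> r" "r \<le> \<sigma> t0" "\<sigma> t0 - d2 < p" for p r
  proof -
    have "norm (- G (- (- p)) - (- G (- (- r))) - (- p - (- r)) *\<^sub>R v) \<le> e * (- p - (- r))"
      by (rule d2(2)) (use that im in \<open>auto simp: \<sigma>'_def\<close>)
    then show ?thesis by simp
  qed
  show ?thesis
  proof (intro exI[of _ "min d1 d2"] conjI ballI impI)
    show "0 < min d1 d2" using d1 d2 by simp
    fix p r assume pr: "p \<in> \<sigma> ` J \<inter> ball (\<sigma> t0) (min d1 d2)" "r \<in> \<sigma> ` J \<inter> ball (\<sigma> t0) (min d1 d2)" "p \<le> r"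
    then have pr': "p \<in> \<sigma> ` J" "r \<in> \<sigma> ` J" "\<sigma> t0 - d2 < p" "r < \<sigma> t0 + d1" by (auto simp: dist_real_def)
    have 0: "\<sigma> t0 \<in> \<sigma> ` J" using t0 by blast
    consider "r \<le> \<sigma> t0" | "\<sigma> t0 \<le> p" | "p \<le> \<sigma> t0" "\<sigma> t0 \<le> r" by linarith
    then show "norm (G r - G p - (r - p) *\<^sub>R v) \<le> e * (r - p)"
    proof cases
      case 1 then show ?thesis using left pr pr' by blast
    next
      case 2 then show ?thesis using d1(2) pr pr' by blast
    next
      \<comment> \<open>The estimates on the two sides of \<open>\<sigma> t0\<close> have the same
        vector \<open>v\<close> and errors proportional to the lengths, so they add up.\<close>
      case 3
      have "norm (G r - G (\<sigma> t0) - (r - \<sigma> t0) *\<^sub>R v) \<le> e * (r - \<sigma> t0)" using d1(2)[OF 0 pr'(2)] 3 pr' by simp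
      moreover have "norm (G (\<sigma> t0) - G p - (\<sigma> t0 - p) *\<^sub>R v) \<le> e * (\<sigma> t0 - p)" using left[OF pr'(1) 0] 3 pr' by simp
      moreover have "G r - G p - (r - p) *\<^sub>R v = (G r - G (\<sigma> t0) - (r - \<sigma> t0) *\<^sub>R v) + (G (\<sigma> t0) - G p - (\<sigma> t0 - p) *\<^sub>R v)"
        by (simp add: algebra_simps)
      ultimately have "norm (G r - G p - (r - p) *\<^sub>R v) \<le> e * (r - \<sigma> t0) + e * (\<sigma> t0 - p)"
        by (simp only: norm_triangle_mono)
      then show ?thesis by (simp add: algebra_simps)
    qed
  qed
qed

lemma strong_derivative_imp_vector_derivative:
  fixes G :: "real \<Rightarrow> 'b::real_normed_vector"
  assumes st: "\<And>e. e > 0 \<Longrightarrow> \<exists>d>0. \<forall>p\<in>K \<inter> ball x d. \<forall>r\<in>K \<inter> ball x d. p \<le> r \<longrightarrow> norm (G r - G p - (r - p) *\<^sub>R v) \<le> e * (r - p)"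
    and x: "x \<in> K"
  shows "(G has_vector_derivative v) (at x within K)"
  unfolding has_vector_derivative_def has_derivative_within_alt
proof (intro conjI allI impI)
  show "bounded_linear (\<lambda>h. h *\<^sub>R v)" by (rule bounded_linear_scaleR_left)
  fix e :: real assume "e > 0"
  from st[OF this] obtain d where d0: "d > 0" and d1: "\<forall>p\<in>K \<inter> ball x d. \<forall>r\<in>K \<inter> ball x d. p \<le> r \<longrightarrow> norm (G r - G p - (r - p) *\<^sub>R v) \<le> e * (r - p)"
    by (elim exE conjE)
  have d: "d > 0" "\<And>p r. p \<in> K \<inter> ball x d \<Longrightarrow> r \<in> K \<inter> ball x d \<Longrightarrow> p \<le> r \<Longrightarrow> norm (G r - G p - (r - p) *\<^sub>R v) \<le> e * (r - p)"
    using d0 d1 by simp_all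
  show "\<exists>d>0. \<forall>y\<in>K. norm (y - x) < d \<longrightarrow> norm (G y - G x - (y - x) *\<^sub>R v) \<le> e * norm (y - x)"
  proof (intro exI[of _ d] conjI ballI impI d(1))
    fix y assume y: "y \<in> K" "norm (y - x) < d"
    have xy: "x \<in> K \<inter> ball x d" "y \<in> K \<inter> ball x d" using x y d by (auto simp: dist_norm norm_minus_commute)
    show "norm (G y - G x - (y - x) *\<^sub>R v) \<le> e * norm (y - x)"
    proof (cases "x \<le> y")
      case True
      then show ?thesis using d(2)[OF xy True] by simp
    next
      case False
      then have "norm (G x - G y - (x - y) *\<^sub>R v) \<le> e * (x - y)" using d(2)[OF xy(2,1)] by simp
      moreover have "G y - G x - (y - x) *\<^sub>R v = - (G x - G y - (x - y) *\<^sub>R v)" by (simp add: algebra_simps)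
      ultimately show ?thesis using False by (simp only: norm_minus_cancel real_norm_def) simp
    qed
  qed
qed

text \<open>Arzela-Ascoli by diagonal extraction on a countable dense subset of \<open>J\<close>;
  the common Lipschitz bound carries convergence over to all of \<open>J\<close>. The domains
  \<open>Js i\<close> vary, and a time of \<open>J\<close> belongs to them only from some index
  on.\<close>

lemma lipschitz_subsequence:
  fixes h :: "nat \<Rightarrow> real \<Rightarrow> real"
  assumes ev: "\<And>t. t \<in> J \<Longrightarrow> \<forall>\<^sub>F i in sequentially. t \<in> Js i" and t0: "t0 \<in> J"
    and lip: "\<And>i a b. a \<in> Js i \<Longrightarrow> b \<in> Js i \<Longrightarrow> a \<le> b \<Longrightarrow> 0 \<le> h i b - h i a \<and> h i b - h i a \<le> b - a"
  obtains k \<sigma> where "strict_mono k" "\<And>t. t \<in> J \<Longrightarrow> (\<lambda>i. h (k i) t - h (k i) t0) \<longlonglongrightarrow> \<sigma> t"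
proof -
  have lip': "\<bar>h i b - h i a\<bar> \<le> \<bar>b - a\<bar>" if "a \<in> Js i" "b \<in> Js i" for i a b
    using lip[of a i b] lip[of b i a] that by (cases "a \<le> b") auto
  \<comment> \<open>Division by \<open>1 + |t - t0|\<close> gives the uniform bound 1 that the
    extraction requires. The default 0 outside the domains affects no limit.\<close>
  define f where "f i t = (if t \<in> Js i \<and> t0 \<in> Js i then (h i t - h i t0) / (1 + \<bar>t - t0\<bar>) else 0)" for i t
  obtain T where T: "countable T" "T \<subseteq> J" "J \<subseteq> closure T" using separable by blast
  have "norm (f i t) \<le> 1" for i t
  proof (cases "t \<in> Js i \<and> t0 \<in> Js i")
    case True
    then have "\<bar>h i t - h i t0\<bar> \<le> 1 + \<bar>t - t0\<bar>" using lip'[of t0 i t] by auto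
    then show ?thesis using True by (simp add: f_def)
  qed (auto simp: f_def)
  then obtain k where k: "strict_mono (k::nat\<Rightarrow>nat)" "\<And>t. t \<in> T \<Longrightarrow> \<exists>l. (\<lambda>n. f (k n) t) \<longlonglongrightarrow> l"
    using function_convergent_subsequence[OF T(1)] by metis
  have evk: "\<forall>\<^sub>F i in sequentially. t \<in> Js (k i)" if "t \<in> J" for t
    using eventually_subseq[OF k(1) ev[OF that]] .
  have "\<exists>l. (\<lambda>i. h (k i) t - h (k i) t0) \<longlonglongrightarrow> l" if t: "t \<in> J" for t
  proof -
    have "Cauchy (\<lambda>i. h (k i) t - h (k i) t0)"
    proof (rule metric_CauchyI)
      fix e :: real assume e: "e > 0"
      then obtain s where s: "s \<in> T" "dist s t < e/4"
        using T(3) t closure_approachable[of t T] by (meson subsetD zero_less_divide_iff zero_less_numeral)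
      then have sJ: "s \<in> J" using T by blast
      obtain l where l: "(\<lambda>n. f (k n) s) \<longlonglongrightarrow> l" using k(2) s by blast
      have "(\<lambda>n. (1 + \<bar>s - t0\<bar>) * f (k n) s) \<longlonglongrightarrow> (1 + \<bar>s - t0\<bar>) * l" by (intro tendsto_intros l)
      moreover have "\<forall>\<^sub>F n in sequentially. (1 + \<bar>s - t0\<bar>) * f (k n) s = h (k n) s - h (k n) t0"
        using evk[OF sJ] evk[OF t0] by eventually_elim (simp add: f_def add_pos_nonneg)
      ultimately have "(\<lambda>n. h (k n) s - h (k n) t0) \<longlonglongrightarrow> (1 + \<bar>s - t0\<bar>) * l" by (rule Lim_transform_eventually)
      then have "Cauchy (\<lambda>n. h (k n) s - h (k n) t0)" by (rule LIMSEQ_imp_Cauchy)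
      then obtain M1 where M1: "\<And>m n. m \<ge> M1 \<Longrightarrow> n \<ge> M1 \<Longrightarrow> dist (h (k m) s - h (k m) t0) (h (k n) s - h (k n) t0) < e/4"
        using e unfolding Cauchy_def by (meson zero_less_divide_iff zero_less_numeral)
      obtain M2 where M2: "\<And>n. n \<ge> M2 \<Longrightarrow> s \<in> Js (k n) \<and> t \<in> Js (k n)"
        using eventually_conj[OF evk[OF sJ] evk[OF t]] by (auto simp: eventually_sequentially)
      have "dist (h (k m) t - h (k m) t0) (h (k n) t - h (k n) t0) < e" if mn: "m \<ge> max M1 M2" "n \<ge> max M1 M2" for m n
      proof -
        have "\<bar>h (k m) t - h (k m) s\<bar> \<le> \<bar>t - s\<bar>" "\<bar>h (k n) t - h (k n) s\<bar> \<le> \<bar>t - s\<bar>"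
          using M2 mn by (auto intro!: lip')
        moreover have "\<bar>t - s\<bar> < e/4" using s by (simp add: dist_real_def abs_minus_commute)
        moreover have "\<bar>(h (k m) s - h (k m) t0) - (h (k n) s - h (k n) t0)\<bar> < e/4" using M1[of m n] mn by (simp add: dist_real_def)
        ultimately show ?thesis using e unfolding dist_real_def abs_less_iff abs_le_iff by linarith
      qed
      then show "\<exists>M. \<forall>m\<ge>M. \<forall>n\<ge>M. dist (h (k m) t - h (k m) t0) (h (k n) t - h (k n) t0) < e" by blast
    qed
    then show ?thesis using Cauchy_convergent_iff convergent_def by blast
  qed
  then show ?thesis using that[OF k(1)] by metis
qed

section \<open>Tangent and cotangent spaces\<close>

lemma components_in: "v \<in> components V A q \<Longrightarrow> c \<in> A \<Longrightarrow> q \<in> fst c \<Longrightarrow> v c \<in> V"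
  unfolding components_def mem_Collect_eq by (drule spec[of _ c]) simp

lemma components_out: "v \<in> components V A q \<Longrightarrow> \<not> (c \<in> A \<and> q \<in> fst c) \<Longrightarrow> v c = 0"
  unfolding components_def mem_Collect_eq by (drule spec[of _ c]) auto

lemma tangent_components: "v \<in> tangent_space V A q \<Longrightarrow> v \<in> components V A q"
  by (simp add: tangent_space_def)

lemma cotangent_components: "p \<in> cotangent_space V A q \<Longrightarrow> p \<in> components V A q"
  by (simp add: cotangent_space_def)

lemmas tangent_in = components_in[OF tangent_components]
  and cotangent_in = components_in[OF cotangent_components]

lemma cotangent_bundleD:
  "z \<in> cotangent_bundle V A \<Longrightarrow> snd z \<in> cotangent_space V A (fst z)"
  by (auto simp: cotangent_bundle_def)

text \<open>What \<open>M\<close> (with \<open>V = UNIV\<close>) and the boundary of the table (with \<open>V\<close> a hyperplane) have in common.\<close>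

locale atlas =
  fixes V :: "'e::euclidean_space set" and A :: "('a, 'e) chart set"
  assumes subspace: "subspace V"
    and inj: "c \<in> A \<Longrightarrow> inj_on (snd c) (fst c)"
    and image: "c \<in> A \<Longrightarrow> snd c ` fst c \<subseteq> V"
    and rel_open: "c \<in> A \<Longrightarrow> d \<in> A \<Longrightarrow> q \<in> fst c \<Longrightarrow> q \<in> fst d \<Longrightarrow>
      \<exists>Q. open Q \<and> snd c q \<in> Q \<and> Q \<inter> V \<subseteq> snd c ` (fst c \<inter> fst d)"
    and differentiable: "c \<in> A \<Longrightarrow> d \<in> A \<Longrightarrow> q \<in> fst c \<Longrightarrow> q \<in> fst d \<Longrightarrow>
      \<exists>L. (transition c d has_derivative L) (at (snd c q) within snd c ` (fst c \<inter> fst d))"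
begin

lemma chart_inv_eq: "c \<in> A \<Longrightarrow> q \<in> fst c \<Longrightarrow> chart_inv c (snd c q) = q"
  by (simp add: chart_inv_def inv_into_f_f inj)

lemma transition_eq: "c \<in> A \<Longrightarrow> q \<in> fst c \<Longrightarrow> transition c d (snd c q) = snd d q"
  by (simp add: transition_def chart_inv_eq)

lemma in_V: "c \<in> A \<Longrightarrow> q \<in> fst c \<Longrightarrow> snd c q \<in> V"
  using image by blast

lemma derivative_unique:
  assumes c: "c \<in> A" "d \<in> A" "q \<in> fst c" "q \<in> fst d" and h: "h \<in> V"
    and f: "(f has_derivative L) (at (snd c q) within snd c ` (fst c \<inter> fst d))"
      "(f has_derivative L') (at (snd c q) within snd c ` (fst c \<inter> fst d))"
  shows "L h = L' h"
proof -
  obtain Q where "open Q" "snd c q \<in> Q" "Q \<inter> V \<subseteq> snd c ` (fst c \<inter> fst d)"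
    using rel_open[OF c] by blast
  then show ?thesis
    using has_derivative_unique_on_subspace[OF f subspace] in_V[OF c(1,3)] h by blast
qed

lemma transforms_unique:
  assumes c: "c \<in> A" "d \<in> A" "q \<in> fst c" "q \<in> fst d" and h: "h \<in> V"
    and "transforms c d q h k" "transforms c d q h k'"
  shows "k = k'"
  using assms(6,7) derivative_unique[OF c h] unfolding transforms_def by blast

lemma transforms_exists:
  "c \<in> A \<Longrightarrow> d \<in> A \<Longrightarrow> q \<in> fst c \<Longrightarrow> q \<in> fst d \<Longrightarrow> \<exists>k. transforms c d q h k"
  using differentiable unfolding transforms_def by blast

text \<open>The difference quotients of the transition along \<open>h\<close> lie in the subspace
  \<open>V\<close>, which is closed.\<close>

lemma transforms_in:
  assumes c: "c \<in> A" "d \<in> A" "q \<in> fst c" "q \<in> fst d" and h: "h \<in> V" and t: "transforms c d q h k"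
  shows "k \<in> V"
proof -
  obtain L where L: "(transition c d has_derivative L) (at (snd c q) within snd c ` (fst c \<inter> fst d))" "k = L h"
    using t unfolding transforms_def by blast
  obtain Q where Q: "open Q" "snd c q \<in> Q" "Q \<inter> V \<subseteq> snd c ` (fst c \<inter> fst d)"
    using rel_open[OF c] by blast
  define F where "F t = transition c d (snd c q + t *\<^sub>R h)" for t
  have F: "(F has_vector_derivative k) (at 0)"
    unfolding F_def L(2) by (rule has_derivative_path[OF L(1) subspace Q in_V[OF c(1,3)] h])
  define e where "e n = inverse (real (Suc n))" for n
  have e: "e \<longlonglongrightarrow> 0" "e n > 0" for n
    unfolding e_def using LIMSEQ_inverse_real_of_nat by auto
  have lim: "(\<lambda>n. (F (0 + e n) - F 0) /\<^sub>R e n) \<longlonglongrightarrow> k"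
    by (rule difference_quotient_sequence[OF F]) (use e in auto)
  have "(\<lambda>n. snd c q + e n *\<^sub>R h) \<longlonglongrightarrow> snd c q + 0 *\<^sub>R h"
    by (intro tendsto_intros e)
  then have "\<forall>\<^sub>F n in sequentially. snd c q + e n *\<^sub>R h \<in> Q"
    using Q by (intro topological_tendstoD) auto
  then have "\<forall>\<^sub>F n in sequentially. (F (0 + e n) - F 0) /\<^sub>R e n \<in> V"
  proof eventually_elim
    case (elim n)
    have "snd c q + e n *\<^sub>R h \<in> V" using subspace in_V[OF c(1,3)] h by (simp add: subspace_add subspace_mul)
    with elim Q obtain q' where q': "snd c q + e n *\<^sub>R h = snd c q'" "q' \<in> fst c" "q' \<in> fst d" by blast
    have "F (e n) = snd d q'" "F 0 = snd d q" using c q' by (simp_all add: F_def transition_eq)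
    then show ?case using in_V c q' subspace by (simp add: subspace_diff subspace_mul)
  qed
  then show ?thesis
    using Lim_in_closed_set[OF closed_subspace[OF subspace] _ _ lim] by simp
qed

lemma transforms_combination:
  assumes c: "c \<in> A" "d \<in> A" "q \<in> fst c" "q \<in> fst d" and h: "h \<in> V" "h' \<in> V"
    and t: "transforms c d q h k" "transforms c d q h' k'"
  shows "transforms c d q (a *\<^sub>R h + b *\<^sub>R h') (a *\<^sub>R k + b *\<^sub>R k')"
proof -
  obtain L where L: "(transition c d has_derivative L) (at (snd c q) within snd c ` (fst c \<inter> fst d))" "k = L h"
    using t unfolding transforms_def by blast
  have "transforms c d q h' (L h')" using L unfolding transforms_def by blast
  then have "k' = L h'" using transforms_unique[OF c h(2)] t by blast
  moreover have "linear L" using has_derivative_linear[OF L(1)] .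
  ultimately have "a *\<^sub>R k + b *\<^sub>R k' = L (a *\<^sub>R h + b *\<^sub>R h')"
    using L(2) by (simp add: linear_add linear_scale)
  then show ?thesis using L(1) unfolding transforms_def by blast
qed

lemma transforms_refl:
  assumes c: "c \<in> A" "q \<in> fst c"
  shows "transforms c c q h h"
proof -
  have "(transition c c has_derivative (\<lambda>h. h)) (at (snd c q) within snd c ` (fst c \<inter> fst c))"
    by (rule has_derivative_transform[OF _ _ has_derivative_ident]) (use c in \<open>auto simp: transition_eq\<close>)
  then show ?thesis unfolding transforms_def by blast
qed

text \<open>Chain rule on the triple overlap. It is still relatively open in \<open>V\<close>, so
  the composed derivative coincides on \<open>V\<close> with the one taken within the larger overlap
  of \<open>c\<close> and \<open>e\<close>.\<close>

lemma transforms_trans: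
  assumes c: "c \<in> A" "q \<in> fst c" and d: "d \<in> A" "q \<in> fst d" and e: "e \<in> A" "q \<in> fst e" and h: "h \<in> V"
    and t: "transforms c d q h k" "transforms d e q k l"
  shows "transforms c e q h l"
proof -
  obtain L where L: "(transition c d has_derivative L) (at (snd c q) within snd c ` (fst c \<inter> fst d))" "k = L h"
    using t unfolding transforms_def by blast
  obtain L' where L': "(transition d e has_derivative L') (at (snd d q) within snd d ` (fst d \<inter> fst e))" "l = L' k"
    using t unfolding transforms_def by blast
  obtain L2 where L2: "(transition c e has_derivative L2) (at (snd c q) within snd c ` (fst c \<inter> fst e))"
    using differentiable[OF c(1) e(1) c(2) e(2)] by blast
  let ?S = "snd c ` (fst c \<inter> fst d \<inter> fst e)"
  have 1: "(transition c d has_derivative L) (at (snd c q) within ?S)"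
    by (rule has_derivative_subset[OF L(1)]) auto
  have 2: "(transition d e has_derivative L') (at (transition c d (snd c q)) within transition c d ` ?S)"
    unfolding transition_eq[OF c]
    by (rule has_derivative_subset[OF L'(1)]) (use c in \<open>auto simp: transition_eq image_iff\<close>)
  have "((\<lambda>x. transition d e (transition c d x)) has_derivative (\<lambda>h. L' (L h))) (at (snd c q) within ?S)"
    by (rule has_derivative_in_compose[OF 1 2])
  then have 3: "(transition c e has_derivative (\<lambda>h. L' (L h))) (at (snd c q) within ?S)"
    by (rule has_derivative_transform[rotated 2]) (use c d e in \<open>auto simp: transition_eq\<close>)
  have 4: "(transition c e has_derivative L2) (at (snd c q) within ?S)"
    by (rule has_derivative_subset[OF L2]) auto
  obtain Q1 where Q1: "open Q1" "snd c q \<in> Q1" "Q1 \<inter> V \<subseteq> snd c ` (fst c \<inter> fst d)"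
    using rel_open[OF c(1) d(1) c(2) d(2)] by blast
  obtain Q2 where Q2: "open Q2" "snd c q \<in> Q2" "Q2 \<inter> V \<subseteq> snd c ` (fst c \<inter> fst e)"
    using rel_open[OF c(1) e(1) c(2) e(2)] by blast
  have "Q1 \<inter> Q2 \<inter> V \<subseteq> ?S"
  proof
    fix x assume x: "x \<in> Q1 \<inter> Q2 \<inter> V"
    then obtain q1 q2 where "x = snd c q1" "q1 \<in> fst c" "q1 \<in> fst d" "x = snd c q2" "q2 \<in> fst c" "q2 \<in> fst e"
      using Q1 Q2 by blast
    moreover from this have "q1 = q2" using inj[OF c(1)] by (auto dest: inj_onD)
    ultimately show "x \<in> ?S" by blast
  qed
  then have "L' (L h) = L2 h"
    using has_derivative_unique_on_subspace[OF 3 4 subspace open_Int[OF Q1(1) Q2(1)] _ _ in_V[OF c] h] Q1 Q2 by blast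
  then show ?thesis using L(2) L'(2) L2 unfolding transforms_def by auto
qed

lemma tangent_eqI:
  assumes v: "v \<in> tangent_space V A q" "v' \<in> tangent_space V A q" and c: "c \<in> A" "q \<in> fst c" "v c = v' c"
  shows "v = v'"
proof
  fix d
  show "v d = v' d"
  proof (cases "d \<in> A \<and> q \<in> fst d")
    case True
    have "v c \<in> V" using tangent_in[OF v(1) c(1,2)] .
    moreover have "transforms c d q (v c) (v d)" "transforms c d q (v c) (v' d)"
      using v c True unfolding tangent_space_def by auto
    ultimately show ?thesis using transforms_unique c True by blast
  next
    case False
    then show ?thesis using v[THEN tangent_components, THEN components_out] by simp
  qed
qed

lemma tangent_combination:
  assumes v: "v \<in> tangent_space V A q" "v' \<in> tangent_space V A q"
  shows "(\<lambda>c. a *\<^sub>R v c + b *\<^sub>R v' c) \<in> tangent_space V A q"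
proof -
  have V: "v c \<in> V" "v' c \<in> V" if "c \<in> A" "q \<in> fst c" for c
    using tangent_in[OF v(1) that] tangent_in[OF v(2) that] .
  have "(\<lambda>c. a *\<^sub>R v c + b *\<^sub>R v' c) \<in> components V A q"
    using V subspace v[THEN tangent_components, THEN components_out]
    by (auto simp: components_def intro!: subspace_add subspace_mul)
  moreover have "transforms c d q (a *\<^sub>R v c + b *\<^sub>R v' c) (a *\<^sub>R v d + b *\<^sub>R v' d)"
    if "c \<in> A" "d \<in> A" "q \<in> fst c \<inter> fst d" for c d
    using that v by (intro transforms_combination V) (auto simp: tangent_space_def)
  ultimately show ?thesis unfolding tangent_space_def by blast
qed

lemma zero_tangent: "(\<lambda>c. 0) \<in> tangent_space V A q"
proof -
  have "transforms c d q 0 0" if c: "c \<in> A" "d \<in> A" "q \<in> fst c" "q \<in> fst d" for c d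
  proof -
    obtain L where L: "(transition c d has_derivative L) (at (snd c q) within snd c ` (fst c \<inter> fst d))"
      using differentiable[OF c] by blast
    then have "L 0 = 0" using has_derivative_linear linear_0 by blast
    then show ?thesis using L unfolding transforms_def by auto
  qed
  then show ?thesis using subspace by (auto simp: tangent_space_def components_def subspace_0)
qed

lemma pairing_chart:
  assumes p: "p \<in> cotangent_space V A q" and v: "v \<in> tangent_space V A q" and c: "c \<in> A" "q \<in> fst c"
  shows "pairing A q p v = p c \<bullet> v c"
proof -
  define d where "d = (SOME c. c \<in> A \<and> q \<in> fst c)"
  have d: "d \<in> A \<and> q \<in> fst d" unfolding d_def by (rule someI[of _ c]) (use c in auto)
  have "v c \<in> V" by (rule tangent_in[OF v c])
  moreover have "transforms c d q (v c) (v d)" using v c d by (auto simp: tangent_space_def)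
  ultimately have "p c \<bullet> v c = p d \<bullet> v d" using p c d unfolding cotangent_space_def by auto
  then show ?thesis by (simp add: pairing_def d_def[symmetric] Let_def)
qed

text \<open>A covector is tested against \<open>V\<close> only, but its components lie in
  \<open>V\<close>, so the inner products with \<open>V\<close> determine them.\<close>

lemma cotangent_eqI:
  assumes p: "p \<in> cotangent_space V A q" "p' \<in> cotangent_space V A q" and c: "c \<in> A" "q \<in> fst c" "p c = p' c"
  shows "p = p'"
proof
  fix d
  show "p d = p' d"
  proof (cases "d \<in> A \<and> q \<in> fst d")
    case True
    have pV: "p d - p' d \<in> V"
      using True by (intro subspace_diff subspace p[THEN cotangent_in]) simp_all
    have "p d \<bullet> k = p' d \<bullet> k" if k: "k \<in> V" for k
    proof -
      obtain h where h: "transforms d c q k h" using transforms_exists True c by blast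
      have "p d \<bullet> k = p c \<bullet> h" "p' d \<bullet> k = p' c \<bullet> h"
        using p k h True c unfolding cotangent_space_def by auto
      then show ?thesis using c by simp
    qed
    from this[OF pV] have "(p d - p' d) \<bullet> (p d - p' d) = 0" by (simp add: inner_diff_left)
    then show ?thesis by simp
  next
    case False
    then show ?thesis using p[THEN cotangent_components, THEN components_out] by simp
  qed
qed

text \<open>The adjoint represents the functional on the whole space; its orthogonal projection to
  \<open>V\<close> represents it on \<open>V\<close> and is a legitimate component.\<close>

lemma riesz_in_subspace:
  fixes L :: "'e \<Rightarrow> 'e"
  assumes "linear L"
  shows "\<exists>r\<in>V. \<forall>h\<in>V. r \<bullet> h = m \<bullet> L h"
proof -
  obtain r s where r: "r \<in> span V" "\<And>w. w \<in> span V \<Longrightarrow> orthogonal s w" "adjoint L m = r + s"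
    using orthogonal_subspace_decomp_exists[of V "adjoint L m"] by blast
  have sp: "span V = V" using subspace by (simp add: span_eq_iff)
  have "r \<bullet> h = m \<bullet> L h" if "h \<in> V" for h
  proof -
    have "m \<bullet> L h = adjoint L m \<bullet> h" using adjoint_works[OF assms, of h m] by (simp add: inner_commute)
    also have "\<dots> = r \<bullet> h + s \<bullet> h" by (simp add: r inner_add_left)
    also have "s \<bullet> h = 0" using r(2)[of h] that sp by (simp add: orthogonal_def)
    finally show ?thesis by simp
  qed
  then show ?thesis using r sp by auto
qed

text \<open>\<open>m\<close> is pulled back along the derivative of the transition from each chart
  into \<open>c\<close>; consistency between two such charts is the chain rule
  \<open>transforms_trans\<close>.\<close>

lemma cotangent_exists:
  assumes c: "c \<in> A" "q \<in> fst c" and m: "m \<in> V"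
  shows "\<exists>p\<in>cotangent_space V A q. p c = m"
proof -
  have "\<exists>r\<in>V. \<forall>h\<in>V. \<forall>k. transforms d c q h k \<longrightarrow> r \<bullet> h = m \<bullet> k" if d: "d \<in> A" "q \<in> fst d" for d
  proof -
    obtain L where L: "(transition d c has_derivative L) (at (snd d q) within snd d ` (fst d \<inter> fst c))"
      using differentiable[OF d(1) c(1) d(2) c(2)] by blast
    obtain r where r: "r \<in> V" "\<And>h. h \<in> V \<Longrightarrow> r \<bullet> h = m \<bullet> L h"
      using riesz_in_subspace[OF has_derivative_linear[OF L]] by blast
    have "k = L h" if "h \<in> V" "transforms d c q h k" for h k
      using transforms_unique[OF d(1) c(1) d(2) c(2) that(1) that(2)] L unfolding transforms_def by blast
    then show ?thesis using r by metis
  qed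
  then obtain r where r: "\<And>d. d \<in> A \<Longrightarrow> q \<in> fst d \<Longrightarrow> r d \<in> V"
    "\<And>d h k. d \<in> A \<Longrightarrow> q \<in> fst d \<Longrightarrow> h \<in> V \<Longrightarrow> transforms d c q h k \<Longrightarrow> r d \<bullet> h = m \<bullet> k"
    by metis
  define p where "p d = (if d \<in> A \<and> q \<in> fst d then r d else 0)" for d
  have "p c = m"
  proof -
    have "r c \<bullet> h = m \<bullet> h" if "h \<in> V" for h using r(2)[OF c that transforms_refl[OF c]] .
    moreover have "r c - m \<in> V" using r(1)[OF c] m subspace by (simp add: subspace_diff)
    ultimately have "(r c - m) \<bullet> (r c - m) = 0" by (simp add: inner_diff_left)
    then show ?thesis using c by (simp add: p_def)
  qed
  moreover have "p \<in> cotangent_space V A q"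
  proof -
    have "p d \<bullet> h = p e \<bullet> k" if d: "d \<in> A" "e \<in> A" "q \<in> fst d" "q \<in> fst e" and h: "h \<in> V" "transforms d e q h k" for d e h k
    proof -
      have kV: "k \<in> V" using transforms_in[OF d h] .
      obtain l where l: "transforms e c q k l" using transforms_exists d c by blast
      have "transforms d c q h l" using transforms_trans[OF d(1,3) d(2,4) c h(1) h(2) l] .
      then have "r d \<bullet> h = m \<bullet> l" "r e \<bullet> k = m \<bullet> l" using r(2) d h kV l by blast+
      then show ?thesis using d by (simp add: p_def)
    qed
    then show ?thesis using r(1) by (auto simp: cotangent_space_def components_def p_def)
  qed
  ultimately show ?thesis by blast
qed

lemma coords_inj:
  assumes "z \<in> cotangent_bundle V A" "z' \<in> cotangent_bundle V A" and c: "c \<in> A" "fst z \<in> fst c" "fst z' \<in> fst c"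
    and "coords c z = coords c z'"
  shows "z = z'"
proof -
  have 1: "fst z = fst z'" using inj[OF c(1)] assms by (auto simp: coords_def dest: inj_onD)
  have "snd z = snd z'"
    by (rule cotangent_eqI[of _ "fst z" _ c]) (use assms 1 in \<open>auto simp: coords_def cotangent_bundle_def\<close>)
  with 1 show ?thesis by (simp add: prod_eq_iff)
qed

lemma coords_inv:
  assumes "z \<in> cotangent_bundle V A" "c \<in> A" "fst z \<in> fst c"
  shows "inv_into {z \<in> cotangent_bundle V A. fst z \<in> fst c} (coords c) (coords c z) = z"
proof -
  have "inj_on (coords c) {z \<in> cotangent_bundle V A. fst z \<in> fst c}"
    using coords_inj[OF _ _ assms(2)] by (intro inj_onI) blast
  then show ?thesis using assms by (intro inv_into_f_f) auto
qed

text \<open>Hamiltonians are differentiated through the inverse of \<open>coords c\<close>. This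
  evaluates that inverse at every coordinate pair over the chart.\<close>

lemma lift_exists:
  assumes c: "c \<in> A" "q \<in> fst c" and m: "m \<in> V"
  obtains p where "(q, p) \<in> cotangent_bundle V A" "coords c (q, p) = (snd c q, m)"
    "inv_into {z \<in> cotangent_bundle V A. fst z \<in> fst c} (coords c) (snd c q, m) = (q, p)"
proof -
  obtain p where p: "p \<in> cotangent_space V A q" "p c = m" using cotangent_exists[OF assms] by blast
  have 1: "(q, p) \<in> cotangent_bundle V A" using p c by (auto simp: cotangent_bundle_def)
  have 2: "coords c (q, p) = (snd c q, m)" using p by (simp add: coords_def)
  show ?thesis using that[OF 1 2] coords_inv[OF 1, of c] c 2 by simp
qed

lemma coords_in: "z \<in> cotangent_bundle V A \<Longrightarrow> c \<in> A \<Longrightarrow> fst z \<in> fst c \<Longrightarrow> coords c z \<in> V \<times> V"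
  by (simp add: coords_def in_V cotangent_in[OF cotangent_bundleD])

text \<open>The derivative fixes the inner products of \<open>fst w\<close> and \<open>snd w\<close>
  with \<open>V\<close>; membership in \<open>V \<times> V\<close> removes the remaining
  freedom.\<close>

lemma hamiltonian_vector_unique:
  assumes z: "z \<in> cotangent_bundle V A" and c: "c \<in> A" "fst z \<in> fst c"
    and w: "hamiltonian_vector V A H c z w" "hamiltonian_vector V A H c z w'"
  shows "w = w'"
proof -
  have sub: "subspace (V \<times> V)" using subspace by (simp add: subspace_Times)
  have ww: "w \<in> V \<times> V" "w' \<in> V \<times> V" using w by (auto simp: hamiltonian_vector_def)
  have *: "fst w \<bullet> snd y - snd w \<bullet> fst y = fst w' \<bullet> snd y - snd w' \<bullet> fst y" if "y \<in> V \<times> V" for y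
    using has_derivative_unique_on_subspace[OF conjunct2[OF w(1)[unfolded hamiltonian_vector_def]]
        conjunct2[OF w(2)[unfolded hamiltonian_vector_def]] sub open_UNIV _ _ coords_in[OF z c] that]
    by (simp add: case_prod_beta)
  have d: "fst w - fst w' \<in> V" "snd w - snd w' \<in> V" using ww subspace by (auto intro: subspace_diff)
  have "(fst w - fst w') \<bullet> (fst w - fst w') = 0"
    using *[of "(0, fst w - fst w')"] d subspace by (simp add: subspace_0 inner_diff_left)
  moreover have "(snd w - snd w') \<bullet> (snd w - snd w') = 0"
    using *[of "(snd w - snd w', 0)"] d subspace by (simp add: subspace_0 inner_diff_left)
  ultimately show ?thesis by (simp add: prod_eq_iff)
qed

end

section \<open>From the smooth structure to the sub-Finsler manifold\<close>

lemma smooth_on_C1: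
  assumes "smooth_on V S f"
  shows "\<exists>D. (\<forall>x\<in>S. (f has_derivative D x) (at x within S)) \<and> (\<forall>v\<in>V. continuous_on S (\<lambda>x. D x v))"
proof -
  have "Ck_on V S (Suc 0) f" using assms unfolding smooth_on_def by blast
  then show ?thesis by simp
qed

lemma smooth_on_C2:
  assumes "smooth_on V S f"
  shows "\<exists>D. (\<forall>x\<in>S. (f has_derivative D x) (at x within S)) \<and>
    (\<forall>v\<in>V. \<exists>D2. \<forall>x\<in>S. ((\<lambda>x. D x v) has_derivative D2 x) (at x within S))"
proof -
  have "Ck_on V S (Suc (Suc 0)) f" using assms unfolding smooth_on_def by blast
  then show ?thesis by (simp only: Ck_on.simps) blast
qed

lemma open_chart_image:
  assumes c: "is_chart c" and T: "open T" "T \<subseteq> fst c"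
  shows "open (snd c ` T)"
proof -
  have "snd c ` T = chart_inv c -` T \<inter> snd c ` fst c"
    using c T by (auto simp: is_chart_def chart_inv_def inv_into_f_f image_iff)
  moreover have "open (chart_inv c -` T \<inter> snd c ` fst c)"
    using c T(1) continuous_on_open_vimage[of "snd c ` fst c" "chart_inv c"] by (simp add: is_chart_def)
  ultimately show ?thesis by simp
qed

lemma smooth_structure_atlas:
  assumes "smooth_structure A"
  shows "atlas UNIV A"
proof
  have ch: "is_chart c" if "c \<in> A" for c using assms that by (simp add: smooth_structure_def)
  show "subspace UNIV" by simp
  show "inj_on (snd c) (fst c)" if "c \<in> A" for c using ch[OF that] by (simp add: is_chart_def)
  show "snd c ` fst c \<subseteq> UNIV" if "c \<in> A" for c by simp
  fix c d q assume c: "c \<in> A" "d \<in> A" and q: "q \<in> fst c" "q \<in> fst d"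
  have "open (snd c ` (fst c \<inter> fst d))"
    using ch[OF c(1)] ch[OF c(2)] by (intro open_chart_image) (auto simp: is_chart_def)
  then show "\<exists>Q. open Q \<and> snd c q \<in> Q \<and> Q \<inter> UNIV \<subseteq> snd c ` (fst c \<inter> fst d)"
    using q by (intro exI[of _ "snd c ` (fst c \<inter> fst d)"]) auto
  have "smooth_on UNIV (snd c ` (fst c \<inter> fst d)) (transition c d)"
    using assms c by (simp add: smooth_structure_def compatible_def)
  from smooth_on_C1[OF this] show "\<exists>L. (transition c d has_derivative L) (at (snd c q) within snd c ` (fst c \<inter> fst d))"
    using q by blast
qed

locale sub_finsler =
  fixes A :: "('a::topological_space, 'e::euclidean_space) chart set"
    and \<xi> :: "'a \<Rightarrow> (('a, 'e) chart \<Rightarrow> 'e) set"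
    and f :: "'a \<Rightarrow> (('a, 'e) chart \<Rightarrow> 'e) \<Rightarrow> real"
  assumes sub_finsler: "sub_finsler_manifold A \<xi> f"
begin

lemma sf: "smooth_structure A" "smooth_distribution A \<xi>" "finsler_norm A \<xi> f"
  using sub_finsler by (auto simp: sub_finsler_manifold_def)

lemma is_chart: "c \<in> A \<Longrightarrow> is_chart c"
  using sf by (simp add: smooth_structure_def)

lemma chart_exists: "\<exists>c\<in>A. q \<in> fst c"
  using sf(1) unfolding smooth_structure_def by blast

lemma xi_tangent: "v \<in> \<xi> q \<Longrightarrow> v \<in> tangent_space UNIV A q"
  using sf(2) unfolding smooth_distribution_def by blast

lemma norm_nonneg: "v \<in> \<xi> q \<Longrightarrow> 0 \<le> f q v" and norm_zero: "v \<in> \<xi> q \<Longrightarrow> f q v = 0 \<longleftrightarrow> v = (\<lambda>c. 0)"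
  and norm_scale: "v \<in> \<xi> q \<Longrightarrow> r > 0 \<Longrightarrow> f q (\<lambda>c. r *\<^sub>R v c) = r * f q v"
  using sf(3) unfolding finsler_norm_def by blast+

end

sublocale sub_finsler \<subseteq> M: atlas UNIV A
  by (rule smooth_structure_atlas[OF sf(1)])

section \<open>The Hamiltonian in a local frame of the distribution\<close>

locale finsler_frame = sub_finsler A \<xi> f
  for A :: "('a::topological_space, 'e::euclidean_space) chart set" and \<xi> f +
  fixes c :: "('a, 'e) chart" and \<Omega> W F
  assumes c: "c \<in> A" and triv: "trivialises \<xi> c \<Omega> W F"
begin

abbreviation pt :: "'e \<Rightarrow> 'a" where "pt \<equiv> chart_inv c"

definition vec :: "'e \<Rightarrow> 'e \<Rightarrow> ('a, 'e) chart \<Rightarrow> 'e" where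
  "vec x w = (THE v. v \<in> tangent_space UNIV A (pt x) \<and> v c = F x w)"

definition phi :: "'e \<Rightarrow> 'e \<Rightarrow> real" where
  "phi x w = f (pt x) (vec x w)"

definition sph :: "'e set" where
  "sph = {w \<in> W. norm w = 1}"

text \<open>By homogeneity the maximum over the unit ball of \<open>f\<close> is a maximum over the fixed set \<open>sph\<close>.\<close>

definition Phi :: "'e \<times> 'e \<Rightarrow> 'e \<Rightarrow> real" where
  "Phi z w = (snd z \<bullet> F (fst z) w) / phi (fst z) w"

lemma frame: "open \<Omega>" "\<Omega> \<subseteq> snd c ` fst c" "subspace W"
  "\<And>x. x \<in> \<Omega> \<Longrightarrow> linear (F x)" "\<And>x. x \<in> \<Omega> \<Longrightarrow> inj_on (F x) W"
  "\<And>x. x \<in> \<Omega> \<Longrightarrow> F x ` W = (\<lambda>v. v c) ` \<xi> (pt x)"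
  "\<And>w. w \<in> W \<Longrightarrow> smooth_on UNIV \<Omega> (\<lambda>x. F x w)"
  using triv by (auto simp: trivialises_def)

lemma pt: "x \<in> \<Omega> \<Longrightarrow> pt x \<in> fst c" "x \<in> \<Omega> \<Longrightarrow> snd c (pt x) = x"
  using frame(2) by (auto simp: chart_inv_def inv_into_into f_inv_into_f)

lemma vecI:
  assumes "x \<in> \<Omega>" "v \<in> tangent_space UNIV A (pt x)" "v c = F x w"
  shows "vec x w = v"
  unfolding vec_def
  by (rule the_equality) (use assms M.tangent_eqI[OF _ _ c pt(1)] in auto)

lemma vec:
  assumes x: "x \<in> \<Omega>" and w: "w \<in> W"
  shows "vec x w \<in> \<xi> (pt x)" "vec x w c = F x w"
proof -
  obtain v where v: "v \<in> \<xi> (pt x)" "v c = F x w" using frame(6)[OF x] w by (metis (no_types, lifting) imageE imageI)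
  then have "vec x w = v" using vecI[OF x xi_tangent] by blast
  then show "vec x w \<in> \<xi> (pt x)" "vec x w c = F x w" using v by auto
qed

lemma vec_surj:
  assumes x: "x \<in> \<Omega>" and v: "v \<in> \<xi> (pt x)"
  obtains w where "w \<in> W" "v = vec x w"
proof -
  obtain w where "w \<in> W" "v c = F x w" using frame(6)[OF x] v by (metis (no_types, lifting) imageE imageI)
  then show ?thesis using that vecI[OF x xi_tangent[OF v]] by metis
qed

lemma vec_combination:
  assumes x: "x \<in> \<Omega>" and w: "w \<in> W" "w' \<in> W"
  shows "vec x (a *\<^sub>R w + b *\<^sub>R w') = (\<lambda>d. a *\<^sub>R vec x w d + b *\<^sub>R vec x w' d)"
  by (rule vecI[OF x M.tangent_combination[OF xi_tangent[OF vec(1)[OF x w(1)]] xi_tangent[OF vec(1)[OF x w(2)]]]])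
    (use frame(4)[OF x] in \<open>simp add: vec(2)[OF x w(1)] vec(2)[OF x w(2)] linear_add linear_scale\<close>)

lemma vec_eq_zero:
  assumes x: "x \<in> \<Omega>" and w: "w \<in> W" and "vec x w = (\<lambda>d. 0)"
  shows "w = 0"
proof -
  have "F x w = F x 0" using assms vec(2)[OF x w] frame(4)[OF x] by (simp add: linear_0)
  then show ?thesis using frame(5)[OF x] w frame(3) by (auto dest: inj_onD simp: subspace_0)
qed

lemma phi_pos: "x \<in> \<Omega> \<Longrightarrow> w \<in> W \<Longrightarrow> w \<noteq> 0 \<Longrightarrow> phi x w > 0"
  using norm_nonneg[OF vec(1), of x w] norm_zero[OF vec(1), of x w] vec_eq_zero[of x w]
  by (auto simp: phi_def order_le_less)

lemma phi_scale:
  assumes "x \<in> \<Omega>" "w \<in> W" "r > 0"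
  shows "phi x (r *\<^sub>R w) = r * phi x w"
proof -
  have "vec x (r *\<^sub>R w + 0 *\<^sub>R w) = (\<lambda>d. r *\<^sub>R vec x w d + 0 *\<^sub>R vec x w d)"
    by (rule vec_combination) (use assms in auto)
  then show ?thesis using norm_scale[OF vec(1)[OF assms(1,2)] assms(3)] by (simp add: phi_def)
qed

lemma phi_smooth: "smooth_on (UNIV \<times> W) (\<Omega> \<times> (W - {0})) (\<lambda>(x, w). phi x w)"
  using sf(3) c triv unfolding finsler_norm_def phi_def vec_def by blast

lemma sph: "w \<in> sph \<Longrightarrow> w \<in> W" "w \<in> sph \<Longrightarrow> w \<noteq> 0" "compact sph"
proof -
  show "w \<in> sph \<Longrightarrow> w \<in> W" "w \<in> sph \<Longrightarrow> w \<noteq> 0" by (auto simp: sph_def)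
  have "sph = W \<inter> sphere 0 1" by (auto simp: sph_def)
  then show "compact sph" using closed_subspace[OF frame(3)] by (simp add: closed_Int_compact)
qed

lemma sph_normalise: "w \<in> W \<Longrightarrow> w \<noteq> 0 \<Longrightarrow> (1 / norm w) *\<^sub>R w \<in> sph"
  using frame(3) by (simp add: sph_def subspace_mul)

text \<open>A trivialisation is smooth in \<open>x\<close> for each fixed \<open>w\<close> only.
  Linearity in \<open>w\<close> and a finite orthonormal basis of \<open>W\<close> turn this into
  joint regularity in \<open>(x, w)\<close>.\<close>

lemma F_expansion:
  obtains B where "finite B" "B \<subseteq> W" "\<And>x w. x \<in> \<Omega> \<Longrightarrow> w \<in> W \<Longrightarrow> F x w = (\<Sum>b\<in>B. (w \<bullet> b) *\<^sub>R F x b)"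
proof -
  obtain B where B: "B \<subseteq> W" "pairwise orthogonal B" "\<And>x. x \<in> B \<Longrightarrow> norm x = 1" "independent B" "span B = W"
    using orthonormal_basis_subspace[OF frame(3)] by metis
  have fin: "finite B" using B(4) independent_imp_finite by blast
  have "F x w = (\<Sum>b\<in>B. (w \<bullet> b) *\<^sub>R F x b)" if "x \<in> \<Omega>" "w \<in> W" for x w
  proof -
    have "w = (\<Sum>b\<in>B. (w \<bullet> b) *\<^sub>R b)" using orthonormal_basis_expand[OF B(2,3) _ fin] that B by auto
    then have "F x w = F x (\<Sum>b\<in>B. (w \<bullet> b) *\<^sub>R b)" by simp
    then show ?thesis using frame(4)[OF that(1)] by (simp add: linear_sum linear_scale)
  qed
  then show ?thesis using that fin B by blast
qed

lemma F_derivative: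
  obtains DF where "\<And>x w. x \<in> \<Omega> \<Longrightarrow> w \<in> W \<Longrightarrow> ((\<lambda>x. F x w) has_derivative DF x w) (at x)"
    "\<And>h. continuous_on (\<Omega> \<times> W) (\<lambda>(x, w). DF x w h)" "continuous_on (\<Omega> \<times> W) (\<lambda>(x, w). F x w)"
proof -
  obtain B where B: "finite B" "B \<subseteq> W" "\<And>x w. x \<in> \<Omega> \<Longrightarrow> w \<in> W \<Longrightarrow> F x w = (\<Sum>b\<in>B. (w \<bullet> b) *\<^sub>R F x b)"
    using F_expansion by metis
  have "\<forall>b\<in>B. \<exists>D. (\<forall>x\<in>\<Omega>. ((\<lambda>x. F x b) has_derivative D x) (at x within \<Omega>)) \<and> (\<forall>v\<in>UNIV. continuous_on \<Omega> (\<lambda>x. D x v))"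
    using smooth_on_C1[OF frame(7)] B(2) by blast
  then obtain D where D: "\<And>b x. b \<in> B \<Longrightarrow> x \<in> \<Omega> \<Longrightarrow> ((\<lambda>x. F x b) has_derivative D b x) (at x within \<Omega>)"
    "\<And>b v. b \<in> B \<Longrightarrow> continuous_on \<Omega> (\<lambda>x. D b x v)"
    by (metis UNIV_I)
  show ?thesis
  proof (rule that[of "\<lambda>x w h. \<Sum>b\<in>B. (w \<bullet> b) *\<^sub>R D b x h"])
    fix x w assume x: "x \<in> \<Omega>" and w: "w \<in> W"
    have "((\<lambda>x. \<Sum>b\<in>B. (w \<bullet> b) *\<^sub>R F x b) has_derivative (\<lambda>h. \<Sum>b\<in>B. (w \<bullet> b) *\<^sub>R D b x h)) (at x within \<Omega>)"
      by (intro has_derivative_sum has_derivative_scaleR_right D x)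
    then have "((\<lambda>x. F x w) has_derivative (\<lambda>h. \<Sum>b\<in>B. (w \<bullet> b) *\<^sub>R D b x h)) (at x within \<Omega>)"
      by (rule has_derivative_transform[rotated 2]) (use x w B(3) in auto)
    then show "((\<lambda>x. F x w) has_derivative (\<lambda>h. \<Sum>b\<in>B. (w \<bullet> b) *\<^sub>R D b x h)) (at x)"
      using at_within_open[OF x frame(1)] by simp
  next
    fix h
    have "continuous_on (\<Omega> \<times> W) (\<lambda>z. \<Sum>b\<in>B. (snd z \<bullet> b) *\<^sub>R D b (fst z) h)"
      by (intro continuous_intros continuous_on_compose2[OF D(2)]) auto
    then show "continuous_on (\<Omega> \<times> W) (\<lambda>(x, w). \<Sum>b\<in>B. (w \<bullet> b) *\<^sub>R D b x h)" by (simp add: case_prod_beta)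
  next
    have Fb: "continuous_on \<Omega> (\<lambda>x. F x b)" if "b \<in> B" for b
      using has_derivative_continuous_on[of \<Omega> "\<lambda>x. F x b" "D b"] D(1) that by blast
    have "continuous_on (\<Omega> \<times> W) (\<lambda>z. \<Sum>b\<in>B. (snd z \<bullet> b) *\<^sub>R F (fst z) b)"
      by (intro continuous_intros continuous_on_compose2[OF Fb]) auto
    then show "continuous_on (\<Omega> \<times> W) (\<lambda>(x, w). F x w)"
      by (rule continuous_on_eq) (auto simp: B(3)[symmetric])
  qed
qed

lemma phi_total_derivative:
  obtains D where "\<And>x w. x \<in> \<Omega> \<Longrightarrow> w \<in> W - {0} \<Longrightarrow> ((\<lambda>(x, w). phi x w) has_derivative D (x, w)) (at (x, w) within \<Omega> \<times> (W - {0}))"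
    "\<And>h. continuous_on (\<Omega> \<times> (W - {0})) (\<lambda>z. D z (h, 0))"
proof -
  have "(h, 0) \<in> UNIV \<times> W" for h :: 'e using frame(3) by (simp add: subspace_0)
  moreover obtain D where D: "\<forall>y\<in>\<Omega> \<times> (W - {0}). ((\<lambda>(x, w). phi x w) has_derivative D y) (at y within \<Omega> \<times> (W - {0}))"
    "\<forall>v\<in>UNIV \<times> W. continuous_on (\<Omega> \<times> (W - {0})) (\<lambda>z. D z v)"
    using smooth_on_C1[OF phi_smooth] by blast
  ultimately show ?thesis by (intro that[of D]) blast+
qed

lemma phi_derivative:
  obtains P where "\<And>x w. x \<in> \<Omega> \<Longrightarrow> w \<in> W - {0} \<Longrightarrow> ((\<lambda>x. phi x w) has_derivative P x w) (at x)"
    "\<And>h. continuous_on (\<Omega> \<times> (W - {0})) (\<lambda>(x, w). P x w h)" "continuous_on (\<Omega> \<times> (W - {0})) (\<lambda>(x, w). phi x w)"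
proof -
  obtain D where D: "\<And>x w. x \<in> \<Omega> \<Longrightarrow> w \<in> W - {0} \<Longrightarrow> ((\<lambda>(x, w). phi x w) has_derivative D (x, w)) (at (x, w) within \<Omega> \<times> (W - {0}))"
    "\<And>h. continuous_on (\<Omega> \<times> (W - {0})) (\<lambda>z. D z (h, 0))"
    using phi_total_derivative by metis
  show ?thesis
  proof (rule that[of "\<lambda>x w h. D (x, w) (h, 0)"])
    fix x w assume x: "x \<in> \<Omega>" and w: "w \<in> W - {0}"
    have 1: "((\<lambda>x. (x, w)) has_derivative (\<lambda>h. (h, 0))) (at x within \<Omega>)"
      by (auto intro!: derivative_eq_intros)
    have 2: "((\<lambda>(x, w). phi x w) has_derivative D (x, w)) (at (x, w) within (\<lambda>x. (x, w)) ` \<Omega>)"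
      by (rule has_derivative_subset[OF D(1)[OF x w]]) (use w in auto)
    have "((\<lambda>x. phi x w) has_derivative (\<lambda>h. D (x, w) (h, 0))) (at x within \<Omega>)"
      using has_derivative_in_compose[OF 1 2] by simp
    then show "((\<lambda>x. phi x w) has_derivative (\<lambda>h. D (x, w) (h, 0))) (at x)"
      using at_within_open[OF x frame(1)] by simp
  next
    show "continuous_on (\<Omega> \<times> (W - {0})) (\<lambda>(x, w). D (x, w) (h, 0))" for h
      using D(2) by (simp add: case_prod_beta)
    show "continuous_on (\<Omega> \<times> (W - {0})) (\<lambda>(x, w). phi x w)"
      by (rule has_derivative_continuous_on[of _ _ D]) (use D(1) in auto)
  qed
qed

lemma Phi_continuous: "continuous_on ((\<Omega> \<times> UNIV) \<times> sph) (\<lambda>(z, w). Phi z w)"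
proof -
  obtain DF where DF: "continuous_on (\<Omega> \<times> W) (\<lambda>(x, w). F x w)" using F_derivative by metis
  obtain P where P: "continuous_on (\<Omega> \<times> (W - {0})) (\<lambda>(x, w). phi x w)" using phi_derivative by metis
  have 1: "continuous_on ((\<Omega> \<times> UNIV) \<times> sph) (\<lambda>y. (\<lambda>(x, w). F x w) (fst (fst y), snd y))"
    by (intro continuous_on_compose2[OF DF] continuous_intros) (auto simp: sph)
  have 2: "continuous_on ((\<Omega> \<times> UNIV) \<times> sph) (\<lambda>y. (\<lambda>(x, w). phi x w) (fst (fst y), snd y))"
    by (intro continuous_on_compose2[OF P] continuous_intros) (auto simp: sph)
  have nz: "phi x w \<noteq> 0" if "x \<in> \<Omega>" "w \<in> sph" for x w using phi_pos[OF that(1) sph(1)[OF that(2)] sph(2)[OF that(2)]] by simp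
  have "continuous_on ((\<Omega> \<times> UNIV) \<times> sph) (\<lambda>y. (snd (fst y) \<bullet> F (fst (fst y)) (snd y)) / phi (fst (fst y)) (snd y))"
    using 1 2 by (intro continuous_intros) (auto simp: nz)
  then show ?thesis by (simp add: Phi_def case_prod_beta)
qed

lemma inner_gradient:
  fixes g :: "'z::euclidean_space \<Rightarrow> real"
  assumes "linear g"
  shows "(\<Sum>b\<in>Basis. g b *\<^sub>R b) \<bullet> h = g h"
proof -
  have "g h = g (\<Sum>b\<in>Basis. (h \<bullet> b) *\<^sub>R b)" by (simp add: euclidean_representation)
  also have "\<dots> = (\<Sum>b\<in>Basis. (h \<bullet> b) * g b)" using assms by (simp add: linear_sum linear_scale)
  also have "\<dots> = (\<Sum>b\<in>Basis. (g b *\<^sub>R b) \<bullet> h)" by (simp add: inner_commute mult.commute)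
  finally show ?thesis by (simp add: inner_sum_left)
qed

lemma Phi_gradient:
  obtains D where "\<And>z w. z \<in> \<Omega> \<times> UNIV \<Longrightarrow> w \<in> sph \<Longrightarrow> ((\<lambda>z. Phi z w) has_derivative (\<lambda>h. D z w \<bullet> h)) (at z)"
    "continuous_on ((\<Omega> \<times> UNIV) \<times> sph) (\<lambda>(z, w). D z w)"
proof -
  obtain DF where DF: "\<And>x w. x \<in> \<Omega> \<Longrightarrow> w \<in> W \<Longrightarrow> ((\<lambda>x. F x w) has_derivative DF x w) (at x)"
    "\<And>h. continuous_on (\<Omega> \<times> W) (\<lambda>(x, w). DF x w h)" "continuous_on (\<Omega> \<times> W) (\<lambda>(x, w). F x w)"
    using F_derivative by metis
  obtain P where P: "\<And>x w. x \<in> \<Omega> \<Longrightarrow> w \<in> W - {0} \<Longrightarrow> ((\<lambda>x. phi x w) has_derivative P x w) (at x)"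
    "\<And>h. continuous_on (\<Omega> \<times> (W - {0})) (\<lambda>(x, w). P x w h)" "continuous_on (\<Omega> \<times> (W - {0})) (\<lambda>(x, w). phi x w)"
    using phi_derivative by metis
  define L :: "'e \<times> 'e \<Rightarrow> 'e \<Rightarrow> 'e \<times> 'e \<Rightarrow> real" where "L z w h = (snd h \<bullet> F (fst z) w + snd z \<bullet> DF (fst z) w (fst h)) / phi (fst z) w
    - (snd z \<bullet> F (fst z) w) * P (fst z) w (fst h) / (phi (fst z) w)\<^sup>2" for z w h
  have nz: "phi x w \<noteq> 0" if "x \<in> \<Omega>" "w \<in> sph" for x w using phi_pos[OF that(1) sph(1)[OF that(2)] sph(2)[OF that(2)]] by simp
  have der: "((\<lambda>z. Phi z w) has_derivative L z w) (at z)" if z: "z \<in> \<Omega> \<times> UNIV" and w: "w \<in> sph" for z w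
  proof -
    have x: "fst z \<in> \<Omega>" using z by auto
    have w': "w \<in> W" "w \<in> W - {0}" using sph(1,2)[OF w] by auto
    have fz: "(fst has_derivative fst) (at z)" using has_derivative_fst[OF has_derivative_ident[of "at z"]] by simp
    have sz: "(snd has_derivative snd) (at z)" using has_derivative_snd[OF has_derivative_ident[of "at z"]] by simp
    have 1: "((\<lambda>z. F (fst z) w) has_derivative (\<lambda>h. DF (fst z) w (fst h))) (at z)"
      by (rule has_derivative_compose[OF fz DF(1)[OF x w'(1)]])
    have 2: "((\<lambda>z. phi (fst z) w) has_derivative (\<lambda>h. P (fst z) w (fst h))) (at z)"
      by (rule has_derivative_compose[OF fz P(1)[OF x w'(2)]])
    have 3: "((\<lambda>z. snd z \<bullet> F (fst z) w) has_derivative (\<lambda>h. snd z \<bullet> DF (fst z) w (fst h) + snd h \<bullet> F (fst z) w)) (at z)"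
      by (rule has_derivative_inner[OF sz 1])
    have "((\<lambda>z. (snd z \<bullet> F (fst z) w) / phi (fst z) w) has_derivative
       (\<lambda>h. - (snd z \<bullet> F (fst z) w) * (inverse (phi (fst z) w) * P (fst z) w (fst h) * inverse (phi (fst z) w)) +
          (snd z \<bullet> DF (fst z) w (fst h) + snd h \<bullet> F (fst z) w) / phi (fst z) w)) (at z)"
      by (rule has_derivative_divide[OF 3 2 nz[OF x w]])
    moreover have "(\<lambda>h. - (snd z \<bullet> F (fst z) w) * (inverse (phi (fst z) w) * P (fst z) w (fst h) * inverse (phi (fst z) w)) +
          (snd z \<bullet> DF (fst z) w (fst h) + snd h \<bullet> F (fst z) w) / phi (fst z) w) = L z w"
      by (simp add: L_def fun_eq_iff divide_inverse power2_eq_square algebra_simps)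
    ultimately show ?thesis unfolding Phi_def by simp
  qed
  have contL: "continuous_on ((\<Omega> \<times> UNIV) \<times> sph) (\<lambda>y. L (fst y) (snd y) h)" for h
  proof -
    have 1: "continuous_on ((\<Omega> \<times> UNIV) \<times> sph) (\<lambda>y. F (fst (fst y)) (snd y))"
      using continuous_on_compose2[OF DF(3), of "(\<Omega> \<times> UNIV) \<times> sph" "\<lambda>y. (fst (fst y), snd y)"]
      by (force simp: sph intro!: continuous_intros)
    have 2: "continuous_on ((\<Omega> \<times> UNIV) \<times> sph) (\<lambda>y. phi (fst (fst y)) (snd y))"
      using continuous_on_compose2[OF P(3), of "(\<Omega> \<times> UNIV) \<times> sph" "\<lambda>y. (fst (fst y), snd y)"]
      by (force simp: sph intro!: continuous_intros)
    have 3: "continuous_on ((\<Omega> \<times> UNIV) \<times> sph) (\<lambda>y. DF (fst (fst y)) (snd y) (fst h))"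
      using continuous_on_compose2[OF DF(2)[of "fst h"], of "(\<Omega> \<times> UNIV) \<times> sph" "\<lambda>y. (fst (fst y), snd y)"]
      by (force simp: sph intro!: continuous_intros)
    have 4: "continuous_on ((\<Omega> \<times> UNIV) \<times> sph) (\<lambda>y. P (fst (fst y)) (snd y) (fst h))"
      using continuous_on_compose2[OF P(2)[of "fst h"], of "(\<Omega> \<times> UNIV) \<times> sph" "\<lambda>y. (fst (fst y), snd y)"]
      by (force simp: sph intro!: continuous_intros)
    show ?thesis unfolding L_def
      by (intro continuous_intros 1 2 3 4) (auto simp: nz)
  qed
  show ?thesis
  proof (rule that[of "\<lambda>z w. \<Sum>b\<in>Basis. L z w b *\<^sub>R b"])
    fix z :: "'e \<times> 'e" and w assume zw: "z \<in> \<Omega> \<times> UNIV" "w \<in> sph"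
    have "(\<lambda>h. (\<Sum>b\<in>Basis. L z w b *\<^sub>R b) \<bullet> h) = L z w"
      using inner_gradient[OF has_derivative_linear[OF der[OF zw]]] by (rule ext)
    then show "((\<lambda>z. Phi z w) has_derivative (\<lambda>h. (\<Sum>b\<in>Basis. L z w b *\<^sub>R b) \<bullet> h)) (at z)"
      using der[OF zw] by simp
  next
    have "continuous_on ((\<Omega> \<times> UNIV) \<times> sph) (\<lambda>y. \<Sum>b\<in>Basis. L (fst y) (snd y) b *\<^sub>R b)"
      by (intro continuous_intros contL)
    then show "continuous_on ((\<Omega> \<times> UNIV) \<times> sph) (\<lambda>(z, w). \<Sum>b\<in>Basis. L z w b *\<^sub>R b)"
      by (simp add: case_prod_beta)
  qed
qed

text \<open>Along the line through two maximisers \<open>f\<^sup>2\<close> is bounded below by its value at both of them, so its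
  derivative vanishes at both; by Rolle this contradicts strong convexity.\<close>

lemma maximiser_unique:
  assumes x: "x \<in> \<Omega>" and u: "u1 \<in> W" "u2 \<in> W" "phi x u1 = 1" "phi x u2 = 1"
    and m: "p \<bullet> F x u1 = m" "p \<bullet> F x u2 = m" "m > 0" and le: "\<And>w. w \<in> W \<Longrightarrow> p \<bullet> F x w \<le> m * phi x w"
  shows "u1 = u2"
proof (rule ccontr)
  assume ne: "u1 \<noteq> u2"
  define h where "h = u2 - u1"
  define l where "l t = u1 + t *\<^sub>R h" for t
  have hW: "h \<in> W" "h \<noteq> 0" using u ne frame(3) by (auto simp: h_def subspace_diff)
  have lW: "l t \<in> W" for t using u hW frame(3) by (simp add: l_def subspace_add subspace_mul)
  have pl: "p \<bullet> F x (l t) = m" for t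
    using m frame(4)[OF x] by (simp add: l_def h_def linear_add linear_scale linear_diff inner_add_right inner_diff_right)
  \<comment> \<open>\<open>p\<close> has the positive value \<open>m\<close> along the whole line,
    which therefore avoids the zero section, where \<open>phi\<close> may fail to be smooth.\<close>
  have l0: "l t \<noteq> 0" for t using pl[of t] m(3) frame(4)[OF x] by (auto simp: linear_0)
  obtain D where D: "\<forall>y\<in>\<Omega> \<times> (W - {0}). ((\<lambda>(x, w). phi x w) has_derivative D y) (at y within \<Omega> \<times> (W - {0}))"
    "\<forall>v\<in>UNIV \<times> W. \<exists>D2. \<forall>y\<in>\<Omega> \<times> (W - {0}). ((\<lambda>y. D y v) has_derivative D2 y) (at y within \<Omega> \<times> (W - {0}))"
    using smooth_on_C2[OF phi_smooth] by blast
  obtain D2 where D2: "\<forall>y\<in>\<Omega> \<times> (W - {0}). ((\<lambda>y. D y (0, h)) has_derivative D2 y) (at y within \<Omega> \<times> (W - {0}))"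
    using D(2) hW by blast
  define g1 where "g1 t = phi x (l t)" for t
  define d1 where "d1 t = D (x, l t) (0, h)" for t
  define d2 where "d2 t = D2 (x, l t) (0, h)" for t
  have line: "((\<lambda>t. (x, l t)) has_derivative (\<lambda>s. s *\<^sub>R (0, h))) (at t)" for t
    unfolding l_def by (auto intro!: derivative_eq_intros)
  have along: "((\<lambda>t. G (x, l t)) has_real_derivative G' (0, h)) (at t)"
    if G: "(G has_derivative G') (at (x, l t) within \<Omega> \<times> (W - {0}))" for G :: "'e \<times> 'e \<Rightarrow> real" and G' t
  proof -
    have "(G has_derivative G') (at (x, l t) within range (\<lambda>t. (x, l t)))"
      by (rule has_derivative_subset[OF G]) (use x lW l0 in auto)
    from has_derivative_in_compose[OF line this]
    have "((\<lambda>t. G (x, l t)) has_derivative (\<lambda>s. G' (s *\<^sub>R (0, h)))) (at t)" .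
    moreover have "(\<lambda>s. G' (s *\<^sub>R (0, h))) = (\<lambda>s. G' (0, h) * s)"
      using has_derivative_linear[OF G] linear_scale[of G' _ "(0, h)"] by (simp add: fun_eq_iff mult.commute)
    ultimately show ?thesis by (simp add: has_field_derivative_def)
  qed
  have g1d: "(g1 has_real_derivative d1 t) (at t)" for t
    using along[of "\<lambda>(x, w). phi x w" "D (x, l t)" t] D(1) x lW l0 unfolding g1_def[abs_def] d1_def by auto
  have d1d: "(d1 has_real_derivative d2 t) (at t)" for t
    using along[of "\<lambda>y. D y (0, h)" "D2 (x, l t)" t] D2 x lW l0 unfolding d1_def[abs_def] d2_def by auto
  define g where "g t = (g1 t)\<^sup>2" for t
  define g' where "g' t = 2 * g1 t * d1 t" for t
  define g'' where "g'' t = 2 * d1 t * d1 t + 2 * g1 t * d2 t" for t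
  have gd: "(g has_real_derivative g' t) (at t)" for t
    unfolding g_def[abs_def] g'_def by (auto intro!: derivative_eq_intros g1d)
  have g'd: "(g' has_real_derivative g'' t) (at t)" for t
    unfolding g'_def[abs_def] g''_def by (auto intro!: derivative_eq_intros g1d d1d)
  have g1ge: "g1 t \<ge> 1" for t
  proof -
    have "m * 1 \<le> m * g1 t" using le[OF lW[of t]] pl[of t] by (simp add: g1_def)
    then show ?thesis using m(3) by (simp only: mult_le_cancel_left_pos)
  qed
  have gge: "g t \<ge> 1" for t using g1ge[of t] by (simp add: g_def one_le_power)
  have g01: "g 0 = 1" "g 1 = 1" using u by (auto simp: g_def g1_def l_def h_def)
  have "g' 0 = 0" by (rule DERIV_local_min[OF gd, of 1]) (use gge g01 in auto)
  moreover have "g' 1 = 0" by (rule DERIV_local_min[OF gd, of 1]) (use gge g01 in auto)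
  moreover have "\<exists>t>0. t < 1 \<and> g' 1 - g' 0 = (1 - 0) * g'' t"
    by (rule MVT2) (use g'd in auto)
  ultimately obtain t where t: "g'' t = 0" by auto
  have "vec x (l t) \<in> \<xi> (pt x) - {\<lambda>c. 0}" "vec x h \<in> \<xi> (pt x) - {\<lambda>c. 0}"
    using vec(1)[OF x] vec_eq_zero[OF x] lW l0 hW by auto
  then have "deriv (deriv (\<lambda>s. (f (pt x) (\<lambda>d. vec x (l t) d + s *\<^sub>R vec x h d))\<^sup>2)) 0 > 0"
    using sf(3) unfolding finsler_norm_def by blast
  moreover have "(\<lambda>s. (f (pt x) (\<lambda>d. vec x (l t) d + s *\<^sub>R vec x h d))\<^sup>2) = (\<lambda>s. g (s + t))"
  proof
    fix s
    have "vec x (1 *\<^sub>R l t + s *\<^sub>R h) = (\<lambda>d. 1 *\<^sub>R vec x (l t) d + s *\<^sub>R vec x h d)"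
      by (rule vec_combination[OF x lW hW(1)])
    moreover have "1 *\<^sub>R l t + s *\<^sub>R h = l (s + t)" by (simp add: l_def algebra_simps)
    ultimately show "(f (pt x) (\<lambda>d. vec x (l t) d + s *\<^sub>R vec x h d))\<^sup>2 = g (s + t)"
      by (simp add: g_def g1_def phi_def)
  qed
  moreover have "deriv (\<lambda>s. g (s + t)) = (\<lambda>s. g' (s + t))"
    using gd DERIV_shift[of g] by (intro ext DERIV_imp_deriv) auto
  moreover have "deriv (\<lambda>s. g' (s + t)) 0 = g'' t"
    using g'd[of "0 + t"] DERIV_shift[of g' _ 0 t] by (intro DERIV_imp_deriv) auto
  ultimately show False using t by simp
qed

section \<open>The Hamiltonian as a maximum over the sphere of the frame\<close>

definition maxPhi :: "'e \<times> 'e \<Rightarrow> real" where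
  "maxPhi z = (SUP w\<in>sph. Phi z w)"

lemma maxPhi_attained:
  assumes z: "z \<in> \<Omega> \<times> UNIV" and ne: "sph \<noteq> {}"
  obtains w where "w \<in> sph" "Phi z w = maxPhi z"
proof -
  have "continuous_on sph ((\<lambda>(z, w). Phi z w) \<circ> (\<lambda>w. (z, w)))"
    by (intro continuous_on_compose continuous_intros continuous_on_subset[OF Phi_continuous]) (use z in auto)
  then have "continuous_on sph (Phi z)" by (simp add: o_def)
  then obtain w where w: "w \<in> sph" "\<And>w'. w' \<in> sph \<Longrightarrow> Phi z w' \<le> Phi z w"
    using continuous_attains_sup[OF sph(3) ne] by blast
  then have "maxPhi z = Phi z w" unfolding maxPhi_def by (intro cSup_eq_maximum) auto
  then show ?thesis using w that by auto
qed

lemma Phi_le: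
  assumes z: "z \<in> \<Omega> \<times> UNIV" and w: "w \<in> sph"
  shows "Phi z w \<le> maxPhi z"
proof -
  have "continuous_on sph ((\<lambda>(z, w). Phi z w) \<circ> (\<lambda>w. (z, w)))"
    by (intro continuous_on_compose continuous_intros continuous_on_subset[OF Phi_continuous]) (use z in auto)
  then have "continuous_on sph (Phi z)" by (simp add: o_def)
  then have "compact (Phi z ` sph)" using sph(3) compact_continuous_image by blast
  then show ?thesis unfolding maxPhi_def
    by (intro cSup_upper bounded_imp_bdd_above compact_imp_bounded) (use w in auto)
qed

lemma phi_zero: "x \<in> \<Omega> \<Longrightarrow> phi x 0 = 0" and vec_zero: "x \<in> \<Omega> \<Longrightarrow> vec x 0 = (\<lambda>d. 0)"
proof -
  assume x: "x \<in> \<Omega>"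
  have 0: "0 \<in> W" using frame(3) by (rule subspace_0)
  show v: "vec x 0 = (\<lambda>d. 0)" using vec_combination[OF x 0 0, of 0 0] by simp
  show "phi x 0 = 0" using norm_zero[OF vec(1)[OF x 0]] v by (simp add: phi_def)
qed

lemma Phi_normalise:
  assumes z: "fst z \<in> \<Omega>" and w: "w \<in> W" "w \<noteq> 0"
  shows "snd z \<bullet> F (fst z) w = Phi z ((1 / norm w) *\<^sub>R w) * phi (fst z) w"
proof -
  have "phi (fst z) ((1 / norm w) *\<^sub>R w) = (1 / norm w) * phi (fst z) w"
    by (rule phi_scale[OF z w(1)]) (use w in simp)
  then show ?thesis using w phi_pos[OF z w] frame(4)[OF z] by (simp add: Phi_def linear_scale)
qed

text \<open>The norm may be asymmetric, but the numerator of \<open>Phi\<close> is odd in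
  \<open>w\<close>, so one of \<open>w\<close> and \<open>- w\<close> gives a value that is not
  negative.\<close>

lemma maxPhi_nonneg:
  assumes z: "z \<in> \<Omega> \<times> UNIV" and ne: "sph \<noteq> {}"
  shows "0 \<le> maxPhi z"
proof -
  have x: "fst z \<in> \<Omega>" using z by auto
  obtain w where w: "w \<in> sph" using ne by blast
  then have w': "- w \<in> sph" using frame(3) by (auto simp: sph_def subspace_neg)
  have p: "phi (fst z) w > 0" "phi (fst z) (- w) > 0"
    using phi_pos[OF x] sph(1,2)[OF w] sph(1,2)[OF w'] by auto
  have "F (fst z) (- w) = - F (fst z) w" using frame(4)[OF x] by (simp add: linear_neg)
  then have "0 \<le> Phi z w \<or> 0 \<le> Phi z (- w)" using p by (auto simp: Phi_def divide_simps)
  then show ?thesis using Phi_le[OF z w] Phi_le[OF z w'] by linarith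
qed

lemma inner_le_maxPhi:
  assumes z: "z \<in> \<Omega> \<times> UNIV" and w: "w \<in> W"
  shows "snd z \<bullet> F (fst z) w \<le> maxPhi z * phi (fst z) w"
proof (cases "w = 0")
  case True
  then show ?thesis using z frame(4)[of "fst z"] phi_zero[of "fst z"] by (auto simp: linear_0)
next
  case False
  have x: "fst z \<in> \<Omega>" using z by auto
  show ?thesis unfolding Phi_normalise[OF x w False]
    by (rule mult_right_mono[OF Phi_le[OF z sph_normalise[OF w False]]]) (use phi_pos[OF x w False] in simp)
qed

lemma pairing_vec:
  assumes y: "y \<in> cotangent_bundle UNIV A" "fst y \<in> fst c" "snd c (fst y) \<in> \<Omega>" and w: "w \<in> W"
  shows "pt (snd c (fst y)) = fst y" "vec (snd c (fst y)) w \<in> \<xi> (fst y)"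
    "pairing A (fst y) (snd y) (vec (snd c (fst y)) w) = snd (coords c y) \<bullet> F (fst (coords c y)) w"
    "f (fst y) (vec (snd c (fst y)) w) = phi (fst (coords c y)) w"
proof -
  show pt: "pt (snd c (fst y)) = fst y" by (rule M.chart_inv_eq[OF c y(2)])
  show v: "vec (snd c (fst y)) w \<in> \<xi> (fst y)" using vec(1)[OF y(3) w] pt by simp
  show "pairing A (fst y) (snd y) (vec (snd c (fst y)) w) = snd (coords c y) \<bullet> F (fst (coords c y)) w"
    using M.pairing_chart[OF cotangent_bundleD[OF y(1)] xi_tangent[OF v] c y(2)] vec(2)[OF y(3) w]
    by (simp add: coords_def)
  show "f (fst y) (vec (snd c (fst y)) w) = phi (fst (coords c y)) w"
    using pt by (simp add: phi_def coords_def)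
qed

text \<open>The maximum over the unit ball is attained on rescaled points of the sphere, because
  \<open>maxPhi\<close> is not negative and shorter vectors give no more. In rank zero the sphere is
  empty and \<open>maxPhi\<close> says nothing; the only vector is then 0.\<close>

lemma hamiltonian_properties:
  assumes y: "y \<in> cotangent_bundle UNIV A" "fst y \<in> fst c" "snd c (fst y) \<in> \<Omega>"
  shows "sph \<noteq> {} \<Longrightarrow> maximised_hamiltonian A \<xi> f y = maxPhi (coords c y)"
    and "sph = {} \<Longrightarrow> maximised_hamiltonian A \<xi> f y = 0"
proof -
  let ?x = "snd c (fst y)" and ?z = "coords c y"
  let ?S = "{pairing A (fst y) (snd y) v |v. v \<in> \<xi> (fst y) \<and> f (fst y) v \<le> 1}"
  have z: "?z \<in> \<Omega> \<times> UNIV" "fst ?z = ?x" using y by (auto simp: coords_def)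
  have S: "?S = {snd ?z \<bullet> F (fst ?z) w |w. w \<in> W \<and> phi (fst ?z) w \<le> 1}" (is "_ = ?T")
  proof
    show "?T \<subseteq> ?S"
    proof clarify
      fix w assume w: "w \<in> W" "phi (fst ?z) w \<le> 1"
      then show "\<exists>v. snd ?z \<bullet> F (fst ?z) w = pairing A (fst y) (snd y) v \<and> v \<in> \<xi> (fst y) \<and> f (fst y) v \<le> 1"
        using pairing_vec[OF y w(1)] by (intro exI[of _ "vec ?x w"]) simp
    qed
    show "?S \<subseteq> ?T"
    proof clarify
      fix v assume v: "v \<in> \<xi> (fst y)" "f (fst y) v \<le> 1"
      then have "v \<in> \<xi> (pt ?x)" using M.chart_inv_eq[OF c y(2)] by simp
      then obtain w where w: "w \<in> W" "v = vec ?x w" using vec_surj[OF y(3)] by blast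
      then show "\<exists>w. pairing A (fst y) (snd y) v = snd ?z \<bullet> F (fst ?z) w \<and> w \<in> W \<and> phi (fst ?z) w \<le> 1"
        using pairing_vec[OF y w(1)] v by (intro exI[of _ w]) simp
    qed
  qed
  show "maximised_hamiltonian A \<xi> f y = maxPhi ?z" if ne: "sph \<noteq> {}"
    unfolding maximised_hamiltonian_def S
  proof (rule cSup_eq_maximum)
    obtain w where w: "w \<in> sph" "Phi ?z w = maxPhi ?z" using maxPhi_attained[OF z(1) ne] by blast
    have ph: "phi ?x w > 0" using phi_pos[OF y(3)] sph(1,2)[OF w(1)] by blast
    define r where "r = 1 / phi ?x w"
    have r: "r > 0" using ph by (simp add: r_def)
    have "phi ?x (r *\<^sub>R w) = 1" using phi_scale[OF y(3) sph(1)[OF w(1)] r] ph by (simp add: r_def)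
    moreover have "snd ?z \<bullet> F ?x (r *\<^sub>R w) = maxPhi ?z"
      using w(2) frame(4)[OF y(3)] z(2) by (simp add: Phi_def r_def linear_scale)
    moreover have "r *\<^sub>R w \<in> W" using sph(1)[OF w(1)] frame(3) by (simp add: subspace_mul)
    ultimately show "maxPhi ?z \<in> ?T" using z(2) by (intro CollectI exI[of _ "r *\<^sub>R w"]) simp
  next
    fix s assume "s \<in> ?T"
    then obtain w where w: "w \<in> W" "phi (fst ?z) w \<le> 1" "s = snd ?z \<bullet> F (fst ?z) w" by blast
    have "s \<le> maxPhi ?z * phi (fst ?z) w" using inner_le_maxPhi[OF z(1) w(1)] w(3) by simp
    also have "\<dots> \<le> maxPhi ?z * 1" using maxPhi_nonneg[OF z(1) ne] w(2) by (intro mult_left_mono) auto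
    finally show "s \<le> maxPhi ?z" by simp
  qed
  show "maximised_hamiltonian A \<xi> f y = 0" if e: "sph = {}"
  proof -
    have W0: "w = 0" if "w \<in> W" for w using sph_normalise[OF that] e by blast
    have 0: "0 \<in> W" using frame(3) by (rule subspace_0)
    have "?T = {0}"
    proof
      show "?T \<subseteq> {0}"
      proof clarify
        fix w assume "w \<in> W"
        then have "w = 0" by (rule W0)
        then show "snd ?z \<bullet> F (fst ?z) w = 0" using frame(4)[OF y(3)] z(2) by (simp add: linear_0)
      qed
      show "{0} \<subseteq> ?T" using 0 frame(4)[OF y(3)] z(2) phi_zero[OF y(3)] by (auto simp: linear_0 intro!: exI[of _ 0])
    qed
    then show ?thesis unfolding maximised_hamiltonian_def S by simp
  qed
qed

lemma pairing_le:
  assumes y: "y \<in> cotangent_bundle UNIV A" "fst y \<in> fst c" "snd c (fst y) \<in> \<Omega>" and v: "v \<in> \<xi> (fst y)"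
  shows "pairing A (fst y) (snd y) v \<le> maximised_hamiltonian A \<xi> f y * f (fst y) v" "0 \<le> maximised_hamiltonian A \<xi> f y"
proof -
  have z: "coords c y \<in> \<Omega> \<times> UNIV" using y by (auto simp: coords_def)
  have "v \<in> \<xi> (pt (snd c (fst y)))" using v M.chart_inv_eq[OF c y(2)] by simp
  then obtain w where w: "w \<in> W" "v = vec (snd c (fst y)) w" using vec_surj[OF y(3)] by blast
  note pv = pairing_vec[OF y w(1)]
  show "pairing A (fst y) (snd y) v \<le> maximised_hamiltonian A \<xi> f y * f (fst y) v"
  proof (cases "sph = {}")
    case True
    then have "w = 0" using sph_normalise[OF w(1)] by blast
    then show ?thesis using pv hamiltonian_properties(2)[OF y True] frame(4)[OF y(3)] w by (simp add: coords_def linear_0)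
  next
    case False
    then show ?thesis using pv inner_le_maxPhi[OF z w(1)] hamiltonian_properties(1)[OF y False] w by simp
  qed
  show "0 \<le> maximised_hamiltonian A \<xi> f y"
    using hamiltonian_properties[OF y] maxPhi_nonneg[OF z] by (cases "sph = {}") auto
qed

text \<open>Rescaling to length 1 with respect to \<open>f\<close> reduces this to
  \<open>maximiser_unique\<close>; as both points have Euclidean norm 1, the scaling factors agree
  too.\<close>

lemma Phi_maximiser_unique:
  assumes z: "z \<in> \<Omega> \<times> UNIV" and w: "w1 \<in> sph" "w2 \<in> sph" "Phi z w1 = maxPhi z" "Phi z w2 = maxPhi z" and pos: "maxPhi z > 0"
  shows "w1 = w2"
proof -
  have x: "fst z \<in> \<Omega>" using z by auto
  have n: "(1 / phi (fst z) w) *\<^sub>R w \<in> W \<and> phi (fst z) ((1 / phi (fst z) w) *\<^sub>R w) = 1 \<and>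
      snd z \<bullet> F (fst z) ((1 / phi (fst z) w) *\<^sub>R w) = maxPhi z \<and> phi (fst z) w > 0"
    if w: "w \<in> sph" "Phi z w = maxPhi z" for w
  proof -
    have ph: "phi (fst z) w > 0" using phi_pos[OF x] sph(1,2)[OF w(1)] by blast
    show ?thesis using ph w phi_scale[OF x sph(1)[OF w(1)], of "1 / phi (fst z) w"] sph(1)[OF w(1)] frame(3) frame(4)[OF x]
      by (simp add: subspace_mul linear_scale Phi_def)
  qed
  note n1 = n[OF w(1,3)] and n2 = n[OF w(2,4)]
  have "(1 / phi (fst z) w1) *\<^sub>R w1 = (1 / phi (fst z) w2) *\<^sub>R w2"
    by (rule maximiser_unique[OF x _ _ _ _ _ _ pos, where p = "snd z"]) (use n1 n2 inner_le_maxPhi[OF z] in auto)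
  moreover have nr: "norm ((1 / phi (fst z) w) *\<^sub>R w) = 1 / phi (fst z) w" if "w \<in> sph" "phi (fst z) w > 0" for w
    using that by (simp add: sph_def)
  ultimately have "1 / phi (fst z) w1 = 1 / phi (fst z) w2" using nr w n1 n2 by metis
  with \<open>(1 / phi (fst z) w1) *\<^sub>R w1 = (1 / phi (fst z) w2) *\<^sub>R w2\<close> n1 show ?thesis by simp
qed

lemma maximiser_vector:
  assumes y: "y \<in> cotangent_bundle UNIV A" "fst y \<in> fst c" "snd c (fst y) \<in> \<Omega>" and pos: "maximised_hamiltonian A \<xi> f y > 0"
  shows "\<exists>!v. v \<in> \<xi> (fst y) \<and> f (fst y) v = 1 \<and> pairing A (fst y) (snd y) v = maximised_hamiltonian A \<xi> f y"
proof -
  let ?x = "snd c (fst y)" and ?z = "coords c y"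
  have z: "?z \<in> \<Omega> \<times> UNIV" "fst ?z = ?x" using y by (auto simp: coords_def)
  have ne: "sph \<noteq> {}" using hamiltonian_properties(2)[OF y] pos by auto
  note H = hamiltonian_properties(1)[OF y ne]
  obtain w where w: "w \<in> sph" "Phi ?z w = maxPhi ?z" using maxPhi_attained[OF z(1) ne] by blast
  have ph: "phi ?x w > 0" using phi_pos[OF y(3)] sph(1,2)[OF w(1)] by blast
  define u where "u = (1 / phi ?x w) *\<^sub>R w"
  have u: "u \<in> W" "phi ?x u = 1" "snd ?z \<bullet> F ?x u = maxPhi ?z"
    using ph phi_scale[OF y(3) sph(1)[OF w(1)], of "1 / phi ?x w"] sph(1)[OF w(1)] frame(3) frame(4)[OF y(3)] w(2) z(2)
    by (simp_all add: u_def subspace_mul linear_scale Phi_def)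
  show ?thesis
  proof (rule ex1I[of _ "vec ?x u"])
    show "vec ?x u \<in> \<xi> (fst y) \<and> f (fst y) (vec ?x u) = 1 \<and> pairing A (fst y) (snd y) (vec ?x u) = maximised_hamiltonian A \<xi> f y"
      using pairing_vec[OF y u(1)] u z(2) H by simp
    fix v assume v: "v \<in> \<xi> (fst y) \<and> f (fst y) v = 1 \<and> pairing A (fst y) (snd y) v = maximised_hamiltonian A \<xi> f y"
    then have "v \<in> \<xi> (pt ?x)" using M.chart_inv_eq[OF c y(2)] by simp
    then obtain u' where u': "u' \<in> W" "v = vec ?x u'" using vec_surj[OF y(3)] by blast
    have "u' = u"
      by (rule maximiser_unique[OF y(3) u'(1) u(1) _ u(2) _ u(3)])
        (use pairing_vec[OF y u'(1)] u' v z H pos inner_le_maxPhi[OF z(1)] in auto)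
    then show "v = vec ?x u" using u' by simp
  qed
qed

lemma hamiltonian_continuous:
  assumes y: "y \<in> cotangent_bundle UNIV A" "fst y \<in> fst c" "snd c (fst y) \<in> \<Omega>" and "e > 0"
  shows "\<exists>d>0. \<forall>y'\<in>cotangent_bundle UNIV A. fst y' \<in> fst c \<and> dist (coords c y') (coords c y) < d \<longrightarrow>
     \<bar>maximised_hamiltonian A \<xi> f y' - maximised_hamiltonian A \<xi> f y\<bar> < e"
proof -
  obtain r where r: "r > 0" "ball (snd c (fst y)) r \<subseteq> \<Omega>" using frame(1) y(3) openE by blast
  have in\<Omega>: "snd c (fst y') \<in> \<Omega>" if "dist (coords c y') (coords c y) < r" for y'
  proof -
    have "dist (snd c (fst y')) (snd c (fst y)) \<le> dist (coords c y') (coords c y)"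
      using dist_fst_le[of "coords c y'" "coords c y"] by (simp add: coords_def)
    then show ?thesis using that r by (auto simp: dist_commute)
  qed
  have z: "coords c y \<in> \<Omega> \<times> UNIV" using y by (auto simp: coords_def)
  show ?thesis
  proof (cases "sph = {}")
    case True
    then have "maximised_hamiltonian A \<xi> f y' = 0" if "y' \<in> cotangent_bundle UNIV A" "fst y' \<in> fst c" "dist (coords c y') (coords c y) < r" for y'
      using hamiltonian_properties(2)[OF that(1,2) in\<Omega>[OF that(3)]] by blast
    then show ?thesis using r(1) \<open>e > 0\<close> hamiltonian_properties(2)[OF y True] by (intro exI[of _ r]) auto
  next
    case False
    obtain d where d: "d > 0" "\<forall>z\<in>\<Omega> \<times> UNIV. dist z (coords c y) < d \<longrightarrow> \<bar>maxPhi z - maxPhi (coords c y)\<bar> < e"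
      using maximum_continuous[OF Phi_continuous sph(3) False z \<open>e > 0\<close>] unfolding maxPhi_def by blast
    show ?thesis
    proof (intro exI[of _ "min r d"] conjI ballI impI)
      show "0 < min r d" using r d by simp
      fix y' assume y': "y' \<in> cotangent_bundle UNIV A" "fst y' \<in> fst c \<and> dist (coords c y') (coords c y) < min r d"
      then have "snd c (fst y') \<in> \<Omega>" using in\<Omega> by simp
      moreover from this have "coords c y' \<in> \<Omega> \<times> UNIV" by (auto simp: coords_def)
      then have "\<bar>maxPhi (coords c y') - maxPhi (coords c y)\<bar> < e" by (rule d(2)[rule_format]) (use y' in simp)
      ultimately show "\<bar>maximised_hamiltonian A \<xi> f y' - maximised_hamiltonian A \<xi> f y\<bar> < e"
        using hamiltonian_properties(1)[OF y'(1) _ _ False] hamiltonian_properties(1)[OF y False] y'(2) by simp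
    qed
  qed
qed

lemma hamiltonian_in_chart:
  assumes z: "z \<in> \<Omega> \<times> UNIV" and ne: "sph \<noteq> {}"
  shows "maximised_hamiltonian A \<xi> f (inv_into {z \<in> cotangent_bundle UNIV A. fst z \<in> fst c} (coords c) z) = maxPhi z"
proof -
  have x: "fst z \<in> \<Omega>" using z by auto
  obtain p where p: "(pt (fst z), p) \<in> cotangent_bundle UNIV A" "coords c (pt (fst z), p) = (snd c (pt (fst z)), snd z)"
    "inv_into {z \<in> cotangent_bundle UNIV A. fst z \<in> fst c} (coords c) (snd c (pt (fst z)), snd z) = (pt (fst z), p)"
    using M.lift_exists[OF c pt(1)[OF x]] by blast
  then show ?thesis using hamiltonian_properties(1)[OF p(1) _ _ ne] pt[OF x] x by simp
qed

text \<open>Where the Hamiltonian is positive its maximiser is unique, so Danskin's theorem gives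
  its gradient as the gradient of \<open>Phi\<close> at the maximiser. The maximiser depends
  continuously on the covector, hence so does the gradient.\<close>

lemma hamiltonian_vector_continuous:
  assumes y: "y \<in> cotangent_bundle UNIV A" "fst y \<in> fst c" "snd c (fst y) \<in> \<Omega>" and pos: "maximised_hamiltonian A \<xi> f y > 0"
  shows "\<exists>w. hamiltonian_vector UNIV A (maximised_hamiltonian A \<xi> f) c y w \<and>
    (\<forall>e>0. \<exists>d>0. \<forall>y'\<in>cotangent_bundle UNIV A. fst y' \<in> fst c \<and> dist (coords c y') (coords c y) < d \<and> maximised_hamiltonian A \<xi> f y' > 0 \<longrightarrow>
      (\<forall>w'. hamiltonian_vector UNIV A (maximised_hamiltonian A \<xi> f) c y' w' \<longrightarrow> dist w' w < e))"
proof -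
  let ?H = "maximised_hamiltonian A \<xi> f"
  obtain D where D: "\<And>z w. z \<in> \<Omega> \<times> UNIV \<Longrightarrow> w \<in> sph \<Longrightarrow> ((\<lambda>z. Phi z w) has_derivative (\<lambda>h. D z w \<bullet> h)) (at z)"
    "continuous_on ((\<Omega> \<times> UNIV) \<times> sph) (\<lambda>(z, w). D z w)"
    using Phi_gradient by metis
  have ne: "sph \<noteq> {}" using hamiltonian_properties(2)[OF y] pos by auto
  have op: "open (\<Omega> \<times> (UNIV :: 'e set))" using frame(1) by (intro open_Times) auto
  have uniq: "Phi z w' < Phi z w" if "z \<in> \<Omega> \<times> UNIV" "maxPhi z > 0" "w \<in> sph" "Phi z w = maxPhi z" "w' \<in> sph" "w' \<noteq> w" for z w w'
    using Phi_le[OF that(1,5)] Phi_maximiser_unique[OF that(1,5,3) _ that(4,2)] that(4,6) by fastforce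
  \<comment> \<open>Symplectic rotation of the gradient: the fibre part becomes the base velocity,
    minus the base part the velocity of the covector.\<close>
  have hv: "hamiltonian_vector UNIV A ?H c y' (snd (D (coords c y') w), - fst (D (coords c y') w))"
    if y': "coords c y' \<in> \<Omega> \<times> UNIV" "maxPhi (coords c y') > 0" "w \<in> sph" "Phi (coords c y') w = maxPhi (coords c y')" for y' w
  proof -
    have "((\<lambda>z. SUP w\<in>sph. Phi z w) has_derivative (\<lambda>h. D (coords c y') w \<bullet> h)) (at (coords c y'))"
      by (rule has_derivative_maximum[OF op sph(3) y'(3) y'(1) Phi_continuous D(2) D(1) uniq[OF y'(1,2,3,4)]])
    then have "(maxPhi has_derivative (\<lambda>h. D (coords c y') w \<bullet> h)) (at (coords c y'))"
      by (simp add: maxPhi_def[abs_def])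
    then have "((\<lambda>z. ?H (inv_into {z \<in> cotangent_bundle UNIV A. fst z \<in> fst c} (coords c) z)) has_derivative (\<lambda>h. D (coords c y') w \<bullet> h)) (at (coords c y'))"
      by (rule has_derivative_transform_within_open[OF _ op y'(1)]) (simp add: hamiltonian_in_chart[OF _ ne])
    moreover have "(\<lambda>h. D (coords c y') w \<bullet> h) = (\<lambda>(h, k). fst (snd (D (coords c y') w), - fst (D (coords c y') w)) \<bullet> k - snd (snd (D (coords c y') w), - fst (D (coords c y') w)) \<bullet> h)"
      by (simp add: fun_eq_iff inner_prod_def add.commute)
    ultimately show ?thesis unfolding hamiltonian_vector_def by simp
  qed
  have z: "coords c y \<in> \<Omega> \<times> UNIV" using y by (auto simp: coords_def)
  have pz: "maxPhi (coords c y) > 0" using pos hamiltonian_properties(1)[OF y ne] by simp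
  obtain w0 where w0: "w0 \<in> sph" "Phi (coords c y) w0 = maxPhi (coords c y)" using maxPhi_attained[OF z ne] by blast
  obtain r where r: "r > 0" "ball (snd c (fst y)) r \<subseteq> \<Omega>" using frame(1) y(3) openE by blast
  show ?thesis
  proof (intro exI[of _ "(snd (D (coords c y) w0), - fst (D (coords c y) w0))"] conjI allI impI)
    show "hamiltonian_vector UNIV A ?H c y (snd (D (coords c y) w0), - fst (D (coords c y) w0))"
      by (rule hv[OF z pz w0])
    fix e :: real assume e: "e > 0"
    have zw: "(coords c y, w0) \<in> (\<Omega> \<times> UNIV) \<times> sph" using z w0 by simp
    obtain d1 where d1: "d1 > 0" "\<forall>x\<in>(\<Omega> \<times> UNIV) \<times> sph. dist x (coords c y, w0) < d1 \<longrightarrow> dist ((\<lambda>(z, w). D z w) x) ((\<lambda>(z, w). D z w) (coords c y, w0)) < e"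
      using D(2) zw e unfolding continuous_on_iff by meson
    have d12: "d1 / 2 > 0" using d1 by simp
    obtain d2 where d2: "d2 > 0" "\<forall>z\<in>\<Omega> \<times> UNIV. dist z (coords c y) < d2 \<longrightarrow> (\<forall>w\<in>sph. (\<forall>w'\<in>sph. Phi z w' \<le> Phi z w) \<longrightarrow> dist w w0 < d1/2)"
      using maximiser_continuous[OF Phi_continuous sph(3) w0(1) z uniq[OF z pz w0] d12] by blast
    show "\<exists>d>0. \<forall>y'\<in>cotangent_bundle UNIV A. fst y' \<in> fst c \<and> dist (coords c y') (coords c y) < d \<and> ?H y' > 0 \<longrightarrow>
      (\<forall>w'. hamiltonian_vector UNIV A ?H c y' w' \<longrightarrow> dist w' (snd (D (coords c y) w0), - fst (D (coords c y) w0)) < e)"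
    proof (intro exI[of _ "min r (min d2 (d1/2))"] conjI ballI impI allI)
      show "0 < min r (min d2 (d1/2))" using r d1 d2 by simp
      fix y' w' assume y': "y' \<in> cotangent_bundle UNIV A" "fst y' \<in> fst c \<and> dist (coords c y') (coords c y) < min r (min d2 (d1/2)) \<and> ?H y' > 0"
        and w': "hamiltonian_vector UNIV A ?H c y' w'"
      have "dist (snd c (fst y')) (snd c (fst y)) \<le> dist (coords c y') (coords c y)"
        using dist_fst_le[of "coords c y'" "coords c y"] by (simp add: coords_def)
      then have x': "snd c (fst y') \<in> \<Omega>" using y' r by (auto simp: dist_commute)
      then have z': "coords c y' \<in> \<Omega> \<times> UNIV" by (auto simp: coords_def)
      have pz': "maxPhi (coords c y') > 0" using y' hamiltonian_properties(1)[OF y'(1) _ x' ne] by simp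
      obtain w1 where w1: "w1 \<in> sph" "Phi (coords c y') w1 = maxPhi (coords c y')" using maxPhi_attained[OF z' ne] by blast
      have eq: "w' = (snd (D (coords c y') w1), - fst (D (coords c y') w1))"
        using M.hamiltonian_vector_unique[OF y'(1) c _ w' hv[OF z' pz' w1]] y' by blast
      have "dist w1 w0 < d1/2"
        using d2(2) z' y'(2) w1 Phi_le[OF z'] by auto
      moreover have "dist (coords c y', w1) (coords c y, w0) \<le> dist (coords c y') (coords c y) + dist w1 w0"
        unfolding dist_Pair_Pair by (rule sqrt_sum_squares_le_sum) auto
      ultimately have "dist (coords c y', w1) (coords c y, w0) < d1" using y'(2) by simp
      then have D': "dist (D (coords c y') w1) (D (coords c y) w0) < e" using d1(2) z' w1(1) by auto
      have "dist w' (snd (D (coords c y) w0), - fst (D (coords c y) w0)) = dist (D (coords c y') w1) (D (coords c y) w0)"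
        unfolding eq by (simp add: dist_prod_def dist_minus add.commute)
      then show "dist w' (snd (D (coords c y) w0), - fst (D (coords c y) w0)) < e" using D' by simp
    qed
  qed
qed

end

section \<open>Local estimates for the distribution\<close>

lemma isCont_tendsto_nhds: "isCont g x \<Longrightarrow> (g \<longlongrightarrow> g x) (nhds x)"
  unfolding continuous_at using tendsto_at_iff_tendsto_nhds[of g x] by blast

context finsler_frame
begin

text \<open>The quotient of the Euclidean length by \<open>f\<close> is invariant under scaling and
  continuous on the compact product of a ball and the sphere. This gives curves of unit speed a
  common local Lipschitz constant in a chart.\<close>

lemma vector_bound:
  assumes q: "q0 \<in> fst c" "snd c q0 \<in> \<Omega>"
  shows "\<exists>C\<ge>0. \<exists>d>0. \<forall>q\<in>fst c. dist (snd c q) (snd c q0) < d \<longrightarrow> (\<forall>v\<in>\<xi> q. norm (v c) \<le> C * f q v)"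
proof -
  obtain r where r: "r > 0" "cball (snd c q0) r \<subseteq> \<Omega>" using frame(1) q(2) open_contains_cball by blast
  let ?K = "cball (snd c q0) r \<times> sph"
  obtain DF where DF: "continuous_on (\<Omega> \<times> W) (\<lambda>(x, w). F x w)" using F_derivative by metis
  obtain P where P: "continuous_on (\<Omega> \<times> (W - {0})) (\<lambda>(x, w). phi x w)" using phi_derivative by metis
  have sub: "?K \<subseteq> \<Omega> \<times> W" "?K \<subseteq> \<Omega> \<times> (W - {0})" using r sph(1,2) by auto
  have nz: "phi (fst y) (snd y) \<noteq> 0" if "y \<in> ?K" for y
    using phi_pos[of "fst y" "snd y"] sph(1,2)[of "snd y"] that r by fastforce
  have c1: "continuous_on ?K (\<lambda>y. F (fst y) (snd y))"
    using continuous_on_subset[OF DF sub(1)] by (simp add: case_prod_beta)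
  have c2: "continuous_on ?K (\<lambda>y. phi (fst y) (snd y))"
    using continuous_on_subset[OF P sub(2)] by (simp add: case_prod_beta)
  have "continuous_on ?K (\<lambda>y. norm (F (fst y) (snd y)) / phi (fst y) (snd y))"
    using nz by (intro continuous_intros c1 c2) auto
  moreover have "compact ?K" by (intro compact_Times compact_cball sph(3))
  ultimately have "bounded ((\<lambda>y. norm (F (fst y) (snd y)) / phi (fst y) (snd y)) ` ?K)"
    using compact_continuous_image compact_imp_bounded by blast
  then obtain C where C: "\<forall>s\<in>(\<lambda>y. norm (F (fst y) (snd y)) / phi (fst y) (snd y)) ` ?K. norm s \<le> C"
    unfolding bounded_iff by blast
  have main: "norm (v c) \<le> max C 0 * f q v" if qq: "q \<in> fst c" "dist (snd c q) (snd c q0) < r" and v: "v \<in> \<xi> q" for q v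
  proof -
    let ?x = "snd c q"
    have x: "?x \<in> \<Omega>" "?x \<in> cball (snd c q0) r" using qq r by (auto simp: dist_commute)
    have ptx: "pt ?x = q" by (rule M.chart_inv_eq[OF c qq(1)])
    obtain w where w: "w \<in> W" "v = vec ?x w" using vec_surj[OF x(1)] v ptx by metis
    have vc: "v c = F ?x w" "f q v = phi ?x w" using vec(2)[OF x(1) w(1)] w ptx by (auto simp: phi_def)
    show ?thesis
    proof (cases "w = 0")
      case True
      then show ?thesis using vc frame(4)[OF x(1)] phi_zero[OF x(1)] by (simp add: linear_0)
    next
      case False
      let ?u = "(1 / norm w) *\<^sub>R w"
      have u: "?u \<in> sph" by (rule sph_normalise[OF w(1) False])
      have "norm (norm (F ?x ?u) / phi ?x ?u) \<le> C" using C x u by auto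
      moreover have "norm (F ?x ?u) / phi ?x ?u = norm (F ?x w) / phi ?x w"
        using phi_scale[OF x(1) w(1), of "1 / norm w"] False frame(4)[OF x(1)] by (simp add: linear_scale)
      ultimately have "norm (F ?x w) / phi ?x w \<le> max C 0" using phi_pos[OF x(1) w(1) False] by auto
      then show ?thesis using vc phi_pos[OF x(1) w(1) False] by (simp add: pos_divide_le_eq)
    qed
  qed
  show ?thesis
    by (intro exI[of _ "max C 0"] exI[of _ r] conjI ballI impI) (use r main in auto)
qed

text \<open>\<open>v0\<close> is extended with constant frame coordinates and corrected by the
  multiple \<beta> of the transverse section that cancels the component along \<open>n\<close>. As
  \<beta> vanishes at the given point, the value \<open>v0\<close> is kept. The resulting section is
  the competitor that bounds the boundary Hamiltonian from below near a regular point.\<close>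

lemma transverse_correction:
  assumes q: "q0 \<in> fst c" "snd c q0 \<in> \<Omega>"
    and v0: "v0 \<in> \<xi> q0" "v0 \<noteq> (\<lambda>d. 0)" "v0 c \<bullet> n = 0" and e: "e \<in> \<xi> q0" "e c \<bullet> n \<noteq> 0"
  shows "\<exists>Y \<psi> d. d > 0 \<and> Y differentiable (at (snd c q0)) \<and> \<psi> differentiable (at (snd c q0)) \<and>
    Y (snd c q0) = v0 c \<and> \<psi> (snd c q0) = f q0 v0 \<and>
    (\<forall>q\<in>fst c. dist (snd c q) (snd c q0) < d \<longrightarrow> \<psi> (snd c q) > 0 \<and>
      (\<exists>v\<in>\<xi> q. v c = Y (snd c q) \<and> f q v = \<psi> (snd c q) \<and> v c \<bullet> n = 0))"
proof -
  let ?x = "snd c q0"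
  have ptx: "pt ?x = q0" by (rule M.chart_inv_eq[OF c q(1)])
  obtain w0 where w0: "w0 \<in> W" "v0 = vec ?x w0" using vec_surj[OF q(2)] v0 ptx by metis
  obtain w1 where w1: "w1 \<in> W" "e = vec ?x w1" using vec_surj[OF q(2)] e ptx by metis
  have w00: "w0 \<noteq> 0" using v0(2) w0 vec_zero[OF q(2)] by auto
  have F0: "F ?x w0 \<bullet> n = 0" "F ?x w1 \<bullet> n \<noteq> 0" using v0 e vec(2)[OF q(2) w0(1)] vec(2)[OF q(2) w1(1)] w0 w1 by auto
  obtain DF where DF: "\<And>x w. x \<in> \<Omega> \<Longrightarrow> w \<in> W \<Longrightarrow> ((\<lambda>x. F x w) has_derivative DF x w) (at x)" using F_derivative by metis
  define \<beta> where "\<beta> x = (F x w0 \<bullet> n) / (F x w1 \<bullet> n)" for x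
  have Fd: "(\<lambda>x. F x w0) differentiable (at ?x)" "(\<lambda>x. F x w1) differentiable (at ?x)"
    using DF[OF q(2) w0(1)] DF[OF q(2) w1(1)] unfolding differentiable_def by blast+
  have ind: "(\<lambda>x. F x w \<bullet> n) differentiable (at ?x)" if "w \<in> W" for w
    using has_derivative_inner_left[OF DF[OF q(2) that]] unfolding differentiable_def by blast
  have \<beta>d: "\<beta> differentiable (at ?x)" unfolding \<beta>_def[abs_def]
    by (intro differentiable_divide ind w0 w1 F0)
  have \<beta>0: "\<beta> ?x = 0" using F0 by (simp add: \<beta>_def)
  define u where "u x = w0 - \<beta> x *\<^sub>R w1" for x
  have ud: "u differentiable (at ?x)" unfolding u_def[abs_def]
    by (intro differentiable_diff differentiable_const differentiable_scaleR \<beta>d)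
  have u0: "u ?x = w0" by (simp add: u_def \<beta>0)
  have uW: "u x \<in> W" for x using w0 w1 frame(3) by (simp add: u_def subspace_diff subspace_mul)
  have "\<forall>\<^sub>F x in nhds ?x. u x \<noteq> 0"
    by (rule tendsto_imp_eventually_ne[OF isCont_tendsto_nhds[OF differentiable_imp_continuous_within[OF ud]]])
      (use u0 w00 in simp)
  moreover have "\<forall>\<^sub>F x in nhds ?x. F x w1 \<bullet> n \<noteq> 0"
    by (rule tendsto_imp_eventually_ne[OF isCont_tendsto_nhds[OF differentiable_imp_continuous_within[OF ind[OF w1(1)]]]])
      (use F0 in simp)
  moreover have "\<forall>\<^sub>F x in nhds ?x. x \<in> \<Omega>" using frame(1) q(2) by (rule eventually_nhds_in_open)
  ultimately have "\<forall>\<^sub>F x in nhds ?x. u x \<noteq> 0 \<and> F x w1 \<bullet> n \<noteq> 0 \<and> x \<in> \<Omega>"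
    by (intro eventually_conj)
  then obtain d where d: "d > 0" "\<And>x. dist x ?x < d \<Longrightarrow> u x \<noteq> 0 \<and> F x w1 \<bullet> n \<noteq> 0 \<and> x \<in> \<Omega>"
    unfolding eventually_nhds_metric by blast
  obtain D where D: "\<And>x w. x \<in> \<Omega> \<Longrightarrow> w \<in> W - {0} \<Longrightarrow> ((\<lambda>(x, w). phi x w) has_derivative D (x, w)) (at (x, w) within \<Omega> \<times> (W - {0}))"
    using phi_total_derivative by metis
  define Y where "Y x = F x w0 - \<beta> x *\<^sub>R F x w1" for x
  define \<psi> where "\<psi> x = phi x (u x)" for x
  have Yd: "Y differentiable (at ?x)" unfolding Y_def[abs_def]
    by (intro differentiable_diff differentiable_scaleR Fd \<beta>d)
  have \<psi>d: "\<psi> differentiable (at ?x)"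
  proof -
    obtain u' where u': "(u has_derivative u') (at ?x)" using ud unfolding differentiable_def by blast
    have 1: "((\<lambda>x. (x, u x)) has_derivative (\<lambda>h. (h, u' h))) (at ?x within ball ?x d)"
      by (intro has_derivative_Pair has_derivative_ident has_derivative_at_withinI[OF u'])
    have "((\<lambda>(x, w). phi x w) has_derivative D (?x, w0)) (at (?x, w0) within \<Omega> \<times> (W - {0}))"
      using D q(2) w0 w00 by blast
    then have 2: "((\<lambda>(x, w). phi x w) has_derivative D (?x, w0)) (at (?x, u ?x) within (\<lambda>x. (x, u x)) ` ball ?x d)"
      unfolding u0 by (rule has_derivative_subset) (use d uW in \<open>auto simp: dist_commute\<close>)
    have "(\<psi> has_derivative (\<lambda>h. D (?x, w0) (h, u' h))) (at ?x within ball ?x d)"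
      using has_derivative_in_compose[OF 1 2] by (simp add: \<psi>_def[abs_def])
    then have "(\<psi> has_derivative (\<lambda>h. D (?x, w0) (h, u' h))) (at ?x)"
      using at_within_open[of ?x "ball ?x d"] d(1) by simp
    then show ?thesis unfolding differentiable_def by blast
  qed
  have sec: "\<psi> (snd c q) > 0 \<and> (\<exists>v\<in>\<xi> q. v c = Y (snd c q) \<and> f q v = \<psi> (snd c q) \<and> v c \<bullet> n = 0)"
    if qq: "q \<in> fst c" "dist (snd c q) ?x < d" for q
  proof -
    note dq = d(2)[OF qq(2)]
    have pq: "pt (snd c q) = q" by (rule M.chart_inv_eq[OF c qq(1)])
    have vc: "vec (snd c q) (u (snd c q)) c = Y (snd c q)"
      using vec(2)[of "snd c q", OF _ uW] dq frame(4)[of "snd c q"] by (simp add: Y_def u_def linear_diff linear_scale)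
    have "Y (snd c q) \<bullet> n = 0" using dq by (simp add: Y_def \<beta>_def inner_diff_left)
    then show ?thesis
      using vec(1)[of "snd c q", OF _ uW] dq pq vc phi_pos[of "snd c q", OF _ uW]
      by (auto simp: \<psi>_def phi_def intro!: bexI[of _ "vec (snd c q) (u (snd c q))"])
  qed
  have "Y ?x = v0 c" using vec(2)[OF q(2) w0(1)] w0 \<beta>0 by (simp add: Y_def)
  moreover have "\<psi> ?x = f q0 v0" using u0 w0 ptx by (simp add: \<psi>_def phi_def)
  ultimately show ?thesis using d(1) Yd \<psi>d sec by blast
qed

text \<open>A functional with trivial kernel on the fibre over \<open>q0\<close> makes this fibre a
  line, hence also the model space \<open>W\<close> and with it every nearby fibre. \<open>E\<close>
  is a section with constant frame coordinates.\<close>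

lemma rank_one_frame:
  assumes q: "q0 \<in> fst c" "snd c q0 \<in> \<Omega>" and e: "e \<in> \<xi> q0" "e c \<bullet> n \<noteq> 0"
    and zero: "\<And>v. v \<in> \<xi> q0 \<Longrightarrow> v c \<bullet> n = 0 \<Longrightarrow> v = (\<lambda>d. 0)"
  shows "\<exists>E C1 C2 d. d > 0 \<and> 0 < C1 \<and> E (snd c q0) = e c \<and> continuous_on (ball (snd c q0) d) E \<and>
    (\<forall>q\<in>fst c. dist (snd c q) (snd c q0) < d \<longrightarrow>
      (\<forall>v\<in>\<xi> q. f q v = 1 \<longrightarrow> (\<exists>r. v c = r *\<^sub>R E (snd c q) \<and> C1 \<le> \<bar>r\<bar> \<and> \<bar>r\<bar> \<le> C2)))"
proof -
  let ?x = "snd c q0"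
  have ptx: "pt ?x = q0" by (rule M.chart_inv_eq[OF c q(1)])
  obtain w1 where w1: "w1 \<in> W" "e = vec ?x w1" using vec_surj[OF q(2)] e ptx by metis
  have w1n: "w1 \<noteq> 0" using vec(2)[OF q(2) w1(1)] e(2) w1(2) frame(4)[OF q(2)] by (auto simp: linear_0)
  have m1: "- w1 \<in> W" "- w1 \<noteq> 0" using w1 w1n frame(3) by (auto simp: subspace_neg)
  have F1: "F ?x w1 \<bullet> n \<noteq> 0" using e vec(2)[OF q(2) w1(1)] w1 by auto
  have line: "\<exists>r. w = r *\<^sub>R w1" if w: "w \<in> W" for w
  proof -
    define t where "t = (F ?x w \<bullet> n) / (F ?x w1 \<bullet> n)"
    have W': "w - t *\<^sub>R w1 \<in> W" using w w1 frame(3) by (simp add: subspace_diff subspace_mul)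
    have "vec ?x (w - t *\<^sub>R w1) c \<bullet> n = 0"
      using vec(2)[OF q(2) W'] frame(4)[OF q(2)] F1 by (simp add: linear_diff linear_scale t_def inner_diff_left)
    then have "vec ?x (w - t *\<^sub>R w1) = (\<lambda>d. 0)" using zero vec(1)[OF q(2) W'] ptx by simp
    then have "w - t *\<^sub>R w1 = 0" by (rule vec_eq_zero[OF q(2) W'])
    then show ?thesis by (intro exI[of _ t]) simp
  qed
  obtain DF where DF: "continuous_on (\<Omega> \<times> W) (\<lambda>(x, w). F x w)" using F_derivative by metis
  obtain P where P: "continuous_on (\<Omega> \<times> (W - {0})) (\<lambda>(x, w). phi x w)" using phi_derivative by metis
  have Ec: "continuous_on \<Omega> (\<lambda>x. F x w1)"
  proof -
    have "continuous_on \<Omega> (\<lambda>x. (\<lambda>(x, w). F x w) (x, w1))"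
      by (rule continuous_on_compose2[OF DF]) (use w1 in \<open>auto intro!: continuous_intros\<close>)
    then show ?thesis by simp
  qed
  have pc: "continuous_on \<Omega> (\<lambda>x. phi x w)" if "w \<in> W" "w \<noteq> 0" for w
  proof -
    have "continuous_on \<Omega> (\<lambda>x. (\<lambda>(x, w). phi x w) (x, w))"
      by (rule continuous_on_compose2[OF P]) (use that in \<open>auto intro!: continuous_intros\<close>)
    then show ?thesis by simp
  qed
  have bound: "\<exists>d>0. \<forall>x. dist x ?x < d \<longrightarrow> x \<in> \<Omega> \<and> phi ?x w / 2 < phi x w \<and> phi x w < 2 * phi ?x w" if "w \<in> W" "w \<noteq> 0" for w
  proof -
    have pos: "phi ?x w > 0" by (rule phi_pos[OF q(2) that])
    have lim: "((\<lambda>x. phi x w) \<longlongrightarrow> phi ?x w) (nhds ?x)"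
    proof -
      have "isCont (\<lambda>x. phi x w) ?x" using continuous_on_interior[OF pc[OF that]] frame(1) q(2) by (simp add: interior_open)
      then show ?thesis by (rule isCont_tendsto_nhds)
    qed
    have "\<forall>\<^sub>F x in nhds ?x. phi ?x w / 2 < phi x w" by (rule order_tendstoD(1)[OF lim]) (use pos in simp)
    moreover have "\<forall>\<^sub>F x in nhds ?x. phi x w < 2 * phi ?x w" by (rule order_tendstoD(2)[OF lim]) (use pos in simp)
    moreover have "\<forall>\<^sub>F x in nhds ?x. x \<in> \<Omega>" using frame(1) q(2) by (rule eventually_nhds_in_open)
    ultimately have "\<forall>\<^sub>F x in nhds ?x. x \<in> \<Omega> \<and> phi ?x w / 2 < phi x w \<and> phi x w < 2 * phi ?x w"
      by eventually_elim simp
    then show ?thesis unfolding eventually_nhds_metric .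
  qed
  obtain d1 where d1: "d1 > 0" "\<And>x. dist x ?x < d1 \<Longrightarrow> x \<in> \<Omega> \<and> phi ?x w1 / 2 < phi x w1 \<and> phi x w1 < 2 * phi ?x w1"
    using bound[OF w1(1) w1n] by blast
  obtain d2 where d2: "d2 > 0" "\<And>x. dist x ?x < d2 \<Longrightarrow> x \<in> \<Omega> \<and> phi ?x (- w1) / 2 < phi x (- w1) \<and> phi x (- w1) < 2 * phi ?x (- w1)"
    using bound[OF m1] by blast
  let ?a = "phi ?x w1" and ?b = "phi ?x (- w1)"
  have ab: "?a > 0" "?b > 0" using phi_pos[OF q(2)] w1 w1n m1 by auto
  \<comment> \<open>Near the point \<open>phi\<close> changes by less than a factor 2, so a factor
    \<open>r\<close> with \<open>r * phi = 1\<close> lies between half and twice its value at the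
    point. The two directions of the line have separate lengths, as the norm may be
    asymmetric.\<close>
  define C1 where "C1 = min (1 / (2 * ?a)) (1 / (2 * ?b))"
  define C2 where "C2 = max (2 / ?a) (2 / ?b)"
  have est: "1 / (2 * a) \<le> r \<and> r \<le> 2 / a" if "a > 0" "r > 0" "a / 2 < p" "p < 2 * a" "r * p = 1" for a r p :: real
  proof -
    have p: "p > 0" using that by linarith
    then have r: "r = 1 / p" using that by (simp add: field_simps)
    have "1 / (2 * a) \<le> 1 / p" using that p by (intro divide_left_mono) auto
    moreover have "1 / p \<le> 1 / (a / 2)" using that p by (intro divide_left_mono) auto
    ultimately show ?thesis using r by simp
  qed
  have main: "\<exists>r. v c = r *\<^sub>R F (snd c q) w1 \<and> C1 \<le> \<bar>r\<bar> \<and> \<bar>r\<bar> \<le> C2"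
    if qq: "q \<in> fst c" "dist (snd c q) ?x < min d1 d2" and v: "v \<in> \<xi> q" "f q v = 1" for q v
  proof -
    let ?y = "snd c q"
    have y: "?y \<in> \<Omega>" using d1 qq by simp
    have pq: "pt ?y = q" by (rule M.chart_inv_eq[OF c qq(1)])
    obtain w where w: "w \<in> W" "v = vec ?y w" using vec_surj[OF y] v pq by metis
    obtain r where r: "w = r *\<^sub>R w1" using line[OF w(1)] by blast
    have vc: "v c = r *\<^sub>R F ?y w1" using vec(2)[OF y w(1)] w r frame(4)[OF y] by (simp add: linear_scale)
    have ph: "phi ?y (r *\<^sub>R w1) = 1" using v w r pq by (simp add: phi_def)
    have "r \<noteq> 0" using ph phi_zero[OF y] by auto
    then consider "r > 0" | "r < 0" by linarith
    then show ?thesis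
    proof cases
      case 1
      then have "r * phi ?y w1 = 1" using ph phi_scale[OF y w1(1)] by simp
      then have "1 / (2 * ?a) \<le> r \<and> r \<le> 2 / ?a"
        by (rule est[OF ab(1) 1, rotated 2]) (use d1(2)[of ?y] qq in auto)
      then show ?thesis using vc 1 by (intro exI[of _ r]) (auto simp: C1_def C2_def min_def max_def)
    next
      case 2
      have "phi ?y ((- r) *\<^sub>R (- w1)) = (- r) * phi ?y (- w1)" by (rule phi_scale[OF y m1(1)]) (use 2 in simp)
      then have rp: "(- r) * phi ?y (- w1) = 1" using ph by simp
      have b: "?b / 2 < phi ?y (- w1)" "phi ?y (- w1) < 2 * ?b" "- r > 0" using 2 d2(2)[of ?y] qq by simp_all
      have "1 / (2 * ?b) \<le> - r \<and> - r \<le> 2 / ?b" by (rule est[OF ab(2) b(3,1,2) rp])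
      then show ?thesis using vc 2 by (intro exI[of _ r]) (auto simp: C1_def C2_def min_def max_def)
    qed
  qed
  show ?thesis
  proof (rule exI[of _ "\<lambda>x. F x w1"], rule exI[of _ C1], rule exI[of _ C2], rule exI[of _ "min d1 d2"], intro conjI ballI impI)
    show "min d1 d2 > 0" using d1 d2 by simp
    show "0 < C1" using ab by (simp add: C1_def)
    show "F ?x w1 = e c" using vec(2)[OF q(2) w1(1)] w1 by simp
    show "continuous_on (ball ?x (min d1 d2)) (\<lambda>x. F x w1)"
      by (rule continuous_on_subset[OF Ec]) (use d1 in \<open>auto simp: dist_commute\<close>)
  qed (use main in auto)
qed

end

section \<open>The maximised Hamiltonian\<close>

context sub_finsler
begin

abbreviation H :: "('a, 'e) cotangent \<Rightarrow> real" where "H \<equiv> maximised_hamiltonian A \<xi> f"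

lemma frame_exists:
  assumes "c \<in> A" "q \<in> fst c"
  obtains \<Omega> W F where "finsler_frame A \<xi> f c \<Omega> W F" "snd c q \<in> \<Omega>"
proof -
  obtain \<Omega> W F where *: "snd c q \<in> \<Omega>" "trivialises \<xi> c \<Omega> W F"
    using sf(2) assms unfolding smooth_distribution_def by blast
  have "finsler_frame A \<xi> f c \<Omega> W F" by unfold_locales (use assms * in auto)
  then show ?thesis using that * by blast
qed

lemma
  assumes z: "z \<in> cotangent_bundle UNIV A"
  shows H_pairing_le: "v \<in> \<xi> (fst z) \<Longrightarrow> pairing A (fst z) (snd z) v \<le> H z * f (fst z) v" and H_nonneg: "0 \<le> H z"
proof -
  obtain c where ch: "c \<in> A" "fst z \<in> fst c" using chart_exists by blast
  obtain \<Omega> W F where *: "finsler_frame A \<xi> f c \<Omega> W F" "snd c (fst z) \<in> \<Omega>" using frame_exists[OF ch] by blast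
  interpret finsler_frame A \<xi> f c \<Omega> W F by fact
  show "v \<in> \<xi> (fst z) \<Longrightarrow> pairing A (fst z) (snd z) v \<le> H z * f (fst z) v"
    by (rule pairing_le(1)[OF z ch(2) *(2)])
  obtain w where "w \<in> W" using frame(3) subspace_0 by blast
  then show "0 \<le> H z" using pairing_le(2)[OF z ch(2) *(2)] pairing_vec(2)[OF z ch(2) *(2)] by blast
qed

lemma H_maximiser:
  assumes z: "z \<in> cotangent_bundle UNIV A" and "H z > 0"
  shows "\<exists>!v. v \<in> \<xi> (fst z) \<and> f (fst z) v = 1 \<and> pairing A (fst z) (snd z) v = H z"
proof -
  obtain c where ch: "c \<in> A" "fst z \<in> fst c" using chart_exists by blast
  obtain \<Omega> W F where *: "finsler_frame A \<xi> f c \<Omega> W F" "snd c (fst z) \<in> \<Omega>" using frame_exists[OF ch] by blast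
  interpret finsler_frame A \<xi> f c \<Omega> W F by fact
  show ?thesis by (rule maximiser_vector[OF z ch(2) *(2) assms(2)])
qed

lemma H_continuous:
  assumes z: "z \<in> cotangent_bundle UNIV A" and ch: "c \<in> A" "fst z \<in> fst c" and "e > 0"
  shows "\<exists>d>0. \<forall>z'\<in>cotangent_bundle UNIV A. fst z' \<in> fst c \<and> dist (coords c z') (coords c z) < d \<longrightarrow> \<bar>H z' - H z\<bar> < e"
proof -
  obtain \<Omega> W F where *: "finsler_frame A \<xi> f c \<Omega> W F" "snd c (fst z) \<in> \<Omega>" using frame_exists[OF ch] by blast
  interpret finsler_frame A \<xi> f c \<Omega> W F by fact
  show ?thesis by (rule hamiltonian_continuous[OF z ch(2) *(2) assms(4)])
qed

lemma H_vector_continuous: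
  assumes z: "z \<in> cotangent_bundle UNIV A" and ch: "c \<in> A" "fst z \<in> fst c" and pos: "H z > 0"
  shows "\<exists>w. hamiltonian_vector UNIV A H c z w \<and>
    (\<forall>e>0. \<exists>d>0. \<forall>z'\<in>cotangent_bundle UNIV A. fst z' \<in> fst c \<and> dist (coords c z') (coords c z) < d \<and> H z' > 0 \<longrightarrow>
      (\<forall>w'. hamiltonian_vector UNIV A H c z' w' \<longrightarrow> dist w' w < e))"
proof -
  obtain \<Omega> W F where *: "finsler_frame A \<xi> f c \<Omega> W F" "snd c (fst z) \<in> \<Omega>" using frame_exists[OF ch] by blast
  interpret finsler_frame A \<xi> f c \<Omega> W F by fact
  show ?thesis by (rule hamiltonian_vector_continuous[OF z ch(2) *(2) pos])
qed

text \<open>Along the fibre, the pairing with \<open>v\<close> is a linear function below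
  \<open>H\<close> that touches it at \<open>z\<close>. The fibre derivative of \<open>H\<close> is
  therefore \<open>v\<close>.\<close>

lemma H_vector_fst:
  assumes z: "z \<in> cotangent_bundle UNIV A" and ch: "c \<in> A" "fst z \<in> fst c"
    and v: "v \<in> \<xi> (fst z)" "f (fst z) v = 1" "pairing A (fst z) (snd z) v = H z"
    and w: "hamiltonian_vector UNIV A H c z w"
  shows "fst w = v c"
proof -
  let ?g = "\<lambda>y. H (inv_into {z \<in> cotangent_bundle UNIV A. fst z \<in> fst c} (coords c) y)"
  have "fst w \<bullet> k = v c \<bullet> k" for k
  proof -
    have "((\<lambda>t. ?g (coords c z + t *\<^sub>R (0, k))) has_vector_derivative (\<lambda>(h, k). fst w \<bullet> k - snd w \<bullet> h) (0, k)) (at 0)"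
      by (rule has_derivative_path[OF _ subspace_UNIV open_UNIV]) (use w in \<open>auto simp: hamiltonian_vector_def\<close>)
    then have der: "((\<lambda>t. ?g (coords c z + t *\<^sub>R (0, k))) has_real_derivative fst w \<bullet> k) (at 0)"
      by (simp add: has_real_derivative_iff_has_vector_derivative)
    have ge: "H z + t * (v c \<bullet> k) \<le> ?g (coords c z + t *\<^sub>R (0, k))" for t
    proof -
      have eq: "coords c z + t *\<^sub>R (0, k) = (snd c (fst z), snd z c + t *\<^sub>R k)" by (simp add: coords_def)
      obtain p where p: "(fst z, p) \<in> cotangent_bundle UNIV A" "coords c (fst z, p) = (snd c (fst z), snd z c + t *\<^sub>R k)"
        "inv_into {z \<in> cotangent_bundle UNIV A. fst z \<in> fst c} (coords c) (snd c (fst z), snd z c + t *\<^sub>R k) = (fst z, p)"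
        using M.lift_exists[OF ch] by blast
      have "pairing A (fst z) p v \<le> H (fst z, p)" using H_pairing_le[OF p(1), of v] v by simp
      moreover have "pairing A (fst z) p v = p c \<bullet> v c"
        using M.pairing_chart[OF _ xi_tangent[OF v(1)] ch] cotangent_bundleD[OF p(1)] by simp
      moreover have "pairing A (fst z) (snd z) v = snd z c \<bullet> v c"
        using M.pairing_chart[OF cotangent_bundleD[OF z] xi_tangent[OF v(1)] ch] .
      moreover have "p c = snd z c + t *\<^sub>R k" using p(2) by (simp add: coords_def)
      ultimately show ?thesis using v(3) unfolding eq p(3) by (simp add: inner_add_left inner_commute[of "v c" k])
    qed
    show ?thesis
      by (rule derivative_touching[OF der _ zero_less_one ge]) (use M.coords_inv[OF z ch] in \<open>simp add: zero_prod_def[symmetric]\<close>)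
  qed
  then show ?thesis by (metis vector_eq_rdot)
qed

lemma xi_combination:
  assumes "v \<in> \<xi> q" "v' \<in> \<xi> q"
  shows "(\<lambda>d. a *\<^sub>R v d + b *\<^sub>R v' d) \<in> \<xi> q"
proof -
  obtain c where ch: "c \<in> A" "q \<in> fst c" using chart_exists by blast
  obtain \<Omega> W F where *: "finsler_frame A \<xi> f c \<Omega> W F" "snd c q \<in> \<Omega>" using frame_exists[OF ch] by blast
  interpret finsler_frame A \<xi> f c \<Omega> W F by fact
  have ptx: "pt (snd c q) = q" by (rule M.chart_inv_eq[OF ch])
  obtain w w' where w: "w \<in> W" "v = vec (snd c q) w" "w' \<in> W" "v' = vec (snd c q) w'"
    using vec_surj[OF *(2)] assms ptx by metis
  have "vec (snd c q) (a *\<^sub>R w + b *\<^sub>R w') \<in> \<xi> q"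
    using vec(1)[OF *(2), of "a *\<^sub>R w + b *\<^sub>R w'"] w frame(3) ptx by (simp add: subspace_add subspace_mul)
  then show ?thesis using vec_combination[OF *(2) w(1,3)] w by simp
qed

lemma xi_zero: "(\<lambda>d. 0) \<in> \<xi> q"
proof -
  obtain c where ch: "c \<in> A" "q \<in> fst c" using chart_exists by blast
  obtain \<Omega> W F where *: "finsler_frame A \<xi> f c \<Omega> W F" "snd c q \<in> \<Omega>" using frame_exists[OF ch] by blast
  interpret finsler_frame A \<xi> f c \<Omega> W F by fact
  show ?thesis
    using vec(1)[OF *(2) subspace_0[OF frame(3)]] vec_zero[OF *(2)] M.chart_inv_eq[OF ch] by simp
qed

lemma xi_vector_bound:
  assumes "c \<in> A" "q0 \<in> fst c"
  shows "\<exists>C\<ge>0. \<exists>d>0. \<forall>q\<in>fst c. dist (snd c q) (snd c q0) < d \<longrightarrow> (\<forall>v\<in>\<xi> q. norm (v c) \<le> C * f q v)"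
proof -
  obtain \<Omega> W F where *: "finsler_frame A \<xi> f c \<Omega> W F" "snd c q0 \<in> \<Omega>" using frame_exists[OF assms] by blast
  interpret finsler_frame A \<xi> f c \<Omega> W F by fact
  show ?thesis by (rule vector_bound[OF assms(2) *(2)])
qed

lemma xi_transverse_correction:
  assumes ch: "c \<in> A" "q0 \<in> fst c"
    and v0: "v0 \<in> \<xi> q0" "v0 \<noteq> (\<lambda>d. 0)" "v0 c \<bullet> n = 0" and e: "e \<in> \<xi> q0" "e c \<bullet> n \<noteq> 0"
  shows "\<exists>Y \<psi> d. d > 0 \<and> Y differentiable (at (snd c q0)) \<and> \<psi> differentiable (at (snd c q0)) \<and>
    Y (snd c q0) = v0 c \<and> \<psi> (snd c q0) = f q0 v0 \<and>
    (\<forall>q\<in>fst c. dist (snd c q) (snd c q0) < d \<longrightarrow> \<psi> (snd c q) > 0 \<and>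
      (\<exists>v\<in>\<xi> q. v c = Y (snd c q) \<and> f q v = \<psi> (snd c q) \<and> v c \<bullet> n = 0))"
proof -
  obtain \<Omega> W F where *: "finsler_frame A \<xi> f c \<Omega> W F" "snd c q0 \<in> \<Omega>" using frame_exists[OF ch] by blast
  interpret finsler_frame A \<xi> f c \<Omega> W F by fact
  show ?thesis by (rule transverse_correction[OF ch(2) *(2) v0 e])
qed

lemma xi_rank_one:
  assumes ch: "c \<in> A" "q0 \<in> fst c" and e: "e \<in> \<xi> q0" "e c \<bullet> n \<noteq> 0"
    and zero: "\<And>v. v \<in> \<xi> q0 \<Longrightarrow> v c \<bullet> n = 0 \<Longrightarrow> v = (\<lambda>d. 0)"
  shows "\<exists>E C1 C2 d. d > 0 \<and> 0 < C1 \<and> E (snd c q0) = e c \<and> continuous_on (ball (snd c q0) d) E \<and>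
    (\<forall>q\<in>fst c. dist (snd c q) (snd c q0) < d \<longrightarrow>
      (\<forall>v\<in>\<xi> q. f q v = 1 \<longrightarrow> (\<exists>r. v c = r *\<^sub>R E (snd c q) \<and> C1 \<le> \<bar>r\<bar> \<and> \<bar>r\<bar> \<le> C2)))"
proof -
  obtain \<Omega> W F where *: "finsler_frame A \<xi> f c \<Omega> W F" "snd c q0 \<in> \<Omega>" using frame_exists[OF ch] by blast
  interpret finsler_frame A \<xi> f c \<Omega> W F by fact
  show ?thesis by (rule rank_one_frame[OF ch(2) *(2) e zero])
qed

end

section \<open>The boundary of the table\<close>

lemma has_derivative_cong_on_subspace:
  assumes f: "(f has_derivative L) (at z within S)" and S: "subspace S" "z \<in> S"
    and L': "bounded_linear L'" "\<And>h. h \<in> S \<Longrightarrow> L h = L' h"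
  shows "(f has_derivative L') (at z within S)"
proof -
  have "L (y - z) = L' (y - z)" if "y \<in> S" for y
    using L'(2) S that by (simp add: subspace_diff)
  then show ?thesis using f L'(1) unfolding has_derivative_within_alt by (metis (no_types, lifting))
qed

lemma conormal:
  "(conormal :: 'e::euclidean_space) \<in> Basis" "norm (conormal :: 'e) = 1" "(conormal :: 'e) \<bullet> conormal = 1"
proof -
  show "(conormal :: 'e) \<in> Basis"
    unfolding conormal_def by (rule someI_ex) (use nonempty_Basis in blast)
  then show "norm (conormal :: 'e) = 1" "(conormal :: 'e) \<bullet> conormal = 1" by simp_all
qed

lemma subspace_boundary_model: "subspace boundary_model"
  unfolding boundary_model_def by (rule subspace_hyperplane2)

text \<open>Orthogonal projection onto \<open>boundary_model\<close>. On the components of a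
  covector it is restriction to the vectors tangent to the boundary.\<close>

definition tan_part :: "'e::euclidean_space \<Rightarrow> 'e" where
  "tan_part p = p - (p \<bullet> conormal) *\<^sub>R conormal"

lemma tan_part:
  "tan_part p \<in> boundary_model" "h \<in> boundary_model \<Longrightarrow> tan_part p \<bullet> h = p \<bullet> h"
  "h \<in> boundary_model \<Longrightarrow> tan_part h = h" "tan_part p + (p \<bullet> conormal) *\<^sub>R conormal = p"
  "bounded_linear tan_part"
proof -
  show "tan_part p \<in> boundary_model" by (simp add: tan_part_def boundary_model_def inner_diff_left conormal)
  show "h \<in> boundary_model \<Longrightarrow> tan_part p \<bullet> h = p \<bullet> h"
    by (simp add: tan_part_def boundary_model_def inner_diff_left inner_commute[of conormal])
  show "h \<in> boundary_model \<Longrightarrow> tan_part h = h" by (simp add: tan_part_def boundary_model_def)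
  show "tan_part p + (p \<bullet> conormal) *\<^sub>R conormal = p" by (simp add: tan_part_def)
  show "bounded_linear tan_part" unfolding tan_part_def[abs_def]
    by (intro bounded_linear_sub bounded_linear_ident bounded_linear_compose[OF bounded_linear_scaleR_left bounded_linear_inner_left])
qed

locale billiard_boundary = sub_finsler A \<xi> f
  for A :: "('a::topological_space, 'e::euclidean_space) chart set" and \<xi> f +
  fixes U :: "'a set"
  assumes table: "billiard_table A U"
begin

abbreviation "BC \<equiv> boundary_charts A U"
abbreviation "BA \<equiv> boundary_atlas A U"

definition bd :: "('a, 'e) chart \<Rightarrow> ('a, 'e) chart" where
  "bd c = (fst c \<inter> frontier U, snd c)"

lemma bd: "fst (bd c) = fst c \<inter> frontier U" "snd (bd c) = snd c"
  by (simp_all add: bd_def)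

lemma BA_eq: "BA = bd ` BC"
  by (simp add: boundary_atlas_def bd_def[abs_def])

lemma BC_A: "c \<in> BC \<Longrightarrow> c \<in> A"
  by (simp add: boundary_charts_def)

lemma BC_exists: "q \<in> frontier U \<Longrightarrow> \<exists>c\<in>BC. q \<in> fst c"
  using table by (simp add: billiard_table_def)

text \<open>Boundary charts describe \<open>U\<close>, and the frontier has to be recovered from
  this: points of positive height have a neighbourhood in \<open>U\<close>, while from height zero a
  small step against \<open>conormal\<close> leaves the half space.\<close>

lemma frontier_iff:
  assumes c: "c \<in> BC" and q: "q \<in> fst c"
  shows "q \<in> frontier U \<longleftrightarrow> snd c q \<in> boundary_model"
proof -
  have cA: "c \<in> A" using c by (rule BC_A)
  have ch: "is_chart c" using cA by (rule is_chart)
  have mem: "q' \<in> U \<longleftrightarrow> 0 \<le> snd c q' \<bullet> conormal" if q': "q' \<in> fst c" for q'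
  proof -
    have im: "snd c ` (fst c \<inter> U) = snd c ` fst c \<inter> {x. 0 \<le> x \<bullet> conormal}" using c by (simp add: boundary_charts_def)
    have "q' \<in> U \<longleftrightarrow> snd c q' \<in> snd c ` (fst c \<inter> U)"
      using q' M.inj[OF cA] by (auto dest: inj_onD)
    also have "\<dots> \<longleftrightarrow> 0 \<le> snd c q' \<bullet> conormal" using q' by (simp add: im)
    finally show ?thesis .
  qed
  have cl: "frontier U = U - interior U" using table by (simp add: billiard_table_def frontier_def)
  show ?thesis
  proof
    assume fr: "q \<in> frontier U"
    then have "0 \<le> snd c q \<bullet> conormal" using mem[OF q] cl by simp
    moreover have "\<not> 0 < snd c q \<bullet> conormal"
    proof
      assume pos: "0 < snd c q \<bullet> conormal"
      define T where "T = fst c \<inter> snd c -` {x. 0 < x \<bullet> conormal}"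
      have "open T" unfolding T_def
        using ch by (intro continuous_open_preimage) (auto simp: is_chart_def intro!: open_Collect_less continuous_intros)
      moreover have "T \<subseteq> U" using mem by (auto simp: T_def)
      moreover have "q \<in> T" using q pos by (simp add: T_def)
      ultimately have "q \<in> interior U" by (meson interiorI)
      then show False using fr cl by simp
    qed
    ultimately show "snd c q \<in> boundary_model" by (simp add: boundary_model_def)
  next
    assume "snd c q \<in> boundary_model"
    then have 0: "snd c q \<bullet> conormal = 0" by (simp add: boundary_model_def)
    have "q \<in> U" using mem[OF q] 0 by simp
    moreover have "q \<notin> interior U"
    proof
      assume qi: "q \<in> interior U"
      have "open (snd c ` (fst c \<inter> interior U))"
        using ch by (intro open_chart_image) (auto simp: is_chart_def)
      moreover have "snd c q \<in> snd c ` (fst c \<inter> interior U)" using q qi by blast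
      ultimately obtain e where e: "e > 0" "ball (snd c q) e \<subseteq> snd c ` (fst c \<inter> interior U)" using openE by blast
      have "snd c q - (e / 2) *\<^sub>R conormal \<in> ball (snd c q) e" using e(1) by (simp add: dist_norm conormal)
      then obtain q' where q': "snd c q - (e / 2) *\<^sub>R conormal = snd c q'" "q' \<in> fst c" "q' \<in> interior U" using e by blast
      have "0 \<le> snd c q' \<bullet> conormal" using mem[OF q'(2)] q'(3) interior_subset by blast
      then show False using q'(1)[symmetric] 0 e(1) by (simp add: inner_diff_left conormal)
    qed
    ultimately show "q \<in> frontier U" using cl by simp
  qed
qed

lemma chart_inv_bd: "c \<in> BC \<Longrightarrow> q \<in> fst c \<Longrightarrow> q \<in> frontier U \<Longrightarrow> chart_inv (bd c) (snd c q) = q"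
  unfolding chart_inv_def bd using inj_on_subset[OF M.inj[OF BC_A], of c "fst c \<inter> frontier U"]
  by (intro inv_into_f_f) auto

lemma boundary_open:
  assumes c: "c \<in> BC" and d: "d \<in> A" and q: "q \<in> fst c" "q \<in> fst d" "q \<in> frontier U"
  obtains Q where "open Q" "snd c q \<in> Q" "Q \<inter> boundary_model \<subseteq> snd c ` (fst c \<inter> fst d \<inter> frontier U)"
proof -
  obtain Q where Q: "open Q" "snd c q \<in> Q" "Q \<inter> UNIV \<subseteq> snd c ` (fst c \<inter> fst d)"
    using M.rel_open[OF BC_A[OF c] d q(1,2)] by blast
  have "Q \<inter> boundary_model \<subseteq> snd c ` (fst c \<inter> fst d \<inter> frontier U)"
    using Q(3) frontier_iff[OF c] by blast
  then show ?thesis using that Q by blast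
qed

text \<open>The two derivatives are taken within different sets, but on
  \<open>boundary_model\<close> both are determined by the boundary part of the overlap. The set
  \<open>S\<close> covers two uses: \<open>frontier U\<close> gives transitions between boundary
  charts, \<open>UNIV\<close> transitions from a boundary chart to a chart of the manifold.\<close>

lemma transforms_bd:
  assumes c: "c \<in> BC" and d: "d \<in> A" and q: "q \<in> fst c" "q \<in> fst d" "q \<in> frontier U" and S: "frontier U \<subseteq> S"
    and h: "h \<in> boundary_model"
  shows "transforms (bd c) (fst d \<inter> S, snd d) q h k \<longleftrightarrow> transforms c d q h k"
proof -
  let ?T = "snd c ` (fst c \<inter> fst d \<inter> frontier U)"
  have T: "snd (bd c) ` (fst (bd c) \<inter> fst (fst d \<inter> S, snd d)) = ?T" using S by (auto simp: bd)
  have eq: "transition (bd c) (fst d \<inter> S, snd d) x = transition c d x" if "x \<in> ?T" for x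
    using that chart_inv_bd[OF c] M.chart_inv_eq[OF BC_A[OF c]] by (auto simp: transition_def)
  have iff: "(transition (bd c) (fst d \<inter> S, snd d) has_derivative L) (at (snd c q) within ?T) \<longleftrightarrow>
      (transition c d has_derivative L) (at (snd c q) within ?T)" for L
    using has_derivative_transform[of "snd c q" ?T "transition c d" "transition (bd c) (fst d \<inter> S, snd d)" L]
      has_derivative_transform[of "snd c q" ?T "transition (bd c) (fst d \<inter> S, snd d)" "transition c d" L] eq q by fastforce
  obtain L0 where L0: "(transition c d has_derivative L0) (at (snd c q) within snd c ` (fst c \<inter> fst d))"
    using M.differentiable[OF BC_A[OF c] d q(1,2)] by blast
  have L0T: "(transition c d has_derivative L0) (at (snd c q) within ?T)"
    by (rule has_derivative_subset[OF L0]) auto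
  obtain Q where Q: "open Q" "snd c q \<in> Q" "Q \<inter> boundary_model \<subseteq> ?T" using boundary_open[OF c d q] by blast
  have x: "snd c q \<in> boundary_model" using frontier_iff[OF c q(1)] q(3) by simp
  have "transforms (bd c) (fst d \<inter> S, snd d) q h k \<longleftrightarrow> k = L0 h"
    unfolding transforms_def T unfolding bd iff
    using has_derivative_unique_on_subspace[OF _ L0T subspace_boundary_model Q x h] L0T by blast
  moreover have "transforms c d q h k \<longleftrightarrow> k = L0 h"
    unfolding transforms_def
    using M.derivative_unique[OF BC_A[OF c] d q(1,2) UNIV_I _ L0] L0 by blast
  ultimately show ?thesis by simp
qed

lemma transforms_bd_bd:
  assumes "c \<in> BC" "d \<in> BC" "q \<in> fst c" "q \<in> fst d" "q \<in> frontier U" "h \<in> boundary_model"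
  shows "transforms (bd c) (bd d) q h k \<longleftrightarrow> transforms c d q h k"
  using transforms_bd[OF assms(1) BC_A[OF assms(2)] assms(3-5) order_refl assms(6)] by (simp add: bd_def)

lemma transforms_bd_A:
  assumes "c \<in> BC" "d \<in> A" "q \<in> fst c" "q \<in> fst d" "q \<in> frontier U" "h \<in> boundary_model"
  shows "transforms (bd c) d q h k \<longleftrightarrow> transforms c d q h k"
  using transforms_bd[OF assms(1-5) subset_UNIV assms(6)] by simp

end

sublocale billiard_boundary \<subseteq> B: atlas boundary_model BA
proof
  show "subspace boundary_model" by (rule subspace_boundary_model)
  show "inj_on (snd c) (fst c)" if "c \<in> BA" for c
  proof -
    obtain d where d: "d \<in> BC" "c = bd d" using \<open>c \<in> BA\<close> by (auto simp: BA_eq)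
    show ?thesis unfolding d(2) bd by (rule inj_on_subset[OF M.inj[OF BC_A[OF d(1)]]]) auto
  qed
  show "snd c ` fst c \<subseteq> boundary_model" if "c \<in> BA" for c
    using that frontier_iff by (auto simp: BA_eq bd)
  fix c' d' q assume c': "c' \<in> BA" "d' \<in> BA" "q \<in> fst c'" "q \<in> fst d'"
  then obtain c d where c: "c \<in> BC" "c' = bd c" and d: "d \<in> BC" "d' = bd d" by (auto simp: BA_eq)
  have q: "q \<in> fst c" "q \<in> fst d" "q \<in> frontier U" using c' c d by (auto simp: bd)
  obtain Q where Q: "open Q" "snd c q \<in> Q" "Q \<inter> boundary_model \<subseteq> snd c ` (fst c \<inter> fst d \<inter> frontier U)"
    using boundary_open[OF c(1) BC_A[OF d(1)] q] by blast
  moreover have "fst c \<inter> fst d \<inter> frontier U = fst c' \<inter> fst d'" using c d by (auto simp: bd)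
  ultimately show "\<exists>Q. open Q \<and> snd c' q \<in> Q \<and> Q \<inter> boundary_model \<subseteq> snd c' ` (fst c' \<inter> fst d')"
    using c by (auto simp: bd)
  obtain k where "transforms c d q 0 k" using M.transforms_exists[OF BC_A[OF c(1)] BC_A[OF d(1)] q(1,2)] by blast
  then have "transforms c' d' q 0 k"
    using transforms_bd_bd[OF c(1) d(1) q subspace_0[OF subspace_boundary_model]] c d by simp
  then show "\<exists>L. (transition c' d' has_derivative L) (at (snd c' q) within snd c' ` (fst c' \<inter> fst d'))"
    unfolding transforms_def by blast
qed

context billiard_boundary
begin

lemma bd_in: "c \<in> BC \<Longrightarrow> bd c \<in> BA" by (simp add: BA_eq)

text \<open>\<open>bd\<close> forgets part of the domain, so one chart of the boundary may come from
  several charts of the manifold. These share the coordinate map, whence the components in them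
  agree and the choice made by \<open>some_chart\<close> is harmless.\<close>

lemma same_bd:
  assumes c: "c \<in> BC" "d \<in> BC" "bd c = bd d" and q: "q \<in> fst c" "q \<in> frontier U"
  shows "q \<in> fst d" "transforms c d q h h"
proof -
  have s: "snd c = snd d" "fst c \<inter> frontier U = fst d \<inter> frontier U" using c(3) by (auto simp: bd_def)
  then show qd: "q \<in> fst d" using q by blast
  have tr: "transition c d y = y" if "y \<in> snd c ` (fst c \<inter> fst d)" for y
    using that M.transition_eq[OF BC_A[OF c(1)], of _ d] s(1) by force
  have "(transition c d has_derivative (\<lambda>h. h)) (at (snd c q) within snd c ` (fst c \<inter> fst d))"
    by (rule has_derivative_transform[OF _ tr has_derivative_ident]) (use q qd in auto)
  then show "transforms c d q h h" unfolding transforms_def by blast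
qed

definition some_chart :: "('a, 'e) chart \<Rightarrow> ('a, 'e) chart" where
  "some_chart c' = (SOME c. c \<in> BC \<and> c' = bd c)"

lemma some_chart:
  assumes "c' \<in> BA" shows "some_chart c' \<in> BC" "c' = bd (some_chart c')"
proof -
  have "some_chart c' \<in> BC \<and> c' = bd (some_chart c')"
    unfolding some_chart_def by (rule someI_ex) (use assms BA_eq in auto)
  then show "some_chart c' \<in> BC" "c' = bd (some_chart c')" by auto
qed

text \<open>Transitions between boundary charts restrict to the hyperplane, so tangency to the
  boundary may be tested in any one boundary chart.\<close>

lemma tangent_in_boundary_model:
  assumes v: "v \<in> tangent_space UNIV A q" and c: "c \<in> BC" "d \<in> BC" and q: "q \<in> fst c" "q \<in> fst d" "q \<in> frontier U"
    and vc: "v c \<in> boundary_model"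
  shows "v d \<in> boundary_model"
proof -
  have "transforms c d q (v c) (v d)" using v BC_A[OF c(1)] BC_A[OF c(2)] q by (simp add: tangent_space_def)
  then have "transforms (bd c) (bd d) q (v c) (v d)" using transforms_bd_bd[OF c q vc] by simp
  then show ?thesis by (rule B.transforms_in[rotated 5]) (use c q vc in \<open>auto simp: bd bd_in\<close>)
qed

lemma pushes_forward_chart:
  assumes p: "pushes_forward A U q u v" and c: "c \<in> BC" "q \<in> fst c" "q \<in> frontier U"
  shows "u (bd c) = v c" "v c \<in> boundary_model"
proof -
  have b: "bd c \<in> BA" "q \<in> fst (bd c)" using c by (auto simp: bd_in bd)
  have u: "u \<in> tangent_space boundary_model BA q" using p by (simp add: pushes_forward_def)
  have ub: "u (bd c) \<in> boundary_model" by (rule tangent_in[OF u b])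
  have "transforms (bd c) c q (u (bd c)) (v c)" using p b c BC_A[OF c(1)] by (auto simp: pushes_forward_def)
  then have "transforms c c q (u (bd c)) (v c)"
    using transforms_bd_A[OF c(1) BC_A[OF c(1)] c(2,2,3) ub] by simp
  then show "u (bd c) = v c"
    using M.transforms_unique[OF BC_A[OF c(1)] BC_A[OF c(1)] c(2,2) UNIV_I] M.transforms_refl[OF BC_A[OF c(1)] c(2)] by blast
  then show "v c \<in> boundary_model" using ub by simp
qed

lemma pushes_forward_exists:
  assumes v: "v \<in> tangent_space UNIV A q" and c: "c \<in> BC" "q \<in> fst c" "q \<in> frontier U" and vc: "v c \<in> boundary_model"
  shows "\<exists>u. pushes_forward A U q u v"
proof -
  define u where "u c' = (if c' \<in> BA \<and> q \<in> fst c' then v (some_chart c') else 0)" for c'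
  have V: "v d \<in> boundary_model" if "d \<in> BC" "q \<in> fst d" for d
    by (rule tangent_in_boundary_model[OF v c(1) that(1) c(2) that(2) c(3) vc])
  have tr: "transforms d e q (v d) (v e)" if "d \<in> A" "e \<in> A" "q \<in> fst d" "q \<in> fst e" for d e
    using v that by (simp add: tangent_space_def)
  have sc: "some_chart c' \<in> BC" "q \<in> fst (some_chart c')" "c' = bd (some_chart c')" if "c' \<in> BA" "q \<in> fst c'" for c'
  proof -
    show "some_chart c' \<in> BC" "c' = bd (some_chart c')" using some_chart[OF that(1)] by auto
    then show "q \<in> fst (some_chart c')" using that(2) by (metis IntD1 bd(1))
  qed
  have "u \<in> tangent_space boundary_model BA q"
    unfolding tangent_space_def
  proof (intro CollectI conjI ballI impI)
    show "u \<in> components boundary_model BA q"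
      using V sc by (auto simp: components_def u_def)
    fix c' d' assume cd: "c' \<in> BA" "d' \<in> BA" "q \<in> fst c' \<inter> fst d'"
    let ?c = "some_chart c'" and ?d = "some_chart d'"
    have s: "?c \<in> BC" "q \<in> fst ?c" "c' = bd ?c" "?d \<in> BC" "q \<in> fst ?d" "d' = bd ?d" using sc cd by blast+
    have "transforms (bd ?c) (bd ?d) q (v ?c) (v ?d)"
      using transforms_bd_bd[OF s(1,4,2,5) c(3) V[OF s(1,2)]] tr[OF BC_A[OF s(1)] BC_A[OF s(4)] s(2,5)] by simp
    then show "transforms c' d' q (u c') (u d')" using s cd by (simp add: u_def)
  qed
  moreover have "transforms c' d q (u c') (v d)" if cd: "c' \<in> BA" "d \<in> A" "q \<in> fst c' \<inter> fst d" for c' d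
  proof -
    let ?c = "some_chart c'"
    have s: "?c \<in> BC" "q \<in> fst ?c" "c' = bd ?c" using sc cd by blast+
    have "transforms (bd ?c) d q (v ?c) (v d)"
      using transforms_bd_A[OF s(1) cd(2) s(2) _ c(3) V[OF s(1,2)]] tr[OF BC_A[OF s(1)] cd(2) s(2)] cd by simp
    then show ?thesis using s cd by (simp add: u_def)
  qed
  ultimately show ?thesis using v unfolding pushes_forward_def by blast
qed

lemma pushes_forward_unique:
  assumes "pushes_forward A U q u v" "pushes_forward A U q u v'" and q: "q \<in> frontier U"
  shows "v = v'"
proof -
  obtain c where c: "c \<in> BC" "q \<in> fst c" using BC_exists[OF q] by blast
  show ?thesis
    by (rule M.tangent_eqI[OF _ _ BC_A[OF c(1)] c(2)])
      (use assms pushes_forward_chart[OF assms(1) c q] pushes_forward_chart[OF assms(2) c q] in \<open>auto simp: pushes_forward_def\<close>)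
qed

lemma boundary_norm_eq:
  assumes "pushes_forward A U q u v" "q \<in> frontier U"
  shows "boundary_norm A f U q u = f q v"
  unfolding boundary_norm_def using pushes_forward_unique[OF _ assms(1) assms(2)] assms(1)
  by (metis (mono_tags, lifting) theI)

lemma regular_boundary_iff:
  assumes c: "c \<in> BC" "q \<in> fst c" "q \<in> frontier U"
  shows "q \<in> regular_boundary A \<xi> U \<longleftrightarrow> (\<exists>v\<in>\<xi> q. v c \<bullet> conormal \<noteq> 0)"
proof -
  have "(\<exists>u. pushes_forward A U q u v) \<longleftrightarrow> v c \<bullet> conormal = 0" if "v \<in> \<xi> q" for v
    using pushes_forward_exists[OF xi_tangent[OF that] c] pushes_forward_chart(2)[OF _ c, of _ v]
    by (auto simp: boundary_model_def)
  then show ?thesis using c(3) by (auto simp: regular_boundary_def)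
qed

text \<open>Pullback of a covector to the boundary. A chart of the boundary does not determine the
  chart of the manifold from which it comes, hence the detour through
  \<open>some_chart\<close>.\<close>

definition restrict_covector :: "'a \<Rightarrow> (('a, 'e) chart \<Rightarrow> 'e) \<Rightarrow> ('a, 'e) chart \<Rightarrow> 'e" where
  "restrict_covector q p c' = (if c' \<in> BA \<and> q \<in> fst c' then tan_part (p (some_chart c')) else 0)"

lemma restrict_covector_chart:
  assumes p: "p \<in> cotangent_space UNIV A q" and c: "c \<in> BC" "q \<in> fst c" "q \<in> frontier U"
  shows "restrict_covector q p (bd c) = tan_part (p c)"
proof -
  let ?d = "some_chart (bd c)"
  have b: "bd c \<in> BA" "q \<in> fst (bd c)" using c by (auto simp: bd_in bd)
  have d: "?d \<in> BC" "bd c = bd ?d" using some_chart[OF b(1)] by auto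
  have t: "q \<in> fst ?d" "transforms c ?d q h h" for h using same_bd[OF c(1) d(1,2) c(2,3)] by auto
  have "p c \<bullet> h = p ?d \<bullet> h" for h
    using p t BC_A[OF c(1)] BC_A[OF d(1)] c by (auto simp: cotangent_space_def)
  then have "p c = p ?d" by (metis vector_eq_rdot)
  then show ?thesis using b by (simp add: restrict_covector_def)
qed

lemma restrict_covector:
  assumes p: "p \<in> cotangent_space UNIV A q" and q: "q \<in> frontier U"
  shows "restrict_covector q p \<in> cotangent_space boundary_model BA q"
  unfolding cotangent_space_def
proof (intro CollectI conjI ballI impI allI)
  show "restrict_covector q p \<in> components boundary_model BA q"
    by (auto simp: components_def restrict_covector_def tan_part)
  fix c' d' h k assume cd: "c' \<in> BA" "d' \<in> BA" "q \<in> fst c' \<inter> fst d'" and h: "h \<in> boundary_model" and t: "transforms c' d' q h k"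
  obtain c d where c: "c \<in> BC" "c' = bd c" and d: "d \<in> BC" "d' = bd d" using cd by (auto simp: BA_eq)
  have qc: "q \<in> fst c" "q \<in> fst d" using cd c d by (auto simp: bd)
  have k: "k \<in> boundary_model" by (rule B.transforms_in[OF cd(1,2) _ _ h t]) (use cd in auto)
  have "transforms c d q h k" using t transforms_bd_bd[OF c(1) d(1) qc q h] c d by simp
  then have "p c \<bullet> h = p d \<bullet> k"
    using p BC_A[OF c(1)] BC_A[OF d(1)] qc by (auto simp: cotangent_space_def)
  then show "restrict_covector q p c' \<bullet> h = restrict_covector q p d' \<bullet> k"
    using restrict_covector_chart[OF p c(1) qc(1) q] restrict_covector_chart[OF p d(1) qc(2) q] c d h k
    by (simp add: tan_part)
qed

section \<open>The boundary Hamiltonian and its Hamiltonian vector\<close>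

abbreviation HB :: "('a, 'e) cotangent \<Rightarrow> real" where
  "HB \<equiv> boundary_hamiltonian A \<xi> f U"

lemma HB_eq:
  assumes m: "m \<in> cotangent_space boundary_model BA q" and c: "c \<in> BC" "q \<in> fst c" "q \<in> frontier U"
  shows "HB (q, m) = Sup {m (bd c) \<bullet> v c |v. v \<in> \<xi> q \<and> v c \<in> boundary_model \<and> f q v \<le> 1}"
proof -
  have b: "bd c \<in> BA" "q \<in> fst (bd c)" using c by (auto simp: bd_in bd)
  have pair: "pairing BA q m u = m (bd c) \<bullet> v c" if "pushes_forward A U q u v" for u v
    using B.pairing_chart[OF m _ b, of u] that pushes_forward_chart(1)[OF that c] by (simp add: pushes_forward_def)
  have "{pairing BA q m u |u. u \<in> boundary_distribution A \<xi> U q \<and> boundary_norm A f U q u \<le> 1} =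
    {m (bd c) \<bullet> v c |v. v \<in> \<xi> q \<and> v c \<in> boundary_model \<and> f q v \<le> 1}" (is "?S = ?T")
  proof
    show "?S \<subseteq> ?T"
    proof clarify
      fix u assume u: "u \<in> boundary_distribution A \<xi> U q" "boundary_norm A f U q u \<le> 1"
      then obtain v where v: "v \<in> \<xi> q" "pushes_forward A U q u v" by (auto simp: boundary_distribution_def)
      then show "\<exists>v. pairing BA q m u = m (bd c) \<bullet> v c \<and> v \<in> \<xi> q \<and> v c \<in> boundary_model \<and> f q v \<le> 1"
        using pair[OF v(2)] pushes_forward_chart(2)[OF v(2) c] boundary_norm_eq[OF v(2) c(3)] u(2)
        by (intro exI[of _ v]) simp
    qed
    show "?T \<subseteq> ?S"
    proof clarify
      fix v assume v: "v \<in> \<xi> q" "v c \<in> boundary_model" "f q v \<le> 1"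
      obtain u where u: "pushes_forward A U q u v" using pushes_forward_exists[OF xi_tangent[OF v(1)] c v(2)] by blast
      then show "\<exists>u. m (bd c) \<bullet> v c = pairing BA q m u \<and> u \<in> boundary_distribution A \<xi> U q \<and> boundary_norm A f U q u \<le> 1"
        using pair[OF u] boundary_norm_eq[OF u c(3)] v by (intro exI[of _ u]) (auto simp: boundary_distribution_def)
    qed
  qed
  then show ?thesis by (simp add: boundary_hamiltonian_def maximised_hamiltonian_def)
qed

lemma pairing_tangent_le:
  assumes p: "(q, p) \<in> cotangent_bundle UNIV A" and c: "c \<in> BC" "q \<in> fst c"
    and v: "v \<in> \<xi> q" "v c \<in> boundary_model" and m: "tan_part (p c) = m"
  shows "m \<bullet> v c \<le> H (q, p) * f q v"
proof -
  have "pairing A q p v = p c \<bullet> v c"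
    using M.pairing_chart[OF _ xi_tangent[OF v(1)] BC_A[OF c(1)] c(2)] cotangent_bundleD[OF p] by simp
  then show ?thesis using H_pairing_le[OF p, of v] v m tan_part(2)[of "v c" "p c"] by simp
qed

text \<open>\<open>p\<close> and \<open>m\<close> agree on tangent vectors, and the supremum for
  \<open>HB\<close> runs over fewer vectors. Every extension \<open>p\<close> of \<open>m\<close>
  thus provides an upper barrier.\<close>

lemma HB_le_H:
  assumes m: "m \<in> cotangent_space boundary_model BA q" and c: "c \<in> BC" "q \<in> fst c" "q \<in> frontier U"
    and p: "(q, p) \<in> cotangent_bundle UNIV A" and mp: "tan_part (p c) = m (bd c)"
  shows "HB (q, m) \<le> H (q, p)"
  unfolding HB_eq[OF m c]
proof (rule cSup_least)
  show "{m (bd c) \<bullet> v c |v. v \<in> \<xi> q \<and> v c \<in> boundary_model \<and> f q v \<le> 1} \<noteq> {}"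
    using xi_zero norm_zero[OF xi_zero] subspace_0[OF subspace_boundary_model] by fastforce
  fix s assume "s \<in> {m (bd c) \<bullet> v c |v. v \<in> \<xi> q \<and> v c \<in> boundary_model \<and> f q v \<le> 1}"
  then obtain v where v: "v \<in> \<xi> q" "v c \<in> boundary_model" "f q v \<le> 1" "s = m (bd c) \<bullet> v c" by blast
  have "s \<le> H (q, p) * f q v" using pairing_tangent_le[OF p c(1,2) v(1,2) mp] v(4) by simp
  also have "\<dots> \<le> H (q, p) * 1" by (rule mult_left_mono[OF v(3) H_nonneg[OF p]])
  finally show "s \<le> H (q, p)" by simp
qed

lemma HB_ge:
  assumes m: "m \<in> cotangent_space boundary_model BA q" and c: "c \<in> BC" "q \<in> fst c" "q \<in> frontier U"
    and v: "v \<in> \<xi> q" "v c \<in> boundary_model" "f q v > 0"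
  shows "(m (bd c) \<bullet> v c) / f q v \<le> HB (q, m)"
  unfolding HB_eq[OF m c]
proof (rule cSup_upper)
  have b: "bd c \<in> BA" "q \<in> fst (bd c)" using c by (auto simp: bd_in bd)
  define v' where "v' = (\<lambda>d. (1 / f q v) *\<^sub>R v d)"
  have "(\<lambda>d. (1 / f q v) *\<^sub>R v d + 0 *\<^sub>R v d) \<in> \<xi> q" by (rule xi_combination[OF v(1) v(1)])
  then have "v' \<in> \<xi> q" by (simp add: v'_def)
  moreover have "f q v' = 1" using norm_scale[OF v(1), of "1 / f q v"] v(3) by (simp add: v'_def)
  moreover have "v' c \<in> boundary_model" unfolding v'_def by (rule subspace_mul[OF subspace_boundary_model v(2)])
  moreover have "(m (bd c) \<bullet> v c) / f q v = m (bd c) \<bullet> v' c" by (simp add: v'_def)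
  ultimately show "(m (bd c) \<bullet> v c) / f q v \<in> {m (bd c) \<bullet> v c |v. v \<in> \<xi> q \<and> v c \<in> boundary_model \<and> f q v \<le> 1}"
    by (intro CollectI exI[of _ v']) simp
  \<comment> \<open>The extension of \<open>m\<close> with normal component 0; its Hamiltonian
    bounds the set from above.\<close>
  obtain p where p: "(q, p) \<in> cotangent_bundle UNIV A" "coords c (q, p) = (snd c q, m (bd c))"
    using M.lift_exists[OF BC_A[OF c(1)] c(2) UNIV_I, of "m (bd c)"] by blast
  have mV: "m (bd c) \<in> boundary_model" by (rule cotangent_in[OF m b])
  have mp: "tan_part (p c) = m (bd c)" using p(2) tan_part(3)[OF mV] by (simp add: coords_def)
  show "bdd_above {m (bd c) \<bullet> v c |v. v \<in> \<xi> q \<and> v c \<in> boundary_model \<and> f q v \<le> 1}"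
  proof (rule bdd_aboveI[of _ "H (q, p)"])
    fix s assume "s \<in> {m (bd c) \<bullet> v c |v. v \<in> \<xi> q \<and> v c \<in> boundary_model \<and> f q v \<le> 1}"
    then obtain v where v: "v \<in> \<xi> q" "v c \<in> boundary_model" "f q v \<le> 1" "s = m (bd c) \<bullet> v c" by blast
    have "s \<le> H (q, p) * f q v" using pairing_tangent_le[OF p(1) c(1,2) v(1,2) mp] v(4) by simp
    also have "\<dots> \<le> H (q, p) * 1" by (rule mult_left_mono[OF v(3) H_nonneg[OF p(1)]])
    finally show "s \<le> H (q, p)" by simp
  qed
qed

text \<open>As \<open>H z = 1\<close>, the vector \<open>v\<close> is the maximiser for \<open>z\<close>.\<close>

definition tangent_covector :: "('a, 'e) cotangent \<Rightarrow> (('a, 'e) chart \<Rightarrow> 'e) \<Rightarrow> bool" where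
  "tangent_covector z v \<longleftrightarrow> z \<in> cotangent_bundle UNIV A \<and> fst z \<in> frontier U \<and> H z = 1 \<and>
     v \<in> \<xi> (fst z) \<and> f (fst z) v = 1 \<and> pairing A (fst z) (snd z) v = 1 \<and>
     (\<exists>c\<in>BC. fst z \<in> fst c \<and> v c \<in> boundary_model)"

lemma tangent_covectorD:
  assumes "tangent_covector z v"
  shows "z \<in> cotangent_bundle UNIV A" "fst z \<in> frontier U" "H z = 1" "v \<in> \<xi> (fst z)" "f (fst z) v = 1"
    "pairing A (fst z) (snd z) v = 1" "\<And>c. c \<in> BC \<Longrightarrow> fst z \<in> fst c \<Longrightarrow> v c \<in> boundary_model"
  using assms tangent_in_boundary_model[OF xi_tangent] unfolding tangent_covector_def by blast+

text \<open>Since \<open>v'\<close> is tangent, its pairings with \<open>p\<close> and with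
  \<open>p'\<close> both depend only on the common restriction. So \<open>v'\<close> maximises
  \<open>p\<close> as well, and the maximiser is unique.\<close>

lemma tangent_covector_unique:
  assumes z: "tangent_covector (q, p) v" and z': "tangent_covector (q, p') v'"
    and eq: "restrict_covector q p = restrict_covector q p'"
  shows "v = v'"
proof -
  have q: "q \<in> frontier U" using tangent_covectorD(2)[OF z] by simp
  obtain c where c: "c \<in> BC" "q \<in> fst c" using BC_exists[OF q] by blast
  have pc: "p \<in> cotangent_space UNIV A q" "p' \<in> cotangent_space UNIV A q"
    using tangent_covectorD(1)[OF z] tangent_covectorD(1)[OF z'] cotangent_bundleD by fastforce+
  have v: "v' \<in> \<xi> q" "f q v' = 1" "v' c \<in> boundary_model"
    using tangent_covectorD(4,5)[OF z'] tangent_covectorD(7)[OF z' c(1)] c by simp_all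
  have "pairing A q p v' = tan_part (p c) \<bullet> v' c"
    using M.pairing_chart[OF pc(1) xi_tangent[OF v(1)] BC_A[OF c(1)] c(2)] tan_part(2)[OF v(3)] by simp
  also have "tan_part (p c) = tan_part (p' c)"
    using restrict_covector_chart[OF pc(1) c q] restrict_covector_chart[OF pc(2) c q] eq by simp
  also have "tan_part (p' c) \<bullet> v' c = pairing A q p' v'"
    using M.pairing_chart[OF pc(2) xi_tangent[OF v(1)] BC_A[OF c(1)] c(2)] tan_part(2)[OF v(3)] by simp
  also have "\<dots> = 1" using tangent_covectorD(6)[OF z'] by simp
  finally have "pairing A q p v' = 1" .
  then show ?thesis
    using H_maximiser[OF tangent_covectorD(1)[OF z]] tangent_covectorD(3,4,5,6)[OF z] v by auto
qed

text \<open>The upper barrier \<open>H\<close> and the lower barrier given by the tangent maximiser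
  both have the value 1.\<close>

lemma HB_tangent_covector:
  assumes z: "tangent_covector (q, p) v"
  shows "HB (q, restrict_covector q p) = 1"
proof -
  have q: "q \<in> frontier U" using tangent_covectorD(2)[OF z] by simp
  obtain c where c: "c \<in> BC" "q \<in> fst c" using BC_exists[OF q] by blast
  note D = tangent_covectorD[OF z, unfolded fst_conv snd_conv]
  have p: "p \<in> cotangent_space UNIV A q" using cotangent_bundleD[OF D(1)] by simp
  have m: "restrict_covector q p \<in> cotangent_space boundary_model BA q" by (rule restrict_covector[OF p q])
  have mc: "restrict_covector q p (bd c) = tan_part (p c)" by (rule restrict_covector_chart[OF p c q])
  have vV: "v c \<in> boundary_model" by (rule D(7)[OF c])
  have "HB (q, restrict_covector q p) \<le> 1"
    using HB_le_H[OF m c q D(1)] mc D(3) by simp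
  moreover have "tan_part (p c) \<bullet> v c = 1"
    using M.pairing_chart[OF p xi_tangent[OF D(4)] BC_A[OF c(1)] c(2)] tan_part(2)[OF vV] D(6) by simp
  then have "1 \<le> HB (q, restrict_covector q p)"
    using HB_ge[OF m c q D(4) vV] mc D(5) by simp
  ultimately show ?thesis by simp
qed

text \<open>The boundary Hamiltonian lies between \<open>m \<bullet> Y / \<psi>\<close>, for a tangent section \<open>Y\<close> of length \<open>\<psi>\<close> through the
  maximising vector, and the restriction of \<open>H\<close> to covectors with the same normal component.\<close>

lemma boundary_hamiltonian_vector:
  assumes z: "tangent_covector (q, p) v" and reg: "q \<in> regular_boundary A \<xi> U" and c: "c \<in> BC" "q \<in> fst c"
    and w: "hamiltonian_vector UNIV A H c (q, p) w"
  shows "hamiltonian_vector boundary_model BA HB (bd c) (q, restrict_covector q p) (fst w, tan_part (snd w))"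
proof -
  note D = tangent_covectorD[OF z, unfolded fst_conv snd_conv]
  have q: "q \<in> frontier U" by (rule D(2))
  have cA: "c \<in> A" by (rule BC_A[OF c(1)])
  have b: "bd c \<in> BA" "q \<in> fst (bd c)" using c q by (auto simp: bd_in bd)
  have p: "p \<in> cotangent_space UNIV A q" using cotangent_bundleD[OF D(1)] by simp
  have vV: "v c \<in> boundary_model" by (rule D(7)[OF c])
  have mc: "restrict_covector q p (bd c) = tan_part (p c)" by (rule restrict_covector_chart[OF p c q])
  define x0 where "x0 = snd c q"
  define s0 where "s0 = p c \<bullet> conormal"
  define z0 where "z0 = (x0, tan_part (p c))"
  have z0: "coords (bd c) (q, restrict_covector q p) = z0" by (simp add: coords_def bd mc z0_def x0_def)
  have cz: "coords c (q, p) = (x0, tan_part (p c) + s0 *\<^sub>R conormal)" by (simp add: coords_def x0_def s0_def tan_part)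
  let ?S = "boundary_model \<times> boundary_model :: ('e \<times> 'e) set"
  have S: "subspace ?S" by (intro subspace_Times subspace_boundary_model)
  have z0S: "z0 \<in> ?S" using frontier_iff[OF c] q by (simp add: z0_def x0_def tan_part)
  define g where "g y = H (inv_into {z \<in> cotangent_bundle UNIV A. fst z \<in> fst c} (coords c) y)" for y
  define m where "m y = HB (inv_into {z \<in> cotangent_bundle boundary_model BA. fst z \<in> fst (bd c)} (coords (bd c)) y)" for y
  define u where "u y = g (fst y, snd y + s0 *\<^sub>R conormal)" for y
  have v0: "v \<noteq> (\<lambda>d. 0)" using norm_zero[OF D(4)] D(5) by auto
  obtain e where e: "e \<in> \<xi> q" "e c \<bullet> conormal \<noteq> 0" using reg regular_boundary_iff[OF c q] by blast
  have vn: "v c \<bullet> conormal = 0" using vV by (simp add: boundary_model_def)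
  obtain Y \<psi> d where d: "d > 0" and Yd: "Y differentiable (at x0)" "\<psi> differentiable (at x0)"
    and Y0: "Y x0 = v c" "\<psi> x0 = f q v"
    and Yn: "\<And>q. q \<in> fst c \<Longrightarrow> dist (snd c q) x0 < d \<Longrightarrow> \<psi> (snd c q) > 0 \<and>
      (\<exists>v\<in>\<xi> q. v c = Y (snd c q) \<and> f q v = \<psi> (snd c q) \<and> v c \<bullet> conormal = 0)"
    using xi_transverse_correction[OF cA c(2) D(4) v0 vn e] unfolding x0_def by metis
  define l where "l y = (snd y \<bullet> Y (fst y)) / \<psi> (fst y)" for y :: "'e \<times> 'e"
  obtain Q where Q: "open Q" "snd c q \<in> Q" "Q \<inter> boundary_model \<subseteq> snd c ` (fst c \<inter> fst c \<inter> frontier U)"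
    using boundary_open[OF c(1) cA c(2,2) q] by blast
  obtain d2 where d2: "d2 > 0" "ball x0 d2 \<subseteq> Q" using Q openE unfolding x0_def by blast
  have near: "l y \<le> m y \<and> m y \<le> u y" if y: "y \<in> ?S" "dist y z0 < min d d2" for y
  proof -
    have yx: "dist (fst y) x0 < min d d2" using dist_fst_le[of y z0] y(2) by (simp add: z0_def)
    have "fst y \<in> Q \<inter> boundary_model" using yx d2 y(1) by (auto simp: dist_commute)
    then obtain q' where q': "fst y = snd c q'" "q' \<in> fst c" "q' \<in> frontier U" using Q(3) by blast
    have b': "q' \<in> fst (bd c)" using q' by (simp add: bd)
    have sy: "snd y \<in> boundary_model" using y(1) by auto
    obtain m' where m': "(q', m') \<in> cotangent_bundle boundary_model BA" "coords (bd c) (q', m') = (snd (bd c) q', snd y)"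
      "inv_into {z \<in> cotangent_bundle boundary_model BA. fst z \<in> fst (bd c)} (coords (bd c)) (snd (bd c) q', snd y) = (q', m')"
      using B.lift_exists[OF b(1) b' sy] by blast
    have my: "m y = HB (q', m')" using m'(3) q'(1) by (simp add: m_def bd) (metis prod.collapse)
    have mc': "m' (bd c) = snd y" using m'(2) by (simp add: coords_def)
    have mm: "m' \<in> cotangent_space boundary_model BA q'" using cotangent_bundleD[OF m'(1)] by simp
    obtain p' where p': "(q', p') \<in> cotangent_bundle UNIV A" "coords c (q', p') = (snd c q', snd y + s0 *\<^sub>R conormal)"
      "inv_into {z \<in> cotangent_bundle UNIV A. fst z \<in> fst c} (coords c) (snd c q', snd y + s0 *\<^sub>R conormal) = (q', p')"
      using M.lift_exists[OF cA q'(2) UNIV_I] by blast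
    have uy: "u y = H (q', p')" using p'(3) q'(1) by (simp add: u_def g_def)
    have "p' c = snd y + s0 *\<^sub>R conormal" using p'(2) by (simp add: coords_def)
    then have "tan_part (p' c) = snd y" using sy
      by (simp add: tan_part_def boundary_model_def inner_add_left conormal)
    then have le: "m y \<le> u y" unfolding my uy using HB_le_H[OF mm c(1) q'(2,3) p'(1)] mc' by simp
    obtain v' where v': "v' \<in> \<xi> q'" "v' c = Y (snd c q')" "f q' v' = \<psi> (snd c q')" "v' c \<bullet> conormal = 0" "\<psi> (snd c q') > 0"
      using Yn[OF q'(2)] yx q'(1) by auto
    have "l y \<le> m y" unfolding my l_def
      using HB_ge[OF mm c(1) q'(2,3) v'(1)] v' mc' q'(1) by (simp add: boundary_model_def)
    then show ?thesis using le by simp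
  qed
  have pv: "tan_part (p c) \<bullet> v c = 1"
    using M.pairing_chart[OF p xi_tangent[OF D(4)] cA c(2)] tan_part(2)[OF vV] D(6) by simp
  have l0: "l z0 = 1" using pv Y0 D(5) by (simp add: l_def z0_def)
  have u0: "u z0 = 1"
    using M.coords_inv[OF D(1) cA] c(2) cz D(3) by (simp add: u_def g_def z0_def)
  have m0: "m z0 = 1"
  proof -
    have "(q, restrict_covector q p) \<in> cotangent_bundle boundary_model BA"
      using restrict_covector[OF p q] b by (auto simp: cotangent_bundle_def)
    from B.coords_inv[OF this b(1)] show ?thesis using b(2) z0 HB_tangent_covector[OF z] by (simp add: m_def)
  qed
  obtain l' where l': "(l has_derivative l') (at z0 within ?S)"
  proof -
    have fstd: "fst differentiable (at z0)" by (rule bounded_linear_imp_differentiable[OF bounded_linear_fst])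
    have sd: "snd differentiable (at z0)" by (rule bounded_linear_imp_differentiable[OF bounded_linear_snd])
    have "(Y \<circ> fst) differentiable (at z0)" "(\<psi> \<circ> fst) differentiable (at z0)"
      by (rule differentiable_chain_at[OF fstd]; use Yd in \<open>simp add: z0_def\<close>)+
    then have fd: "(\<lambda>y. Y (fst y)) differentiable (at z0)" "(\<lambda>y. \<psi> (fst y)) differentiable (at z0)"
      by (simp_all add: o_def)
    have "(\<lambda>y. snd y \<bullet> Y (fst y)) differentiable (at z0)"
      using has_derivative_inner[of snd _ z0 UNIV "\<lambda>y. Y (fst y)"] sd fd(1) unfolding differentiable_def by blast
    then have "l differentiable (at z0)" unfolding l_def[abs_def]
      by (rule differentiable_divide[OF _ fd(2)]) (use Y0 D(5) in \<open>simp add: z0_def\<close>)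
    then show ?thesis using that has_derivative_at_withinI unfolding differentiable_def by blast
  qed
  have u': "(u has_derivative (\<lambda>(h, k). fst w \<bullet> k - snd w \<bullet> h)) (at z0 within ?S)"
  proof -
    have 1: "((\<lambda>y. (fst y, snd y + s0 *\<^sub>R conormal)) has_derivative (\<lambda>h. (fst h, snd h + 0))) (at z0 within ?S)"
      by (intro has_derivative_Pair has_derivative_add has_derivative_const has_derivative_fst has_derivative_snd has_derivative_ident)
    have "(g has_derivative (\<lambda>(h, k). fst w \<bullet> k - snd w \<bullet> h)) (at (coords c (q, p)) within UNIV)"
      using w by (simp add: hamiltonian_vector_def g_def[abs_def])
    moreover have "coords c (q, p) = (fst z0, snd z0 + s0 *\<^sub>R conormal)" unfolding cz z0_def by simp
    ultimately have "(g has_derivative (\<lambda>(h, k). fst w \<bullet> k - snd w \<bullet> h)) (at (fst z0, snd z0 + s0 *\<^sub>R conormal))" by simp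
    then have 2: "(g has_derivative (\<lambda>(h, k). fst w \<bullet> k - snd w \<bullet> h)) (at (fst z0, snd z0 + s0 *\<^sub>R conormal) within (\<lambda>y. (fst y, snd y + s0 *\<^sub>R conormal)) ` ?S)"
      by (rule has_derivative_at_withinI)
    have "(\<lambda>h. (\<lambda>(h, k). fst w \<bullet> k - snd w \<bullet> h) (fst h, snd h + 0)) = (\<lambda>(h, k). fst w \<bullet> k - snd w \<bullet> h)"
      by (simp add: fun_eq_iff)
    then show ?thesis using has_derivative_in_compose[OF 1 2] unfolding u_def[abs_def] by simp
  qed
  have "(m has_derivative (\<lambda>(h, k). fst w \<bullet> k - snd w \<bullet> h)) (at z0 within ?S)"
    by (rule has_derivative_squeeze[OF l' u' S z0S, of "min d d2"]) (use near d d2 l0 u0 m0 in auto)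
  \<comment> \<open>Directions in \<open>?S\<close> see only the tangential part of
    \<open>snd w\<close>. Projecting it puts the vector into
    \<open>boundary_model \<times> boundary_model\<close>, as \<open>hamiltonian_vector\<close>
    demands; \<open>fst w\<close> lies there already, being the tangent vector
    \<open>v c\<close>.\<close>
  then have "(m has_derivative (\<lambda>(h, k). fst w \<bullet> k - tan_part (snd w) \<bullet> h)) (at z0 within ?S)"
  proof (rule has_derivative_cong_on_subspace[OF _ S z0S])
    show "bounded_linear (\<lambda>(h, k). fst w \<bullet> k - tan_part (snd w) \<bullet> h)"
      unfolding case_prod_beta
      by (intro bounded_linear_sub bounded_linear_inner_right_comp bounded_linear_fst bounded_linear_snd)
  qed (auto simp: tan_part)
  moreover have "fst w = v c"
    by (rule H_vector_fst[OF D(1) cA _ _ _ _ w]) (use D c in auto)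
  ultimately show ?thesis
    unfolding hamiltonian_vector_def z0 m_def[symmetric] using vV by (simp add: tan_part m_def[abs_def])
qed

text \<open>Minimise \<open>H\<close> over the covectors \<open>v1 + s \<cdot> conormal\<close>: at the minimum the maximising vector is tangent.\<close>

lemma tangent_covector_exists:
  assumes q: "q \<in> frontier U" and c: "c \<in> BC" "q \<in> fst c"
    and v1: "v1 \<in> \<xi> q" "v1 \<noteq> (\<lambda>d. 0)" "v1 c \<in> boundary_model" and e: "e \<in> \<xi> q" "e c \<bullet> conormal \<noteq> 0"
  shows "\<exists>p v. tangent_covector (q, p) v"
proof -
  have cA: "c \<in> A" by (rule BC_A[OF c(1)])
  \<comment> \<open>\<open>e\<close> is oriented towards positive normal component. The norm may be
    asymmetric, so the opposite vector \<open>e''\<close> has its own length.\<close>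
  define e' where "e' = (\<lambda>d. sgn (e c \<bullet> conormal) *\<^sub>R e d)"
  define e'' where "e'' = (\<lambda>d. - e' d)"
  define a where "a = e' c \<bullet> conormal"
  have a: "a > 0" using e(2) by (auto simp: a_def e'_def sgn_if)
  have xi: "e' \<in> \<xi> q" "e'' \<in> \<xi> q"
    using xi_combination[OF e(1) e(1), of "sgn (e c \<bullet> conormal)" 0] xi_combination[OF e(1) e(1), of "- sgn (e c \<bullet> conormal)" 0]
    by (simp_all add: e'_def e''_def)
  \<comment> \<open>The vector \<open>v1 c\<close> is read as a covector. Since \<open>v1\<close> is
    tangent, its pairing with every covector of the family is \<open>v1 c \<bullet> v1 c\<close>,
    which keeps \<open>H\<close> positive along the family.\<close>
  have "\<forall>s. \<exists>p. (q, p) \<in> cotangent_bundle UNIV A \<and> coords c (q, p) = (snd c q, v1 c + s *\<^sub>R conormal) \<and>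
      inv_into {z \<in> cotangent_bundle UNIV A. fst z \<in> fst c} (coords c) (snd c q, v1 c + s *\<^sub>R conormal) = (q, p)"
  proof
    fix s :: real
    obtain p where "(q, p) \<in> cotangent_bundle UNIV A" "coords c (q, p) = (snd c q, v1 c + s *\<^sub>R conormal)"
      "inv_into {z \<in> cotangent_bundle UNIV A. fst z \<in> fst c} (coords c) (snd c q, v1 c + s *\<^sub>R conormal) = (q, p)"
      by (rule M.lift_exists[OF cA c(2) UNIV_I])
    then show "\<exists>p. (q, p) \<in> cotangent_bundle UNIV A \<and> coords c (q, p) = (snd c q, v1 c + s *\<^sub>R conormal) \<and>
      inv_into {z \<in> cotangent_bundle UNIV A. fst z \<in> fst c} (coords c) (snd c q, v1 c + s *\<^sub>R conormal) = (q, p)" by blast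
  qed
  from choice[OF this] obtain P where P': "\<forall>s. (q, P s) \<in> cotangent_bundle UNIV A \<and> coords c (q, P s) = (snd c q, v1 c + s *\<^sub>R conormal) \<and>
      inv_into {z \<in> cotangent_bundle UNIV A. fst z \<in> fst c} (coords c) (snd c q, v1 c + s *\<^sub>R conormal) = (q, P s)" by blast
  then have P: "\<And>s. (q, P s) \<in> cotangent_bundle UNIV A" "\<And>s. coords c (q, P s) = (snd c q, v1 c + s *\<^sub>R conormal)"
    "\<And>s. inv_into {z \<in> cotangent_bundle UNIV A. fst z \<in> fst c} (coords c) (snd c q, v1 c + s *\<^sub>R conormal) = (q, P s)"
    by blast+
  define h where "h s = H (q, P s)" for s
  have pair: "pairing A q (P s) v = v1 c \<bullet> v c + s * (v c \<bullet> conormal)" if "v \<in> \<xi> q" for s v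
  proof -
    have "P s c = v1 c + s *\<^sub>R conormal" using P(2)[of s] by (simp add: coords_def)
    then show ?thesis
      using M.pairing_chart[OF _ xi_tangent[OF that] cA c(2), of "P s"] cotangent_bundleD[OF P(1)[of s]]
      by (simp add: inner_add_left inner_commute[of conormal])
  qed
  have hle: "v1 c \<bullet> v c + s * (v c \<bullet> conormal) \<le> h s * f q v" if "v \<in> \<xi> q" for s v
    using H_pairing_le[OF P(1)[of s], of v] that pair[OF that, of s] by (simp add: h_def)
  have v1c: "v1 c \<noteq> 0"
  proof
    assume "v1 c = 0"
    then have "v1 = (\<lambda>d. 0)" using M.tangent_eqI[OF xi_tangent[OF v1(1)] M.zero_tangent cA c(2)] by simp
    then show False using v1(2) by simp
  qed
  have fv1: "f q v1 > 0" using norm_nonneg[OF v1(1)] norm_zero[OF v1(1)] v1(2) by (simp add: order_le_less)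
  have hpos: "h s > 0" for s
  proof -
    have "0 < v1 c \<bullet> v1 c" using v1c by simp
    also have "\<dots> \<le> h s * f q v1" using hle[OF v1(1), of s] v1(3) by (simp add: boundary_model_def)
    finally show ?thesis using fv1 by (simp add: zero_less_mult_iff)
  qed
  define L where "L = max (f q e') (f q e'') + 1"
  have L: "L > 0" "f q e' \<le> L" "f q e'' \<le> L" using norm_nonneg[OF xi(1)] by (auto simp: L_def)
  define k where "k = \<bar>v1 c \<bullet> e' c\<bar>"
  \<comment> \<open>Testing with \<open>e'\<close> for \<open>s \<ge> 0\<close> and with
    \<open>e''\<close> for \<open>s < 0\<close> shows that \<open>h\<close> grows at least linearly
    in both directions, so it attains its minimum.\<close>
  have grow: "\<bar>s\<bar> * a - k \<le> h s * L" for s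
  proof (cases "s \<ge> 0")
    case True
    have "\<bar>s\<bar> * a - k \<le> v1 c \<bullet> e' c + s * a" using True by (simp add: k_def)
    also have "\<dots> \<le> h s * f q e'" using hle[OF xi(1), of s] by (simp add: a_def)
    also have "\<dots> \<le> h s * L" using L(2) hpos[of s] by (intro mult_left_mono) auto
    finally show ?thesis .
  next
    case False
    have "\<bar>s\<bar> * a - k \<le> v1 c \<bullet> e'' c + s * (e'' c \<bullet> conormal)" using False by (simp add: k_def a_def e''_def)
    also have "\<dots> \<le> h s * f q e''" using hle[OF xi(2), of s] .
    also have "\<dots> \<le> h s * L" using L(3) hpos[of s] by (intro mult_left_mono) auto
    finally show ?thesis .
  qed
  have hcont: "continuous_on UNIV h"
    unfolding continuous_on_iff
  proof (intro ballI allI impI)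
    fix s r :: real assume "0 < r"
    then obtain d where d: "d > 0" "\<And>z'. z' \<in> cotangent_bundle UNIV A \<Longrightarrow> fst z' \<in> fst c \<Longrightarrow> dist (coords c z') (coords c (q, P s)) < d \<Longrightarrow> \<bar>H z' - H (q, P s)\<bar> < r"
      using H_continuous[OF P(1)[of s] cA] c(2) by (metis fst_conv)
    have "dist (coords c (q, P t)) (coords c (q, P s)) = dist t s" for t
      by (simp add: P(2) dist_Pair_Pair dist_norm scaleR_diff_left[symmetric] conormal)
    then show "\<exists>d>0. \<forall>t\<in>UNIV. dist t s < d \<longrightarrow> dist (h t) (h s) < r"
      using d P(1) c(2) by (intro exI[of _ d]) (auto simp: h_def dist_real_def)
  qed
  \<comment> \<open>\<open>R\<close> solves \<open>R * a - k = L * (h 0 + 1)\<close>, so that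
    \<open>h s \<ge> h 0 + 1\<close> as soon as \<open>|s| \<ge> R\<close>.\<close>
  define R where "R = (k + L * (h 0 + 1)) / a"
  have R: "R > 0" unfolding R_def using a L(1) hpos[of 0] by (intro divide_pos_pos add_nonneg_pos mult_pos_pos) (auto simp: k_def)
  have out: "h 0 < h s" if "\<bar>s\<bar> \<ge> R" for s
  proof -
    have "R * a \<le> \<bar>s\<bar> * a" using that a by (intro mult_right_mono) auto
    then have "L * (h 0 + 1) \<le> h s * L" using grow[of s] a by (simp add: R_def)
    then have "h 0 + 1 \<le> h s" using L(1) by (simp add: mult.commute[of L])
    then show ?thesis by simp
  qed
  have "\<exists>s\<in>{-R..R}. \<forall>t\<in>{-R..R}. h s \<le> h t"
  proof (rule continuous_attains_inf)
    show "continuous_on {-R..R} h" by (rule continuous_on_subset[OF hcont]) simp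
  qed (use R in auto)
  then obtain s where s: "s \<in> {-R..R}" "\<And>t. t \<in> {-R..R} \<Longrightarrow> h s \<le> h t" by blast
  have smin: "h s \<le> h t" for t
  proof (cases "t \<in> {-R..R}")
    case False
    then have "\<bar>t\<bar> \<ge> R" by auto
    then show ?thesis using out[of t] s(2)[of 0] R by simp
  qed (rule s(2))
  have Hs: "H (q, P s) > 0" using hpos[of s] by (simp add: h_def)
  obtain w where w: "hamiltonian_vector UNIV A H c (q, P s) w"
    using H_vector_continuous[OF P(1) cA _ Hs] c(2) by auto
  obtain v where v: "v \<in> \<xi> q" "f q v = 1" "pairing A q (P s) v = h s"
    using H_maximiser[OF P(1) Hs] by (auto simp: h_def)
  have wv: "fst w = v c" by (rule H_vector_fst[OF P(1) cA _ _ _ _ w]) (use c v in \<open>auto simp: h_def\<close>)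
  let ?g = "\<lambda>y. H (inv_into {z \<in> cotangent_bundle UNIV A. fst z \<in> fst c} (coords c) y)"
  have "((\<lambda>t. ?g (coords c (q, P s) + t *\<^sub>R (0, conormal))) has_vector_derivative (\<lambda>(h, k). fst w \<bullet> k - snd w \<bullet> h) (0, conormal)) (at 0)"
    by (rule has_derivative_path[OF _ subspace_UNIV open_UNIV]) (use w in \<open>auto simp: hamiltonian_vector_def\<close>)
  then have "((\<lambda>t. ?g (coords c (q, P s) + t *\<^sub>R (0, conormal))) has_real_derivative v c \<bullet> conormal) (at 0)"
    by (simp add: has_real_derivative_iff_has_vector_derivative wv)
  moreover have "?g (coords c (q, P s) + t *\<^sub>R (0, conormal)) = h (s + t)" for t
  proof -
    have "coords c (q, P s) + t *\<^sub>R (0, conormal) = (snd c q, v1 c + (s + t) *\<^sub>R conormal)"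
      by (simp add: P(2) scaleR_add_left add.assoc)
    then show ?thesis using P(3)[of "s + t"] by (simp add: h_def)
  qed
  ultimately have der: "((\<lambda>t. h (s + t)) has_real_derivative v c \<bullet> conormal) (at 0)" by simp
  have vn: "v c \<bullet> conormal = 0"
    by (rule derivative_touching[OF der refl zero_less_one]) (use smin in simp)
  \<comment> \<open>Division by the minimal value puts the covector on the unit level and does not
    change its maximiser.\<close>
  obtain p where p: "(q, p) \<in> cotangent_bundle UNIV A" "coords c (q, p) = (snd c q, (1 / h s) *\<^sub>R P s c)"
    using M.lift_exists[OF cA c(2) UNIV_I] by blast
  have pp: "pairing A q p v' = pairing A q (P s) v' / h s" if "v' \<in> \<xi> q" for v'
  proof -
    have "p c = (1 / h s) *\<^sub>R P s c" using p(2) by (simp add: coords_def)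
    then show ?thesis
      using M.pairing_chart[OF _ xi_tangent[OF that] cA c(2), of "P s"] cotangent_bundleD[OF P(1)[of s]]
        M.pairing_chart[OF _ xi_tangent[OF that] cA c(2), of p] cotangent_bundleD[OF p(1)] by simp
  qed
  have pv: "pairing A q p v = 1" using pp[OF v(1)] v(3) hpos[of s] by simp
  have H1: "1 \<le> H (q, p)" using H_pairing_le[OF p(1), of v] v pv by simp
  then obtain v' where v': "v' \<in> \<xi> q" "f q v' = 1" "pairing A q p v' = H (q, p)"
    using H_maximiser[OF p(1)] by auto
  have "pairing A q (P s) v' \<le> h s" using H_pairing_le[OF P(1)[of s], of v'] v' by (simp add: h_def)
  then have "H (q, p) \<le> 1" using pp[OF v'(1)] v'(3) hpos[of s] by simp
  then have "tangent_covector (q, p) v"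
    using H1 p(1) q v pv vn c by (auto simp: tangent_covector_def boundary_model_def)
  then show ?thesis by blast
qed

end

section \<open>Billiard characteristics and their limits\<close>

locale billiard = billiard_boundary A \<xi> f U
  for A :: "('a::topological_space, 'e::euclidean_space) chart set" and \<xi> f U +
  fixes G :: "'a \<Rightarrow> real"
  assumes G: "table_function A \<xi> f U G"
begin

lemma lifted_in_chart:
  assumes c: "c \<in> A" and y: "fst y \<in> snd c ` fst c"
  shows "lifted G (inv_into {z \<in> cotangent_bundle UNIV A. fst z \<in> fst c} (coords c) y) = G (chart_inv c (fst y))"
proof -
  obtain q where q: "q \<in> fst c" "fst y = snd c q" using y by blast
  obtain p where "inv_into {z \<in> cotangent_bundle UNIV A. fst z \<in> fst c} (coords c) (snd c q, snd y) = (q, p)"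
    using M.lift_exists[OF c q(1) UNIV_I] by blast
  then show ?thesis using q M.chart_inv_eq[OF c q(1)] by (simp add: lifted_def) (metis prod.collapse fst_conv)
qed

lemma lifted_vector:
  assumes z: "z \<in> cotangent_bundle UNIV A" and c: "c \<in> A" "fst z \<in> fst c"
    and w: "hamiltonian_vector UNIV A (lifted G) c z w"
  shows "fst w = 0" "((G \<circ> chart_inv c) has_derivative (\<lambda>h. - (snd w \<bullet> h))) (at (snd c (fst z)))"
proof -
  let ?g = "\<lambda>y. lifted G (inv_into {z \<in> cotangent_bundle UNIV A. fst z \<in> fst c} (coords c) y)"
  let ?x = "snd c (fst z)"
  have g: "(?g has_derivative (\<lambda>(h, k). fst w \<bullet> k - snd w \<bullet> h)) (at (coords c z))"
    using w by (simp add: hamiltonian_vector_def)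
  have op: "open (snd c ` fst c)" using is_chart[OF c(1)] by (simp add: is_chart_def)
  have "fst w \<bullet> k = 0" for k
  proof -
    have "((\<lambda>t. ?g (coords c z + t *\<^sub>R (0, k))) has_vector_derivative (\<lambda>(h, k). fst w \<bullet> k - snd w \<bullet> h) (0, k)) (at 0)"
      by (rule has_derivative_path[OF g subspace_UNIV open_UNIV]) auto
    then have "((\<lambda>t::real. G (chart_inv c ?x)) has_real_derivative fst w \<bullet> k) (at 0)"
      using lifted_in_chart[OF c(1)] c(2) by (simp add: has_real_derivative_iff_has_vector_derivative coords_def)
    then show ?thesis using DERIV_unique[OF _ DERIV_const] by blast
  qed
  then show "fst w = 0" by (metis inner_eq_zero_iff)
  have 1: "((\<lambda>x. (x, snd z c)) has_derivative (\<lambda>h. (h, 0))) (at ?x)"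
    by (auto intro!: derivative_eq_intros)
  have 2: "(?g has_derivative (\<lambda>(h, k). fst w \<bullet> k - snd w \<bullet> h)) (at (?x, snd z c))"
    using g by (simp add: coords_def)
  have "((\<lambda>x. ?g (x, snd z c)) has_derivative (\<lambda>h. - (snd w \<bullet> h))) (at ?x)"
    using has_derivative_compose[OF 1 2] by simp
  then show "((G \<circ> chart_inv c) has_derivative (\<lambda>h. - (snd w \<bullet> h))) (at ?x)"
    by (rule has_derivative_transform_within_open[OF _ op]) (use c lifted_in_chart[OF c(1)] in auto)
qed

text \<open>\<open>G\<close> is constant on the boundary, so its differential annihilates the
  hyperplane of tangent vectors and is a multiple of \<open>conormal\<close> in a boundary
  chart.\<close>

lemma lifted_vector_boundary:
  assumes z: "z \<in> cotangent_bundle UNIV A" and c: "c \<in> BC" "fst z \<in> fst c" and q: "fst z \<in> frontier U"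
    and w: "hamiltonian_vector UNIV A (lifted G) c z w"
  shows "\<exists>r. w = (0, r *\<^sub>R conormal)"
proof -
  have cA: "c \<in> A" by (rule BC_A[OF c(1)])
  note lv = lifted_vector[OF z cA c(2) w]
  let ?x = "snd c (fst z)"
  obtain r where r: "frontier U = G -` {r}" using G by (auto simp: table_function_def)
  obtain Q where Q: "open Q" "?x \<in> Q" "Q \<inter> boundary_model \<subseteq> snd c ` (fst c \<inter> fst c \<inter> frontier U)"
    using boundary_open[OF c(1) cA c(2,2) q] by blast
  have x: "?x \<in> boundary_model" using frontier_iff[OF c] q by simp
  have "snd w \<bullet> h = 0" if h: "h \<in> boundary_model" for h
  proof -
    have "((\<lambda>_. r) has_derivative (\<lambda>h. 0)) (at ?x within Q \<inter> boundary_model)" by simp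
    moreover have "((G \<circ> chart_inv c) has_derivative (\<lambda>h. 0)) (at ?x within Q \<inter> boundary_model)"
    proof (rule has_derivative_transform[OF _ _ calculation])
      show "?x \<in> Q \<inter> boundary_model" using Q x by blast
      fix y assume "y \<in> Q \<inter> boundary_model"
      then obtain q' where "y = snd c q'" "q' \<in> fst c" "q' \<in> frontier U" using Q(3) by blast
      then show "(G \<circ> chart_inv c) y = r" using r M.chart_inv_eq[OF cA] by auto
    qed
    ultimately show ?thesis
      using has_derivative_unique_on_subspace[OF has_derivative_at_withinI[OF lv(2)] _ subspace_boundary_model Q(1,2) order_refl x h] by fastforce
  qed
  from this[OF tan_part(1)] have "tan_part (snd w) \<bullet> tan_part (snd w) = 0"
    using tan_part(2)[OF tan_part(1)] by metis
  then have "tan_part (snd w) = 0" by simp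
  then have "snd w = (snd w \<bullet> conormal) *\<^sub>R conormal" using tan_part(4)[of "snd w"] by simp
  then show ?thesis using lv(1) by (metis prod.collapse)
qed

lemma interval_islimpt:
  fixes J :: "real set"
  assumes "is_interval J" "a \<in> J" "b \<in> J" "a < b" "t \<in> J"
  shows "at t within J \<noteq> bot"
proof -
  have "t islimpt J"
    by (rule connected_imp_perfect) (use assms is_interval_connected in force)+
  then show ?thesis using trivial_limit_within by blast
qed

lemma speed_eq:
  assumes nb: "at t within J \<noteq> bot" and v: "velocity UNIV A \<alpha> J t v"
  shows "speed A f \<alpha> J t = f (\<alpha> t) v"
proof -
  have "v' = v" if v': "velocity UNIV A \<alpha> J t v'" for v'
  proof -
    obtain c where c: "c \<in> A" "\<alpha> t \<in> fst c" using chart_exists by blast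
    have "((\<lambda>s. snd c (\<alpha> s)) has_vector_derivative v c) (at t within J)"
      "((\<lambda>s. snd c (\<alpha> s)) has_vector_derivative v' c) (at t within J)"
      using v v' c by (auto simp: velocity_def)
    then have "v' c = v c" using vector_derivative_unique_within[OF nb] by blast
    then show ?thesis using M.tangent_eqI[of v' "\<alpha> t" v c] v v' c by (auto simp: velocity_def)
  qed
  then have "(THE v. velocity UNIV A \<alpha> J t v) = v" using v by (intro the_equality)
  then show ?thesis by (simp add: speed_def)
qed

lemma speed_H:
  assumes nb: "at t within J \<noteq> bot" and l: "lam t \<in> unit_level A \<xi> f" and fl: "flows_along UNIV A H lam J t"
  shows "speed A f (\<lambda>t. fst (lam t)) J t = 1"
proof -
  have z: "lam t \<in> cotangent_bundle UNIV A" "H (lam t) = 1" using l by (auto simp: unit_level_def)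
  obtain v where v: "v \<in> \<xi> (fst (lam t))" "f (fst (lam t)) v = 1" "pairing A (fst (lam t)) (snd (lam t)) v = H (lam t)"
    using H_maximiser[OF z(1)] z(2) by auto
  have "velocity UNIV A (\<lambda>t. fst (lam t)) J t v"
    unfolding velocity_def
  proof (intro conjI ballI impI xi_tangent v(1))
    fix c assume c: "c \<in> A" "fst (lam t) \<in> fst c"
    then obtain w where w: "hamiltonian_vector UNIV A H c (lam t) w" "((\<lambda>s. coords c (lam s)) has_vector_derivative w) (at t within J)"
      using fl unfolding flows_along_def by blast
    have "fst w = v c" by (rule H_vector_fst[OF z(1) c v w(1)])
    then show "((\<lambda>s. snd c (fst (lam s))) has_vector_derivative v c) (at t within J)"
      using bounded_linear.has_vector_derivative[OF bounded_linear_fst w(2)] by (simp add: coords_def)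
  qed
  from speed_eq[OF nb this] show ?thesis using v by simp
qed

lemma speed_G:
  assumes nb: "at t within J \<noteq> bot" and z: "lam t \<in> cotangent_bundle UNIV A" and fl: "flows_along UNIV A (lifted G) lam J t"
  shows "speed A f (\<lambda>t. fst (lam t)) J t = 0"
proof -
  have "velocity UNIV A (\<lambda>t. fst (lam t)) J t (\<lambda>d. 0)"
    unfolding velocity_def
  proof (intro conjI ballI impI M.zero_tangent)
    fix c assume c: "c \<in> A" "fst (lam t) \<in> fst c"
    then obtain w where w: "hamiltonian_vector UNIV A (lifted G) c (lam t) w" "((\<lambda>s. coords c (lam s)) has_vector_derivative w) (at t within J)"
      using fl unfolding flows_along_def by blast
    show "((\<lambda>s. snd c (fst (lam s))) has_vector_derivative 0) (at t within J)"
      using bounded_linear.has_vector_derivative[OF bounded_linear_fst w(2)] lifted_vector(1)[OF z c w(1)] by (simp add: coords_def)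
  qed
  from speed_eq[OF nb this] show ?thesis using norm_zero[OF xi_zero] by simp
qed

text \<open>Arclength grows at rate 1 along \<open>X_f\<close> and rests along \<open>X_G\<close>.
  The two distinct points of \<open>J\<close> make every time a limit point of \<open>J\<close>; at
  an isolated time the velocity would not be unique and \<open>speed\<close> would have no definite
  value.\<close>

lemma characteristic_cases:
  assumes bc: "billiard_characteristic A \<xi> f U G lam J" and ab: "a \<in> J" "b \<in> J" "a < b"
  obtains N where "negligible N" "\<And>t. t \<in> J - N \<Longrightarrow>
      lam t \<in> unit_level A \<xi> f \<and> flows_along UNIV A H lam J t \<and> speed A f (\<lambda>t. fst (lam t)) J t = 1 \<or>
      fst (lam t) \<in> frontier U \<and> lam t \<in> cotangent_bundle UNIV A \<and> flows_along UNIV A (lifted G) lam J t \<and> speed A f (\<lambda>t. fst (lam t)) J t = 0"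
proof -
  have "AE t in lebesgue. t \<in> J \<longrightarrow>
        lam t \<in> unit_level A \<xi> f \<and> fst (lam t) \<in> U \<and> flows_along UNIV A H lam J t \<or>
        lam t \<in> unit_disc A \<xi> f \<and> fst (lam t) \<in> frontier U \<and> flows_along UNIV A (lifted G) lam J t"
    using bc unfolding billiard_characteristic_def by blast
  then obtain N where N: "N \<in> null_sets lebesgue" "{t \<in> space lebesgue. \<not> (t \<in> J \<longrightarrow>
        lam t \<in> unit_level A \<xi> f \<and> fst (lam t) \<in> U \<and> flows_along UNIV A H lam J t \<or>
        lam t \<in> unit_disc A \<xi> f \<and> fst (lam t) \<in> frontier U \<and> flows_along UNIV A (lifted G) lam J t)} \<subseteq> N"
    unfolding eventually_ae_filter by blast
  have J: "is_interval J" using bc by (simp add: billiard_characteristic_def)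
  show ?thesis
  proof (rule that[of N])
    show "negligible N" using N(1) by (simp add: negligible_iff_null_sets)
    fix t assume t: "t \<in> J - N"
    have nb: "at t within J \<noteq> bot" using interval_islimpt[OF J ab] t by blast
    have "lam t \<in> unit_level A \<xi> f \<and> fst (lam t) \<in> U \<and> flows_along UNIV A H lam J t \<or>
        lam t \<in> unit_disc A \<xi> f \<and> fst (lam t) \<in> frontier U \<and> flows_along UNIV A (lifted G) lam J t"
      using N(2) t by auto
    then show "lam t \<in> unit_level A \<xi> f \<and> flows_along UNIV A H lam J t \<and> speed A f (\<lambda>t. fst (lam t)) J t = 1 \<or>
      fst (lam t) \<in> frontier U \<and> lam t \<in> cotangent_bundle UNIV A \<and> flows_along UNIV A (lifted G) lam J t \<and> speed A f (\<lambda>t. fst (lam t)) J t = 0"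
      using speed_H[OF nb] speed_G[OF nb] unfolding unit_disc_def by blast
  qed
qed

abbreviation arclength :: "(real \<Rightarrow> ('a, 'e) cotangent) \<Rightarrow> real set \<Rightarrow> (real \<Rightarrow> real) \<Rightarrow> bool" where
  "arclength lam J s \<equiv> \<forall>a\<in>J. \<forall>b\<in>J. a \<le> b \<longrightarrow> (speed A f (\<lambda>t. fst (lam t)) J has_integral (s b - s a)) {a..b}"

lemma arclength_lipschitz:
  assumes bc: "billiard_characteristic A \<xi> f U G lam J" and arc: "arclength lam J s" and ab: "a \<in> J" "b \<in> J" "a \<le> b"
  shows "0 \<le> s b - s a \<and> s b - s a \<le> b - a"
proof (cases "a = b")
  case False
  then have lt: "a < b" using ab by simp
  obtain N where N: "negligible N" "\<And>t. t \<in> J - N \<Longrightarrow>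
      lam t \<in> unit_level A \<xi> f \<and> flows_along UNIV A H lam J t \<and> speed A f (\<lambda>t. fst (lam t)) J t = 1 \<or>
      fst (lam t) \<in> frontier U \<and> lam t \<in> cotangent_bundle UNIV A \<and> flows_along UNIV A (lifted G) lam J t \<and> speed A f (\<lambda>t. fst (lam t)) J t = 0"
    using characteristic_cases[OF bc ab(1,2) lt] by blast
  have J: "is_interval J" using bc by (simp add: billiard_characteristic_def)
  have sub: "{a..b} \<subseteq> J" by (rule interval_Icc_subset[OF J ab(1,2)])
  let ?v = "speed A f (\<lambda>t. fst (lam t)) J"
  have int: "(?v has_integral (s b - s a)) {a..b}" using arc ab by blast
  define v' where "v' t = (if t \<in> N then 0 else ?v t)" for t
  have int': "(v' has_integral (s b - s a)) {a..b}"
    by (rule has_integral_spike[OF N(1) _ int]) (simp add: v'_def)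
  have v': "0 \<le> v' t \<and> v' t \<le> 1" if "t \<in> {a..b}" for t
  proof -
    have "t \<in> J" using that sub by blast
    then show ?thesis using N(2)[of t] by (cases "t \<in> N") (auto simp: v'_def)
  qed
  have "0 \<le> s b - s a" by (rule has_integral_nonneg[OF int']) (use v' in auto)
  moreover have "s b - s a \<le> b - a"
  proof -
    have "((\<lambda>_. 1::real) has_integral (b - a)) {a..b}" using has_integral_const_real[of "1::real" a b] ab by simp
    from has_integral_le[OF int' this] v' show ?thesis by simp
  qed
  ultimately show ?thesis by simp
qed simp

text \<open>Off a null set the velocity is \<open>X_f\<close> with speed 1 or \<open>X_G\<close>
  with speed 0, and \<open>P\<close> annihilates \<open>X_G\<close> over the boundary. In both cases
  the derivative of the image under \<open>P\<close> differs from the speed times \<open>y\<close>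
  by at most \<epsilon> times the speed. Integration yields an estimate in which arclength has taken
  the place of time.\<close>

lemma characteristic_estimate_lipschitz:
  fixes P :: "'e \<times> 'e \<Rightarrow> 'b::euclidean_space"
  assumes bc: "billiard_characteristic A \<xi> f U G lam J" and arc: "arclength lam J s" and ab: "a \<in> J" "b \<in> J" "a \<le> b"
    and c: "c \<in> BC" "\<And>t. t \<in> {a..b} \<Longrightarrow> fst (lam t) \<in> fst c" and lip: "C-lipschitz_on {a..b} (\<lambda>t. coords c (lam t))"
    and P: "bounded_linear P" "\<And>r. P (0, r *\<^sub>R conormal) = 0"
    and y: "\<And>t w. t \<in> {a..b} \<Longrightarrow> lam t \<in> unit_level A \<xi> f \<Longrightarrow> hamiltonian_vector UNIV A H c (lam t) w \<Longrightarrow> norm (P w - y) \<le> \<epsilon>"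
  shows "norm (P (coords c (lam b)) - P (coords c (lam a)) - (s b - s a) *\<^sub>R y) \<le> \<epsilon> * (s b - s a)"
proof (cases "a = b")
  case False
  then have lt: "a < b" using ab by simp
  obtain N where N: "negligible N" "\<And>t. t \<in> J - N \<Longrightarrow>
      lam t \<in> unit_level A \<xi> f \<and> flows_along UNIV A H lam J t \<and> speed A f (\<lambda>t. fst (lam t)) J t = 1 \<or>
      fst (lam t) \<in> frontier U \<and> lam t \<in> cotangent_bundle UNIV A \<and> flows_along UNIV A (lifted G) lam J t \<and> speed A f (\<lambda>t. fst (lam t)) J t = 0"
    using characteristic_cases[OF bc ab(1,2) lt] by blast
  have J: "is_interval J" using bc by (simp add: billiard_characteristic_def)
  have sub: "{a..b} \<subseteq> J" by (rule interval_Icc_subset[OF J ab(1,2)])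
  let ?v = "speed A f (\<lambda>t. fst (lam t)) J"
  define g where "g t = P (coords c (lam t))" for t
  have cA: "c \<in> A" by (rule BC_A[OF c(1)])
  have "\<forall>t\<in>{a..b} - N. \<exists>D. (g has_vector_derivative D) (at t within {a..b}) \<and> norm (D - ?v t *\<^sub>R y) \<le> \<epsilon> * ?v t"
  proof
    fix t assume t: "t \<in> {a..b} - N"
    then have fc: "fst (lam t) \<in> fst c" using c by blast
    have gw: "(g has_vector_derivative P w) (at t within {a..b})"
      if "((\<lambda>s. coords c (lam s)) has_vector_derivative w) (at t within J)" for w
      unfolding g_def[abs_def]
      by (rule bounded_linear.has_vector_derivative[OF P(1) has_vector_derivative_within_subset[OF that sub]])
    consider "lam t \<in> unit_level A \<xi> f" "flows_along UNIV A H lam J t" "?v t = 1"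
      | "fst (lam t) \<in> frontier U" "lam t \<in> cotangent_bundle UNIV A" "flows_along UNIV A (lifted G) lam J t" "?v t = 0"
      using N(2)[of t] t sub by blast
    then show "\<exists>D. (g has_vector_derivative D) (at t within {a..b}) \<and> norm (D - ?v t *\<^sub>R y) \<le> \<epsilon> * ?v t"
    proof cases
      case 1
      then obtain w where w: "hamiltonian_vector UNIV A H c (lam t) w" "((\<lambda>s. coords c (lam s)) has_vector_derivative w) (at t within J)"
        using cA fc unfolding flows_along_def by blast
      then show ?thesis using gw[OF w(2)] y[OF _ 1(1) w(1)] t 1(3) by (intro exI[of _ "P w"]) simp
    next
      case 2
      then obtain w where w: "hamiltonian_vector UNIV A (lifted G) c (lam t) w" "((\<lambda>s. coords c (lam s)) has_vector_derivative w) (at t within J)"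
        using cA fc unfolding flows_along_def by blast
      obtain r where "w = (0, r *\<^sub>R conormal)" using lifted_vector_boundary[OF 2(2) c(1) fc 2(1) w(1)] by blast
      then have "P w = 0" using P(2) by simp
      then show ?thesis using gw[OF w(2)] 2(4) by (intro exI[of _ "P w"]) simp
    qed
  qed
  from bchoice[OF this] obtain D where D: "\<And>t. t \<in> {a..b} - N \<Longrightarrow> (g has_vector_derivative D t) (at t within {a..b})"
    "\<And>t. t \<in> {a..b} - N \<Longrightarrow> norm (D t - ?v t *\<^sub>R y) \<le> \<epsilon> * ?v t" by blast
  obtain C' where "C'-lipschitz_on {a..b} g"
  proof -
    obtain B where B0: "0 \<le> B" "\<And>x. norm (P x) \<le> norm x * B" using bounded_linear.nonneg_bounded[OF P(1)] by blast
    have "dist (P x) (P x') \<le> B * dist x x'" for x x'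
      using B0(2)[of "x - x'"] linear_diff[OF bounded_linear.linear[OF P(1)], of x x'] by (simp add: dist_norm mult.commute)
    then have B: "B-lipschitz_on UNIV P" using B0(1) by (intro lipschitz_onI) auto
    have "(B * C)-lipschitz_on {a..b} (P \<circ> (\<lambda>t. coords c (lam t)))"
      by (rule lipschitz_on_compose[OF lip lipschitz_on_subset[OF B]]) simp
    then show ?thesis using that by (simp add: g_def[abs_def] o_def)
  qed
  then have Dint: "(D has_integral (g b - g a)) {a..b}"
    using lipschitz_fundamental_theorem_of_calculus[OF ab(3) _ N(1) D(1)] by blast
  have vint: "(?v has_integral (s b - s a)) {a..b}" using arc ab by blast
  have vy: "((\<lambda>t. ?v t *\<^sub>R y) has_integral (s b - s a) *\<^sub>R y) {a..b}"
    by (rule has_integral_scaleR_left[OF vint])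
  have i1: "((\<lambda>t. if t \<in> N then 0 else D t - ?v t *\<^sub>R y) has_integral (g b - g a - (s b - s a) *\<^sub>R y)) {a..b}"
    by (rule has_integral_spike[OF N(1) _ has_integral_diff[OF Dint vy]]) simp
  have i2: "((\<lambda>t. if t \<in> N then 0 else \<epsilon> * ?v t) has_integral (\<epsilon> * (s b - s a))) {a..b}"
    by (rule has_integral_spike[OF N(1) _ has_integral_mult_right[OF vint]]) simp
  have "norm (integral {a..b} (\<lambda>t. if t \<in> N then 0 else D t - ?v t *\<^sub>R y)) \<le> integral {a..b} (\<lambda>t. if t \<in> N then 0 else \<epsilon> * ?v t)"
    by (rule Henstock_Kurzweil_Integration.integral_norm_bound_integral) (use i1 i2 D(2) in \<open>auto simp: has_integral_integrable\<close>)
  then show ?thesis using integral_unique[OF i1] integral_unique[OF i2] by (simp add: g_def)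
qed simp

text \<open>The conclusion is additive over adjacent intervals, so bisection reduces it to intervals
  on which the characteristic is Lipschitz in the chart.\<close>

lemma characteristic_estimate:
  fixes P :: "'e \<times> 'e \<Rightarrow> 'b::euclidean_space"
  assumes bc: "billiard_characteristic A \<xi> f U G lam J" and arc: "arclength lam J s" and ab: "a \<in> J" "b \<in> J" "a \<le> b"
    and c: "c \<in> BC" "\<And>t. t \<in> {a..b} \<Longrightarrow> fst (lam t) \<in> fst c"
    and P: "bounded_linear P" "\<And>r. P (0, r *\<^sub>R conormal) = 0"
    and y: "\<And>t w. t \<in> {a..b} \<Longrightarrow> lam t \<in> unit_level A \<xi> f \<Longrightarrow> hamiltonian_vector UNIV A H c (lam t) w \<Longrightarrow> norm (P w - y) \<le> \<epsilon>"
  shows "norm (P (coords c (lam b)) - P (coords c (lam a)) - (s b - s a) *\<^sub>R y) \<le> \<epsilon> * (s b - s a)"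
proof -
  have J: "is_interval J" using bc by (simp add: billiard_characteristic_def)
  have sub: "{a..b} \<subseteq> J" by (rule interval_Icc_subset[OF J ab(1,2)])
  have lc: "lipschitz_in_charts A (\<lambda>t. fst (lam t)) (\<lambda>c t. coords c (lam t)) J"
    using bc by (simp add: billiard_characteristic_def)
  define Q where "Q r t \<longleftrightarrow> (a \<le> r \<and> t \<le> b \<longrightarrow> norm (P (coords c (lam t)) - P (coords c (lam r)) - (s t - s r) *\<^sub>R y) \<le> \<epsilon> * (s t - s r))" for r t
  have "Q a b"
  proof (rule Bolzano[OF ab(3)])
    fix r t u assume Q: "Q r t" "Q t u" "r \<le> t" "t \<le> u"
    show "Q r u" unfolding Q_def
    proof
      assume ru: "a \<le> r \<and> u \<le> b"
      have "norm (P (coords c (lam t)) - P (coords c (lam r)) - (s t - s r) *\<^sub>R y) \<le> \<epsilon> * (s t - s r)"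
        "norm (P (coords c (lam u)) - P (coords c (lam t)) - (s u - s t) *\<^sub>R y) \<le> \<epsilon> * (s u - s t)"
        using Q ru by (auto simp: Q_def)
      from norm_triangle_mono[OF this]
      show "norm (P (coords c (lam u)) - P (coords c (lam r)) - (s u - s r) *\<^sub>R y) \<le> \<epsilon> * (s u - s r)"
        by (simp add: algebra_simps)
    qed
  next
    fix x assume x: "a \<le> x" "x \<le> b"
    then have "x \<in> J" "fst (lam x) \<in> fst c" using sub c by auto
    then obtain d C where d: "d > 0" "C-lipschitz_on (J \<inter> ball x d) (\<lambda>t. coords c (lam t))"
      using lc BC_A[OF c(1)] unfolding lipschitz_in_charts_def by blast
    show "\<exists>d>0. \<forall>a b. a \<le> x \<and> x \<le> b \<and> b - a < d \<longrightarrow> Q a b"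
    proof (intro exI[of _ d] conjI allI impI d(1))
      fix r t assume rt: "r \<le> x \<and> x \<le> t \<and> t - r < d"
      show "Q r t" unfolding Q_def
      proof
        assume art: "a \<le> r \<and> t \<le> b"
        have s2: "{r..t} \<subseteq> J \<inter> ball x d" using rt art sub by (auto simp: dist_real_def)
        show "norm (P (coords c (lam t)) - P (coords c (lam r)) - (s t - s r) *\<^sub>R y) \<le> \<epsilon> * (s t - s r)"
          by (rule characteristic_estimate_lipschitz[OF bc arc _ _ _ c(1) _ lipschitz_on_subset[OF d(2) s2] P y])
            (use rt art s2 c(2) in auto)
      qed
    qed
  qed
  then show ?thesis by (simp add: Q_def)
qed

end

section \<open>The limit characteristic and its rate with respect to \<sigma>\<close>

definition tangential :: "'e::euclidean_space \<times> 'e \<Rightarrow> 'e \<times> 'e" where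
  "tangential z = (fst z, tan_part (snd z))"

lemma tangential:
  "bounded_linear tangential" "tangential (0, r *\<^sub>R conormal) = 0" "fst (tangential z) = fst z"
proof -
  show "bounded_linear tangential" unfolding tangential_def[abs_def]
    by (intro bounded_linear_Pair bounded_linear_fst bounded_linear_compose[OF tan_part(5) bounded_linear_snd])
  show "tangential (0, r *\<^sub>R conormal) = 0" by (simp add: tangential_def tan_part_def conormal zero_prod_def)
  show "fst (tangential z) = fst z" by (simp add: tangential_def)
qed

lemma C0_loc_limit_eventually:
  assumes "C0_loc_limit T Js gs J g" "t \<in> J"
  shows "\<forall>\<^sub>F i in sequentially. t \<in> Js i"
proof -
  have "compact {t}" "{t} \<subseteq> J" "openin T (topspace T)" "g ` {t} \<subseteq> topspace T"
    using assms by (auto simp: C0_loc_limit_def continuous_map_def)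
  then have "\<forall>\<^sub>F i in sequentially. {t} \<subseteq> Js i \<and> gs i ` {t} \<subseteq> topspace T"
    using assms(1) unfolding C0_loc_limit_def by blast
  then show ?thesis by eventually_elim simp
qed

text \<open>The arclengths are normalised at \<open>t0\<close>, since their values there are not
  known to converge. Only they need the subsequence \<open>k\<close>; the characteristics converge
  along the full sequence.\<close>

locale limit_billiard = billiard A \<xi> f U G
  for A :: "('a::topological_space, 'e::euclidean_space) chart set" and \<xi> f U G +
  fixes lams Js ss lam J k \<sigma> t0
  assumes chars: "\<And>i::nat. billiard_characteristic A \<xi> f U G (lams i) (Js i)"
    and arcs: "\<And>i. arclength (lams i) (Js i) (ss i)"
    and J: "is_interval J"
    and lim: "C0_loc_limit (cotangent_topology UNIV A) Js lams J lam"
    and boundary: "\<And>t. t \<in> J \<Longrightarrow> fst (lam t) \<in> frontier U"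
    and k: "strict_mono k" and t0: "t0 \<in> J"
    and \<sigma>: "\<And>t. t \<in> J \<Longrightarrow> (\<lambda>i. ss (k i) t - ss (k i) t0) \<longlonglongrightarrow> \<sigma> t"
begin

lemma lam_bundle: "t \<in> J \<Longrightarrow> lam t \<in> cotangent_bundle UNIV A"
proof -
  assume t: "t \<in> J"
  have "continuous_map (top_of_set J) (cotangent_topology UNIV A) lam"
    using lim by (auto simp: C0_loc_limit_def)
  then have "lam t \<in> topspace (cotangent_topology UNIV A)" using t by (auto simp: continuous_map_def)
  then show ?thesis by (auto simp: cotangent_topology_def topology_generated_by_topspace)
qed

text \<open>The preimage of a coordinate ball about \<open>lam t\<close> is open in the cotangent
  topology. The limit maps a compact neighbourhood of \<open>t\<close> into it, hence so do all
  characteristics of large index.\<close>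

lemma coords_convergence:
  assumes t: "t \<in> J" and c: "c \<in> A" "fst (lam t) \<in> fst c" and r: "r > 0"
  shows "\<exists>d>0. (\<forall>s\<in>J \<inter> ball t d. fst (lam s) \<in> fst c) \<and>
    (\<forall>\<^sub>F i in sequentially. \<forall>s\<in>J \<inter> ball t d. s \<in> Js i \<and> lams i s \<in> cotangent_bundle UNIV A \<and> fst (lams i s) \<in> fst c \<and>
        dist (coords c (lams i s)) (coords c (lam t)) < r)"
proof -
  let ?T = "cotangent_topology UNIV A"
  define N where "N = {z \<in> cotangent_bundle UNIV A. fst z \<in> fst c \<and> coords c z \<in> ball (coords c (lam t)) r}"
  have N: "openin ?T N" unfolding cotangent_topology_def N_def
    by (rule topology_generated_by_Basis) (use c open_ball in blast)
  have "continuous_map (top_of_set J) ?T lam"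
    using lim by (auto simp: C0_loc_limit_def)
  then have "openin (top_of_set J) {s \<in> J. lam s \<in> N}"
    using N by (auto simp: continuous_map_def)
  moreover have "lam t \<in> N" using lam_bundle[OF t] c r by (simp add: N_def)
  ultimately obtain e where e: "e > 0" "J \<inter> ball t e \<subseteq> {s \<in> J. lam s \<in> N}"
    using t unfolding openin_contains_ball by (metis (no_types, lifting) Int_commute mem_Collect_eq)
  obtain a b d where d: "d > 0" "a \<le> t" "t \<le> b" "a \<in> J" "b \<in> J" "{a..b} \<subseteq> J \<inter> ball t e" "J \<inter> ball t d \<subseteq> {a..b}"
    using interval_neighbourhood[OF J t e(1)] by metis
  have "\<forall>\<^sub>F i in sequentially. {a..b} \<subseteq> Js i \<and> lams i ` {a..b} \<subseteq> N"
  proof -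
    have "compact {a..b}" "{a..b} \<subseteq> J" "lam ` {a..b} \<subseteq> N" using d(6) e(2) by auto
    then show ?thesis using lim N unfolding C0_loc_limit_def by blast
  qed
  then have ev: "\<forall>\<^sub>F i in sequentially. \<forall>s\<in>J \<inter> ball t d. s \<in> Js i \<and> lams i s \<in> cotangent_bundle UNIV A \<and> fst (lams i s) \<in> fst c \<and>
        dist (coords c (lams i s)) (coords c (lam t)) < r"
  proof eventually_elim
    case (elim i)
    show ?case
    proof
      fix s assume "s \<in> J \<inter> ball t d"
      then have "s \<in> {a..b}" using d(7) by blast
      then have "s \<in> Js i" "lams i s \<in> N" using elim by auto
      then show "s \<in> Js i \<and> lams i s \<in> cotangent_bundle UNIV A \<and> fst (lams i s) \<in> fst c \<and> dist (coords c (lams i s)) (coords c (lam t)) < r"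
        by (simp add: N_def dist_commute)
    qed
  qed
  have "fst (lam s) \<in> fst c" if "s \<in> J \<inter> ball t d" for s
  proof -
    have "s \<in> J \<inter> ball t e" using d(6,7) that by blast
    then show ?thesis using e(2) by (auto simp: N_def)
  qed
  then show ?thesis using d(1) ev by blast
qed

lemma eventually_coords:
  assumes t: "t \<in> J" and c: "c \<in> A" "fst (lam t) \<in> fst c" and r: "r > 0"
  shows "\<forall>\<^sub>F i in sequentially. t \<in> Js i \<and> lams i t \<in> cotangent_bundle UNIV A \<and> fst (lams i t) \<in> fst c \<and> dist (coords c (lams i t)) (coords c (lam t)) < r"
proof -
  obtain d where "d > 0" "\<forall>\<^sub>F i in sequentially. \<forall>s\<in>J \<inter> ball t d. s \<in> Js i \<and> lams i s \<in> cotangent_bundle UNIV A \<and> fst (lams i s) \<in> fst c \<and>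
        dist (coords c (lams i s)) (coords c (lam t)) < r"
    using coords_convergence[OF assms] by blast
  then show ?thesis using t by (elim eventually_mono) auto
qed

lemma coords_tendsto:
  assumes t: "t \<in> J" and c: "c \<in> A" "fst (lam t) \<in> fst c"
  shows "(\<lambda>i. coords c (lams i t)) \<longlonglongrightarrow> coords c (lam t)"
  by (rule tendstoI) (rule eventually_mono[OF eventually_coords[OF assms]], auto)

lemma H_lams: "t \<in> Js i \<Longrightarrow> lams i t \<in> cotangent_bundle UNIV A \<and> H (lams i t) \<le> 1"
  using chars[of i] unfolding billiard_characteristic_def unit_level_def unit_disc_def by auto

lemma H_lam: assumes t: "t \<in> J" shows "H (lam t) \<le> 1"
proof (rule ccontr)
  assume "\<not> H (lam t) \<le> 1"
  then have e: "H (lam t) - 1 > 0" by simp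
  obtain c where c: "c \<in> A" "fst (lam t) \<in> fst c" using chart_exists by blast
  obtain d where d: "d > 0" "\<And>z. z \<in> cotangent_bundle UNIV A \<Longrightarrow> fst z \<in> fst c \<Longrightarrow> dist (coords c z) (coords c (lam t)) < d \<Longrightarrow> \<bar>H z - H (lam t)\<bar> < H (lam t) - 1"
    using H_continuous[OF lam_bundle[OF t] c e] by blast
  have "\<forall>\<^sub>F i in sequentially. False"
    using eventually_coords[OF t c d(1)]
  proof eventually_elim
    case (elim i)
    then have "\<bar>H (lams i t) - H (lam t)\<bar> < H (lam t) - 1" "H (lams i t) \<le> 1" using d(2) H_lams by blast+
    then show False by linarith
  qed
  then show False by simp
qed

lemma \<sigma>_le:
  assumes ab: "a \<in> J" "b \<in> J" "a \<le> b"
  shows "0 \<le> \<sigma> b - \<sigma> a" "\<sigma> b - \<sigma> a \<le> b - a"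
proof -
  have diff: "(\<lambda>i. (ss (k i) b - ss (k i) t0) - (ss (k i) a - ss (k i) t0)) \<longlonglongrightarrow> \<sigma> b - \<sigma> a"
    by (intro tendsto_diff \<sigma> ab)
  have ev: "\<forall>\<^sub>F i in sequentially. 0 \<le> ss (k i) b - ss (k i) a \<and> ss (k i) b - ss (k i) a \<le> b - a"
    using eventually_subseq[OF k C0_loc_limit_eventually[OF lim ab(1)]] eventually_subseq[OF k C0_loc_limit_eventually[OF lim ab(2)]]
    by eventually_elim (rule arclength_lipschitz[OF chars arcs], use ab in auto)
  show "0 \<le> \<sigma> b - \<sigma> a"
    by (rule tendsto_lowerbound[OF diff]) (use ev in \<open>auto elim: eventually_mono\<close>)
  show "\<sigma> b - \<sigma> a \<le> b - a"
    by (rule tendsto_upperbound[OF diff]) (use ev in \<open>auto elim: eventually_mono\<close>)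
qed

lemma \<sigma>_mono: "mono_on J \<sigma>"
  using \<sigma>_le(1) by (auto simp: mono_on_def)

lemma \<sigma>_continuous: "continuous_on J \<sigma>"
proof -
  have "\<bar>\<sigma> x - \<sigma> y\<bar> \<le> 1 * \<bar>x - y\<bar>" if "x \<in> J" "y \<in> J" for x y
    using \<sigma>_le[OF that] \<sigma>_le[OF that(2,1)] by (cases "x \<le> y") auto
  then have "1-lipschitz_on J \<sigma>" by (intro lipschitz_onI) (auto simp: dist_real_def)
  then show ?thesis by (rule lipschitz_on_continuous_on)
qed

definition rest :: "real \<Rightarrow> ('a, 'e) cotangent" where
  "rest t = (fst (lam t), restrict_covector (fst (lam t)) (snd (lam t)))"

lemma rest:
  assumes t: "t \<in> J"
  shows "fst (rest t) = fst (lam t)" "rest t \<in> cotangent_bundle boundary_model BA"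
    and "c \<in> BC \<Longrightarrow> fst (lam t) \<in> fst c \<Longrightarrow> coords (bd c) (rest t) = tangential (coords c (lam t))"
proof -
  have p: "snd (lam t) \<in> cotangent_space UNIV A (fst (lam t))" using cotangent_bundleD[OF lam_bundle[OF t]] .
  show "fst (rest t) = fst (lam t)" by (simp add: rest_def)
  obtain c where c: "c \<in> BC" "fst (lam t) \<in> fst c" using BC_exists[OF boundary[OF t]] by blast
  have "fst (lam t) \<in> fst (bd c)" "bd c \<in> BA" using c boundary[OF t] by (auto simp: bd bd_in)
  then show "rest t \<in> cotangent_bundle boundary_model BA"
    using restrict_covector[OF p boundary[OF t]] by (auto simp: cotangent_bundle_def rest_def)
  show "c \<in> BC \<Longrightarrow> fst (lam t) \<in> fst c \<Longrightarrow> coords (bd c) (rest t) = tangential (coords c (lam t))" for c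
    using restrict_covector_chart[OF p _ _ boundary[OF t], of c] by (simp add: coords_def rest_def tangential_def bd)
qed

text \<open>\<open>y\<close> is the derivative of the restricted limit characteristic with respect to \<open>\<sigma>\<close> at the time \<open>t\<close>.\<close>

definition rate :: "('a, 'e) chart \<Rightarrow> real \<Rightarrow> 'e \<times> 'e \<Rightarrow> bool" where
  "rate c t y \<longleftrightarrow> (\<forall>e>0. \<exists>d>0. \<forall>a\<in>J \<inter> ball t d. \<forall>b\<in>J \<inter> ball t d. a \<le> b \<longrightarrow>
     norm (coords (bd c) (rest b) - coords (bd c) (rest a) - (\<sigma> b - \<sigma> a) *\<^sub>R y) \<le> e * (\<sigma> b - \<sigma> a))"

lemma limit_inequality:
  assumes ab: "a \<in> J" "b \<in> J" and c: "c \<in> BC" "fst (lam a) \<in> fst c" "fst (lam b) \<in> fst c"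
    and ev: "\<forall>\<^sub>F i in sequentially. norm (tangential (coords c (lams i b)) - tangential (coords c (lams i a)) - (ss i b - ss i a) *\<^sub>R y) \<le> e * (ss i b - ss i a)"
  shows "norm (coords (bd c) (rest b) - coords (bd c) (rest a) - (\<sigma> b - \<sigma> a) *\<^sub>R y) \<le> e * (\<sigma> b - \<sigma> a)"
proof -
  have cA: "c \<in> A" by (rule BC_A[OF c(1)])
  have s: "(\<lambda>i. ss (k i) b - ss (k i) a) \<longlonglongrightarrow> \<sigma> b - \<sigma> a"
    using tendsto_diff[OF \<sigma>[OF ab(2)] \<sigma>[OF ab(1)]] by simp
  have z: "(\<lambda>i. tangential (coords c (lams (k i) t))) \<longlonglongrightarrow> coords (bd c) (rest t)" if "t \<in> J" "fst (lam t) \<in> fst c" for t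
    unfolding rest(3)[OF that(1) c(1) that(2)]
    by (rule bounded_linear.tendsto[OF tangential(1)])
      (use LIMSEQ_subseq_LIMSEQ[OF coords_tendsto[OF that(1) cA that(2)] k] in \<open>simp add: o_def\<close>)
  show ?thesis
  proof (rule tendsto_le[OF sequentially_bot])
    show "(\<lambda>i. e * (ss (k i) b - ss (k i) a)) \<longlonglongrightarrow> e * (\<sigma> b - \<sigma> a)" by (intro tendsto_intros s)
    show "(\<lambda>i. norm (tangential (coords c (lams (k i) b)) - tangential (coords c (lams (k i) a)) - (ss (k i) b - ss (k i) a) *\<^sub>R y))
      \<longlonglongrightarrow> norm (coords (bd c) (rest b) - coords (bd c) (rest a) - (\<sigma> b - \<sigma> a) *\<^sub>R y)"
      by (intro tendsto_intros z s ab c)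
    show "\<forall>\<^sub>F i in sequentially. norm (tangential (coords c (lams (k i) b)) - tangential (coords c (lams (k i) a)) - (ss (k i) b - ss (k i) a) *\<^sub>R y) \<le> e * (ss (k i) b - ss (k i) a)"
      by (rule eventually_subseq[OF k ev])
  qed
qed

text \<open>The bound on tangential Hamiltonian vectors is first integrated along each approximating
  characteristic, which for large index stays in the \<open>r\<close>-ball during a fixed time
  interval. Only the integrated inequality is passed to the limit.\<close>

lemma limit_estimate:
  assumes t: "t \<in> J" and c: "c \<in> BC" "fst (lam t) \<in> fst c" and r: "r > 0"
    and y: "\<And>z w. z \<in> unit_level A \<xi> f \<Longrightarrow> fst z \<in> fst c \<Longrightarrow> dist (coords c z) (coords c (lam t)) < r \<Longrightarrow> hamiltonian_vector UNIV A H c z w \<Longrightarrow> norm (tangential w - y) \<le> e"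
  shows "\<exists>d>0. \<forall>a\<in>J \<inter> ball t d. \<forall>b\<in>J \<inter> ball t d. a \<le> b \<longrightarrow>
     norm (coords (bd c) (rest b) - coords (bd c) (rest a) - (\<sigma> b - \<sigma> a) *\<^sub>R y) \<le> e * (\<sigma> b - \<sigma> a)"
proof -
  have cA: "c \<in> A" by (rule BC_A[OF c(1)])
  obtain d where d: "d > 0" "\<forall>s\<in>J \<inter> ball t d. fst (lam s) \<in> fst c"
    "\<forall>\<^sub>F i in sequentially. \<forall>s\<in>J \<inter> ball t d. s \<in> Js i \<and> lams i s \<in> cotangent_bundle UNIV A \<and> fst (lams i s) \<in> fst c \<and>
        dist (coords c (lams i s)) (coords c (lam t)) < r"
    using coords_convergence[OF t cA c(2) r] by blast
  show ?thesis
  proof (intro exI[of _ d] conjI ballI impI d(1))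
    fix a b assume ab: "a \<in> J \<inter> ball t d" "b \<in> J \<inter> ball t d" "a \<le> b"
    have sub: "{a..b} \<subseteq> J \<inter> ball t d"
    proof
      fix s assume s: "s \<in> {a..b}"
      have "s \<in> J" using interval_Icc_subset[OF J, of a b] ab s by blast
      moreover have "dist t s < d" using ab s by (auto simp: dist_real_def)
      ultimately show "s \<in> J \<inter> ball t d" by simp
    qed
    show "norm (coords (bd c) (rest b) - coords (bd c) (rest a) - (\<sigma> b - \<sigma> a) *\<^sub>R y) \<le> e * (\<sigma> b - \<sigma> a)"
    proof (rule limit_inequality)
      show "\<forall>\<^sub>F i in sequentially. norm (tangential (coords c (lams i b)) - tangential (coords c (lams i a)) - (ss i b - ss i a) *\<^sub>R y) \<le> e * (ss i b - ss i a)"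
        using d(3)
      proof eventually_elim
        case (elim i)
        show ?case
        proof (rule characteristic_estimate[OF chars arcs _ _ ab(3) c(1) _ tangential(1,2)])
          show "a \<in> Js i" "b \<in> Js i" using elim ab by blast+
          show "fst (lams i s) \<in> fst c" if "s \<in> {a..b}" for s using elim sub that by blast
          fix s w assume s: "s \<in> {a..b}" and l: "lams i s \<in> unit_level A \<xi> f" and w: "hamiltonian_vector UNIV A H c (lams i s) w"
          have "fst (lams i s) \<in> fst c" "dist (coords c (lams i s)) (coords c (lam t)) < r" using elim sub s by blast+
          then show "norm (tangential w - y) \<le> e" using y[OF l _ _ w] by blast
        qed
      qed
    qed (use ab d c in auto)
  qed
qed

text \<open>Near \<open>lam t\<close> there are no points of the unit level, so
  \<open>limit_estimate\<close> holds with error 0 for every vector \<open>y\<close>. With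
  \<open>y = 0\<close> the restriction is constant; the nonzero vector \<open>(conormal, 0)\<close>
  then forces \<sigma> to be constant as well.\<close>

lemma static_estimate:
  assumes t: "t \<in> J" and c: "c \<in> BC" "fst (lam t) \<in> fst c" and lt: "H (lam t) < 1"
  shows "\<exists>d>0. \<forall>a\<in>J \<inter> ball t d. \<forall>b\<in>J \<inter> ball t d. coords (bd c) (rest b) = coords (bd c) (rest a) \<and> \<sigma> b = \<sigma> a"
proof -
  have cA: "c \<in> A" by (rule BC_A[OF c(1)])
  have e: "1 - H (lam t) > 0" using lt by simp
  obtain r where r: "r > 0" "\<And>z. z \<in> cotangent_bundle UNIV A \<Longrightarrow> fst z \<in> fst c \<Longrightarrow> dist (coords c z) (coords c (lam t)) < r \<Longrightarrow> \<bar>H z - H (lam t)\<bar> < 1 - H (lam t)"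
    using H_continuous[OF lam_bundle[OF t] cA c(2) e] by blast
  have no: False if "z \<in> unit_level A \<xi> f" "fst z \<in> fst c" "dist (coords c z) (coords c (lam t)) < r" for z
    using r(2)[of z] that by (auto simp: unit_level_def)
  have est: "\<exists>d>0. \<forall>a\<in>J \<inter> ball t d. \<forall>b\<in>J \<inter> ball t d. a \<le> b \<longrightarrow>
     norm (coords (bd c) (rest b) - coords (bd c) (rest a) - (\<sigma> b - \<sigma> a) *\<^sub>R y) \<le> 0 * (\<sigma> b - \<sigma> a)" for y
    by (rule limit_estimate[OF t c r(1)]) (use no in blast)
  obtain d1 where d1: "d1 > 0" "\<forall>a\<in>J \<inter> ball t d1. \<forall>b\<in>J \<inter> ball t d1. a \<le> b \<longrightarrow>
     norm (coords (bd c) (rest b) - coords (bd c) (rest a) - (\<sigma> b - \<sigma> a) *\<^sub>R 0) \<le> 0 * (\<sigma> b - \<sigma> a)" using est by blast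
  obtain d2 where d2: "d2 > 0" "\<forall>a\<in>J \<inter> ball t d2. \<forall>b\<in>J \<inter> ball t d2. a \<le> b \<longrightarrow>
     norm (coords (bd c) (rest b) - coords (bd c) (rest a) - (\<sigma> b - \<sigma> a) *\<^sub>R (conormal, 0)) \<le> 0 * (\<sigma> b - \<sigma> a)" using est by blast
  have main: "coords (bd c) (rest b) = coords (bd c) (rest a) \<and> \<sigma> b = \<sigma> a"
    if ab: "a \<in> J \<inter> ball t (min d1 d2)" "b \<in> J \<inter> ball t (min d1 d2)" "a \<le> b" for a b
  proof -
    have 1: "coords (bd c) (rest b) = coords (bd c) (rest a)" using d1(2)[rule_format, of a b] ab by simp
    have "norm (coords (bd c) (rest b) - coords (bd c) (rest a) - (\<sigma> b - \<sigma> a) *\<^sub>R (conormal, 0)) \<le> 0 * (\<sigma> b - \<sigma> a)"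
      using d2(2)[rule_format, of a b] ab by simp
    then have "\<bar>\<sigma> b - \<sigma> a\<bar> * norm (conormal :: 'e) \<le> 0" using 1 by simp
    then have "\<sigma> b = \<sigma> a" by (simp add: conormal(2))
    with 1 show ?thesis by simp
  qed
  show ?thesis
  proof (intro exI[of _ "min d1 d2"] conjI ballI)
    show "0 < min d1 d2" using d1 d2 by simp
    fix a b assume ab: "a \<in> J \<inter> ball t (min d1 d2)" "b \<in> J \<inter> ball t (min d1 d2)"
    show "coords (bd c) (rest b) = coords (bd c) (rest a)" "\<sigma> b = \<sigma> a"
      using main[OF ab] main[OF ab(2,1)] by (metis nle_le)+
  qed
qed

lemma rate_static:
  assumes t: "t \<in> J" and c: "c \<in> BC" "fst (lam t) \<in> fst c" and lt: "H (lam t) < 1"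
  shows "rate c t 0"
  unfolding rate_def
proof (intro allI impI)
  fix e :: real assume e: "e > 0"
  obtain d where d: "d > 0" "\<forall>a\<in>J \<inter> ball t d. \<forall>b\<in>J \<inter> ball t d. coords (bd c) (rest b) = coords (bd c) (rest a) \<and> \<sigma> b = \<sigma> a"
    using static_estimate[OF assms] by blast
  show "\<exists>d>0. \<forall>a\<in>J \<inter> ball t d. \<forall>b\<in>J \<inter> ball t d. a \<le> b \<longrightarrow>
     norm (coords (bd c) (rest b) - coords (bd c) (rest a) - (\<sigma> b - \<sigma> a) *\<^sub>R 0) \<le> e * (\<sigma> b - \<sigma> a)"
  proof (intro exI[of _ d] conjI ballI impI d(1))
    fix a b assume "a \<in> J \<inter> ball t d" "b \<in> J \<inter> ball t d"
    then have "coords (bd c) (rest b) = coords (bd c) (rest a) \<and> \<sigma> b = \<sigma> a" using d(2) by blast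
    then show "norm (coords (bd c) (rest b) - coords (bd c) (rest a) - (\<sigma> b - \<sigma> a) *\<^sub>R 0) \<le> e * (\<sigma> b - \<sigma> a)" by simp
  qed
qed

lemma rate_H:
  assumes t: "t \<in> J" and c: "c \<in> BC" "fst (lam t) \<in> fst c" and H1: "H (lam t) = 1"
    and w: "hamiltonian_vector UNIV A H c (lam t) w"
  shows "rate c t (tangential w)"
  unfolding rate_def
proof (intro allI impI)
  fix e :: real assume e: "e > 0"
  have cA: "c \<in> A" by (rule BC_A[OF c(1)])
  obtain B where B: "B > 0" "\<And>x :: 'e \<times> 'e. norm (tangential x) \<le> norm x * B"
    using bounded_linear.pos_bounded[OF tangential(1)] by blast
  have eB: "e / B > 0" using e B(1) by simp
  have pos: "H (lam t) > 0" using H1 by simp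
  obtain w' where w': "hamiltonian_vector UNIV A H c (lam t) w'"
    "\<And>e. e > 0 \<Longrightarrow> \<exists>d>0. \<forall>z'\<in>cotangent_bundle UNIV A. fst z' \<in> fst c \<and> dist (coords c z') (coords c (lam t)) < d \<and> H z' > 0 \<longrightarrow>
      (\<forall>w''. hamiltonian_vector UNIV A H c z' w'' \<longrightarrow> dist w'' w' < e)"
    using H_vector_continuous[OF lam_bundle[OF t] cA c(2) pos] by blast
  have "w' = w" by (rule M.hamiltonian_vector_unique[OF lam_bundle[OF t] cA c(2) w'(1) w])
  then obtain r where r: "r > 0" "\<forall>z'\<in>cotangent_bundle UNIV A. fst z' \<in> fst c \<and> dist (coords c z') (coords c (lam t)) < r \<and> H z' > 0 \<longrightarrow>
      (\<forall>w''. hamiltonian_vector UNIV A H c z' w'' \<longrightarrow> dist w'' w < e / B)" using w'(2)[OF eB] by blast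
  show "\<exists>d>0. \<forall>a\<in>J \<inter> ball t d. \<forall>b\<in>J \<inter> ball t d. a \<le> b \<longrightarrow>
     norm (coords (bd c) (rest b) - coords (bd c) (rest a) - (\<sigma> b - \<sigma> a) *\<^sub>R tangential w) \<le> e * (\<sigma> b - \<sigma> a)"
  proof (rule limit_estimate[OF t c r(1)])
    fix z w'' assume z: "z \<in> unit_level A \<xi> f" "fst z \<in> fst c" "dist (coords c z) (coords c (lam t)) < r" "hamiltonian_vector UNIV A H c z w''"
    then have "dist w'' w < e / B" using r(2)[rule_format, of z w''] by (simp add: unit_level_def)
    then have "norm (w'' - w) * B \<le> e" using B(1) by (simp add: dist_norm pos_less_divide_eq)
    moreover have "norm (tangential (w'' - w)) \<le> norm (w'' - w) * B" by (rule B(2))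
    ultimately show "norm (tangential w'' - tangential w) \<le> e"
      using linear_diff[OF bounded_linear.linear[OF tangential(1)], of w'' w] by simp
  qed
qed

lemma rate_exists:
  assumes t: "t \<in> J" and c: "c \<in> BC" "fst (lam t) \<in> fst c"
  shows "\<exists>y. rate c t y"
proof (cases "H (lam t) < 1")
  case True
  then show ?thesis using rate_static[OF assms] by blast
next
  case False
  then have H1: "H (lam t) = 1" using H_lam[OF t] by simp
  then obtain w where "hamiltonian_vector UNIV A H c (lam t) w"
    using H_vector_continuous[OF lam_bundle[OF t] BC_A[OF c(1)] c(2)] by auto
  then show ?thesis using rate_H[OF assms H1] by blast
qed

lemma moving_pair:
  assumes mv: "moving J \<sigma> t" and t: "t \<in> J" and d: "d > 0"
  obtains a b where "a \<in> J \<inter> ball t d" "b \<in> J \<inter> ball t d" "a \<le> b" "\<sigma> a < \<sigma> b"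
proof -
  obtain b where b: "b \<in> J" "\<bar>b - t\<bar> < d" "\<sigma> b \<noteq> \<sigma> t" using mv d unfolding moving_def by blast
  have bb: "b \<in> J \<inter> ball t d" "t \<in> J \<inter> ball t d" using b t d by (auto simp: dist_real_def)
  show ?thesis
  proof (cases "t \<le> b")
    case True
    then show ?thesis using that[OF bb(2,1)] \<sigma>_le(1)[OF t b(1)] b(3) by simp
  next
    case False
    then show ?thesis using that[OF bb(1,2)] \<sigma>_le(1)[OF b(1) t] b(3) by simp
  qed
qed

lemma rate_unique:
  assumes mv: "moving J \<sigma> t" and t: "t \<in> J" and y: "rate c t y" "rate c t y'"
  shows "y = y'"
proof (rule ccontr)
  assume "y \<noteq> y'"
  \<comment> \<open>Two rates at distance \<open>3 * e\<close> would each be approximated up to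
    \<open>e * (\<sigma> b - \<sigma> a)\<close>, which is impossible when \<sigma> increases from
    \<open>a\<close> to \<open>b\<close>.\<close>
  define e where "e = norm (y' - y) / 3"
  have e: "e > 0" using \<open>y \<noteq> y'\<close> by (simp add: e_def)
  obtain d1 where d1: "d1 > 0" "\<forall>a\<in>J \<inter> ball t d1. \<forall>b\<in>J \<inter> ball t d1. a \<le> b \<longrightarrow>
     norm (coords (bd c) (rest b) - coords (bd c) (rest a) - (\<sigma> b - \<sigma> a) *\<^sub>R y) \<le> e * (\<sigma> b - \<sigma> a)"
    using y(1) e unfolding rate_def by blast
  obtain d2 where d2: "d2 > 0" "\<forall>a\<in>J \<inter> ball t d2. \<forall>b\<in>J \<inter> ball t d2. a \<le> b \<longrightarrow>
     norm (coords (bd c) (rest b) - coords (bd c) (rest a) - (\<sigma> b - \<sigma> a) *\<^sub>R y') \<le> e * (\<sigma> b - \<sigma> a)"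
    using y(2) e unfolding rate_def by blast
  have d: "min d1 d2 > 0" using d1 d2 by simp
  obtain a b where ab: "a \<in> J \<inter> ball t (min d1 d2)" "b \<in> J \<inter> ball t (min d1 d2)" "a \<le> b" "\<sigma> a < \<sigma> b"
    by (rule moving_pair[OF mv t d])
  let ?x = "coords (bd c) (rest b) - coords (bd c) (rest a)" and ?s = "\<sigma> b - \<sigma> a"
  have "norm (?x - ?s *\<^sub>R y) \<le> e * ?s" "norm (?x - ?s *\<^sub>R y') \<le> e * ?s"
    using d1(2)[rule_format, of a b] d2(2)[rule_format, of a b] ab by simp_all
  then have "norm ((?x - ?s *\<^sub>R y) - (?x - ?s *\<^sub>R y')) \<le> e * ?s + e * ?s"
    by (intro order_trans[OF norm_triangle_ineq4 add_mono])
  moreover have "(?x - ?s *\<^sub>R y) - (?x - ?s *\<^sub>R y') = ?s *\<^sub>R (y' - y)" by (simp add: scaleR_diff_right)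
  ultimately have "norm (?s *\<^sub>R (y' - y)) \<le> e * ?s + e * ?s" by (simp only:)
  then have "\<bar>?s\<bar> * norm (y' - y) \<le> e * ?s + e * ?s" unfolding norm_scaleR .
  moreover have "norm (y' - y) = 3 * e" "\<bar>?s\<bar> = ?s" using ab(4) by (simp_all add: e_def)
  ultimately have "?s * (3 * e) \<le> e * ?s + e * ?s" by (simp only:)
  then have "?s * e \<le> 0" by (simp add: algebra_simps)
  moreover have "?s * e > 0" using ab(4) e by (intro mult_pos_pos) auto
  ultimately show False by simp
qed

lemma moving_tangent:
  assumes mv: "moving J \<sigma> t" and t: "t \<in> J"
  shows "\<exists>v. tangent_covector (lam t) v"
proof -
  obtain c where c: "c \<in> BC" "fst (lam t) \<in> fst c" using BC_exists[OF boundary[OF t]] by blast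
  have cA: "c \<in> A" by (rule BC_A[OF c(1)])
  have H1: "H (lam t) = 1"
  proof (rule ccontr)
    assume "H (lam t) \<noteq> 1"
    then have "H (lam t) < 1" using H_lam[OF t] by simp
    from static_estimate[OF t c this] obtain d where d: "d > 0" "\<forall>a\<in>J \<inter> ball t d. \<forall>b\<in>J \<inter> ball t d. coords (bd c) (rest b) = coords (bd c) (rest a) \<and> \<sigma> b = \<sigma> a" by blast
    obtain a b where "a \<in> J \<inter> ball t d" "b \<in> J \<inter> ball t d" "\<sigma> a < \<sigma> b" by (rule moving_pair[OF mv t d(1)])
    then show False using d(2)[rule_format, of a b] by simp
  qed
  then obtain v where v: "v \<in> \<xi> (fst (lam t))" "f (fst (lam t)) v = 1" "pairing A (fst (lam t)) (snd (lam t)) v = H (lam t)"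
    using H_maximiser[OF lam_bundle[OF t]] by auto
  obtain w where w: "hamiltonian_vector UNIV A H c (lam t) w"
    using H_vector_continuous[OF lam_bundle[OF t] cA c(2)] H1 by auto
  have wv: "fst w = v c" by (rule H_vector_fst[OF lam_bundle[OF t] cA c(2) v w])
  \<comment> \<open>The base point stays in the boundary, so its increments have no normal
    component. All that is left of the normal part of the estimate is
    \<open>(\<sigma> b - \<sigma> a) * (v c \<bullet> conormal)\<close>.\<close>
  have small: "\<bar>v c \<bullet> conormal\<bar> \<le> e" if e: "e > 0" for e
  proof -
    obtain d1 where d1: "d1 > 0" "\<forall>a\<in>J \<inter> ball t d1. \<forall>b\<in>J \<inter> ball t d1. a \<le> b \<longrightarrow>
     norm (coords (bd c) (rest b) - coords (bd c) (rest a) - (\<sigma> b - \<sigma> a) *\<^sub>R tangential w) \<le> e * (\<sigma> b - \<sigma> a)"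
      using rate_H[OF t c H1 w] e unfolding rate_def by blast
    obtain d2 where d2: "d2 > 0" "\<forall>s\<in>J \<inter> ball t d2. fst (lam s) \<in> fst c"
      using coords_convergence[OF t cA c(2) zero_less_one] by blast
    have d: "min d1 d2 > 0" using d1 d2 by simp
    obtain a b where ab: "a \<in> J \<inter> ball t (min d1 d2)" "b \<in> J \<inter> ball t (min d1 d2)" "a \<le> b" "\<sigma> a < \<sigma> b"
      by (rule moving_pair[OF mv t d])
    let ?x = "coords (bd c) (rest b) - coords (bd c) (rest a)" and ?s = "\<sigma> b - \<sigma> a"
    have n: "norm (?x - ?s *\<^sub>R tangential w) \<le> e * ?s" using d1(2)[rule_format, of a b] ab by simp
    have bm: "fst (coords (bd c) (rest u)) \<bullet> conormal = 0" if "u \<in> J \<inter> ball t (min d1 d2)" for u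
    proof -
      have u: "u \<in> J" "fst (lam u) \<in> fst c" using that d2 by auto
      then show ?thesis using frontier_iff[OF c(1) u(2)] boundary[OF u(1)] by (simp add: coords_def bd rest(1) boundary_model_def)
    qed
    have e1: "fst (?x - ?s *\<^sub>R tangential w) \<bullet> conormal = - (?s * (v c \<bullet> conormal))"
      using bm[OF ab(1)] bm[OF ab(2)] by (simp add: inner_diff_left tangential(3) wv left_diff_distrib)
    have "\<bar>fst (?x - ?s *\<^sub>R tangential w) \<bullet> conormal\<bar> \<le> norm (fst (?x - ?s *\<^sub>R tangential w)) * norm (conormal :: 'e)"
      by (rule Cauchy_Schwarz_ineq2)
    then have "\<bar>?s * (v c \<bullet> conormal)\<bar> \<le> norm (fst (?x - ?s *\<^sub>R tangential w)) * norm (conormal :: 'e)"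
      unfolding e1 abs_minus_cancel .
    also have "\<dots> \<le> norm (?x - ?s *\<^sub>R tangential w)" unfolding conormal(2) mult_1_right
      using norm_fst_le[of "fst (?x - ?s *\<^sub>R tangential w)" "snd (?x - ?s *\<^sub>R tangential w)"] by (simp only: prod.collapse)
    also have "\<dots> \<le> e * ?s" by (rule n)
    finally have "?s * \<bar>v c \<bullet> conormal\<bar> \<le> ?s * e" using ab(4) by (simp add: abs_mult mult.commute)
    then show ?thesis using ab(4) by (simp add: mult_le_cancel_left_pos)
  qed
  have "v c \<bullet> conormal = 0"
  proof (rule ccontr)
    assume "v c \<bullet> conormal \<noteq> 0"
    then show False using small[of "\<bar>v c \<bullet> conormal\<bar> / 2"] by simp
  qed
  then have "tangent_covector (lam t) v"
    unfolding tangent_covector_def using lam_bundle[OF t] boundary[OF t] H1 v c by (auto simp: boundary_model_def)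
  then show ?thesis by blast
qed

text \<open>On a plateau of \<sigma> the existence of a rate bounds the local increments by 0;
  bisection passes from chart to chart. This is what makes the restricted characteristic a function
  of \<sigma>.\<close>

lemma rest_constant:
  assumes ab: "a \<in> J" "b \<in> J" and eq: "\<sigma> a = \<sigma> b"
  shows "rest a = rest b"
proof -
  have main: "rest a = rest b" if ab: "a \<in> J" "b \<in> J" "\<sigma> a = \<sigma> b" "a \<le> b" for a b
  proof -
    have sub: "{a..b} \<subseteq> J" by (rule interval_Icc_subset[OF J ab(1,2)])
    have sc: "\<sigma> s = \<sigma> a" if "s \<in> {a..b}" for s
      using \<sigma>_le(1)[of a s] \<sigma>_le(1)[of s b] that sub ab by force
    define Q where "Q r t \<longleftrightarrow> (a \<le> r \<and> t \<le> b \<longrightarrow> rest r = rest t)" for r t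
    have "Q a b"
    proof (rule Bolzano[OF ab(4)])
      show "Q r u" if "Q r t" "Q t u" "r \<le> t" "t \<le> u" for r t u
        using that by (auto simp: Q_def)
    next
      fix x assume x: "a \<le> x" "x \<le> b"
      then have xJ: "x \<in> J" using sub by auto
      obtain c where c: "c \<in> BC" "fst (lam x) \<in> fst c" using BC_exists[OF boundary[OF xJ]] by blast
      obtain y where "rate c x y" using rate_exists[OF xJ c] by blast
      then obtain d1 where d1: "d1 > 0" "\<forall>a\<in>J \<inter> ball x d1. \<forall>b\<in>J \<inter> ball x d1. a \<le> b \<longrightarrow>
         norm (coords (bd c) (rest b) - coords (bd c) (rest a) - (\<sigma> b - \<sigma> a) *\<^sub>R y) \<le> 1 * (\<sigma> b - \<sigma> a)"
        unfolding rate_def using zero_less_one by blast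
      obtain d2 where d2: "d2 > 0" "\<forall>s\<in>J \<inter> ball x d2. fst (lam s) \<in> fst c"
        using coords_convergence[OF xJ BC_A[OF c(1)] c(2) zero_less_one] by blast
      show "\<exists>d>0. \<forall>a b. a \<le> x \<and> x \<le> b \<and> b - a < d \<longrightarrow> Q a b"
      proof (intro exI[of _ "min d1 d2"] conjI allI impI)
        show "min d1 d2 > 0" using d1 d2 by simp
        fix r t assume rt: "r \<le> x \<and> x \<le> t \<and> t - r < min d1 d2"
        show "Q r t" unfolding Q_def
        proof
          assume art: "a \<le> r \<and> t \<le> b"
          have i: "r \<in> {a..b}" "t \<in> {a..b}" using rt art by auto
          have b: "r \<in> J \<inter> ball x (min d1 d2)" "t \<in> J \<inter> ball x (min d1 d2)" using i sub rt by (auto simp: dist_real_def)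
          have "norm (coords (bd c) (rest t) - coords (bd c) (rest r) - (\<sigma> t - \<sigma> r) *\<^sub>R y) \<le> 1 * (\<sigma> t - \<sigma> r)"
            using d1(2)[rule_format, of r t] b rt by simp
          then have ce: "coords (bd c) (rest r) = coords (bd c) (rest t)" using sc[OF i(1)] sc[OF i(2)] by simp
          show "rest r = rest t"
            by (rule B.coords_inj[OF _ _ bd_in[OF c(1)] _ _ ce])
              (use b d2 boundary rest in \<open>auto simp: bd\<close>)
        qed
      qed
    qed
    then show ?thesis by (simp add: Q_def)
  qed
  show ?thesis
  proof (cases "a \<le> b")
    case False
    then have "rest b = rest a" by (intro main[OF ab(2,1) eq[symmetric]]) simp
    then show ?thesis by (rule sym)
  qed (rule main[OF ab eq])
qed

end

section \<open>The boundary geodesic parametrised by \<sigma>\<close>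

lemma strong_derivative_bounds:
  fixes G :: "real \<Rightarrow> 'b::real_normed_vector"
  assumes "\<And>p r. p \<in> K \<Longrightarrow> r \<in> K \<Longrightarrow> p \<le> r \<Longrightarrow> norm (G r - G p - (r - p) *\<^sub>R v) \<le> e * (r - p)"
    and pr: "p \<in> K" "r \<in> K"
  shows "norm (G r - G p) \<le> (norm v + e) * \<bar>r - p\<bar>" "(norm v - e) * \<bar>r - p\<bar> \<le> norm (G r - G p)"
proof -
  have main: "norm (G r - G p) \<le> (norm v + e) * (r - p) \<and> (norm v - e) * (r - p) \<le> norm (G r - G p)"
    if pr: "p \<in> K" "r \<in> K" "p \<le> r" for p r
  proof -
    have n: "norm ((r - p) *\<^sub>R v) = norm v * (r - p)" using pr(3) by simp
    have a: "norm (G r - G p - (r - p) *\<^sub>R v) \<le> e * (r - p)" by (rule assms(1)[OF pr])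
    have "norm (G r - G p) \<le> norm (G r - G p - (r - p) *\<^sub>R v) + norm ((r - p) *\<^sub>R v)"
      by (rule norm_triangle_sub[of "G r - G p" "(r - p) *\<^sub>R v", THEN order_trans]) simp
    moreover have "norm ((r - p) *\<^sub>R v) \<le> norm (G r - G p) + norm (G r - G p - (r - p) *\<^sub>R v)"
      using norm_triangle_sub[of "(r - p) *\<^sub>R v" "G r - G p"] by (simp add: norm_minus_commute)
    ultimately show ?thesis using a unfolding n by (simp add: algebra_simps)
  qed
  have 1: "norm (G r - G p) = norm (G p - G r)" by (rule norm_minus_commute)
  show "norm (G r - G p) \<le> (norm v + e) * \<bar>r - p\<bar>" "(norm v - e) * \<bar>r - p\<bar> \<le> norm (G r - G p)"
    using main[of p r] main[of r p] pr by (cases "p \<le> r"; simp add: norm_minus_commute)+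
qed

context limit_billiard
begin

definition K :: "real set" where "K = \<sigma> ` J"

text \<open>The restricted characteristic as a function of \<sigma>; by \<open>rest_constant\<close>
  the choice of the time does not matter.\<close>

definition mu :: "real \<Rightarrow> ('a, 'e) cotangent" where
  "mu \<tau> = rest (SOME t. t \<in> J \<and> \<sigma> t = \<tau>)"

lemma mu: "t \<in> J \<Longrightarrow> mu (\<sigma> t) = rest t"
proof -
  assume t: "t \<in> J"
  have "(SOME t'. t' \<in> J \<and> \<sigma> t' = \<sigma> t) \<in> J \<and> \<sigma> (SOME t'. t' \<in> J \<and> \<sigma> t' = \<sigma> t) = \<sigma> t"
    by (rule someI[of _ t]) (use t in simp)
  then show "mu (\<sigma> t) = rest t" unfolding mu_def using rest_constant t by blast
qed

lemma K_interval: "is_interval K"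
  unfolding K_def is_interval_connected_1
  by (rule connected_continuous_image[OF \<sigma>_continuous]) (use J is_interval_connected in blast)

lemma mu_in: assumes "\<tau> \<in> K" shows "mu \<tau> \<in> cotangent_bundle boundary_model BA" "fst (mu \<tau>) \<in> frontier U"
proof -
  obtain t where t: "t \<in> J" "\<tau> = \<sigma> t" using assms by (auto simp: K_def)
  then show "mu \<tau> \<in> cotangent_bundle boundary_model BA" "fst (mu \<tau>) \<in> frontier U"
    using mu[OF t(1)] rest(1,2)[OF t(1)] boundary[OF t(1)] by auto
qed

lemma same_base: "t \<in> J \<Longrightarrow> t1 \<in> J \<Longrightarrow> \<sigma> t = \<sigma> t1 \<Longrightarrow> fst (lam t) = fst (lam t1)"
  using rest_constant[of t t1] rest(1) by metis

text \<open>Applied to the indicator of a chart domain, the reparametrisation lemma says that the curve stays in the chart.\<close>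

lemma mu_in_chart:
  assumes t1: "t1 \<in> J" and c: "c \<in> BC" "fst (lam t1) \<in> fst c"
  shows "\<exists>d>0. \<forall>\<tau>\<in>K \<inter> ball (\<sigma> t1) d. fst (mu \<tau>) \<in> fst c"
proof -
  define G where "G \<tau> = (if fst (mu \<tau>) \<in> fst c then 0 else 1 :: real)" for \<tau>
  define g where "g t = (if fst (lam t) \<in> fst c then 0 else 1 :: real)" for t
  have "\<exists>d>0. \<forall>p\<in>\<sigma> ` J \<inter> ball (\<sigma> t1) d. \<forall>r\<in>\<sigma> ` J \<inter> ball (\<sigma> t1) d. p \<le> r \<longrightarrow> norm (G r - G p - (r - p) *\<^sub>R 0) \<le> 1 * (r - p)"
  proof (rule strong_derivative_reparametrisation[OF J \<sigma>_mono \<sigma>_continuous _ _ t1, where g = g and y = "\<lambda>_. 0"])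
    show "G (\<sigma> t) = g t" if "t \<in> J" for t using mu[OF that] rest(1)[OF that] by (simp add: G_def g_def)
    fix t e :: real assume t: "t \<in> J" "\<sigma> t = \<sigma> t1" and e: "e > 0"
    have "fst (lam t) \<in> fst c" using same_base[OF t(1) t1 t(2)] c by simp
    then obtain d where d: "d > 0" "\<forall>s\<in>J \<inter> ball t d. fst (lam s) \<in> fst c"
      using coords_convergence[OF t(1) BC_A[OF c(1)] _ zero_less_one] by blast
    show "\<exists>d>0. \<forall>a\<in>J \<inter> ball t d. \<forall>b\<in>J \<inter> ball t d. a \<le> b \<longrightarrow> norm (g b - g a - (\<sigma> b - \<sigma> a) *\<^sub>R 0) \<le> e * (\<sigma> b - \<sigma> a)"
    proof (intro exI[of _ d] conjI ballI impI d(1))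
      fix a b assume ab: "a \<in> J \<inter> ball t d" "b \<in> J \<inter> ball t d" "a \<le> b"
      then have "g a = 0" "g b = 0" using d(2) by (auto simp: g_def)
      then show "norm (g b - g a - (\<sigma> b - \<sigma> a) *\<^sub>R 0) \<le> e * (\<sigma> b - \<sigma> a)"
        using \<sigma>_le(1)[of a b] ab e by simp
    qed
  qed auto
  then obtain d where d: "d > 0" "\<forall>p\<in>\<sigma> ` J \<inter> ball (\<sigma> t1) d. \<forall>r\<in>\<sigma> ` J \<inter> ball (\<sigma> t1) d. p \<le> r \<longrightarrow> norm (G r - G p - (r - p) *\<^sub>R 0) \<le> 1 * (r - p)"
    by blast
  have G0: "G (\<sigma> t1) = 0" using mu[OF t1] rest(1)[OF t1] c by (simp add: G_def)
  \<comment> \<open>The radius is at most 1: \<open>G\<close> takes only the values 0 and 1, so a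
    change by less than 1 leaves it at 0.\<close>
  show ?thesis
  proof (intro exI[of _ "min d 1"] conjI ballI)
    show "0 < min d 1" using d by simp
    fix \<tau> assume \<tau>: "\<tau> \<in> K \<inter> ball (\<sigma> t1) (min d 1)"
    have i: "\<tau> \<in> \<sigma> ` J \<inter> ball (\<sigma> t1) d" "\<sigma> t1 \<in> \<sigma> ` J \<inter> ball (\<sigma> t1) d" "\<bar>\<tau> - \<sigma> t1\<bar> < 1"
      using \<tau> t1 d(1) by (auto simp: K_def dist_real_def abs_minus_commute)
    have "norm (G \<tau> - G (\<sigma> t1)) \<le> \<bar>\<tau> - \<sigma> t1\<bar>"
    proof (cases "\<tau> \<le> \<sigma> t1")
      case True
      then have "norm (G (\<sigma> t1) - G \<tau> - (\<sigma> t1 - \<tau>) *\<^sub>R 0) \<le> 1 * (\<sigma> t1 - \<tau>)" using d(2) i(1,2) by blast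
      then show ?thesis using True by (simp add: norm_minus_commute)
    next
      case False
      then have "norm (G \<tau> - G (\<sigma> t1) - (\<tau> - \<sigma> t1) *\<^sub>R 0) \<le> 1 * (\<tau> - \<sigma> t1)" using d(2) i(1,2) by simp
      then show ?thesis using False by simp
    qed
    then have "G \<tau> \<noteq> 1" using G0 i(3) by auto
    then show "fst (mu \<tau>) \<in> fst c" by (auto simp: G_def split: if_splits)
  qed
qed

text \<open>If no time of the fibre were moving, the fibre would be open and closed in the interval
  \<open>J\<close>, and \<sigma> would be constant.\<close>

lemma moving_exists:
  assumes t: "t1 \<in> J" "t2 \<in> J" "\<sigma> t1 \<noteq> \<sigma> t2"
  shows "\<exists>t\<in>J. \<sigma> t = \<sigma> t1 \<and> moving J \<sigma> t"
proof (rule ccontr)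
  assume no: "\<not> ?thesis"
  have bol: "(\<sigma> a = \<sigma> t1) = (\<sigma> b = \<sigma> t1)" if ab: "a \<in> J" "b \<in> J" "a \<le> b" for a b
  proof -
    have sub: "{a..b} \<subseteq> J" by (rule interval_Icc_subset[OF J ab(1,2)])
    define Q where "Q r t \<longleftrightarrow> (a \<le> r \<and> t \<le> b \<longrightarrow> (\<sigma> r = \<sigma> t1) = (\<sigma> t = \<sigma> t1))" for r t
    have "Q a b"
    proof (rule Bolzano[OF ab(3)])
      show "Q r u" if "Q r t" "Q t u" "r \<le> t" "t \<le> u" for r t u using that by (auto simp: Q_def)
    next
      fix x assume x: "a \<le> x" "x \<le> b"
      then have xJ: "x \<in> J" using sub by auto
      have "\<exists>d>0. \<forall>s\<in>J. \<bar>s - x\<bar> < d \<longrightarrow> (\<sigma> s = \<sigma> t1) = (\<sigma> x = \<sigma> t1)"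
      proof (cases "\<sigma> x = \<sigma> t1")
        case True
        then have "\<not> moving J \<sigma> x" using no xJ by blast
        then show ?thesis using True unfolding moving_def by metis
      next
        case False
        define d where "d = \<bar>\<sigma> x - \<sigma> t1\<bar>"
        have "\<sigma> s \<noteq> \<sigma> t1" if "s \<in> J" "\<bar>s - x\<bar> < d" for s
          using \<sigma>_le[OF xJ that(1)] \<sigma>_le[OF that(1) xJ] that(2) by (cases "s \<le> x") (auto simp: d_def)
        then show ?thesis using False by (intro exI[of _ d]) (auto simp: d_def)
      qed
      then obtain d where d: "d > 0" "\<forall>s\<in>J. \<bar>s - x\<bar> < d \<longrightarrow> (\<sigma> s = \<sigma> t1) = (\<sigma> x = \<sigma> t1)" by blast
      show "\<exists>d>0. \<forall>a b. a \<le> x \<and> x \<le> b \<and> b - a < d \<longrightarrow> Q a b"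
      proof (intro exI[of _ d] conjI allI impI d(1))
        fix r t assume rt: "r \<le> x \<and> x \<le> t \<and> t - r < d"
        show "Q r t" unfolding Q_def
        proof
          assume art: "a \<le> r \<and> t \<le> b"
          then have "r \<in> J" "t \<in> J" using rt sub by auto
          moreover have "\<bar>r - x\<bar> < d" "\<bar>t - x\<bar> < d" using rt by auto
          ultimately show "(\<sigma> r = \<sigma> t1) = (\<sigma> t = \<sigma> t1)" using d(2) by blast
        qed
      qed
    qed
    then show ?thesis by (simp add: Q_def)
  qed
  show False using bol[OF t(1,2)] bol[OF t(2,1)] t(3) by (cases "t1 \<le> t2") auto
qed

text \<open>\<open>L\<close> selects what is differentiated. The base part has a derivative over
  every boundary point, because all moving times of a fibre share the tangent maximiser. The full
  rates at these times are shown to agree only over regular points, where each is the Hamiltonian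
  vector of \<open>HB\<close>.\<close>

lemma strong_derivative:
  fixes L :: "'e \<times> 'e \<Rightarrow> 'b::real_normed_vector"
  assumes t1: "t1 \<in> J" and c: "c \<in> BC" "fst (lam t1) \<in> fst c"
    and L: "linear L" "\<And>x. norm (L x) \<le> norm x"
    and v: "\<And>t y. t \<in> J \<Longrightarrow> \<sigma> t = \<sigma> t1 \<Longrightarrow> moving J \<sigma> t \<Longrightarrow> rate c t y \<Longrightarrow> L y = v" and e: "e > 0"
  shows "\<exists>d>0. \<forall>p\<in>K \<inter> ball (\<sigma> t1) d. \<forall>r\<in>K \<inter> ball (\<sigma> t1) d. p \<le> r \<longrightarrow>
    norm (L (coords (bd c) (mu r)) - L (coords (bd c) (mu p)) - (r - p) *\<^sub>R v) \<le> e * (r - p)"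
  unfolding K_def
proof (rule strong_derivative_reparametrisation[OF J \<sigma>_mono \<sigma>_continuous _ _ t1 _ e,
    where G = "\<lambda>\<tau>. L (coords (bd c) (mu \<tau>))" and g = "\<lambda>t. L (coords (bd c) (rest t))" and y = "\<lambda>t. L (SOME y. rate c t y)"])
  have ex: "rate c t (SOME y. rate c t y)" if t: "t \<in> J" "\<sigma> t = \<sigma> t1" for t
  proof -
    have fc: "fst (lam t) \<in> fst c" using same_base[OF t(1) t1 t(2)] c by simp
    show ?thesis by (rule someI_ex[OF rate_exists[OF t(1) c(1) fc]])
  qed
  show "L (coords (bd c) (mu (\<sigma> t))) = L (coords (bd c) (rest t))" if "t \<in> J" for t using mu[OF that] by simp
  show "L (SOME y. rate c t y) = v" if "t \<in> J" "\<sigma> t = \<sigma> t1" "moving J \<sigma> t" for t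
    using v[OF that ex[OF that(1,2)]] .
  fix t e :: real assume t: "t \<in> J" "\<sigma> t = \<sigma> t1" and e: "e > 0"
  let ?y = "SOME y. rate c t y"
  obtain d where d: "d > 0" "\<forall>a\<in>J \<inter> ball t d. \<forall>b\<in>J \<inter> ball t d. a \<le> b \<longrightarrow>
     norm (coords (bd c) (rest b) - coords (bd c) (rest a) - (\<sigma> b - \<sigma> a) *\<^sub>R ?y) \<le> e * (\<sigma> b - \<sigma> a)"
    using ex[OF t] e unfolding rate_def by blast
  show "\<exists>d>0. \<forall>a\<in>J \<inter> ball t d. \<forall>b\<in>J \<inter> ball t d. a \<le> b \<longrightarrow>
     norm (L (coords (bd c) (rest b)) - L (coords (bd c) (rest a)) - (\<sigma> b - \<sigma> a) *\<^sub>R L ?y) \<le> e * (\<sigma> b - \<sigma> a)"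
  proof (intro exI[of _ d] conjI ballI impI d(1))
    fix a b assume ab: "a \<in> J \<inter> ball t d" "b \<in> J \<inter> ball t d" "a \<le> b"
    have "norm (L (coords (bd c) (rest b)) - L (coords (bd c) (rest a)) - (\<sigma> b - \<sigma> a) *\<^sub>R L ?y)
      = norm (L (coords (bd c) (rest b) - coords (bd c) (rest a) - (\<sigma> b - \<sigma> a) *\<^sub>R ?y))"
      using L(1) by (simp add: linear_diff linear_scale)
    also have "\<dots> \<le> norm (coords (bd c) (rest b) - coords (bd c) (rest a) - (\<sigma> b - \<sigma> a) *\<^sub>R ?y)" by (rule L(2))
    also have "\<dots> \<le> e * (\<sigma> b - \<sigma> a)" using d(2) ab by blast
    finally show "norm (L (coords (bd c) (rest b)) - L (coords (bd c) (rest a)) - (\<sigma> b - \<sigma> a) *\<^sub>R L ?y) \<le> e * (\<sigma> b - \<sigma> a)" .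
  qed
qed

lemma moving_rate:
  assumes mv: "moving J \<sigma> t" and t: "t \<in> J" and v: "tangent_covector (lam t) v" and c: "c \<in> BC" "fst (lam t) \<in> fst c"
    and y: "rate c t y"
  obtains w where "hamiltonian_vector UNIV A H c (lam t) w" "y = tangential w" "fst w = v c"
proof -
  note D = tangent_covectorD[OF v]
  have cA: "c \<in> A" by (rule BC_A[OF c(1)])
  obtain w where w: "hamiltonian_vector UNIV A H c (lam t) w"
    using H_vector_continuous[OF D(1) cA c(2)] D(3) by auto
  have "y = tangential w" by (rule rate_unique[OF mv t y rate_H[OF t c D(3) w]])
  moreover have "fst w = v c" by (rule H_vector_fst[OF D(1) cA c(2) _ _ _ w]) (use D in auto)
  ultimately show ?thesis using that w by blast
qed

lemma same_tangent:
  assumes t: "t \<in> J" "t' \<in> J" "\<sigma> t = \<sigma> t'" and v: "tangent_covector (lam t) v" "tangent_covector (lam t') v'"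
  shows "v = v'"
proof -
  have "rest t = rest t'" by (rule rest_constant[OF t])
  then have e: "fst (lam t) = fst (lam t')" "restrict_covector (fst (lam t)) (snd (lam t)) = restrict_covector (fst (lam t')) (snd (lam t'))"
    unfolding rest_def prod.inject by blast+
  note eq = e(1) e(2)[unfolded e(1)]
  have "tangent_covector (fst (lam t'), snd (lam t)) v" using v(1) unfolding eq(1)[symmetric] by simp
  moreover have "tangent_covector (fst (lam t'), snd (lam t')) v'" using v(2) by simp
  ultimately show ?thesis using eq(2) by (rule tangent_covector_unique)
qed

text \<open>The velocity is required as a two-point derivative in every boundary chart. That it does
  not vanish yields the lower bound on distances needed to compare parametrisations.\<close>

definition unit_tangent :: "real \<Rightarrow> (('a, 'e) chart \<Rightarrow> 'e) \<Rightarrow> bool" where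
  "unit_tangent \<tau> v \<longleftrightarrow> v \<in> \<xi> (fst (mu \<tau>)) \<and> f (fst (mu \<tau>)) v = 1 \<and>
    (\<forall>c\<in>BC. fst (mu \<tau>) \<in> fst c \<longrightarrow> v c \<in> boundary_model \<and> v c \<noteq> 0 \<and>
      (\<forall>e>0. \<exists>d>0. \<forall>p\<in>K \<inter> ball \<tau> d. \<forall>r\<in>K \<inter> ball \<tau> d. p \<le> r \<longrightarrow>
        norm (snd c (fst (mu r)) - snd c (fst (mu p)) - (r - p) *\<^sub>R v c) \<le> e * (r - p)))"

lemma unit_tangentD:
  assumes "unit_tangent \<tau> v"
  shows "v \<in> \<xi> (fst (mu \<tau>))" "f (fst (mu \<tau>)) v = 1"
    "c \<in> BC \<Longrightarrow> fst (mu \<tau>) \<in> fst c \<Longrightarrow> v c \<in> boundary_model"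
    "c \<in> BC \<Longrightarrow> fst (mu \<tau>) \<in> fst c \<Longrightarrow> v c \<noteq> 0"
    "c \<in> BC \<Longrightarrow> fst (mu \<tau>) \<in> fst c \<Longrightarrow> e > 0 \<Longrightarrow> \<exists>d>0. \<forall>p\<in>K \<inter> ball \<tau> d. \<forall>r\<in>K \<inter> ball \<tau> d. p \<le> r \<longrightarrow>
      norm (snd c (fst (mu r)) - snd c (fst (mu p)) - (r - p) *\<^sub>R v c) \<le> e * (r - p)"
  using assms unfolding unit_tangent_def by blast+

lemma geodesic_velocity:
  assumes t1: "t1 \<in> J" and nd: "\<exists>t2\<in>J. \<sigma> t1 \<noteq> \<sigma> t2"
  shows "\<exists>v. unit_tangent (\<sigma> t1) v"
proof -
  obtain t where t: "t \<in> J" "\<sigma> t = \<sigma> t1" "moving J \<sigma> t" using moving_exists[OF t1] nd by blast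
  obtain v where v: "tangent_covector (lam t) v" using moving_tangent[OF t(3,1)] by blast
  note D = tangent_covectorD[OF v]
  have base: "fst (mu (\<sigma> t1)) = fst (lam t)" "fst (mu (\<sigma> t1)) = fst (lam t1)"
    using mu[OF t1] rest(1)[OF t1] same_base[OF t(1) t1 t(2)] by auto
  have "unit_tangent (\<sigma> t1) v"
    unfolding unit_tangent_def
  proof (intro conjI ballI impI allI)
    show "v \<in> \<xi> (fst (mu (\<sigma> t1)))" "f (fst (mu (\<sigma> t1))) v = 1" using D base by auto
    fix c assume c: "c \<in> BC" "fst (mu (\<sigma> t1)) \<in> fst c"
    show "v c \<in> boundary_model" using D(7)[OF c(1)] c(2) base by simp
    show "v c \<noteq> 0"
    proof
      assume "v c = 0"
      then have "v = (\<lambda>d. 0)"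
        using M.tangent_eqI[OF xi_tangent[OF D(4)] M.zero_tangent BC_A[OF c(1)]] c(2) base by simp
      then show False using norm_zero[OF D(4)] D(5) by simp
    qed
    fix e :: real assume e: "e > 0"
    have "\<exists>d>0. \<forall>p\<in>K \<inter> ball (\<sigma> t1) d. \<forall>r\<in>K \<inter> ball (\<sigma> t1) d. p \<le> r \<longrightarrow>
      norm (fst (coords (bd c) (mu r)) - fst (coords (bd c) (mu p)) - (r - p) *\<^sub>R v c) \<le> e * (r - p)"
    proof (rule strong_derivative[OF t1 c(1) _ bounded_linear.linear[OF bounded_linear_fst] _ _ e])
      show "fst (lam t1) \<in> fst c" using c(2) base by simp
      show "norm (fst x) \<le> norm x" for x :: "'e \<times> 'e" using norm_fst_le[of "fst x" "snd x"] by simp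
      fix t' y assume t': "t' \<in> J" "\<sigma> t' = \<sigma> t1" "moving J \<sigma> t'" and y: "rate c t' y"
      obtain v' where v': "tangent_covector (lam t') v'" using moving_tangent[OF t'(3,1)] by blast
      \<comment> \<open>The normal momenta at \<open>t\<close> and \<open>t'\<close> may differ, but
        the restrictions coincide, and they determine the tangent maximiser.\<close>
      have "v = v'" by (rule same_tangent[OF t(1) t'(1) _ v v']) (use t t' in simp)
      have "fst (lam t') \<in> fst c" using c(2) base same_base[OF t'(1) t1 t'(2)] by simp
      then obtain w where "y = tangential w" "fst w = v' c" using moving_rate[OF t'(3,1) v' c(1) _ y] by blast
      then show "fst y = v c" using \<open>v = v'\<close> by (simp add: tangential(3))
    qed
    then show "\<exists>d>0. \<forall>p\<in>K \<inter> ball (\<sigma> t1) d. \<forall>r\<in>K \<inter> ball (\<sigma> t1) d. p \<le> r \<longrightarrow>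
      norm (snd c (fst (mu r)) - snd c (fst (mu p)) - (r - p) *\<^sub>R v c) \<le> e * (r - p)"
      by (simp add: coords_def bd)
  qed
  then show ?thesis by blast
qed

lemma geodesic_orbit:
  assumes t1: "t1 \<in> J" and nd: "\<exists>t2\<in>J. \<sigma> t1 \<noteq> \<sigma> t2" and reg: "fst (mu (\<sigma> t1)) \<in> regular_boundary A \<xi> U"
  shows "HB (mu (\<sigma> t1)) = 1" "flows_along boundary_model BA HB mu K (\<sigma> t1)"
proof -
  obtain t where t: "t \<in> J" "\<sigma> t = \<sigma> t1" "moving J \<sigma> t" using moving_exists[OF t1] nd by blast
  obtain v where v: "tangent_covector (lam t) v" using moving_tangent[OF t(3,1)] by blast
  have mu1: "mu (\<sigma> t1) = rest t" using mu[OF t(1)] t(2) by simp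
  have \<tau>K: "\<sigma> t1 \<in> K" using t1 by (simp add: K_def)
  have vv: "tangent_covector (fst (lam t), snd (lam t)) v" using v by simp
  have base: "fst (rest t) = fst (lam t)" using rest(1)[OF t(1)] .
  show "HB (mu (\<sigma> t1)) = 1" unfolding mu1 rest_def by (rule HB_tangent_covector[OF vv])
  show "flows_along boundary_model BA HB mu K (\<sigma> t1)"
    unfolding flows_along_def
  proof (intro conjI ballI impI mu_in(1)[OF \<tau>K])
    fix c' assume c': "c' \<in> BA" "fst (mu (\<sigma> t1)) \<in> fst c'"
    then obtain c where c: "c \<in> BC" "c' = bd c" by (auto simp: BA_eq)
    have fc: "fst (lam t) \<in> fst c" using c' c mu1 base by (simp add: bd)
    have fc1: "fst (lam t1) \<in> fst c" using same_base[OF t(1) t1 t(2)] fc by simp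
    \<comment> \<open>Every time of the fibre with a tangent covector yields a Hamiltonian vector of
      \<open>HB\<close> at the same point \<open>rest t\<close>. Its uniqueness makes the rates at
      all moving times of the fibre equal, although the covectors \<open>lam t'\<close> may
      differ.\<close>
    have hvec: "hamiltonian_vector boundary_model BA HB (bd c) (rest t) (tangential w)"
      if w: "hamiltonian_vector UNIV A H c (lam t') w" and t': "t' \<in> J" "\<sigma> t' = \<sigma> t1" "tangent_covector (lam t') v'" for t' v' w
    proof -
      have r: "rest t' = rest t" by (rule rest_constant[OF t'(1) t(1)]) (use t t' in simp)
      have b: "fst (lam t') = fst (lam t)" using r by (simp add: rest_def)
      have "hamiltonian_vector boundary_model BA HB (bd c) (fst (lam t'), restrict_covector (fst (lam t')) (snd (lam t'))) (fst w, tan_part (snd w))"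
      proof (rule boundary_hamiltonian_vector[OF _ _ c(1)])
        show "tangent_covector (fst (lam t'), snd (lam t')) v'" using t'(3) by simp
        show "hamiltonian_vector UNIV A H c (fst (lam t'), snd (lam t')) w" using w by simp
        show "fst (lam t') \<in> fst c" "fst (lam t') \<in> regular_boundary A \<xi> U" unfolding b using fc reg mu1 base by simp_all
      qed
      then show ?thesis using r unfolding rest_def tangential_def by simp
    qed
    obtain y where y: "rate c t y" using rate_exists[OF t(1) c(1) fc] by blast
    obtain w where w: "hamiltonian_vector UNIV A H c (lam t) w" "y = tangential w"
      using moving_rate[OF t(3,1) v c(1) fc y] by blast
    have hw: "hamiltonian_vector boundary_model BA HB (bd c) (rest t) (tangential w)" by (rule hvec[OF w(1) t(1,2) v])
    have strong: "\<exists>d>0. \<forall>p\<in>K \<inter> ball (\<sigma> t1) d. \<forall>r\<in>K \<inter> ball (\<sigma> t1) d. p \<le> r \<longrightarrow>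
      norm (coords (bd c) (mu r) - coords (bd c) (mu p) - (r - p) *\<^sub>R tangential w) \<le> e * (r - p)" if e: "e > 0" for e
    proof (rule strong_derivative[OF t1 c(1) fc1 _ _ _ e, where L = "\<lambda>x. x"])
      fix t' y' assume t': "t' \<in> J" "\<sigma> t' = \<sigma> t1" "moving J \<sigma> t'" and y': "rate c t' y'"
      obtain v' where v': "tangent_covector (lam t') v'" using moving_tangent[OF t'(3,1)] by blast
      have fc': "fst (lam t') \<in> fst c" using fc1 same_base[OF t'(1) t1 t'(2)] by simp
      obtain w' where w': "hamiltonian_vector UNIV A H c (lam t') w'" "y' = tangential w'"
        using moving_rate[OF t'(3,1) v' c(1) fc' y'] by blast
      have hw': "hamiltonian_vector boundary_model BA HB (bd c) (rest t) (tangential w')" by (rule hvec[OF w'(1) t'(1,2) v'])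
      show "y' = tangential w" unfolding w'(2)
        by (rule B.hamiltonian_vector_unique[OF rest(2)[OF t(1)] bd_in[OF c(1)] _ hw' hw])
          (use fc boundary[OF t(1)] base in \<open>simp add: bd\<close>)
    qed (auto simp: linear_id[unfolded id_def])
    have "((\<lambda>\<tau>. coords (bd c) (mu \<tau>)) has_vector_derivative tangential w) (at (\<sigma> t1) within K)"
      by (rule strong_derivative_imp_vector_derivative[OF strong \<tau>K])
    then show "\<exists>w. hamiltonian_vector boundary_model BA HB c' (mu (\<sigma> t1)) w \<and>
        ((\<lambda>s. coords c' (mu s)) has_vector_derivative w) (at (\<sigma> t1) within K)"
      unfolding c(2) mu1 using hw by blast
  qed
qed

lemma boundary_geodesic_mu:
  assumes nd: "\<exists>t\<in>J. \<exists>t'\<in>J. \<sigma> t \<noteq> \<sigma> t'"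
  shows "boundary_geodesic A \<xi> f U (\<lambda>\<tau>. fst (mu \<tau>)) K"
  unfolding boundary_geodesic_def
proof (intro conjI)
  have nd1: "\<exists>t2\<in>J. \<sigma> t1 \<noteq> \<sigma> t2" if "t1 \<in> J" for t1 using nd that by metis
  have pre: "\<exists>t1\<in>J. \<tau> = \<sigma> t1" if "\<tau> \<in> K" for \<tau> using that by (auto simp: K_def)
  show "is_interval K" by (rule K_interval)
  show "(\<lambda>\<tau>. fst (mu \<tau>)) ` K \<subseteq> frontier U" using mu_in(2) by blast
  show "lipschitz_in_charts BA (\<lambda>\<tau>. fst (mu \<tau>)) (\<lambda>c s. snd c (fst (mu s))) K"
    unfolding lipschitz_in_charts_def
  proof (intro ballI impI)
    fix \<tau> c' assume \<tau>: "\<tau> \<in> K" and c': "c' \<in> BA" "fst (mu \<tau>) \<in> fst c'"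
    obtain c where c: "c \<in> BC" "c' = bd c" using c' by (auto simp: BA_eq)
    obtain t1 where t1: "t1 \<in> J" "\<tau> = \<sigma> t1" using pre[OF \<tau>] by blast
    have fc: "fst (mu (\<sigma> t1)) \<in> fst c" using c' c t1 by (simp add: bd)
    obtain v where v: "unit_tangent (\<sigma> t1) v" using geodesic_velocity[OF t1(1) nd1[OF t1(1)]] by blast
    obtain d1 where d1: "d1 > 0" "\<forall>p\<in>K \<inter> ball (\<sigma> t1) d1. \<forall>r\<in>K \<inter> ball (\<sigma> t1) d1. p \<le> r \<longrightarrow>
      norm (snd c (fst (mu r)) - snd c (fst (mu p)) - (r - p) *\<^sub>R v c) \<le> 1 * (r - p)"
      using unit_tangentD(5)[OF v c(1) fc zero_less_one] by blast
    have "fst (lam t1) \<in> fst c" using fc mu[OF t1(1)] rest(1)[OF t1(1)] by simp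
    then obtain d2 where d2: "d2 > 0" "\<forall>\<tau>\<in>K \<inter> ball (\<sigma> t1) d2. fst (mu \<tau>) \<in> fst c"
      using mu_in_chart[OF t1(1) c(1)] by blast
    let ?B = "K \<inter> ball \<tau> (min d1 d2)"
    have "(norm (v c) + 1)-lipschitz_on ?B (\<lambda>s. snd c' (fst (mu s)))"
    proof (rule lipschitz_onI)
      fix p r assume pr: "p \<in> ?B" "r \<in> ?B"
      have "norm (snd c (fst (mu r)) - snd c (fst (mu p))) \<le> (norm (v c) + 1) * \<bar>r - p\<bar>"
        by (rule strong_derivative_bounds(1)[where K = ?B]) (use d1(2) pr t1(2) in auto)
      then show "dist (snd c' (fst (mu p))) (snd c' (fst (mu r))) \<le> (norm (v c) + 1) * dist p r"
        by (simp add: c(2) bd dist_norm norm_minus_commute abs_minus_commute)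
    qed simp
    moreover have "\<forall>s\<in>?B. fst (mu s) \<in> fst c'" using d2 t1(2) c(2) mu_in(2) by (auto simp: bd)
    moreover have "min d1 d2 > 0" using d1 d2 by simp
    ultimately show "\<exists>\<epsilon>>0. \<exists>C. (\<forall>s\<in>K \<inter> ball \<tau> \<epsilon>. fst (mu s) \<in> fst c') \<and> C-lipschitz_on (K \<inter> ball \<tau> \<epsilon>) (\<lambda>s. snd c' (fst (mu s)))"
      by blast
  qed
  \<comment> \<open>Parametrised by \<sigma>, the curve has a unit velocity at every parameter, so
    no null set is excepted.\<close>
  show "AE t in lebesgue. t \<in> K \<longrightarrow> (\<exists>u\<in>boundary_distribution A \<xi> U (fst (mu t)).
           velocity boundary_model BA (\<lambda>\<tau>. fst (mu \<tau>)) K t u \<and> boundary_norm A f U (fst (mu t)) u = 1)"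
  proof (rule AE_I2, intro impI)
    fix \<tau> assume \<tau>: "\<tau> \<in> K"
    obtain t1 where t1: "t1 \<in> J" "\<tau> = \<sigma> t1" using pre[OF \<tau>] by blast
    obtain v where "unit_tangent (\<sigma> t1) v" using geodesic_velocity[OF t1(1) nd1[OF t1(1)]] by blast
    note v = unit_tangentD[OF this]
    have q: "fst (mu (\<sigma> t1)) \<in> frontier U" using mu_in(2)[OF \<tau>] t1 by simp
    obtain c0 where c0: "c0 \<in> BC" "fst (mu (\<sigma> t1)) \<in> fst c0" using BC_exists[OF q] by blast
    obtain u where u: "pushes_forward A U (fst (mu (\<sigma> t1))) u v"
      using pushes_forward_exists[OF xi_tangent[OF v(1)] c0 q v(3)[OF c0]] by blast
    have "velocity boundary_model BA (\<lambda>\<tau>. fst (mu \<tau>)) K \<tau> u"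
      unfolding velocity_def
    proof (intro conjI ballI impI)
      show "u \<in> tangent_space boundary_model BA (fst (mu \<tau>))" using u t1 by (simp add: pushes_forward_def)
      fix c' assume c': "c' \<in> BA" "fst (mu \<tau>) \<in> fst c'"
      obtain c where c: "c \<in> BC" "c' = bd c" using c' by (auto simp: BA_eq)
      have fc: "fst (mu (\<sigma> t1)) \<in> fst c" using c' c t1 by (simp add: bd)
      have "u c' = v c" using pushes_forward_chart(1)[OF u c(1) fc q] c(2) by simp
      moreover have "((\<lambda>s. snd c (fst (mu s))) has_vector_derivative v c) (at (\<sigma> t1) within K)"
        by (rule strong_derivative_imp_vector_derivative[OF v(5)[OF c(1) fc]]) (use \<tau> t1 in auto)
      ultimately show "((\<lambda>s. snd c' (fst (mu s))) has_vector_derivative u c') (at \<tau> within K)"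
        using c(2) t1 by (simp add: bd)
    qed
    moreover have "boundary_norm A f U (fst (mu \<tau>)) u = 1" using boundary_norm_eq[OF u q] v(2) t1 by simp
    moreover have "u \<in> boundary_distribution A \<xi> U (fst (mu \<tau>))" using u v(1) t1 by (auto simp: boundary_distribution_def)
    ultimately show "\<exists>u\<in>boundary_distribution A \<xi> U (fst (mu \<tau>)).
           velocity boundary_model BA (\<lambda>\<tau>. fst (mu \<tau>)) K \<tau> u \<and> boundary_norm A f U (fst (mu \<tau>)) u = 1" by blast
  qed
  show "\<forall>C. is_interval C \<and> C \<subseteq> K \<and> (\<lambda>\<tau>. fst (mu \<tau>)) ` C \<subseteq> regular_boundary A \<xi> U \<longrightarrow>
        (\<exists>\<mu>. unit_boundary_orbit A \<xi> f U \<mu> C \<and> (\<forall>t\<in>C. fst (\<mu> t) = fst (mu t)))"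
  proof (intro allI impI, elim conjE)
    fix C assume C: "C \<subseteq> K" "(\<lambda>\<tau>. fst (mu \<tau>)) ` C \<subseteq> regular_boundary A \<xi> U"
    have "unit_boundary_orbit A \<xi> f U mu C"
      unfolding unit_boundary_orbit_def
    proof (intro ballI conjI)
      fix \<tau> assume \<tau>: "\<tau> \<in> C"
      then have \<tau>K: "\<tau> \<in> K" using C by blast
      obtain t1 where t1: "t1 \<in> J" "\<tau> = \<sigma> t1" using pre[OF \<tau>K] by blast
      show "mu \<tau> \<in> cotangent_bundle boundary_model BA" by (rule mu_in(1)[OF \<tau>K])
      show reg: "fst (mu \<tau>) \<in> regular_boundary A \<xi> U" using C(2) \<tau> by blast
      note orb = geodesic_orbit[OF t1(1) nd1[OF t1(1)], folded t1(2), OF reg]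
      show "HB (mu \<tau>) = 1" by (rule orb(1))
      show "flows_along boundary_model BA HB mu C \<tau>"
        using orb(2) has_vector_derivative_within_subset[OF _ C(1)] unfolding flows_along_def by blast
    qed
    then show "\<exists>\<mu>. unit_boundary_orbit A \<xi> f U \<mu> C \<and> (\<forall>t\<in>C. fst (\<mu> t) = fst (mu t))" by blast
  qed
qed

end

section \<open>Length of characteristics where the distribution is a transverse line\<close>

context billiard
begin

lemma characteristic_continuous:
  assumes bc: "billiard_characteristic A \<xi> f U G lam J" and ab: "{a..b} \<subseteq> J"
    and c: "c \<in> A" "\<And>t. t \<in> {a..b} \<Longrightarrow> fst (lam t) \<in> fst c"
  shows "continuous_on {a..b} (\<lambda>t. coords c (lam t))"
  unfolding continuous_on_eq_continuous_within
proof
  fix t assume t: "t \<in> {a..b}"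
  have "lipschitz_in_charts A (\<lambda>t. fst (lam t)) (\<lambda>c t. coords c (lam t)) J"
    using bc by (simp add: billiard_characteristic_def)
  then obtain d C where d: "d > 0" "C-lipschitz_on (J \<inter> ball t d) (\<lambda>t. coords c (lam t))"
    using t ab c unfolding lipschitz_in_charts_def by blast
  have "continuous_on ({a..b} \<inter> ball t d) (\<lambda>t. coords c (lam t))"
    by (rule continuous_on_subset[OF lipschitz_on_continuous_on[OF d(2)]]) (use ab in auto)
  then have "continuous (at t within {a..b} \<inter> ball t d) (\<lambda>t. coords c (lam t))"
    using t d(1) by (simp add: continuous_on_eq_continuous_within)
  moreover have "at t within {a..b} \<inter> ball t d = at t within {a..b}"
    by (rule at_within_nhd[of _ "ball t d"]) (use d in auto)
  ultimately show "continuous (at t within {a..b}) (\<lambda>t. coords c (lam t))" by (simp add: continuous_within)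
qed

text \<open>Away from the unit level only \<open>X_G\<close> acts, for almost every time. The
  momentum along \<open>l\<close> is the integral of a derivative that is not negative.\<close>

lemma characteristic_monotone:
  assumes bc: "billiard_characteristic A \<xi> f U G lam J" and ab: "a \<in> J" "b \<in> J" "a \<le> b"
    and c: "c \<in> A" "\<And>t. t \<in> {a..b} \<Longrightarrow> fst (lam t) \<in> fst c" and lip: "C-lipschitz_on {a..b} (\<lambda>t. coords c (lam t))"
    and no: "\<And>t. t \<in> {a..b} \<Longrightarrow> lam t \<notin> unit_level A \<xi> f"
    and l: "\<And>t w. t \<in> {a..b} \<Longrightarrow> fst (lam t) \<in> frontier U \<Longrightarrow> lam t \<in> cotangent_bundle UNIV A \<Longrightarrow>
      hamiltonian_vector UNIV A (lifted G) c (lam t) w \<Longrightarrow> 0 \<le> snd w \<bullet> l"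
  shows "snd (lam a) c \<bullet> l \<le> snd (lam b) c \<bullet> l"
proof (cases "a = b")
  case False
  then have lt: "a < b" using ab by simp
  obtain N where N: "negligible N" "\<And>t. t \<in> J - N \<Longrightarrow>
      lam t \<in> unit_level A \<xi> f \<and> flows_along UNIV A H lam J t \<and> speed A f (\<lambda>t. fst (lam t)) J t = 1 \<or>
      fst (lam t) \<in> frontier U \<and> lam t \<in> cotangent_bundle UNIV A \<and> flows_along UNIV A (lifted G) lam J t \<and> speed A f (\<lambda>t. fst (lam t)) J t = 0"
    using characteristic_cases[OF bc ab(1,2) lt] by blast
  have J: "is_interval J" using bc by (simp add: billiard_characteristic_def)
  have sub: "{a..b} \<subseteq> J" by (rule interval_Icc_subset[OF J ab(1,2)])
  have "\<forall>t\<in>{a..b} - N. \<exists>w. ((\<lambda>t. coords c (lam t)) has_vector_derivative w) (at t within {a..b}) \<and> 0 \<le> snd w \<bullet> l"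
  proof
    fix t assume t: "t \<in> {a..b} - N"
    then have g: "fst (lam t) \<in> frontier U" "lam t \<in> cotangent_bundle UNIV A" "flows_along UNIV A (lifted G) lam J t"
      using N(2)[of t] no[of t] sub by auto
    then obtain w where w: "hamiltonian_vector UNIV A (lifted G) c (lam t) w" "((\<lambda>s. coords c (lam s)) has_vector_derivative w) (at t within J)"
      using c t unfolding flows_along_def by blast
    then show "\<exists>w. ((\<lambda>t. coords c (lam t)) has_vector_derivative w) (at t within {a..b}) \<and> 0 \<le> snd w \<bullet> l"
      using has_vector_derivative_within_subset[OF w(2) sub] l[OF _ g(1,2) w(1)] t by blast
  qed
  from bchoice[OF this] obtain D where D: "\<And>t. t \<in> {a..b} - N \<Longrightarrow> ((\<lambda>t. coords c (lam t)) has_vector_derivative D t) (at t within {a..b})"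
    "\<And>t. t \<in> {a..b} - N \<Longrightarrow> 0 \<le> snd (D t) \<bullet> l" by blast
  have "(D has_integral (coords c (lam b) - coords c (lam a))) {a..b}"
    by (rule lipschitz_fundamental_theorem_of_calculus[OF ab(3) lip N(1) D(1)])
  then have "((\<lambda>t. snd (D t) \<bullet> l) has_integral (snd (coords c (lam b) - coords c (lam a)) \<bullet> l)) {a..b}"
    by (intro has_integral_linear[unfolded o_def, where h = "\<lambda>z. snd z \<bullet> l"] bounded_linear_inner_left_comp bounded_linear_snd)
  then have "((\<lambda>t. if t \<in> N then 0 else snd (D t) \<bullet> l) has_integral (snd (coords c (lam b) - coords c (lam a)) \<bullet> l)) {a..b}"
    by (rule has_integral_spike[OF N(1), rotated]) simp
  then have "0 \<le> snd (coords c (lam b) - coords c (lam a)) \<bullet> l"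
    by (rule has_integral_nonneg) (use D(2) in auto)
  then show ?thesis by (simp add: coords_def inner_diff_left)
qed simp

text \<open>If \<open>\<xi>\<close> is spanned by a field \<open>E\<close> transverse to the boundary, \<open>X_f\<close> moves along \<open>E\<close> or against it according to the
  sign of \<open>p \<bullet> E\<close>, and \<open>X_G\<close> can change this sign only in one direction. Hence a characteristic moves monotonically
  in the direction \<open>l\<close> apart from at most one change of direction, and its length in a small set is small.\<close>

lemma rank_one_length:
  fixes l :: 'e
  assumes bc: "billiard_characteristic A \<xi> f U G lam J" and arc: "arclength lam J s" and ab: "\<alpha> \<in> J" "\<beta> \<in> J" "\<alpha> \<le> \<beta>"
    and c: "c \<in> BC" "\<And>t. t \<in> {\<alpha>..\<beta>} \<Longrightarrow> fst (lam t) \<in> fst c"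
    and near: "\<And>t. t \<in> {\<alpha>..\<beta>} \<Longrightarrow> dist (snd c (fst (lam t))) x0 < \<rho>"
    and E: "continuous_on (ball x0 \<rho>) E" and C: "0 < C1"
    and span: "\<And>q v. q \<in> fst c \<Longrightarrow> dist (snd c q) x0 < \<rho> \<Longrightarrow> v \<in> \<xi> q \<Longrightarrow> f q v = 1 \<Longrightarrow> \<exists>r. v c = r *\<^sub>R E (snd c q) \<and> C1 \<le> \<bar>r\<bar> \<and> \<bar>r\<bar> \<le> C2"
    and l: "\<And>x. dist x x0 < \<rho> \<Longrightarrow> \<eta> \<le> E x \<bullet> l \<and> E x \<bullet> l \<le> \<Lambda>" "0 < \<eta>"
    and G_sign: "\<And>z w. z \<in> cotangent_bundle UNIV A \<Longrightarrow> fst z \<in> fst c \<Longrightarrow> fst z \<in> frontier U \<Longrightarrow> dist (snd c (fst z)) x0 < \<rho> \<Longrightarrow>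
      hamiltonian_vector UNIV A (lifted G) c z w \<Longrightarrow> 0 \<le> snd w \<bullet> E (snd c (fst z))"
  shows "C1 * \<eta> * (s \<beta> - s \<alpha>) \<le> 4 * \<rho> * norm l"
proof -
  have cA: "c \<in> A" by (rule BC_A[OF c(1)])
  have J: "is_interval J" using bc by (simp add: billiard_characteristic_def)
  have sub: "{\<alpha>..\<beta>} \<subseteq> J" by (rule interval_Icc_subset[OF J ab(1,2)])
  have lc: "lipschitz_in_charts A (\<lambda>t. fst (lam t)) (\<lambda>c t. coords c (lam t)) J"
    using bc by (simp add: billiard_characteristic_def)
  \<comment> \<open>The momentum along \<open>E\<close>. On the unit level the maximiser is
    \<open>r *\<^sub>R E\<close> with \<open>r * \<phi> t = 1\<close>, so the sign of \<phi> is the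
    direction of motion and |\<phi>| is bounded below there.\<close>
  define \<phi> where "\<phi> t = snd (lam t) c \<bullet> E (snd c (fst (lam t)))" for t
  have cc: "continuous_on {\<alpha>..\<beta>} (\<lambda>t. coords c (lam t))"
    by (rule characteristic_continuous[OF bc sub cA c(2)])
  have X: "continuous_on {\<alpha>..\<beta>} (\<lambda>t. snd c (fst (lam t)))" "continuous_on {\<alpha>..\<beta>} (\<lambda>t. snd (lam t) c)"
    using continuous_on_fst[OF cc] continuous_on_snd[OF cc] by (simp_all add: coords_def)
  have EX: "continuous_on {\<alpha>..\<beta>} (\<lambda>t. E (snd c (fst (lam t))))"
    by (rule continuous_on_compose2[OF E X(1)]) (use near in \<open>auto simp: dist_commute\<close>)
  have \<phi>: "continuous_on {\<alpha>..\<beta>} \<phi>" unfolding \<phi>_def[abs_def] by (rule continuous_on_inner[OF X(2) EX])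
  have unit: "\<exists>r. w = (r *\<^sub>R E (snd c (fst (lam t))), snd w) \<and> C1 \<le> \<bar>r\<bar> \<and> \<bar>r\<bar> \<le> C2 \<and> r * \<phi> t = 1"
    if t: "t \<in> {\<alpha>..\<beta>}" and u: "lam t \<in> unit_level A \<xi> f" and w: "hamiltonian_vector UNIV A H c (lam t) w" for t w
  proof -
    have z: "lam t \<in> cotangent_bundle UNIV A" "H (lam t) = 1" using u by (auto simp: unit_level_def)
    obtain v where v: "v \<in> \<xi> (fst (lam t))" "f (fst (lam t)) v = 1" "pairing A (fst (lam t)) (snd (lam t)) v = H (lam t)"
      using H_maximiser[OF z(1)] z(2) by auto
    have wv: "fst w = v c" by (rule H_vector_fst[OF z(1) cA c(2)[OF t] v w])
    obtain r where r: "v c = r *\<^sub>R E (snd c (fst (lam t)))" "C1 \<le> \<bar>r\<bar>" "\<bar>r\<bar> \<le> C2"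
      using span[OF c(2)[OF t] near[OF t] v(1,2)] by blast
    have "snd (lam t) c \<bullet> v c = 1"
      using M.pairing_chart[OF cotangent_bundleD[OF z(1)] xi_tangent[OF v(1)] cA c(2)[OF t]] v(3) z(2) by simp
    then have "r * \<phi> t = 1" using r(1) by (simp add: \<phi>_def)
    then show ?thesis using r wv by (intro exI[of _ r]) (simp add: prod_eq_iff)
  qed
  have unit_exists: "\<exists>r. C1 \<le> \<bar>r\<bar> \<and> \<bar>r\<bar> \<le> C2 \<and> r * \<phi> t = 1" if t: "t \<in> {\<alpha>..\<beta>}" and u: "lam t \<in> unit_level A \<xi> f" for t
  proof -
    have z: "lam t \<in> cotangent_bundle UNIV A" "H (lam t) > 0" using u by (auto simp: unit_level_def)
    obtain w where "hamiltonian_vector UNIV A H c (lam t) w" using H_vector_continuous[OF z(1) cA c(2)[OF t] z(2)] by blast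
    then show ?thesis using unit[OF t u] by blast
  qed
  \<comment> \<open>The sign of \<phi> never decreases. Where \<phi> is nonzero this is continuity;
    near a zero the unit level is not met, so only \<open>X_G\<close> acts, and \<open>X_G\<close>
    does not decrease \<phi>.\<close>
  have signs: "(0 \<le> \<phi> a \<longrightarrow> 0 \<le> \<phi> b) \<and> (0 < \<phi> a \<longrightarrow> 0 < \<phi> b)" if ab: "\<alpha> \<le> a" "a \<le> b" "b \<le> \<beta>" for a b
  proof -
    define Q where "Q r t \<longleftrightarrow> (\<alpha> \<le> r \<and> t \<le> \<beta> \<longrightarrow> (0 \<le> \<phi> r \<longrightarrow> 0 \<le> \<phi> t) \<and> (0 < \<phi> r \<longrightarrow> 0 < \<phi> t))" for r t
    have "Q a b"
    proof (rule Bolzano[OF ab(2)])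
      show "Q r u" if "Q r t" "Q t u" "r \<le> t" "t \<le> u" for r t u using that by (auto simp: Q_def)
    next
      fix x assume "a \<le> x" "x \<le> b"
      then have x: "x \<in> {\<alpha>..\<beta>}" using ab by auto
      show "\<exists>d>0. \<forall>a b. a \<le> x \<and> x \<le> b \<and> b - a < d \<longrightarrow> Q a b"
      proof (cases "\<phi> x = 0")
        case False
        then have p: "\<bar>\<phi> x\<bar> > 0" by simp
        obtain d where d: "d > 0" "\<And>u. u \<in> {\<alpha>..\<beta>} \<Longrightarrow> dist u x < d \<Longrightarrow> dist (\<phi> u) (\<phi> x) < \<bar>\<phi> x\<bar>"
          using \<phi> x p unfolding continuous_on_iff by blast
        have sg: "(\<phi> x > 0 \<and> \<phi> u > 0) \<or> (\<phi> x < 0 \<and> \<phi> u < 0)" if "u \<in> {\<alpha>..\<beta>}" "dist u x < d" for u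
          using d(2)[OF that] unfolding dist_real_def by linarith
        show ?thesis
        proof (intro exI[of _ d] conjI allI impI d(1))
          fix r t assume rt: "r \<le> x \<and> x \<le> t \<and> t - r < d"
          show "Q r t" unfolding Q_def
          proof
            assume art: "\<alpha> \<le> r \<and> t \<le> \<beta>"
            have "r \<in> {\<alpha>..\<beta>}" "dist r x < d" "t \<in> {\<alpha>..\<beta>}" "dist t x < d" using art rt x by (auto simp: dist_real_def)
            then show "(0 \<le> \<phi> r \<longrightarrow> 0 \<le> \<phi> t) \<and> (0 < \<phi> r \<longrightarrow> 0 < \<phi> t)" using sg[of r] sg[of t] by linarith
          qed
        qed
      next
        case True
        \<comment> \<open>On the unit level \<open>|r| \<le> C2\<close> and
          \<open>r * \<phi> t = 1\<close>, so |\<phi>| exceeds \<open>e\<close>. The added 1 keeps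
          the denominator positive and the inequality strict.\<close>
        define e where "e = 1 / (\<bar>C2\<bar> + 1)"
        have e: "e > 0" by (simp add: e_def add_nonneg_pos)
        obtain d1 where d1: "d1 > 0" "\<And>u. u \<in> {\<alpha>..\<beta>} \<Longrightarrow> dist u x < d1 \<Longrightarrow> dist (\<phi> u) (\<phi> x) < e"
          using \<phi> x e unfolding continuous_on_iff by blast
        obtain d2 L where d2: "d2 > 0" "L-lipschitz_on (J \<inter> ball x d2) (\<lambda>t. coords c (lam t))"
          using lc x sub cA c(2) unfolding lipschitz_in_charts_def by blast
        have nolevel: "lam u \<notin> unit_level A \<xi> f" if u: "u \<in> {\<alpha>..\<beta>}" "dist u x < d1" for u
        proof
          assume "lam u \<in> unit_level A \<xi> f"
          then obtain r where r: "\<bar>r\<bar> \<le> C2" "r * \<phi> u = 1" using unit_exists[OF u(1)] by blast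
          have "\<bar>\<phi> u\<bar> < e" using d1(2)[OF u] True by (simp add: dist_real_def)
          then have "\<bar>\<phi> u\<bar> * (\<bar>C2\<bar> + 1) < 1" by (simp add: e_def pos_less_divide_eq add_nonneg_pos)
          moreover have "\<bar>r\<bar> * \<bar>\<phi> u\<bar> \<le> (\<bar>C2\<bar> + 1) * \<bar>\<phi> u\<bar>" using r(1) by (intro mult_right_mono) auto
          moreover have "\<bar>r\<bar> * \<bar>\<phi> u\<bar> = 1" using r(2) by (simp add: abs_mult[symmetric])
          ultimately show False by (simp add: mult.commute)
        qed
        show ?thesis
        proof (intro exI[of _ "min d1 d2"] conjI allI impI)
          show "0 < min d1 d2" using d1 d2 by simp
          fix r t assume rt: "r \<le> x \<and> x \<le> t \<and> t - r < min d1 d2"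
          show "Q r t" unfolding Q_def
          proof
            assume art: "\<alpha> \<le> r \<and> t \<le> \<beta>"
            have i: "u \<in> {\<alpha>..\<beta>}" "dist u x < d1" "dist x u < d2" if "u \<in> {r..t}" for u
              using that art rt by (auto simp: dist_real_def)
            have rtJ: "r \<in> J" "t \<in> J" "r \<le> t" using sub art rt by auto
            have ch: "fst (lam u) \<in> fst c" if "u \<in> {r..t}" for u using c(2) i(1)[OF that] by blast
            have lip: "L-lipschitz_on {r..t} (\<lambda>t. coords c (lam t))"
              by (rule lipschitz_on_subset[OF d2(2)]) (use i sub in auto)
            \<comment> \<open>Without points of the unit level the base point rests, so
              \<open>E\<close> may be evaluated at one fixed point and \<phi> becomes a fixed linear
              function of the momentum.\<close>
            have const: "snd c (fst (lam u)) = snd c (fst (lam r))" if u: "u \<in> {r..t}" for u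
            proof -
              have "norm (fst (coords c (lam u)) - fst (coords c (lam r)) - (s u - s r) *\<^sub>R 0) \<le> 0 * (s u - s r)"
              proof (rule characteristic_estimate[OF bc arc _ _ _ c(1) _ bounded_linear_fst])
                show "r \<in> J" "u \<in> J" "r \<le> u" using rtJ u i(1)[OF u] sub by auto
                show "fst (lam v) \<in> fst c" if "v \<in> {r..u}" for v using ch that u by auto
                show "fst (0 :: 'e, x *\<^sub>R conormal) = 0" for x by simp
                fix v w assume "v \<in> {r..u}" "lam v \<in> unit_level A \<xi> f"
                then show "norm (fst w - 0) \<le> 0" using nolevel[of v] i[of v] u by auto
              qed
              then show ?thesis by (simp add: coords_def)
            qed
            have "snd (lam r) c \<bullet> E (snd c (fst (lam r))) \<le> snd (lam t) c \<bullet> E (snd c (fst (lam r)))"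
            proof (rule characteristic_monotone[OF bc rtJ cA ch lip])
              show "lam u \<notin> unit_level A \<xi> f" if "u \<in> {r..t}" for u using nolevel i that by blast
              fix u w assume u: "u \<in> {r..t}" and g: "fst (lam u) \<in> frontier U" "lam u \<in> cotangent_bundle UNIV A"
                "hamiltonian_vector UNIV A (lifted G) c (lam u) w"
              show "0 \<le> snd w \<bullet> E (snd c (fst (lam r)))"
                using G_sign[OF g(2) ch[OF u] g(1) near[OF i(1)[OF u]] g(3)] const[OF u] by simp
            qed
            then have "\<phi> r \<le> \<phi> t" using const[of t] rtJ by (simp add: \<phi>_def)
            then show "(0 \<le> \<phi> r \<longrightarrow> 0 \<le> \<phi> t) \<and> (0 < \<phi> r \<longrightarrow> 0 < \<phi> t)" by linarith
          qed
        qed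
      qed
    qed
    then show ?thesis using ab by (simp add: Q_def)
  qed
  define P where "P z = fst z \<bullet> l" for z :: "'e \<times> 'e"
  have P: "bounded_linear P" "P (0, x *\<^sub>R conormal) = 0" for x
    unfolding P_def[abs_def] by (simp_all add: bounded_linear_inner_left_comp bounded_linear_fst)
  \<comment> \<open>On the unit level the component of the velocity along \<open>l\<close> has
    absolute value between \<open>C1 * \<eta>\<close> and \<open>C2 * \<Lambda>\<close>.
    \<open>y\<close> is the midpoint of this range and \<epsilon> half its length, so that
    \<open>y - \<epsilon> = C1 * \<eta>\<close>.\<close>
  define y where "y = (C1 * \<eta> + C2 * \<Lambda>) / 2"
  define \<epsilon> where "\<epsilon> = (C2 * \<Lambda> - C1 * \<eta>) / 2"
  have rb: "C1 * \<eta> \<le> \<bar>r\<bar> * (E x \<bullet> l) \<and> \<bar>r\<bar> * (E x \<bullet> l) \<le> C2 * \<Lambda>" if "dist x x0 < \<rho>" "C1 \<le> \<bar>r\<bar>" "\<bar>r\<bar> \<le> C2" for x r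
    using l(1)[OF that(1)] l(2) that C by (intro conjI mult_mono) auto
  have mid: "\<bar>q - (a + b) / 2\<bar> \<le> (b - a) / 2" if "a \<le> q" "q \<le> b" for a b q :: real
    unfolding abs_le_iff using that by (simp add: field_simps)
  \<comment> \<open>\<open>sg\<close> is the direction of motion along \<open>E\<close>. While it
    does not change, the position along \<open>l\<close> moves in one direction by at least
    \<open>C1 * \<eta>\<close> per unit of arclength.\<close>
  have seg: "C1 * \<eta> * (s v - s u) \<le> sg * (P (coords c (lam v)) - P (coords c (lam u)))"
    if uv: "\<alpha> \<le> u" "u \<le> v" "v \<le> \<beta>" and sg: "sg = 1 \<and> (\<forall>t\<in>{u..v}. 0 \<le> \<phi> t) \<or> sg = -1 \<and> (\<forall>t\<in>{u..v}. \<phi> t \<le> 0)" for u v sg :: real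
  proof -
    have uvJ: "u \<in> J" "v \<in> J" using sub uv by auto
    have "norm (P (coords c (lam v)) - P (coords c (lam u)) - (s v - s u) *\<^sub>R (sg * y)) \<le> \<epsilon> * (s v - s u)"
    proof (rule characteristic_estimate[OF bc arc uvJ uv(2) c(1) _ P])
      show "fst (lam t) \<in> fst c" if "t \<in> {u..v}" for t using c(2) that uv by auto
      fix t w assume t: "t \<in> {u..v}" and lev: "lam t \<in> unit_level A \<xi> f" "hamiltonian_vector UNIV A H c (lam t) w"
      have t': "t \<in> {\<alpha>..\<beta>}" using t uv by auto
      obtain r where r: "w = (r *\<^sub>R E (snd c (fst (lam t))), snd w)" "C1 \<le> \<bar>r\<bar>" "\<bar>r\<bar> \<le> C2" "r * \<phi> t = 1"
        using unit[OF t' lev] by blast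
      have "fst w = r *\<^sub>R E (snd c (fst (lam t)))" using r(1) by (metis fst_conv)
      then have Pw: "P w = r * (E (snd c (fst (lam t))) \<bullet> l)" by (simp add: P_def)
      have "sg * r = \<bar>r\<bar>"
      proof -
        have "sg = 1 \<and> 0 \<le> \<phi> t \<or> sg = -1 \<and> \<phi> t \<le> 0" using sg t by blast
        moreover have "r * \<phi> t > 0" using r(4) by simp
        ultimately show ?thesis by (auto simp: zero_less_mult_iff)
      qed
      then have e: "sg * P w = \<bar>r\<bar> * (E (snd c (fst (lam t))) \<bullet> l)" unfolding Pw by (simp add: mult.assoc[symmetric])
      have "\<bar>sg * P w - y\<bar> \<le> \<epsilon>"
        using rb[OF near[OF t'] r(2,3)] unfolding e y_def \<epsilon>_def by (blast intro: mid)
      moreover have "P w - sg * y = sg * (sg * P w - y)" using sg by auto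
      ultimately show "norm (P w - sg * y) \<le> \<epsilon>" using sg by (auto simp: abs_mult)
    qed
    then have "\<bar>sg * (P (coords c (lam v)) - P (coords c (lam u))) - (s v - s u) * y\<bar> \<le> \<epsilon> * (s v - s u)"
      using sg by auto
    then have "(s v - s u) * y - \<epsilon> * (s v - s u) \<le> sg * (P (coords c (lam v)) - P (coords c (lam u)))"
      unfolding abs_le_iff by linarith
    moreover have "C1 * \<eta> = y - \<epsilon>" by (simp add: y_def \<epsilon>_def field_simps)
    then have "C1 * \<eta> * (s v - s u) = (s v - s u) * y - \<epsilon> * (s v - s u)" by (simp add: left_diff_distrib mult.commute)
    ultimately show ?thesis by simp
  qed
  have Pd: "\<bar>P (coords c (lam v)) - P (coords c (lam u))\<bar> \<le> 2 * \<rho> * norm l" if "u \<in> {\<alpha>..\<beta>}" "v \<in> {\<alpha>..\<beta>}" for u v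
  proof -
    have "dist (snd c (fst (lam v))) (snd c (fst (lam u))) \<le> dist (snd c (fst (lam v))) x0 + dist (snd c (fst (lam u))) x0"
      by (rule dist_triangle2)
    then have "norm (snd c (fst (lam v)) - snd c (fst (lam u))) \<le> 2 * \<rho>" using near[OF that(1)] near[OF that(2)] by (simp add: dist_norm)
    then have "norm (snd c (fst (lam v)) - snd c (fst (lam u))) * norm l \<le> 2 * \<rho> * norm l" by (rule mult_right_mono) simp
    then show ?thesis
      using Cauchy_Schwarz_ineq2[of "snd c (fst (lam v)) - snd c (fst (lam u))" l]
      by (simp add: P_def coords_def inner_diff_left)
  qed
  \<comment> \<open>The turning time, from motion against \<open>E\<close> to motion along it. The
    alternatives \<open>m = \<alpha>\<close> and \<open>m = \<beta>\<close> admit characteristics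
    that never turn.\<close>
  obtain m where m: "m \<in> {\<alpha>..\<beta>}" "\<forall>t\<in>{\<alpha>..m}. \<phi> t \<le> 0 \<or> m = \<alpha>" "\<forall>t\<in>{m..\<beta>}. 0 \<le> \<phi> t \<or> m = \<beta>"
  proof -
    consider "\<phi> \<beta> < 0" | "0 \<le> \<phi> \<alpha>" | "\<phi> \<alpha> < 0" "0 \<le> \<phi> \<beta>" by linarith
    then show ?thesis
    proof cases
      case 1
      have "\<phi> t \<le> 0" if "t \<in> {\<alpha>..\<beta>}" for t using signs[of t \<beta>] 1 that by auto
      then show ?thesis using that[of \<beta>] ab by auto
    next
      case 2
      have "0 \<le> \<phi> t" if "t \<in> {\<alpha>..\<beta>}" for t using signs[of \<alpha> t] 2 that by auto
      then show ?thesis using that[of \<alpha>] ab by auto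
    next
      case 3
      obtain m where m: "\<alpha> \<le> m" "m \<le> \<beta>" "\<phi> m = 0" using IVT'[of \<phi> \<alpha> 0 \<beta>] 3 ab(3) \<phi> by auto
      have "\<phi> t \<le> 0" if "t \<in> {\<alpha>..m}" for t using signs[of t m] m that by force
      moreover have "0 \<le> \<phi> t" if "t \<in> {m..\<beta>}" for t using signs[of m t] m that by force
      ultimately show ?thesis using that[of m] m by auto
    qed
  qed
  have "C1 * \<eta> * (s m - s \<alpha>) \<le> 2 * \<rho> * norm l"
  proof (cases "m = \<alpha>")
    case True
    then show ?thesis using Pd[of \<alpha> \<alpha>] ab by simp
  next
    case False
    have "C1 * \<eta> * (s m - s \<alpha>) \<le> (-1) * (P (coords c (lam m)) - P (coords c (lam \<alpha>)))"
      by (rule seg) (use m False in auto)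
    then show ?thesis using Pd[of \<alpha> m] m(1) ab by (simp add: abs_le_iff)
  qed
  moreover have "C1 * \<eta> * (s \<beta> - s m) \<le> 2 * \<rho> * norm l"
  proof (cases "m = \<beta>")
    case True
    then show ?thesis using Pd[of \<beta> \<beta>] ab by simp
  next
    case False
    have "C1 * \<eta> * (s \<beta> - s m) \<le> 1 * (P (coords c (lam \<beta>)) - P (coords c (lam m)))"
      by (rule seg) (use m False in auto)
    then show ?thesis using Pd[of m \<beta>] m(1) ab by (simp add: abs_le_iff)
  qed
  ultimately show ?thesis by (simp add: algebra_simps)
qed

end

section \<open>The limit of the reduced trajectories\<close>

locale limit_curve = billiard A \<xi> f U G
  for A :: "('a::topological_space, 'e::euclidean_space) chart set" and \<xi> f U G +
  fixes lams Js ss \<gamma>s Is \<gamma> and I :: "real set"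
  assumes chars: "\<And>i::nat. billiard_characteristic A \<xi> f U G (lams i) (Js i)"
    and arcs: "\<And>i. arclength (lams i) (Js i) (ss i)"
    and images: "\<And>i. ss i ` Js i = Is i" "\<And>i t. t \<in> Js i \<Longrightarrow> \<gamma>s i (ss i t) = fst (lams i t)"
    and I: "is_interval I" and lim\<gamma>: "C0_loc_limit euclidean Is \<gamma>s I \<gamma>"
begin

text \<open>Convergence of the reduced curves gives no information on the times of the
  characteristics. Preimages of \<open>y\<close> and \<open>z\<close> under the monotone arclength
  bound a piece of a characteristic whose arclengths stay in \<open>{a..b}\<close>, so its base
  stays in \<open>N\<close>.\<close>

lemma approximating_piece:
  assumes N: "open N" and ab: "{a..b} \<subseteq> I" "\<gamma> ` {a..b} \<subseteq> N"
  shows "\<forall>\<^sub>F i in sequentially. \<forall>y\<in>{a..b}. \<forall>z\<in>{a..b}. y \<le> z \<longrightarrow>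
    (\<exists>\<alpha>\<in>Js i. \<exists>\<beta>\<in>Js i. \<alpha> \<le> \<beta> \<and> ss i \<alpha> = y \<and> ss i \<beta> = z \<and> (\<forall>t\<in>{\<alpha>..\<beta>}. fst (lams i t) \<in> N))"
proof -
  have "compact {a..b}" "openin euclidean N" using N by auto
  then have "\<forall>\<^sub>F i in sequentially. {a..b} \<subseteq> Is i \<and> \<gamma>s i ` {a..b} \<subseteq> N"
    using lim\<gamma> ab unfolding C0_loc_limit_def by blast
  then show ?thesis
  proof eventually_elim
    case (elim i)
    show ?case
    proof (intro ballI impI)
      fix y z assume yz: "y \<in> {a..b}" "z \<in> {a..b}" "y \<le> z"
      have "y \<in> ss i ` Js i" "z \<in> ss i ` Js i" unfolding images(1) using elim yz(1,2) by blast+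
      then obtain \<alpha> \<beta>' where \<alpha>: "\<alpha> \<in> Js i" "ss i \<alpha> = y" and \<beta>': "\<beta>' \<in> Js i" "ss i \<beta>' = z" by (elim imageE) simp
      \<comment> \<open>For \<open>y = z\<close> the two preimages may come in either order, as the
        arclength can have plateaus; then \<alpha> serves for both.\<close>
      obtain \<beta> where \<beta>: "\<beta> \<in> Js i" "ss i \<beta> = z" "\<alpha> \<le> \<beta>"
      proof (cases "y = z")
        case True
        then show ?thesis using that[of \<alpha>] \<alpha> by simp
      next
        case False
        have "\<alpha> \<le> \<beta>'"
        proof (rule ccontr)
          assume "\<not> \<alpha> \<le> \<beta>'"
          then have "0 \<le> ss i \<alpha> - ss i \<beta>'" using arclength_lipschitz[OF chars arcs \<beta>'(1) \<alpha>(1)] by simp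
          then show False using \<alpha> \<beta>' yz False by simp
        qed
        then show ?thesis using that \<beta>' by blast
      qed
      have J: "is_interval (Js i)" using chars[of i] by (simp add: billiard_characteristic_def)
      have "fst (lams i t) \<in> N" if t: "t \<in> {\<alpha>..\<beta>}" for t
      proof -
        have tJ: "t \<in> Js i" using interval_Icc_subset[OF J \<alpha>(1) \<beta>(1)] t by blast
        have "0 \<le> ss i t - ss i \<alpha>" "0 \<le> ss i \<beta> - ss i t"
          using arclength_lipschitz[OF chars arcs \<alpha>(1) tJ] arclength_lipschitz[OF chars arcs tJ \<beta>(1)] t by auto
        then have "ss i t \<in> {a..b}" using \<alpha> \<beta> yz by simp
        then have "\<gamma>s i (ss i t) \<in> N" using elim by blast
        then show ?thesis using images(2)[OF tJ] by simp
      qed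
      then show "\<exists>\<alpha>\<in>Js i. \<exists>\<beta>\<in>Js i. \<alpha> \<le> \<beta> \<and> ss i \<alpha> = y \<and> ss i \<beta> = z \<and> (\<forall>t\<in>{\<alpha>..\<beta>}. fst (lams i t) \<in> N)"
        using \<alpha> \<beta> by blast
    qed
  qed
qed

lemma \<gamma>_continuous: "continuous_on I \<gamma>"
  using lim\<gamma> by (simp add: C0_loc_limit_def)

lemma chart_ball_open:
  assumes "c \<in> A" shows "open (fst c \<inter> snd c -` ball x r)"
  using is_chart[OF assms] by (intro continuous_open_preimage) (auto simp: is_chart_def)

lemma \<gamma>_neighbourhood:
  assumes x: "x \<in> I" and N: "open N" "\<gamma> x \<in> N"
  obtains a b d where "d > 0" "{a..b} \<subseteq> I" "\<gamma> ` {a..b} \<subseteq> N" "I \<inter> ball x d \<subseteq> {a..b}"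
proof -
  have "openin (top_of_set I) (I \<inter> \<gamma> -` N)" by (rule continuous_openin_preimage_gen[OF \<gamma>_continuous N(1)])
  then obtain r where r: "r > 0" "ball x r \<inter> I \<subseteq> I \<inter> \<gamma> -` N" using x N unfolding openin_contains_ball by blast
  obtain a b d where *: "d > 0" "a \<le> x" "x \<le> b" "a \<in> I" "b \<in> I" "{a..b} \<subseteq> I \<inter> ball x r" "I \<inter> ball x d \<subseteq> {a..b}"
    using interval_neighbourhood[OF I x r(1)] by metis
  show ?thesis by (rule that[OF *(1) _ _ *(7)]) (use *(6) r(2) in auto)
qed

lemma \<gamma>_pointwise:
  assumes y: "y \<in> I" and c: "c \<in> A" "\<gamma> y \<in> fst c"
  shows "(\<lambda>i. snd c (\<gamma>s i y)) \<longlonglongrightarrow> snd c (\<gamma> y)"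
proof (rule tendstoI)
  fix r :: real assume r: "r > 0"
  have "compact {y}" "{y} \<subseteq> I" "openin euclidean (fst c \<inter> snd c -` ball (snd c (\<gamma> y)) r)"
    "\<gamma> ` {y} \<subseteq> fst c \<inter> snd c -` ball (snd c (\<gamma> y)) r"
    using y c r chart_ball_open[OF c(1)] by auto
  then have "\<forall>\<^sub>F i in sequentially. {y} \<subseteq> Is i \<and> \<gamma>s i ` {y} \<subseteq> fst c \<inter> snd c -` ball (snd c (\<gamma> y)) r"
    using lim\<gamma> unfolding C0_loc_limit_def by blast
  then show "\<forall>\<^sub>F i in sequentially. dist (snd c (\<gamma>s i y)) (snd c (\<gamma> y)) < r"
    by eventually_elim (auto simp: dist_commute)
qed

text \<open>Vectors of unit length have components bounded by a local constant \<open>C\<close>. So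
  the approximating trajectories, parametrised by arclength, satisfy a common Lipschitz estimate,
  which passes to the pointwise limit.\<close>

lemma \<gamma>_lipschitz:
  assumes x: "x \<in> I" and c: "c \<in> BC" "\<gamma> x \<in> fst c"
  shows "\<exists>d>0. \<exists>C\<ge>0. \<forall>y\<in>I \<inter> ball x d. \<forall>z\<in>I \<inter> ball x d. norm (snd c (\<gamma> z) - snd c (\<gamma> y)) \<le> C * \<bar>z - y\<bar>"
proof -
  have cA: "c \<in> A" by (rule BC_A[OF c(1)])
  obtain C r where C: "C \<ge> 0" and r: "r > 0"
    "\<And>q v. q \<in> fst c \<Longrightarrow> dist (snd c q) (snd c (\<gamma> x)) < r \<Longrightarrow> v \<in> \<xi> q \<Longrightarrow> norm (v c) \<le> C * f q v"
    using xi_vector_bound[OF cA c(2)] by blast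
  define N where "N = fst c \<inter> snd c -` ball (snd c (\<gamma> x)) r"
  have N: "open N" "\<gamma> x \<in> N" using chart_ball_open[OF cA] c r(1) by (auto simp: N_def)
  obtain a b d where d: "d > 0" "{a..b} \<subseteq> I" "\<gamma> ` {a..b} \<subseteq> N" "I \<inter> ball x d \<subseteq> {a..b}"
    by (rule \<gamma>_neighbourhood[OF x N])
  have main: "norm (snd c (\<gamma> z) - snd c (\<gamma> y)) \<le> C * (z - y)" if yz: "y \<in> {a..b}" "z \<in> {a..b}" "y \<le> z" for y z
  proof (rule tendsto_upperbound)
    have "y \<in> I" "z \<in> I" "\<gamma> y \<in> fst c" "\<gamma> z \<in> fst c" using yz d by (auto simp: N_def)
    then show "(\<lambda>i. norm (snd c (\<gamma>s i z) - snd c (\<gamma>s i y))) \<longlonglongrightarrow> norm (snd c (\<gamma> z) - snd c (\<gamma> y))"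
      by (intro tendsto_intros \<gamma>_pointwise cA)
    show "\<forall>\<^sub>F i in sequentially. norm (snd c (\<gamma>s i z) - snd c (\<gamma>s i y)) \<le> C * (z - y)"
      using approximating_piece[OF N(1) d(2,3)]
    proof eventually_elim
      case (elim i)
      obtain \<alpha> \<beta> where \<alpha>\<beta>: "\<alpha> \<in> Js i" "\<beta> \<in> Js i" "\<alpha> \<le> \<beta>" "ss i \<alpha> = y" "ss i \<beta> = z" "\<forall>t\<in>{\<alpha>..\<beta>}. fst (lams i t) \<in> N"
        using elim yz by blast
      have "norm (fst (coords c (lams i \<beta>)) - fst (coords c (lams i \<alpha>)) - (ss i \<beta> - ss i \<alpha>) *\<^sub>R 0) \<le> C * (ss i \<beta> - ss i \<alpha>)"
      proof (rule characteristic_estimate[OF chars arcs \<alpha>\<beta>(1-3) c(1) _ bounded_linear_fst])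
        show "fst (lams i t) \<in> fst c" if "t \<in> {\<alpha>..\<beta>}" for t using \<alpha>\<beta>(6) that by (auto simp: N_def)
        show "fst (0 :: 'e, x *\<^sub>R conormal) = 0" for x by simp
        fix t w assume t: "t \<in> {\<alpha>..\<beta>}" and u: "lams i t \<in> unit_level A \<xi> f" and w: "hamiltonian_vector UNIV A H c (lams i t) w"
        have z: "lams i t \<in> cotangent_bundle UNIV A" "H (lams i t) = 1" using u by (auto simp: unit_level_def)
        have ft: "fst (lams i t) \<in> fst c" "dist (snd c (fst (lams i t))) (snd c (\<gamma> x)) < r"
          using \<alpha>\<beta>(6) t by (auto simp: N_def dist_commute)
        obtain v where v: "v \<in> \<xi> (fst (lams i t))" "f (fst (lams i t)) v = 1" "pairing A (fst (lams i t)) (snd (lams i t)) v = H (lams i t)"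
          using H_maximiser[OF z(1)] z(2) by auto
        have "fst w = v c" by (rule H_vector_fst[OF z(1) cA ft(1) v w])
        then show "norm (fst w - 0) \<le> C" using r(2)[OF ft v(1)] v(2) by simp
      qed
      then show ?case using images(2)[OF \<alpha>\<beta>(1)] images(2)[OF \<alpha>\<beta>(2)] \<alpha>\<beta>(4,5) by (simp add: coords_def)
    qed
  qed simp
  have "norm (snd c (\<gamma> z) - snd c (\<gamma> y)) \<le> C * \<bar>z - y\<bar>" if "y \<in> I \<inter> ball x d" "z \<in> I \<inter> ball x d" for y z
  proof -
    have "y \<in> {a..b}" "z \<in> {a..b}" using that d(4) by auto
    then show ?thesis using main[of y z] main[of z y] by (cases "y \<le> z") (auto simp: norm_minus_commute)
  qed
  then show ?thesis using d(1) C by blast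
qed

end

text \<open>A discontinuity of a monotone function is a jump, which would leave a gap in its
  image.\<close>

lemma mono_interval_image_continuous:
  fixes \<tau> :: "real \<Rightarrow> real"
  assumes mono: "mono_on I \<tau>" and K: "is_interval (\<tau> ` I)" and x: "x \<in> I" and e: "e > 0"
  shows "\<exists>d>0. \<forall>y\<in>I \<inter> ball x d. \<bar>\<tau> y - \<tau> x\<bar> < e"
proof -
  have lt: "y < z" if "y \<in> I" "z \<in> I" "\<tau> y < \<tau> z" for y z
    using mono_onD[OF mono that(2,1)] that(3) by force
  have right: "\<exists>d>0. \<forall>y\<in>I. y < x + d \<longrightarrow> \<tau> y < \<tau> x + e"
  proof (cases "\<exists>z\<in>I. \<tau> x < \<tau> z")
    case True
    then obtain z where z: "z \<in> I" "\<tau> x < \<tau> z" by blast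
    have "{\<tau> x..\<tau> z} \<subseteq> \<tau> ` I" by (rule interval_Icc_subset[OF K]) (use x z in auto)
    moreover have "min (\<tau> z) (\<tau> x + e / 2) \<in> {\<tau> x..\<tau> z}" using z e by auto
    ultimately have "min (\<tau> z) (\<tau> x + e / 2) \<in> \<tau> ` I" by blast
    then obtain z' where z': "z' \<in> I" "\<tau> z' = min (\<tau> z) (\<tau> x + e / 2)" by force
    have xz: "x < z'" by (rule lt[OF x z'(1)]) (use z e z'(2) in auto)
    have "\<tau> y < \<tau> x + e" if "y \<in> I" "y < x + (z' - x)" for y
      using mono_onD[OF mono that(1) z'(1)] that(2) z'(2) e by auto
    then show ?thesis using xz by (intro exI[of _ "z' - x"]) auto
  next
    case False
    then show ?thesis using e by (intro exI[of _ 1]) force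
  qed
  have left: "\<exists>d>0. \<forall>y\<in>I. x - d < y \<longrightarrow> \<tau> x - e < \<tau> y"
  proof (cases "\<exists>z\<in>I. \<tau> z < \<tau> x")
    case True
    then obtain z where z: "z \<in> I" "\<tau> z < \<tau> x" by blast
    have "{\<tau> z..\<tau> x} \<subseteq> \<tau> ` I" by (rule interval_Icc_subset[OF K]) (use x z in auto)
    moreover have "max (\<tau> z) (\<tau> x - e / 2) \<in> {\<tau> z..\<tau> x}" using z e by auto
    ultimately have "max (\<tau> z) (\<tau> x - e / 2) \<in> \<tau> ` I" by blast
    then obtain z' where z': "z' \<in> I" "\<tau> z' = max (\<tau> z) (\<tau> x - e / 2)" by force
    have xz: "z' < x" by (rule lt[OF z'(1) x]) (use z e z'(2) in auto)
    have "\<tau> x - e < \<tau> y" if "y \<in> I" "x - (x - z') < y" for y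
      using mono_onD[OF mono z'(1) that(1)] that(2) z'(2) e by auto
    then show ?thesis using xz by (intro exI[of _ "x - z'"]) auto
  next
    case False
    then show ?thesis using e by (intro exI[of _ 1]) force
  qed
  obtain d1 where d1: "d1 > 0" "\<forall>y\<in>I. y < x + d1 \<longrightarrow> \<tau> y < \<tau> x + e" using right by blast
  obtain d2 where d2: "d2 > 0" "\<forall>y\<in>I. x - d2 < y \<longrightarrow> \<tau> x - e < \<tau> y" using left by blast
  show ?thesis
  proof (intro exI[of _ "min d1 d2"] conjI ballI)
    show "0 < min d1 d2" using d1 d2 by simp
    fix y assume y: "y \<in> I \<inter> ball x (min d1 d2)"
    then have "y < x + d1" "x - d2 < y" "y \<in> I" by (auto simp: dist_real_def)
    then have "\<tau> y < \<tau> x + e" "\<tau> x - e < \<tau> y" using d1(2) d2(2) by blast+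
    then show "\<bar>\<tau> y - \<tau> x\<bar> < e" by linarith
  qed
qed

section \<open>Comparison of the two parametrisations of the base curve\<close>

context limit_billiard
begin

text \<open>While \<open>s\<close> rests so does the base point, and since the geodesic has nonzero
  velocity \<sigma> must rest too. Hence \<sigma> factors through \<open>s\<close>, and the factor
  \<tau> is the reparametrisation.\<close>

lemma singular_reparametrisation_mu:
  assumes nd: "\<exists>t\<in>J. \<exists>t'\<in>J. \<sigma> t \<noteq> \<sigma> t'"
    and s: "mono_on J s" "s ` J = I" "\<And>t. t \<in> J \<Longrightarrow> fst (lam t) = \<gamma> (s t)"
    and lip: "\<And>x c. x \<in> I \<Longrightarrow> c \<in> BC \<Longrightarrow> \<gamma> x \<in> fst c \<Longrightarrow>
      \<exists>d>0. \<exists>C\<ge>0. \<forall>y\<in>I \<inter> ball x d. \<forall>z\<in>I \<inter> ball x d. norm (snd c (\<gamma> z) - snd c (\<gamma> y)) \<le> C * \<bar>z - y\<bar>"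
  shows "singular_reparametrisation \<gamma> I (\<lambda>\<tau>. fst (mu \<tau>)) K"
proof -
  have nd1: "\<exists>t2\<in>J. \<sigma> t1 \<noteq> \<sigma> t2" if "t1 \<in> J" for t1 using nd that by metis
  have base: "fst (mu (\<sigma> t)) = \<gamma> (s t)" if "t \<in> J" for t using mu[OF that] rest(1)[OF that] s(3)[OF that] by simp
  have \<sigma>K: "\<sigma> t \<in> K" if "t \<in> J" for t using that by (simp add: K_def)
  have lower: "\<exists>c\<in>BC. \<gamma> (s t1) \<in> fst c \<and> (\<exists>d>0. \<exists>m>0. \<forall>p\<in>K \<inter> ball (\<sigma> t1) d. \<forall>r\<in>K \<inter> ball (\<sigma> t1) d.
      m * \<bar>r - p\<bar> \<le> norm (snd c (fst (mu r)) - snd c (fst (mu p))))" if t1: "t1 \<in> J" for t1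
  proof -
    obtain v where v: "unit_tangent (\<sigma> t1) v" using geodesic_velocity[OF t1 nd1[OF t1]] by blast
    obtain c where c: "c \<in> BC" "fst (mu (\<sigma> t1)) \<in> fst c" using BC_exists[OF mu_in(2)[OF \<sigma>K[OF t1]]] by blast
    have n: "norm (v c) / 2 > 0" using unit_tangentD(4)[OF v c] by simp
    obtain d where d: "d > 0" "\<forall>p\<in>K \<inter> ball (\<sigma> t1) d. \<forall>r\<in>K \<inter> ball (\<sigma> t1) d. p \<le> r \<longrightarrow>
      norm (snd c (fst (mu r)) - snd c (fst (mu p)) - (r - p) *\<^sub>R v c) \<le> norm (v c) / 2 * (r - p)"
      using unit_tangentD(5)[OF v c n] by blast
    have "norm (v c) / 2 * \<bar>r - p\<bar> \<le> norm (snd c (fst (mu r)) - snd c (fst (mu p)))"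
      if "p \<in> K \<inter> ball (\<sigma> t1) d" "r \<in> K \<inter> ball (\<sigma> t1) d" for p r
    proof -
      have "(norm (v c) - norm (v c) / 2) * \<bar>r - p\<bar> \<le> norm (snd c (fst (mu r)) - snd c (fst (mu p)))"
        by (rule strong_derivative_bounds(2)[where K = "K \<inter> ball (\<sigma> t1) d" and G = "\<lambda>r. snd c (fst (mu r))"])
          (use d(2) that in blast)+
      then show ?thesis by simp
    qed
    then show ?thesis using c base[OF t1] d(1) n by metis
  qed
  have le: "\<sigma> t' \<le> \<sigma> t" if t: "t \<in> J" "t' \<in> J" "s t = s t'" for t t'
  proof (rule ccontr)
    assume "\<not> \<sigma> t' \<le> \<sigma> t"
    then have lt: "\<sigma> t < \<sigma> t'" by simp
    obtain c d m where "c \<in> BC" and cd: "d > 0" "m > 0" "\<forall>p\<in>K \<inter> ball (\<sigma> t) d. \<forall>r\<in>K \<inter> ball (\<sigma> t) d.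
      m * \<bar>r - p\<bar> \<le> norm (snd c (fst (mu r)) - snd c (fst (mu p)))" using lower[OF t(1)] by (elim bexE exE conjE)
    \<comment> \<open>A parameter beyond \<open>\<sigma> t\<close>, but not beyond
      \<open>\<sigma> t'\<close> and inside the ball of the lower distance bound. Its base point
      equals the one at \<open>\<sigma> t\<close>, which that bound forbids.\<close>
    define r where "r = min (\<sigma> t') (\<sigma> t + d / 2)"
    have r: "\<sigma> t < r" "r \<le> \<sigma> t'" "r < \<sigma> t + d" using lt cd by (auto simp: r_def)
    have "r \<in> {\<sigma> t..\<sigma> t'}" using r by simp
    then have rK: "r \<in> K" using interval_Icc_subset[OF K_interval \<sigma>K[OF t(1)] \<sigma>K[OF t(2)]] by blast
    have "fst (mu r) = fst (mu (\<sigma> t))"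
    proof -
      obtain u where u: "u \<in> J" "r = \<sigma> u" using rK by (auto simp: K_def)
      have tu: "t \<le> u" using \<sigma>_le(1)[OF u(1) t(1)] r(1) u(2) by (cases "t \<le> u") auto
      show ?thesis
      proof (cases "u \<le> t'")
        case True
        have "s u = s t" using mono_onD[OF s(1) t(1) u(1) tu] mono_onD[OF s(1) u(1) t(2) True] t(3) by simp
        then show ?thesis using base[OF u(1)] base[OF t(1)] u(2) by simp
      next
        case False
        then have "r = \<sigma> t'" using \<sigma>_le(1)[OF t(2) u(1)] r(2) u(2) by simp
        then show ?thesis using base[OF t(1)] base[OF t(2)] t(3) by simp
      qed
    qed
    moreover have "m * \<bar>r - \<sigma> t\<bar> \<le> norm (snd c (fst (mu r)) - snd c (fst (mu (\<sigma> t))))"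
      by (rule cd(3)[rule_format]) (use rK \<sigma>K[OF t(1)] r cd(1) in \<open>auto simp: dist_real_def\<close>)
    ultimately have "m * (r - \<sigma> t) \<le> 0" using r(1) by simp
    then show False using cd(2) r(1) by (simp add: mult_le_0_iff)
  qed
  have eq: "\<sigma> t = \<sigma> t'" if "t \<in> J" "t' \<in> J" "s t = s t'" for t t'
    using le[OF that] le[OF that(2,1) that(3)[symmetric]] by simp
  define \<tau> where "\<tau> x = \<sigma> (SOME t. t \<in> J \<and> s t = x)" for x
  have \<tau>: "\<tau> (s t) = \<sigma> t" if t: "t \<in> J" for t
  proof -
    have "(SOME u. u \<in> J \<and> s u = s t) \<in> J \<and> s (SOME u. u \<in> J \<and> s u = s t) = s t"
      by (rule someI[of _ t]) (use t in simp)
    then show ?thesis unfolding \<tau>_def using eq t by blast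
  qed
  have pre: "\<exists>t\<in>J. x = s t" if "x \<in> I" for x using that s(2) by blast
  have mono: "mono_on I \<tau>"
  proof (rule mono_onI)
    fix x y assume xy: "x \<in> I" "y \<in> I" "x \<le> y"
    obtain t t' where t: "t \<in> J" "x = s t" "t' \<in> J" "y = s t'" using pre xy by blast
    show "\<tau> x \<le> \<tau> y"
    proof (cases "t \<le> t'")
      case True
      then show ?thesis using \<sigma>_le(1)[OF t(1,3)] \<tau>[OF t(1)] \<tau>[OF t(3)] t by simp
    next
      case False
      then have "y \<le> x" using mono_onD[OF s(1) t(3,1)] t by simp
      then show ?thesis using xy by simp
    qed
  qed
  have image: "\<tau> ` I = K"
  proof -
    have "\<tau> ` I = (\<lambda>t. \<tau> (s t)) ` J" using s(2) by (auto simp: image_image[symmetric])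
    also have "\<dots> = \<sigma> ` J" using \<tau> by (intro image_cong) auto
    finally show ?thesis by (simp add: K_def)
  qed
  have \<gamma>\<tau>: "\<gamma> x = fst (mu (\<tau> x))" if x: "x \<in> I" for x
  proof -
    obtain t where t: "t \<in> J" "x = s t" using pre[OF x] by blast
    then show ?thesis using base[OF t(1)] \<tau>[OF t(1)] by simp
  qed
  have "locally_lipschitz I \<tau>"
    unfolding locally_lipschitz_def
  proof
    fix x assume x: "x \<in> I"
    obtain t1 where t1: "t1 \<in> J" "x = s t1" using pre[OF x] by blast
    have \<tau>x: "\<tau> x = \<sigma> t1" using \<tau>[OF t1(1)] t1(2) by simp
    obtain c d m where c: "c \<in> BC" "\<gamma> x \<in> fst c" and d: "d > 0" "m > 0" "\<forall>p\<in>K \<inter> ball (\<sigma> t1) d. \<forall>r\<in>K \<inter> ball (\<sigma> t1) d.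
      m * \<bar>r - p\<bar> \<le> norm (snd c (fst (mu r)) - snd c (fst (mu p)))" using lower[OF t1(1), folded t1(2)] by (elim bexE exE conjE)
    obtain d2 C where d2: "d2 > 0" "C \<ge> 0" "\<forall>y\<in>I \<inter> ball x d2. \<forall>z\<in>I \<inter> ball x d2. norm (snd c (\<gamma> z) - snd c (\<gamma> y)) \<le> C * \<bar>z - y\<bar>"
      using lip[OF x c] by blast
    have iK: "is_interval (\<tau> ` I)" using image K_interval by simp
    obtain d3 where d3: "d3 > 0" "\<forall>y\<in>I \<inter> ball x d3. \<bar>\<tau> y - \<tau> x\<bar> < d"
      using mono_interval_image_continuous[OF mono iK x d(1)] by blast
    \<comment> \<open>Coordinates change by at most \<open>C\<close> per unit of the parameter of
      \<gamma> and by at least \<open>m\<close> per unit of \<tau>. Continuity of \<tau>, from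
      \<open>mono_interval_image_continuous\<close>, keeps its values where the lower bound
      holds.\<close>
    have "(C / m)-lipschitz_on (I \<inter> ball x (min d2 d3)) \<tau>"
    proof (rule lipschitz_onI)
      show "0 \<le> C / m" using d2 d by simp
      fix y z assume yz: "y \<in> I \<inter> ball x (min d2 d3)" "z \<in> I \<inter> ball x (min d2 d3)"
      have K: "\<tau> u \<in> K \<inter> ball (\<sigma> t1) d" if "u \<in> I \<inter> ball x (min d2 d3)" for u
      proof -
        have "\<bar>\<tau> u - \<tau> x\<bar> < d" using d3(2) that by simp
        then show ?thesis using that image \<tau>x by (auto simp: dist_real_def abs_minus_commute)
      qed
      have "m * \<bar>\<tau> z - \<tau> y\<bar> \<le> norm (snd c (fst (mu (\<tau> z))) - snd c (fst (mu (\<tau> y))))"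
        using d(3) K[OF yz(1)] K[OF yz(2)] by blast
      also have "\<dots> = norm (snd c (\<gamma> z) - snd c (\<gamma> y))" using \<gamma>\<tau> yz by simp
      also have "\<dots> \<le> C * \<bar>z - y\<bar>" using d2(3) yz by simp
      finally show "dist (\<tau> y) (\<tau> z) \<le> C / m * dist y z"
        using d(2) by (simp add: dist_real_def abs_minus_commute field_simps)
    qed
    moreover have "min d2 d3 > 0" using d2 d3 by simp
    ultimately show "\<exists>\<epsilon>>0. \<exists>C. C-lipschitz_on (I \<inter> ball x \<epsilon>) \<tau>" by blast
  qed
  then show ?thesis unfolding singular_reparametrisation_def using mono image \<gamma>\<tau> by blast
qed

end

section \<open>Constant limit curves\<close>

context limit_curve
begin

text \<open>Constancy on \<open>{a..b}\<close> forces pieces of the fixed arclength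
  \<open>b - a\<close> into arbitrarily small coordinate balls about \<open>q0\<close>, whereas the
  bound of \<open>rank_one_length\<close> is proportional to the radius.\<close>

lemma rank_one_contradiction:
  assumes q0: "q0 \<in> frontier U" and c: "c \<in> BC" "q0 \<in> fst c" and e0: "e0 \<in> \<xi> q0" "e0 c \<bullet> conormal \<noteq> 0"
    and zero: "\<And>v. v \<in> \<xi> q0 \<Longrightarrow> v c \<in> boundary_model \<Longrightarrow> v = (\<lambda>d. 0)"
    and ab: "a < b" "{a..b} \<subseteq> I" "\<And>x. x \<in> {a..b} \<Longrightarrow> \<gamma> x = q0"
  shows False
proof -
  have cA: "c \<in> A" by (rule BC_A[OF c(1)])
  define x0 where "x0 = snd c q0"
  let ?X = "snd c ` fst c"
  have op: "open ?X" using is_chart[OF cA] by (simp add: is_chart_def)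
  have x0: "x0 \<in> ?X" "x0 \<in> boundary_model" using c frontier_iff[OF c] q0 by (auto simp: x0_def)
  have "smooth_on UNIV ?X (G \<circ> chart_inv c)" using G cA by (simp add: table_function_def)
  from smooth_on_C1[OF this] obtain D where D': "\<forall>x\<in>?X. ((G \<circ> chart_inv c) has_derivative D x) (at x within ?X)"
    "\<forall>v\<in>UNIV. continuous_on ?X (\<lambda>x. D x v)" by blast
  have D: "((G \<circ> chart_inv c) has_derivative D x) (at x)" if "x \<in> ?X" for x
    using D'(1) that at_within_open[OF that op] by auto
  have lin: "linear (D x)" if "x \<in> ?X" for x using has_derivative_linear[OF D[OF that]] .
  have Dtan: "D x0 h = 0" if h: "h \<in> boundary_model" for h
  proof -
    obtain r where r: "frontier U = G -` {r}" using G by (auto simp: table_function_def)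
    obtain Q where Q: "open Q" "snd c q0 \<in> Q" "Q \<inter> boundary_model \<subseteq> snd c ` (fst c \<inter> fst c \<inter> frontier U)"
      using boundary_open[OF c(1) cA c(2,2) q0] by blast
    have 1: "((\<lambda>_. r) has_derivative (\<lambda>h. 0)) (at x0 within Q \<inter> boundary_model)" by simp
    have 2: "((G \<circ> chart_inv c) has_derivative (\<lambda>h. 0)) (at x0 within Q \<inter> boundary_model)"
    proof (rule has_derivative_transform[OF _ _ 1])
      show "x0 \<in> Q \<inter> boundary_model" using Q x0 by (simp add: x0_def)
      fix y assume "y \<in> Q \<inter> boundary_model"
      then obtain q' where "y = snd c q'" "q' \<in> fst c" "q' \<in> frontier U" using Q(3) by blast
      then show "(G \<circ> chart_inv c) y = r" using r M.chart_inv_eq[OF cA] by auto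
    qed
    show ?thesis
      using has_derivative_unique_on_subspace[OF has_derivative_at_withinI[OF D[OF x0(1)]] 2 subspace_boundary_model Q(1) _ order_refl x0(2) h] Q(2)
      by (simp add: x0_def)
  qed
  have Dn: "D x0 h = (h \<bullet> conormal) * D x0 conormal" for h
  proof -
    have "D x0 h = D x0 (tan_part h + (h \<bullet> conormal) *\<^sub>R conormal)" by (simp only: tan_part(4))
    also have "\<dots> = D x0 (tan_part h) + (h \<bullet> conormal) * D x0 conormal"
      using lin[OF x0(1)] by (simp add: linear_add linear_scale)
    also have "D x0 (tan_part h) = 0" by (rule Dtan[OF tan_part(1)])
    finally show ?thesis by simp
  qed
  have "frechet_derivative (G \<circ> chart_inv c) (at (snd c q0)) \<noteq> (\<lambda>h. 0)"
    using G cA c(2) q0 unfolding table_function_def by blast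
  then have "D x0 \<noteq> (\<lambda>h. 0)" unfolding frechet_derivative_at[OF D[OF x0(1)], symmetric, unfolded x0_def] x0_def .
  then obtain h where "D x0 h \<noteq> 0" by blast
  then have Dc: "D x0 conormal \<noteq> 0" unfolding Dn[of h] by simp
  \<comment> \<open>The fibre part of \<open>X_G\<close> is minus the differential of
    \<open>G\<close>. Orienting the spanning vector so that \<open>G\<close> decreases along it
    makes the momentum along \<open>E\<close> nondecreasing under \<open>X_G\<close>.\<close>
  define sg where "sg = - sgn (D x0 (e0 c))"
  define e where "e = (\<lambda>d. sg *\<^sub>R e0 d)"
  have De0: "D x0 (e0 c) \<noteq> 0" using Dn[of "e0 c"] Dc e0(2) by simp
  have sg0: "sg \<noteq> 0" using De0 by (simp add: sg_def sgn_zero_iff)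
  have e: "e \<in> \<xi> q0" using xi_combination[OF e0(1) e0(1), of sg 0] by (simp add: e_def)
  have en: "e c \<bullet> conormal \<noteq> 0" using e0(2) sg0 by (simp add: e_def)
  have De: "D x0 (e c) < 0"
  proof -
    have "D x0 (e c) = sg * D x0 (e0 c)" using lin[OF x0(1)] by (simp add: e_def linear_scale)
    also have "\<dots> = - \<bar>D x0 (e0 c)\<bar>" by (simp add: sg_def abs_sgn mult.commute)
    finally show ?thesis using De0 by simp
  qed
  obtain E C1 C2 d where E: "d > 0" "0 < C1" "E x0 = e c" "continuous_on (ball x0 d) E"
    "\<And>q v. q \<in> fst c \<Longrightarrow> dist (snd c q) x0 < d \<Longrightarrow> v \<in> \<xi> q \<Longrightarrow> f q v = 1 \<Longrightarrow> \<exists>r. v c = r *\<^sub>R E (snd c q) \<and> C1 \<le> \<bar>r\<bar> \<and> \<bar>r\<bar> \<le> C2"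
    using xi_rank_one[OF cA c(2) e en] zero unfolding x0_def boundary_model_def by blast
  define l where "l = e c"
  have l: "l \<bullet> l > 0" using en by (auto simp: l_def)
  \<comment> \<open>At \<open>x0\<close> the value of \<open>E x \<bullet> l\<close> is
    \<open>l \<bullet> l = 2 * \<eta>\<close>; nearby it changes by less than \<eta> and so stays
    between \<eta> and \<open>3 * \<eta>\<close>.\<close>
  define \<eta> where "\<eta> = (l \<bullet> l) / 2"
  have \<eta>: "\<eta> > 0" using l by (simp add: \<eta>_def)
  obtain d1 where d1: "d1 > 0" "\<And>x. x \<in> ball x0 d \<Longrightarrow> dist x x0 < d1 \<Longrightarrow> dist (E x \<bullet> l) (E x0 \<bullet> l) < \<eta>"
  proof -
    have "continuous_on (ball x0 d) (\<lambda>x. E x \<bullet> l)" by (intro continuous_intros E)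
    moreover have "x0 \<in> ball x0 d" using E by simp
    ultimately show ?thesis using that \<eta> unfolding continuous_on_iff by meson
  qed
  obtain d2 where d2: "d2 > 0" "\<And>x. x \<in> ball x0 d \<inter> ?X \<Longrightarrow> dist x x0 < d2 \<Longrightarrow> D x (E x) < 0"
  proof -
    have "continuous_on (ball x0 d \<inter> ?X) (\<lambda>x. \<Sum>b\<in>Basis. (E x \<bullet> b) * D x b)"
      by (intro continuous_intros continuous_on_subset[OF E(4)] continuous_on_subset[OF D'(2)[rule_format]]) auto
    then have "continuous_on (ball x0 d \<inter> ?X) (\<lambda>x. D x (E x))"
    proof (rule continuous_on_eq)
      fix x assume "x \<in> ball x0 d \<inter> ?X"
      then have "linear (D x)" using lin by blast
      then have "D x (\<Sum>b\<in>Basis. (E x \<bullet> b) *\<^sub>R b) = (\<Sum>b\<in>Basis. (E x \<bullet> b) * D x b)" by (simp add: linear_sum linear_scale)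
      then show "(\<Sum>b\<in>Basis. (E x \<bullet> b) * D x b) = D x (E x)" by (simp add: euclidean_representation)
    qed
    moreover have "x0 \<in> ball x0 d \<inter> ?X" using E x0 by simp
    moreover have "- D x0 (E x0) > 0" using De E(3) by simp
    ultimately obtain d2 where "d2 > 0" "\<And>x. x \<in> ball x0 d \<inter> ?X \<Longrightarrow> dist x x0 < d2 \<Longrightarrow> dist (D x (E x)) (D x0 (E x0)) < - D x0 (E x0)"
      unfolding continuous_on_iff by meson
    moreover have "D x (E x) < 0" if "dist (D x (E x)) (D x0 (E x0)) < - D x0 (E x0)" for x
      using that unfolding dist_real_def by linarith
    ultimately show ?thesis using that by blast
  qed
  obtain d3 where d3: "d3 > 0" "ball x0 d3 \<subseteq> ?X" using op x0(1) openE by blast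
  \<comment> \<open>With this radius \<open>4 * \<rho>' * norm l\<close> is half of
    \<open>C1 * \<eta> * (b - a)\<close>, so the length bound fails for a piece of arclength
    \<open>b - a\<close>.\<close>
  define \<rho>' where "\<rho>' = C1 * \<eta> * (b - a) / (8 * norm l)"
  have nl: "norm l > 0" using l by auto
  have \<rho>': "\<rho>' > 0" using E(2) \<eta> ab(1) nl by (simp add: \<rho>'_def)
  define \<rho> where "\<rho> = min (min d \<rho>') (min d1 (min d2 d3))"
  have \<rho>: "\<rho> > 0" "\<rho> \<le> d" "\<rho> \<le> \<rho>'" "\<rho> \<le> d1" "\<rho> \<le> d2" "\<rho> \<le> d3" using E(1) \<rho>' d1 d2 d3 by (auto simp: \<rho>_def)
  define N where "N = fst c \<inter> snd c -` ball x0 \<rho>"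
  have N: "open N" "\<gamma> ` {a..b} \<subseteq> N" using chart_ball_open[OF cA] c ab(3) \<rho>(1) by (auto simp: N_def x0_def)
  obtain i where i: "\<forall>y\<in>{a..b}. \<forall>z\<in>{a..b}. y \<le> z \<longrightarrow>
    (\<exists>\<alpha>\<in>Js i. \<exists>\<beta>\<in>Js i. \<alpha> \<le> \<beta> \<and> ss i \<alpha> = y \<and> ss i \<beta> = z \<and> (\<forall>t\<in>{\<alpha>..\<beta>}. fst (lams i t) \<in> N))"
    using approximating_piece[OF N(1) ab(2) N(2)] by (auto simp: eventually_sequentially)
  have "a \<in> {a..b}" "b \<in> {a..b}" "a \<le> b" using ab(1) by simp_all
  from i[THEN bspec, OF this(1), THEN bspec, OF this(2), THEN mp, OF this(3)] obtain \<alpha> \<beta> where \<alpha>\<beta>: "\<alpha> \<in> Js i" "\<beta> \<in> Js i" "\<alpha> \<le> \<beta>" "ss i \<alpha> = a" "ss i \<beta> = b" "\<forall>t\<in>{\<alpha>..\<beta>}. fst (lams i t) \<in> N"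
    by (elim bexE conjE)
  have "C1 * \<eta> * (ss i \<beta> - ss i \<alpha>) \<le> 4 * \<rho> * norm l"
  proof (rule rank_one_length[OF chars arcs \<alpha>\<beta>(1-3) c(1) _ _ _ E(2), where ?E = E and ?x0.0 = x0 and ?C2.0 = C2 and \<Lambda> = "3 * \<eta>"])
    show "fst (lams i t) \<in> fst c" if "t \<in> {\<alpha>..\<beta>}" for t using \<alpha>\<beta>(6) that by (auto simp: N_def)
    show "dist (snd c (fst (lams i t))) x0 < \<rho>" if "t \<in> {\<alpha>..\<beta>}" for t using \<alpha>\<beta>(6) that by (auto simp: N_def dist_commute)
    show "continuous_on (ball x0 \<rho>) E" by (rule continuous_on_subset[OF E(4)]) (use \<rho> in auto)
    show "\<exists>r. v c = r *\<^sub>R E (snd c q) \<and> C1 \<le> \<bar>r\<bar> \<and> \<bar>r\<bar> \<le> C2" if "q \<in> fst c" "dist (snd c q) x0 < \<rho>" "v \<in> \<xi> q" "f q v = 1" for q v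
      using E(5)[OF that(1) _ that(3,4)] that(2) \<rho>(2) by simp
    show "\<eta> \<le> E x \<bullet> l \<and> E x \<bullet> l \<le> 3 * \<eta>" if "dist x x0 < \<rho>" for x
    proof -
      have "dist (E x \<bullet> l) (E x0 \<bullet> l) < \<eta>" by (rule d1(2)) (use that \<rho> in \<open>auto simp: dist_commute\<close>)
      moreover have "E x0 \<bullet> l = 2 * \<eta>" by (simp add: E(3) l_def \<eta>_def)
      ultimately show ?thesis unfolding dist_real_def by linarith
    qed
    show "0 < \<eta>" by (rule \<eta>)
    fix z w assume z: "z \<in> cotangent_bundle UNIV A" "fst z \<in> fst c" "fst z \<in> frontier U" "dist (snd c (fst z)) x0 < \<rho>"
      and w: "hamiltonian_vector UNIV A (lifted G) c z w"
    have zX: "snd c (fst z) \<in> ?X" using z(2) by blast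
    have "D (snd c (fst z)) = (\<lambda>h. - (snd w \<bullet> h))"
      by (rule has_derivative_unique[OF D[OF zX] lifted_vector(2)[OF z(1) cA z(2) w]])
    moreover have "D (snd c (fst z)) (E (snd c (fst z))) < 0"
      by (rule d2(2)) (use z zX \<rho> in \<open>auto simp: dist_commute\<close>)
    ultimately show "0 \<le> snd w \<bullet> E (snd c (fst z))" by simp
  qed
  also have "4 * \<rho> * norm l \<le> 4 * \<rho>' * norm l" using \<rho>(3) nl by (intro mult_right_mono) auto
  also have "\<dots> = C1 * \<eta> * (b - a) / 2" using nl by (simp add: \<rho>'_def)
  finally have "C1 * \<eta> * (b - a) \<le> C1 * \<eta> * (b - a) / 2" using \<alpha>\<beta>(4,5) by simp
  moreover have "C1 * \<eta> * (b - a) > 0" using E(2) \<eta> ab(1) by simp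
  ultimately show False by linarith
qed

text \<open>On the parameter set \<open>{0}\<close> every vector is a derivative, and
  \<open>{0}\<close> is a null set. What remains to be shown, over a regular point, is that a
  covector with \<open>HB = 1\<close> and a Hamiltonian vector for \<open>HB\<close> exists.\<close>

lemma constant_boundary_geodesic:
  assumes int: "interior I \<noteq> {}" and const: "\<And>x. x \<in> I \<Longrightarrow> \<gamma> x = q0" and q0: "q0 \<in> frontier U"
  shows "boundary_geodesic A \<xi> f U (\<lambda>_. q0) {0} \<and> singular_reparametrisation \<gamma> I (\<lambda>_. q0) {0}"
proof
  have "I \<noteq> {}" using int interior_subset by fastforce
  then show "singular_reparametrisation \<gamma> I (\<lambda>_. q0) {0}"
    unfolding singular_reparametrisation_def
    by (intro exI[of _ "\<lambda>_. 0"])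
      (auto simp: const locally_lipschitz_def mono_on_def lipschitz_on_def intro!: exI[of _ 1])
  have orbit: "\<exists>\<mu>. unit_boundary_orbit A \<xi> f U \<mu> {0} \<and> fst (\<mu> 0) = q0" if reg: "q0 \<in> regular_boundary A \<xi> U"
  proof -
    obtain c where c: "c \<in> BC" "q0 \<in> fst c" using BC_exists[OF q0] by blast
    obtain e where e: "e \<in> \<xi> q0" "e c \<bullet> conormal \<noteq> 0" using reg regular_boundary_iff[OF c q0] by blast
    obtain a b where ab: "a < b" "{a..b} \<subseteq> I"
    proof -
      obtain x r where "r > 0" "ball x r \<subseteq> I" using int by (meson all_not_in_conv mem_interior)
      moreover have "{x..x + r / 2} \<subseteq> ball x r" using \<open>r > 0\<close> by (auto simp: dist_real_def)
      ultimately show ?thesis using that[of x "x + r / 2"] by auto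
    qed
    \<comment> \<open>Otherwise \<xi> is a line transverse to the boundary at \<open>q0\<close>, the
      case excluded by the length estimate.\<close>
    have "\<exists>v1. v1 \<in> \<xi> q0 \<and> v1 \<noteq> (\<lambda>d. 0) \<and> v1 c \<in> boundary_model"
    proof (rule ccontr)
      assume no: "\<not> ?thesis"
      show False
        by (rule rank_one_contradiction[OF q0 c e _ ab]) (use no const ab in auto)
    qed
    then obtain p v where z: "tangent_covector (q0, p) v" using tangent_covector_exists[OF q0 c _ _ _ e] by blast
    have pb: "(q0, p) \<in> cotangent_bundle UNIV A" "H (q0, p) > 0" using tangent_covectorD(1,3)[OF z] by simp_all
    define \<mu> where "\<mu> = (\<lambda>_::real. (q0, restrict_covector q0 p))"
    have "q0 \<in> fst (bd c)" "bd c \<in> BA" using c q0 by (auto simp: bd bd_in)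
    then have mb: "\<mu> 0 \<in> cotangent_bundle boundary_model BA"
      using restrict_covector[OF _ q0] cotangent_bundleD[OF pb(1)] by (auto simp: \<mu>_def cotangent_bundle_def)
    have "flows_along boundary_model BA HB \<mu> {0} 0"
      unfolding flows_along_def
    proof (intro conjI ballI impI mb)
      fix c' assume c': "c' \<in> BA" "fst (\<mu> 0) \<in> fst c'"
      then obtain c1 where c1: "c1 \<in> BC" "c' = bd c1" by (auto simp: BA_eq)
      have qc: "q0 \<in> fst c1" using c' c1 by (simp add: \<mu>_def bd)
      obtain w where w: "hamiltonian_vector UNIV A H c1 (q0, p) w"
        using H_vector_continuous[OF pb(1) BC_A[OF c1(1)] _ pb(2)] qc by auto
      have "hamiltonian_vector boundary_model BA HB (bd c1) (\<mu> 0) (fst w, tan_part (snd w))"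
        unfolding \<mu>_def by (rule boundary_hamiltonian_vector[OF z reg c1(1) qc w])
      moreover have "((\<lambda>s. coords c' (\<mu> s)) has_vector_derivative (fst w, tan_part (snd w))) (at 0 within {0})"
        unfolding has_vector_derivative_def has_derivative_within_singleton_iff by (rule bounded_linear_scaleR_left)
      ultimately show "\<exists>w. hamiltonian_vector boundary_model BA HB c' (\<mu> 0) w \<and>
          ((\<lambda>s. coords c' (\<mu> s)) has_vector_derivative w) (at 0 within {0})" using c1(2) by blast
    qed
    then have "unit_boundary_orbit A \<xi> f U \<mu> {0}"
      unfolding unit_boundary_orbit_def using mb reg HB_tangent_covector[OF z] by (simp add: \<mu>_def)
    then show ?thesis by (intro exI[of _ \<mu>]) (simp add: \<mu>_def)
  qed
  show "boundary_geodesic A \<xi> f U (\<lambda>_. q0) {0}"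
    unfolding boundary_geodesic_def
  proof (intro conjI)
    show "is_interval {0::real}" by (auto simp: is_interval_1)
    show "(\<lambda>_. q0) ` {0::real} \<subseteq> frontier U" using q0 by simp
    show "lipschitz_in_charts BA (\<lambda>_. q0) (\<lambda>c s. snd c q0) {0}"
      unfolding lipschitz_in_charts_def
      by (intro ballI impI exI[of _ 1] conjI zero_less_one exI[of _ 0]) (auto simp: lipschitz_on_def)
    have "{0::real} \<in> null_sets lebesgue" using negligible_sing negligible_iff_null_sets by blast
    then have "AE t in lebesgue. t \<notin> {0::real}" by (rule AE_not_in)
    then show "AE t in lebesgue. t \<in> {0} \<longrightarrow> (\<exists>u\<in>boundary_distribution A \<xi> U q0.
           velocity boundary_model BA (\<lambda>_. q0) {0} t u \<and> boundary_norm A f U q0 u = 1)"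
      by (rule AE_mp) simp
    show "\<forall>C. is_interval C \<and> C \<subseteq> {0} \<and> (\<lambda>_. q0) ` C \<subseteq> regular_boundary A \<xi> U \<longrightarrow>
        (\<exists>\<mu>. unit_boundary_orbit A \<xi> f U \<mu> C \<and> (\<forall>t\<in>C. fst (\<mu> t) = q0))"
    proof (intro allI impI, elim conjE)
      fix C :: "real set" assume C: "C \<subseteq> {0}" "(\<lambda>_. q0) ` C \<subseteq> regular_boundary A \<xi> U"
      show "\<exists>\<mu>. unit_boundary_orbit A \<xi> f U \<mu> C \<and> (\<forall>t\<in>C. fst (\<mu> t) = q0)"
      proof (cases "C = {}")
        case True
        then show ?thesis by (simp add: unit_boundary_orbit_def)
      next
        case False
        then have "C = {0}" using C by blast
        moreover from this have "q0 \<in> regular_boundary A \<xi> U" using C(2) by simp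
        ultimately show ?thesis using orbit by auto
      qed
    qed
  qed
qed

end

theorem proposition4p19:
  fixes A :: "('a::{t2_space, second_countable_topology}, 'e::euclidean_space) chart set"
    and \<xi> :: "'a \<Rightarrow> (('a, 'e) chart \<Rightarrow> 'e) set"
    and f :: "'a \<Rightarrow> (('a, 'e) chart \<Rightarrow> 'e) \<Rightarrow> real"
    and U :: "'a set" and G :: "'a \<Rightarrow> real" and \<gamma> :: "real \<Rightarrow> 'a" and I :: "real set"
  assumes "sub_finsler_manifold A \<xi> f"
    and "billiard_table A U"
    and "table_function A \<xi> f U G"
    and "C1_gliding_trajectory A \<xi> f U G \<gamma> I"
  shows "\<exists>\<delta> K. boundary_geodesic A \<xi> f U \<delta> K \<and> singular_reparametrisation \<gamma> I \<delta> K"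
proof -
  interpret billiard A \<xi> f U G using assms(1-3) by unfold_locales
  have bd\<gamma>: "\<gamma> ` I \<subseteq> frontier U" and limit: "C1_limit_trajectory A \<xi> f U G \<gamma> I"
    using assms(4) unfolding C1_gliding_trajectory_def by blast+
  note limit = limit[unfolded C1_limit_trajectory_def]
  have interval: "is_interval I" "interior I \<noteq> {}" by (rule limit[THEN conjunct1], rule limit[THEN conjunct2, THEN conjunct1])
  obtain \<gamma>s Is lams Js ss lam J s where
    chars: "\<And>i. billiard_characteristic A \<xi> f U G (lams i) (Js i)"
    and arcs: "\<And>i. arclength_reparametrisation A f (\<lambda>t. fst (lams i t)) (Js i) (ss i) (\<gamma>s i) (Is i)"
    and lim\<gamma>: "C0_loc_limit euclidean Is \<gamma>s I \<gamma>" and J: "is_interval J"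
    and lim: "C0_loc_limit (cotangent_topology UNIV A) Js lams J lam"
    and s: "mono_on J s" "s ` J = I" "\<forall>t\<in>J. fst (lam t) = \<gamma> (s t)"
    using limit by (elim conjE exE) (rule that, auto)
  have arc: "arclength (lams i) (Js i) (ss i)" for i using arcs[of i] by (simp add: arclength_reparametrisation_def)
  interpret limit_curve A \<xi> f U G lams Js ss \<gamma>s Is \<gamma> I
    using chars arc arcs interval lim\<gamma> by unfold_locales (auto simp: arclength_reparametrisation_def)
  have "I \<noteq> {}" using interval(2) interior_subset by fastforce
  then obtain t0 where t0: "t0 \<in> J" using s(2) by blast
  obtain k \<sigma> where k: "strict_mono k" "\<And>t. t \<in> J \<Longrightarrow> (\<lambda>i. ss (k i) t - ss (k i) t0) \<longlonglongrightarrow> \<sigma> t"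
    using lipschitz_subsequence[of J Js t0 ss, OF C0_loc_limit_eventually[OF lim] t0 arclength_lipschitz[OF chars arc]] by blast
  have boundary: "fst (lam t) \<in> frontier U" if "t \<in> J" for t using s bd\<gamma> that by auto
  interpret L: limit_billiard A \<xi> f U G lams Js ss lam J k \<sigma> t0
    by unfold_locales (use chars arc J lim boundary k t0 in auto)
  show ?thesis
  proof (cases "\<exists>t\<in>J. \<exists>t'\<in>J. \<sigma> t \<noteq> \<sigma> t'")
    case True
    have "singular_reparametrisation \<gamma> I (\<lambda>\<tau>. fst (L.mu \<tau>)) L.K"
      by (rule L.singular_reparametrisation_mu[OF True s(1,2)]) (use s(3) \<gamma>_lipschitz in auto)
    then show ?thesis using L.boundary_geodesic_mu[OF True] by blast
  next
    case False
    have "\<gamma> x = \<gamma> (s t0)" if x: "x \<in> I" for x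
    proof -
      obtain t where t: "t \<in> J" "x = s t" using x s(2) by blast
      have "\<sigma> t = \<sigma> t0" using False t(1) t0 by blast
      then show ?thesis using L.same_base[OF t(1) t0] s(3) t t0 by simp
    qed
    then show ?thesis using constant_boundary_geodesic[OF interval(2)] boundary[OF t0] s(3) t0 by metis
  qed
qed

end
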